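(* Suppose that $T(s)$ is positive semi-definite for all $s$. Then for every $\mu\in\mathcal{M}$ and $\lambda\in\mathbb{R}$, $$F_N(q)\le 2\log2+\Psi_\mu(\lambda,0,h_1,h_2)-\lambda q-\frac12\int_0^1\alpha_\mu(s)\Bigl(\sum_{\ell=\ell'}\rho_{\ell,\ell'}(s)\zeta_{\ell,\ell'}(s)+\iota\sum_{\ell\ne\ell'}\rho_{\ell,\ell'}(s)\zeta_{\ell,\ell'}(s)\Bigr)ds,$$ where $$F_N(q)=\frac1N\mathbb{E}\log\sum_{R_{1,2}=q}\exp\bigl(H_N^1(\sigma^1)+H_N^2(\sigma^2)\bigr),$$ the sum being over pairs $(\sigma^1,\sigma^2)\in\Sigma_N\times\Sigma_N$ with $R_{1,2}=q$.
   Context: Let $N\ge1$, $\Sigma_N=\{-1,1\}^N$, $R_{1,2}=\frac1N\sum_{i=1}^N\sigma^1_i\sigma^2_i$ for $\sigma^1,\sigma^2\in\Sigma_N$, and $S_N$ the set of possible values of $R_{1,2}$. Let $h_1,h_2\in\mathbb{R}$ and let $X_N^1,X_N^2$ be jointly Gaussian processes indexed by $\Sigma_N$ with mean zero and $\mathbb{E}X_N^\ell(\sigma^1)X_N^{\ell'}(\sigma^2)=N\xi_{\ell,\ell'}(R_{1,2})$, $1\le\ell,\ell'\le2$, where $\xi_{\ell,\ell'}$ are convex functions on $[-1,1]$ given by series $\xi_{\ell,\ell'}(s)=\sum_{p\ge2}\beta_{p,\ell,\ell'}^2s^p$ with fast decaying coefficients. Set $H_N^\ell(\sigma)=X_N^\ell(\sigma)+h_\ell\sum_{i=1}^N\sigma_i$,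 $\ell=1,2$. Fix $q\in S_N$ and let $\iota=1$ if $q\ge0$, $\iota=-1$ if $q<0$. Let $\rho_{\ell,\ell'}$ be nondecreasing continuous functions on $[0,1]$ with $\rho_{\ell,\ell'}(0)=0$ for all $\ell,\ell'$, $\rho_{1,1}(1)=\rho_{2,2}(1)=1$, $\rho_{1,2}(1)=\rho_{2,1}(1)=|q|$, differentiable except at finitely many points, where right derivatives exist. Set $$T(s)=\begin{pmatrix}\zeta_{1,1}(s)&\zeta_{1,2}(s)\\ \zeta_{2,1}(s)&\zeta_{2,2}(s)\end{pmatrix}=\begin{pmatrix}\frac{d}{ds}\xi_{1,1}'(\rho_{1,1}(s))&\frac{d}{ds}\xi_{1,2}'(\iota\rho_{1,2}(s))\\ \frac{d}{ds}\xi_{2,1}'(\iota\rho_{2,1}(s))&\frac{d}{ds}\xi_{2,2}'(\rho_{2,2}(s))\end{pmatrix}$$ (right derivatives at non-differentiability points). The operator norm of $T(s)$ is assumed uniformly bounded by some $K>0$. $\mathcal{M}$ is the set of Borel probability measures on $[0,1]$, $\alpha_\mu(s)=\mu([0,s])$, and $\mathcal{M}_d\subset\mathcal{M}$ is the set of atomic measures (finitely many atoms). For $\mu\in\mathcal{M}_d$, $\Psi_\mu(\lambda,s,\boldsymbol{x})$, $(\lambda,s,\boldsymbol{x})\in\mathbb{R}\times[0,1]\times\mathbb{R}^2$, is the classical solution of $$\partial_s\Psi_\mu=-\tfrac12\bigl(\langle T,\nabla^2\Psi_\mu\rangle+\alpha_\mu\langle T\nabla\Psi_\mu,\nabla\Psi_\mu\rangle\bigr),$$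 $$\Psi_\mu(\lambda,1,\boldsymbol{x})=\log(\cosh x_1\cosh x_2\cosh\lambda+\sinh x_1\sinh x_2\sinh\lambda),$$ with $\nabla,\nabla^2$ acting in $\boldsymbol{x}$. It is given by the Hopf-Cole transformation: backwards over intervals $[a,b)$ on which $\alpha_\mu=m$ is constant and the $\rho_{\ell,\ell'}$ are differentiable, $\Psi_\mu(\lambda,s,\boldsymbol{x})=\frac1m\log\mathbb{E}\exp m\Psi_\mu(\lambda,b,\boldsymbol{x}+y)$ with $y$ centered Gaussian of covariance $\int_s^bT(w)dw$ (read as $\mathbb{E}\Psi_\mu(\lambda,b,\boldsymbol{x}+y)$ if $m=0$). The map $\mu\mapsto\Psi_\mu$ is Lipschitz on $\mathcal{M}_d$ for $d(\mu,\mu')=\int_0^1|\alpha_\mu-\alpha_{\mu'}|ds$ (uniformly in $(\lambda,s,\boldsymbol{x})$), and $\Psi_\mu$ for general $\mu\in\mathcal{M}$ is defined by continuous extension. *)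

theory Defs
  imports "HOL-Probability.Probability"
begin

subsection \<open>Spin configurations and Gaussian processes\<close>

definition spin_configs :: "nat \<Rightarrow> (nat \<Rightarrow> real) set" where
  "spin_configs N = {1..N} \<rightarrow>\<^sub>E {-1, 1}"

definition overlap :: "nat \<Rightarrow> (nat \<Rightarrow> real) \<Rightarrow> (nat \<Rightarrow> real) \<Rightarrow> real" where
  "overlap N \<sigma> \<tau> = (\<Sum>i=1..N. \<sigma> i * \<tau> i) / real N"

definition overlap_values :: "nat \<Rightarrow> real set" where
  "overlap_values N = {overlap N \<sigma> \<tau> | \<sigma> \<tau>. \<sigma> \<in> spin_configs N \<and> \<tau> \<in> spin_configs N}"

text \<open>Constant random variables count as (degenerate) Gaussian ones.\<close>

definition gaussian_rv :: "'a measure \<Rightarrow> ('a \<Rightarrow> real) \<Rightarrow> bool" where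
  "gaussian_rv M Y \<longleftrightarrow> Y \<in> borel_measurable M \<and>
     ((\<exists>m s. 0 < s \<and> distributed M lborel Y (\<lambda>x. ennreal (normal_density m s x))) \<or>
      (\<exists>m. AE \<omega> in M. Y \<omega> = m))"

definition jointly_gaussian :: "'a measure \<Rightarrow> 'i set \<Rightarrow> ('i \<Rightarrow> 'a \<Rightarrow> real) \<Rightarrow> bool" where
  "jointly_gaussian M I X \<longleftrightarrow>
     (\<forall>J c. finite J \<and> J \<subseteq> I \<longrightarrow> gaussian_rv M (\<lambda>\<omega>. \<Sum>j\<in>J. c j * X j \<omega>))"

text \<open>The two systems are indexed by the two-element type \<^typ>\<open>2\<close>, whose elements are
  \<open>1\<close> and \<open>2\<close>.\<close>

definition hamiltonian ::
  "(2 \<Rightarrow> (nat \<Rightarrow> real) \<Rightarrow> 'a \<Rightarrow> real) \<Rightarrow> real^2 \<Rightarrow> nat \<Rightarrow> 2 \<Rightarrow> (nat \<Rightarrow> real) \<Rightarrow> 'a \<Rightarrow> real" where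
  "hamiltonian X h N l \<sigma> \<omega> = X l \<sigma> \<omega> + h $ l * (\<Sum>i=1..N. \<sigma> i)"

definition constrained_free_energy ::
  "'a measure \<Rightarrow> (2 \<Rightarrow> (nat \<Rightarrow> real) \<Rightarrow> 'a \<Rightarrow> real) \<Rightarrow> real^2 \<Rightarrow> nat \<Rightarrow> real \<Rightarrow> real" where
  "constrained_free_energy M X h N q =
     1 / real N *
     (\<integral>\<omega>. ln (\<Sum>(\<sigma>, \<tau>) \<in> {(\<sigma>, \<tau>) \<in> spin_configs N \<times> spin_configs N. overlap N \<sigma> \<tau> = q}.
               exp (hamiltonian X h N 1 \<sigma> \<omega> + hamiltonian X h N 2 \<tau> \<omega>)) \<partial>M)"


subsection \<open>The covariance functions and the matrix T\<close>

text \<open>The series over all \<open>p \<ge> 2\<close>, reindexed.\<close>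

definition xi :: "(nat \<Rightarrow> real) \<Rightarrow> real \<Rightarrow> real" where
  "xi b s = (\<Sum>p. (b (p + 2))\<^sup>2 * s ^ (p + 2))"

text \<open>\<open>xi b\<close> is regarded as a function on the interval from -1 to 1 only, beyond which the
  series may diverge; at the endpoints the derivative is therefore one-sided.\<close>

definition xi_deriv :: "(nat \<Rightarrow> real) \<Rightarrow> real \<Rightarrow> real" where
  "xi_deriv b s = vector_derivative (xi b) (at s within {-1..1})"

definition deriv_or_right :: "(real \<Rightarrow> real) \<Rightarrow> real \<Rightarrow> real" where
  "deriv_or_right f s =
     (if f differentiable (at s within {0..1}) then vector_derivative f (at s within {0..1})
      else vector_derivative f (at_right s))"

definition iota :: "real \<Rightarrow> real" where
  "iota q = (if q \<ge> 0 then 1 else -1)"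

definition T_mat ::
  "(2 \<Rightarrow> 2 \<Rightarrow> nat \<Rightarrow> real) \<Rightarrow> (2 \<Rightarrow> 2 \<Rightarrow> real \<Rightarrow> real) \<Rightarrow> real \<Rightarrow> real \<Rightarrow> real^2^2" where
  "T_mat \<beta> \<rho> q s =
     (\<chi> l l'. deriv_or_right
        (\<lambda>u. xi_deriv (\<beta> l l') ((if l = l' then 1 else iota q) * \<rho> l l' u)) s)"

definition pos_semidef :: "real^'n^'n \<Rightarrow> bool" where
  "pos_semidef A \<longleftrightarrow> transpose A = A \<and> (\<forall>x. 0 \<le> x \<bullet> (A *v x))"


subsection \<open>Measures on the unit interval\<close>

definition prob_measures :: "real measure set" where
  "prob_measures = {\<mu>. prob_space \<mu> \<and> sets \<mu> = sets (restrict_space borel {0..1})}"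

definition atomic_measures :: "real measure set" where
  "atomic_measures = {\<mu> \<in> prob_measures. \<exists>A \<subseteq> {0..1}. finite A \<and> measure \<mu> A = 1}"

definition alpha :: "real measure \<Rightarrow> real \<Rightarrow> real" where
  "alpha \<mu> s = measure \<mu> {0..s}"

definition alpha_dist :: "real measure \<Rightarrow> real measure \<Rightarrow> real" where
  "alpha_dist \<mu> \<nu> = integral {0..1} (\<lambda>s. \<bar>alpha \<mu> s - alpha \<nu> s\<bar>)"

definition atoms :: "real measure \<Rightarrow> real set" where
  "atoms \<mu> = {t \<in> {0..1}. measure \<mu> {t} > 0}"


subsection \<open>The functional Psi\<close>

definition std_gaussian :: "(real^'n) measure" where
  "std_gaussian = density lborel (\<lambda>z. ennreal (\<Prod>i\<in>UNIV. std_normal_density (z $ i)))"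

text \<open>The centered Gaussian law with covariance \<open>C\<close>, for symmetric positive semi-definite
  (possibly singular) \<open>C\<close>: the law of \<open>A z\<close> with \<open>z\<close> standard Gaussian and \<open>A A\<^sup>T = C\<close>,
  which is the same for every such \<open>A\<close>.\<close>

definition centered_gaussian :: "real^'n^'n \<Rightarrow> (real^'n) measure" where
  "centered_gaussian C =
     distr std_gaussian borel (\<lambda>z. (SOME A :: real^'n^'n. A ** transpose A = C) *v z)"

definition hopf_cole_step ::
  "real \<Rightarrow> real^2^2 \<Rightarrow> (real^2 \<Rightarrow> real) \<Rightarrow> real^2 \<Rightarrow> real" where
  "hopf_cole_step m C f x =
     (if m = 0 then \<integral>y. f (x + y) \<partial>centered_gaussian C
      else 1 / m * ln (\<integral>y. exp (m * f (x + y)) \<partial>centered_gaussian C))"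

text \<open>The list holds the breakpoints in \<open>(s, 1]\<close> in increasing order, and \<open>a\<close> is constant on
  every interval \<open>[s, b)\<close> between consecutive ones (and up to the first of them).\<close>

primrec hopf_cole ::
  "(real \<Rightarrow> real) \<Rightarrow> (real \<Rightarrow> real^2^2) \<Rightarrow> (real^2 \<Rightarrow> real) \<Rightarrow> real list \<Rightarrow> real \<Rightarrow> real^2 \<Rightarrow> real" where
  "hopf_cole a T f [] s = f"
| "hopf_cole a T f (b # bs) s = hopf_cole_step (a s) (integral {s..b} T) (hopf_cole a T f bs b)"

definition terminal :: "real \<Rightarrow> real^2 \<Rightarrow> real" where
  "terminal lam x = ln (cosh (x $ 1) * cosh (x $ 2) * cosh lam + sinh (x $ 1) * sinh (x $ 2) * sinh lam)"

definition kinks :: "(2 \<Rightarrow> 2 \<Rightarrow> real \<Rightarrow> real) \<Rightarrow> real set" where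
  "kinks \<rho> = {t \<in> {0..1}. \<exists>l l'. \<not> \<rho> l l' differentiable (at t within {0..1})}"

text \<open>For atomic \<open>\<mu>\<close> this is the classical solution, with terminal value \<open>terminal lam\<close> at
  \<open>s = 1\<close>, of
  \<open>\<partial>\<^sub>s \<Psi> = - 1/2 (\<langle>T, \<nabla>\<^sup>2 \<Psi>\<rangle> + alpha \<mu> s \<langle>T \<nabla>\<Psi>, \<nabla>\<Psi>\<rangle>)\<close> with \<open>T = T_mat \<beta> \<rho> q\<close>, written out by the
  Hopf-Cole transformation.\<close>

definition Psi_atomic ::
  "(2 \<Rightarrow> 2 \<Rightarrow> nat \<Rightarrow> real) \<Rightarrow> (2 \<Rightarrow> 2 \<Rightarrow> real \<Rightarrow> real) \<Rightarrow> real \<Rightarrow>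
   real measure \<Rightarrow> real \<Rightarrow> real \<Rightarrow> real^2 \<Rightarrow> real" where
  "Psi_atomic \<beta> \<rho> q \<mu> lam s =
     hopf_cole (alpha \<mu>) (T_mat \<beta> \<rho> q) (terminal lam)
       (sorted_list_of_set ((atoms \<mu> \<union> kinks \<rho> \<union> {1}) \<inter> {s<..1})) s"

text \<open>Extension by continuity: the limit along atomic \<open>\<nu>\<close> with \<open>alpha_dist \<mu> \<nu> \<rightarrow> 0\<close>.\<close>

definition Psi ::
  "(2 \<Rightarrow> 2 \<Rightarrow> nat \<Rightarrow> real) \<Rightarrow> (2 \<Rightarrow> 2 \<Rightarrow> real \<Rightarrow> real) \<Rightarrow> real \<Rightarrow>
   real measure \<Rightarrow> real \<Rightarrow> real \<Rightarrow> real^2 \<Rightarrow> real" where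
  "Psi \<beta> \<rho> q \<mu> lam s x =
     Lim (inf (filtercomap (alpha_dist \<mu>) (nhds 0)) (principal atomic_measures))
         (\<lambda>\<nu>. Psi_atomic \<beta> \<rho> q \<nu> lam s x)"

end

theory Submission
  imports Defs
begin

text \<open>
  This is Guerra's interpolation with the Ruelle cascades replaced by explicit Gaussian recursions.
  Write \<open>gauss_step m c f x = 1/m log E exp (m f (x + z c))\<close> with a standard Gaussian \<open>z\<close>. Splitting
  all covariance increments into rank-one pieces turns both sides of the bound into an iterated
  \<open>gauss_step\<close> of one function, the log-partition function over pairs with overlap \<open>q\<close>: only the
  covariance of the whole process enters, because centered Gaussian laws are determined by it.

  The time derivative along the interpolation is computed without differentiating under integrals.
  A second-order expansion with cubic remainder, uniform in the base point, is preserved by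
  \<open>gauss_step\<close>, and so is an expansion in the size \<open>e\<close> of additional noise up to \<open>O(e\<^sup>3)\<close>. Moving
  from time \<open>t\<close> to \<open>u\<close> adds noise of size \<open>e = sqrt (u - t)\<close>, so the errors add up to
  \<open>O(sqrt (mesh))\<close> over a subdivision and vanish in the limit. Convexity of the \<open>\<xi>\<close> functions, in the
  form that they lie above their tangents, gives the sign of the main term level by level.

  Dropping the constraint, after inserting a factor that is 1 on it, makes the terminal cascade factorize
  over the sites into copies of \<open>Psi\<close>. Since \<open>Psi\<close> is Lipschitz in \<open>alpha \<mu>\<close>, atomic measures suffice.
\<close>

subsection \<open>Exponential means\<close>

text \<open>The derivative in time has a diagonal part, in which a replica is paired with itself,
  and parts in which two replicas separate at some level. On pairs with overlap q the self-overlaps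
  are the constants 1 and q, the end values of the overlap path, so the diagonal part is a constant;
  this is what the constraint is for. The two-replica parts carry the increments of alpha as
  weights. These are nonnegative, and summing by parts over the levels produces the integral in the
  bound.

  The amplitudes \<open>sqrt t\<close> and \<open>sqrt (1 - t)\<close> are not both differentiable
  at the ends of [0, 1]. Comparing two times by adding independent noise to their common part avoids
  this, provided that the constants do not depend on the directions of the noise beyond a bound on
  their size; hence the uniform form of the lemmas below.

  Working with \<open>scaled_expm1\<close> lets the expectation over the disorder, which is a step
  with m = 0, and the levels of the cascade share their proofs.\<close>

definition scaled_expm1 :: "real \<Rightarrow> real \<Rightarrow> real" where
  "scaled_expm1 m w = (if m = 0 then w else (exp (m * w) - 1) / m)"

lemma scaled_expm1_zero [simp]: "scaled_expm1 m 0 = 0"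
  by (simp add: scaled_expm1_def)

text \<open>Recentring: moving the centre k in \<open>g - k\<close> by a constant \<open>b\<close>
  splits off a multiple of the exponential weight. Both equations of
  \<open>log_mean_shift_root\<close> are integrals of this identity.\<close>

lemma scaled_expm1_add: "scaled_expm1 m (a + b) = scaled_expm1 m a + exp (m * a) * scaled_expm1 m b"
  by (auto simp: scaled_expm1_def field_simps exp_add)

lemma scaled_expm1_has_derivative [derivative_intros]:
  assumes "(f has_real_derivative D) (at x)"
  shows "((\<lambda>x. scaled_expm1 m (f x)) has_real_derivative exp (m * f x) * D) (at x)"
proof (cases "m = 0")
  case True
  then show ?thesis using assms by (simp add: scaled_expm1_def)
next
  case False
  then show ?thesis unfolding scaled_expm1_def using assms
    by (auto intro!: derivative_eq_intros simp: field_simps)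
qed

lemma scaled_expm1_mvt: obtains t where "\<bar>t\<bar> \<le> \<bar>w\<bar>" "scaled_expm1 m w = exp (m * t) * w"
proof -
  have D: "\<And>x. (scaled_expm1 m has_real_derivative exp (m * x)) (at x)"
    using scaled_expm1_has_derivative[OF DERIV_ident] by simp
  consider "w = 0" | "w > 0" | "w < 0" by linarith
  then show ?thesis
  proof cases
    case 1 then show ?thesis using that[of 0] by simp
  next
    case 2
    then obtain z where "0 < z" "z < w" "scaled_expm1 m w - scaled_expm1 m 0 = (w - 0) * exp (m * z)"
      using MVT2[of 0 w "scaled_expm1 m" "\<lambda>x. exp (m * x)"] D by blast
    then show ?thesis using that[of z] by (simp add: mult.commute)
  next
    case 3
    then obtain z where "w < z" "z < 0" "scaled_expm1 m 0 - scaled_expm1 m w = (0 - w) * exp (m * z)"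
      using MVT2[of w 0 "scaled_expm1 m" "\<lambda>x. exp (m * x)"] D by blast
    then show ?thesis using that[of z] by (simp add: mult.commute)
  qed
qed

lemma scaled_expm1_strict_mono: "a < b \<Longrightarrow> scaled_expm1 m a < scaled_expm1 m b"
proof (cases "m = 0")
  case False
  moreover assume "a < b"
  ultimately show ?thesis
    by (cases "m > 0") (auto simp: scaled_expm1_def divide_less_cancel)
qed (simp add: scaled_expm1_def)

lemma scaled_expm1_mono: "a \<le> b \<Longrightarrow> scaled_expm1 m a \<le> scaled_expm1 m b"
  using scaled_expm1_strict_mono[of a b m] by (cases "a = b") auto

lemma scaled_expm1_lower_linear: "0 \<le> m \<Longrightarrow> w \<le> scaled_expm1 m w"
  using exp_ge_add_one_self[of "m * w"] by (auto simp: scaled_expm1_def field_simps)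

text \<open>Inverts \<open>scaled_expm1 m\<close> near 0, uniformly in m: a small value forces a
  small argument. In the mean value form the slope is at least \<open>exp (- |w|)\<close>, because m
  is at most 1.\<close>

lemma scaled_expm1_abs_lower:
  assumes "0 \<le> m" "m \<le> 1" shows "\<bar>w\<bar> \<le> exp \<bar>w\<bar> * \<bar>scaled_expm1 m w\<bar>"
proof -
  obtain t where t: "\<bar>t\<bar> \<le> \<bar>w\<bar>" "scaled_expm1 m w = exp (m * t) * w" by (rule scaled_expm1_mvt)
  have "- \<bar>w\<bar> \<le> m * t"
  proof -
    have "\<bar>m * t\<bar> \<le> 1 * \<bar>w\<bar>" unfolding abs_mult using assms t by (intro mult_mono) auto
    then show ?thesis by linarith
  qed
  then have "1 \<le> exp (\<bar>w\<bar> + m * t)" by simp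
  then have "1 * \<bar>w\<bar> \<le> exp (\<bar>w\<bar> + m * t) * \<bar>w\<bar>" by (intro mult_right_mono) auto
  then show ?thesis by (simp add: t(2) abs_mult exp_add mult.assoc)
qed

lemma scaled_expm1_taylor:
  assumes "0 \<le> m" "m \<le> 1"
  shows "\<bar>scaled_expm1 m w - w - m * w\<^sup>2 / 2\<bar> \<le> \<bar>w\<bar> ^ 3 * exp \<bar>w\<bar>"
proof (cases "m = 0")
  case False
  obtain t where t: "\<bar>t\<bar> \<le> \<bar>m * w\<bar>"
    "exp (m * w) = (\<Sum>k<3. ((m * w) ^ k) / fact k) + (exp t / fact 3) * (m * w) ^ 3"
    using Maclaurin_exp_le by blast
  have tw: "t \<le> \<bar>w\<bar>"
    using t(1) assms mult_right_mono[of m 1 "\<bar>w\<bar>"] by (auto simp: abs_mult)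
  have "exp (m * w) = 1 + m * w + (m * w)\<^sup>2 / 2 + exp t / 6 * (m * w) ^ 3"
    using t(2) by (simp add: numeral_3_eq_3 power2_eq_square fact_numeral)
  then have "scaled_expm1 m w - w - m * w\<^sup>2 / 2 = exp t / 6 * m\<^sup>2 * w ^ 3"
    using False by (simp add: scaled_expm1_def field_simps power2_eq_square power3_eq_cube)
  then have "\<bar>scaled_expm1 m w - w - m * w\<^sup>2 / 2\<bar> = \<bar>exp t / 6 * m\<^sup>2 * w ^ 3\<bar>"
    by (rule arg_cong)
  also have "\<dots> = (m\<^sup>2 / 6) * (exp t * \<bar>w\<bar> ^ 3)"
    by (simp add: abs_mult power_abs)
  also have "\<dots> \<le> 1 * (exp \<bar>w\<bar> * \<bar>w\<bar> ^ 3)"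
    using assms tw power_mono[of m 1 2] by (intro mult_mono) auto
  finally show ?thesis by (simp add: mult.commute)
qed (simp add: scaled_expm1_def)

text \<open>The factor w^2 is the point: the linear terms cancel, so a change of m costs only a
  second moment, and for a Gaussian step that is proportional to the variance. All functions
  involved vanish at 0, and their derivatives are compared separately on the two half-lines.\<close>

lemma scaled_expm1_diff:
  assumes m: "0 \<le> m" "m \<le> m'" "m' \<le> 1"
  shows "scaled_expm1 m w \<le> scaled_expm1 m' w" "scaled_expm1 m' w \<le> scaled_expm1 m w + (m' - m) / 2 * (w\<^sup>2 * exp \<bar>w\<bar>)"
proof -
  have pos: "scaled_expm1 m w \<le> scaled_expm1 m' w \<and> scaled_expm1 m' w \<le> scaled_expm1 m w + (m' - m) / 2 * (w\<^sup>2 * exp w)"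
    if "0 \<le> w" for w
  proof
    have "scaled_expm1 m 0 - scaled_expm1 m' 0 \<ge> scaled_expm1 m w - scaled_expm1 m' w"
    proof (rule DERIV_nonpos_imp_nonincreasing[OF that])
      fix u :: real assume u: "0 \<le> u" "u \<le> w"
      have "((\<lambda>u. scaled_expm1 m u - scaled_expm1 m' u) has_real_derivative exp (m * u) - exp (m' * u)) (at u)"
        by (auto intro!: derivative_eq_intros)
      moreover have "exp (m * u) - exp (m' * u) \<le> 0" using u m by (simp add: mult_right_mono)
      ultimately show "\<exists>y. ((\<lambda>u. scaled_expm1 m u - scaled_expm1 m' u) has_real_derivative y) (at u) \<and> y \<le> 0" by blast
    qed
    then show "scaled_expm1 m w \<le> scaled_expm1 m' w" by simp
    let ?F = "\<lambda>u. scaled_expm1 m u + (m' - m) / 2 * (u\<^sup>2 * exp u) - scaled_expm1 m' u"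
    have "?F 0 \<le> ?F w"
    proof (rule DERIV_nonneg_imp_nondecreasing[OF that])
      fix u :: real assume u: "0 \<le> u" "u \<le> w"
      \<comment> \<open>The derivative of u^2 exp u / 2 is u exp u plus a nonnegative term; u exp u
        alone already pays for the difference of the two exponentials.\<close>
      let ?D = "exp (m * u) + (m' - m) / 2 * (2 * u * exp u + u\<^sup>2 * exp u) - exp (m' * u)"
      have "(?F has_real_derivative ?D) (at u)"
        by (auto intro!: derivative_eq_intros simp: field_simps)
      moreover have "?D \<ge> 0"
      proof -
        have "1 + (m - m') * u \<le> exp ((m - m') * u)" by (rule exp_ge_add_one_self)
        then have "exp (m' * u) * (1 + (m - m') * u) \<le> exp (m' * u) * exp ((m - m') * u)"
          by (intro mult_left_mono) auto
        also have "\<dots> = exp (m * u)" by (simp add: exp_add[symmetric] algebra_simps)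
        finally have "exp (m' * u) - exp (m * u) \<le> (m' - m) * u * exp (m' * u)"
          by (simp add: algebra_simps)
        also have "\<dots> \<le> (m' - m) * u * exp u"
          using m u mult_right_mono[of m' 1 u] by (intro mult_left_mono) auto
        finally have "exp (m' * u) - exp (m * u) \<le> (m' - m) * u * exp u" .
        moreover have "0 \<le> (m' - m) / 2 * (u\<^sup>2 * exp u)" using m by simp
        moreover have "?D = exp (m * u) - exp (m' * u) + (m' - m) * u * exp u + (m' - m) / 2 * (u\<^sup>2 * exp u)"
          by (simp add: field_simps)
        ultimately show ?thesis by linarith
      qed
      ultimately show "\<exists>y. (?F has_real_derivative y) (at u) \<and> 0 \<le> y" by blast
    qed
    then show "scaled_expm1 m' w \<le> scaled_expm1 m w + (m' - m) / 2 * (w\<^sup>2 * exp w)" by simp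
  qed
  have neg: "scaled_expm1 m (-w) \<le> scaled_expm1 m' (-w) \<and> scaled_expm1 m' (-w) \<le> scaled_expm1 m (-w) + (m' - m) / 2 * (w\<^sup>2 * exp w)"
    if "0 \<le> w" for w
  proof
    have "scaled_expm1 m (-0) - scaled_expm1 m' (-0) \<ge> scaled_expm1 m (-w) - scaled_expm1 m' (-w)"
    proof (rule DERIV_nonpos_imp_nonincreasing[OF that])
      fix u :: real assume u: "0 \<le> u" "u \<le> w"
      have "((\<lambda>u. scaled_expm1 m (-u) - scaled_expm1 m' (-u)) has_real_derivative - exp (- m * u) + exp (- m' * u)) (at u)"
        by (auto intro!: derivative_eq_intros)
      moreover have "- exp (- m * u) + exp (- m' * u) \<le> 0" using u m by (simp add: mult_right_mono)
      ultimately show "\<exists>y. ((\<lambda>u. scaled_expm1 m (-u) - scaled_expm1 m' (-u)) has_real_derivative y) (at u) \<and> y \<le> 0" by blast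
    qed
    then show "scaled_expm1 m (-w) \<le> scaled_expm1 m' (-w)" by simp
    let ?F = "\<lambda>u. scaled_expm1 m (-u) + (m' - m) / 2 * (u\<^sup>2 * exp u) - scaled_expm1 m' (-u)"
    have "?F 0 \<le> ?F w"
    proof (rule DERIV_nonneg_imp_nondecreasing[OF that])
      fix u :: real assume u: "0 \<le> u" "u \<le> w"
      let ?D = "- exp (- m * u) + (m' - m) / 2 * (2 * u * exp u + u\<^sup>2 * exp u) + exp (- m' * u)"
      have "(?F has_real_derivative ?D) (at u)"
        by (auto intro!: derivative_eq_intros simp: field_simps)
      moreover have "?D \<ge> 0"
      proof -
        have "1 + (m - m') * u \<le> exp ((m - m') * u)" by (rule exp_ge_add_one_self)
        then have "exp (- m * u) * (1 + (m - m') * u) \<le> exp (- m * u) * exp ((m - m') * u)"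
          by (intro mult_left_mono) auto
        also have "\<dots> = exp (- m' * u)" by (simp add: exp_add[symmetric] algebra_simps)
        finally have "exp (- m * u) - exp (- m' * u) \<le> (m' - m) * u * exp (- m * u)"
          by (simp add: algebra_simps)
        also have "\<dots> \<le> (m' - m) * u * exp u"
        proof -
          have "- (m * u) \<le> u" using m u mult_nonneg_nonneg[of m u] by linarith
          then show ?thesis using m u by (intro mult_left_mono) auto
        qed
        finally have "exp (- m * u) - exp (- m' * u) \<le> (m' - m) * u * exp u" .
        moreover have "0 \<le> (m' - m) / 2 * (u\<^sup>2 * exp u)" using m by simp
        moreover have "?D = exp (- m' * u) - exp (- m * u) + (m' - m) * u * exp u + (m' - m) / 2 * (u\<^sup>2 * exp u)"
          by (simp add: field_simps)
        ultimately show ?thesis by linarith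
      qed
      ultimately show "\<exists>y. (?F has_real_derivative y) (at u) \<and> 0 \<le> y" by blast
    qed
    then show "scaled_expm1 m' (-w) \<le> scaled_expm1 m (-w) + (m' - m) / 2 * (w\<^sup>2 * exp w)" by simp
  qed
  show "scaled_expm1 m w \<le> scaled_expm1 m' w" "scaled_expm1 m' w \<le> scaled_expm1 m w + (m' - m) / 2 * (w\<^sup>2 * exp \<bar>w\<bar>)"
    using pos[of w] neg[of "-w"] by (cases "0 \<le> w"; simp)+
qed

text \<open>The value k at which the mean of \<open>scaled_expm1 m (g - k)\<close> vanishes, for m =
  0 as for other m. Most proofs below use this equation, through \<open>log_mean_root\<close> and
  \<open>log_mean_le_iff\<close>, instead of the logarithm.\<close>

definition log_mean :: "real \<Rightarrow> 'a measure \<Rightarrow> ('a \<Rightarrow> real) \<Rightarrow> real" where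
  "log_mean m P g = (if m = 0 then \<integral>x. g x \<partial>P else 1 / m * ln (\<integral>x. exp (m * g x) \<partial>P))"

context prob_space
begin

lemma integral_exp_pos:
  assumes "integrable M (\<lambda>x. exp (g x))" shows "0 < (\<integral>x. exp (g x) \<partial>M :: real)"
proof -
  have "(\<integral>x. exp (g x) \<partial>M) \<noteq> 0"
  proof
    assume "(\<integral>x. exp (g x) \<partial>M) = 0"
    then have "AE x in M. exp (g x) = 0"
      using integral_nonneg_eq_0_iff_AE[OF assms] by simp
    then show False using AE_False by simp
  qed
  moreover have "0 \<le> (\<integral>x. exp (g x) \<partial>M)" by simp
  ultimately show ?thesis by linarith
qed

lemma integrable_exp_le:
  fixes g Z :: "'a \<Rightarrow> real"
  assumes "g \<in> borel_measurable M" "integrable M (\<lambda>x. exp (k * Z x))"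
    and "\<And>x. \<bar>g x\<bar> \<le> B * exp (k * Z x)"
  shows "integrable M g"
proof (rule Bochner_Integration.integrable_bound[of _ "\<lambda>x. B * exp (k * Z x)"])
  show "AE x in M. norm (g x) \<le> norm (B * exp (k * Z x))"
    using assms(3) by (auto intro: order_trans[OF _ abs_ge_self])
qed (use assms in auto)

lemma log_mean_root:
  assumes "integrable M g" "integrable M (\<lambda>x. exp (m * g x))"
  shows "(\<integral>x. exp (m * (g x - log_mean m M g)) \<partial>M) = 1"
    and "(\<integral>x. scaled_expm1 m (g x - log_mean m M g) \<partial>M) = 0"
    and "integrable M (\<lambda>x. exp (m * (g x - k)))"
    and "integrable M (\<lambda>x. scaled_expm1 m (g x - k))"
proof -
  have eq: "exp (m * (g x - k)) = exp (- m * k) * exp (m * g x)" for x k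
    by (simp add: exp_add[symmetric] algebra_simps)
  show *: "integrable M (\<lambda>x. exp (m * (g x - k)))" for k
    unfolding eq using assms by simp
  show "integrable M (\<lambda>x. scaled_expm1 m (g x - k))" for k
    using assms *[of k] by (cases "m = 0") (auto simp: scaled_expm1_def)
  show **: "(\<integral>x. exp (m * (g x - log_mean m M g)) \<partial>M) = 1"
  proof (cases "m = 0")
    case False
    then have "exp (m * log_mean m M g) = (\<integral>x. exp (m * g x) \<partial>M)"
      using integral_exp_pos[OF assms(2)] by (simp add: log_mean_def)
    then show ?thesis unfolding eq using integral_exp_pos[OF assms(2)] by (simp add: exp_minus)
  qed (simp add: prob_space)
  show "(\<integral>x. scaled_expm1 m (g x - log_mean m M g) \<partial>M) = 0"
  proof (cases "m = 0")
    case True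
    then show ?thesis using assms by (simp add: scaled_expm1_def log_mean_def prob_space)
  next
    case False
    then show ?thesis using ** * by (simp add: scaled_expm1_def prob_space)
  qed
qed

text \<open>Two ways to compare a guess k with the root: the weight may be taken at the root, where
  its mean is 1, or at the guess. The second form serves \<open>log_mean_expansion\<close>, where
  only the guess is explicit.\<close>

lemma log_mean_shift_root:
  assumes "integrable M g" "integrable M (\<lambda>x. exp (m * g x))"
  shows "scaled_expm1 m (log_mean m M g - k) * (\<integral>x. exp (m * (g x - log_mean m M g)) \<partial>M) = (\<integral>x. scaled_expm1 m (g x - k) \<partial>M)"
    and "(\<integral>x. scaled_expm1 m (g x - k) \<partial>M) + scaled_expm1 m (k - log_mean m M g) * (\<integral>x. exp (m * (g x - k)) \<partial>M) = 0"
proof -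
  note r = log_mean_root[OF assms]
  have "(\<integral>x. scaled_expm1 m (g x - k) \<partial>M) =
     (\<integral>x. scaled_expm1 m (g x - log_mean m M g) + exp (m * (g x - log_mean m M g)) * scaled_expm1 m (log_mean m M g - k) \<partial>M)"
    unfolding scaled_expm1_add[symmetric] by simp
  also have "\<dots> = scaled_expm1 m (log_mean m M g - k)"
    using r by simp
  finally show "scaled_expm1 m (log_mean m M g - k) * (\<integral>x. exp (m * (g x - log_mean m M g)) \<partial>M) = (\<integral>x. scaled_expm1 m (g x - k) \<partial>M)"
    using r by simp
  have "(\<integral>x. scaled_expm1 m (g x - log_mean m M g) \<partial>M) =
     (\<integral>x. scaled_expm1 m (g x - k) + exp (m * (g x - k)) * scaled_expm1 m (k - log_mean m M g) \<partial>M)"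
    unfolding scaled_expm1_add[symmetric] by simp
  then show "(\<integral>x. scaled_expm1 m (g x - k) \<partial>M) + scaled_expm1 m (k - log_mean m M g) * (\<integral>x. exp (m * (g x - k)) \<partial>M) = 0"
    using r by (simp add: mult.commute)
qed

lemma log_mean_le_iff:
  assumes "integrable M g" "integrable M (\<lambda>x. exp (m * g x))"
  shows "log_mean m M g \<le> k \<longleftrightarrow> (\<integral>x. scaled_expm1 m (g x - k) \<partial>M) \<le> 0"
    and "k \<le> log_mean m M g \<longleftrightarrow> 0 \<le> (\<integral>x. scaled_expm1 m (g x - k) \<partial>M)"
proof -
  have e: "(\<integral>x. scaled_expm1 m (g x - k) \<partial>M) = scaled_expm1 m (log_mean m M g - k)"
    using log_mean_shift_root(1)[OF assms, of k] log_mean_root(1)[OF assms] by simp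
  have s: "scaled_expm1 m u \<le> 0 \<longleftrightarrow> u \<le> 0" "0 \<le> scaled_expm1 m u \<longleftrightarrow> 0 \<le> u" for u
    using scaled_expm1_mono[of u 0 m] scaled_expm1_mono[of 0 u m] scaled_expm1_strict_mono[of u 0 m] scaled_expm1_strict_mono[of 0 u m]
    by (auto simp: not_le[symmetric])
  show "log_mean m M g \<le> k \<longleftrightarrow> (\<integral>x. scaled_expm1 m (g x - k) \<partial>M) \<le> 0"
    and "k \<le> log_mean m M g \<longleftrightarrow> 0 \<le> (\<integral>x. scaled_expm1 m (g x - k) \<partial>M)"
    unfolding e s by auto
qed

lemma log_mean_mono:
  assumes f: "integrable M f" "integrable M (\<lambda>x. exp (m * f x))"
    and g: "integrable M g" "integrable M (\<lambda>x. exp (m * g x))"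
    and "\<And>x. f x \<le> g x"
  shows "log_mean m M f \<le> log_mean m M g"
  unfolding log_mean_le_iff(1)[OF f]
proof -
  have "(\<integral>x. scaled_expm1 m (f x - log_mean m M g) \<partial>M) \<le> (\<integral>x. scaled_expm1 m (g x - log_mean m M g) \<partial>M)"
    by (intro integral_mono log_mean_root f g scaled_expm1_mono) (simp add: assms)
  then show "(\<integral>x. scaled_expm1 m (f x - log_mean m M g) \<partial>M) \<le> 0" using log_mean_root[OF g] by simp
qed

lemma log_mean_add_const:
  assumes f: "integrable M f" "integrable M (\<lambda>x. exp (m * f x))"
  shows "log_mean m M (\<lambda>x. f x + k) = log_mean m M f + k"
proof -
  have e: "exp (m * (f x + k)) = exp (m * f x) * exp (m * k)" for x
    by (simp add: exp_add[symmetric] algebra_simps)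
  have f': "integrable M (\<lambda>x. f x + k)" "integrable M (\<lambda>x. exp (m * (f x + k)))"
    unfolding e using f by auto
  show ?thesis
  proof (rule antisym)
    show "log_mean m M (\<lambda>x. f x + k) \<le> log_mean m M f + k"
      unfolding log_mean_le_iff(1)[OF f'] using log_mean_root(2)[OF f] by simp
    show "log_mean m M f + k \<le> log_mean m M (\<lambda>x. f x + k)"
      unfolding log_mean_le_iff(2)[OF f'] using log_mean_root(2)[OF f] by simp
  qed
qed

lemma log_mean_const: "log_mean m M (\<lambda>_. k) = k"
  by (simp add: log_mean_def prob_space)

lemma integrable_dominated_exp:
  fixes g Z :: "'a \<Rightarrow> real"
  assumes "g \<in> borel_measurable M" "\<And>x. \<bar>g x\<bar> \<le> Z x" "integrable M (\<lambda>x. exp (Z x))" "0 \<le> m" "m \<le> 1"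
  shows "integrable M g" "integrable M (\<lambda>x. exp (m * g x))"
proof -
  have Z0: "0 \<le> Z x" for x using assms(2)[of x] by linarith
  show "integrable M g"
    by (rule integrable_exp_le[where k=1 and Z=Z and B=1])
       (use assms in \<open>auto intro!: order_trans[OF assms(2)] order_trans[OF _ exp_ge_add_one_self]\<close>)
  show "integrable M (\<lambda>x. exp (m * g x))"
  proof (rule integrable_exp_le[where k=1 and Z=Z and B=1])
    show "\<bar>exp (m * g x)\<bar> \<le> 1 * exp (1 * Z x)" for x
    proof -
      have "m * g x \<le> 1 * Z x"
        using assms(2)[of x] assms(4,5) Z0[of x] mult_mono[of m 1 "\<bar>g x\<bar>" "Z x"]
          mult_left_mono[OF abs_ge_self[of "g x"] assms(4)] by linarith
      then show ?thesis by simp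
    qed
  qed (use assms in auto)
qed

text \<open>Monotonicity in m squeezes the value between the mean of \<open>g\<close>, the case m =
  0, and \<open>ln E\<close>, which bounds the case m = 1. An exponential moment of the dominating
  \<open>Z\<close> controls both.\<close>

lemma log_mean_between:
  assumes g: "g \<in> borel_measurable M" "\<And>x. \<bar>g x\<bar> \<le> Z x" "integrable M (\<lambda>x. exp (Z x))" "0 \<le> m" "m \<le> 1"
    and Z [measurable]: "Z \<in> borel_measurable M" and E: "(\<integral>x. exp (Z x) \<partial>M) \<le> E"
  shows "\<bar>log_mean m M g\<bar> \<le> E"
proof -
  note i = integrable_dominated_exp[OF g] and i1 = integrable_dominated_exp[OF g(1-3), of 1, simplified]
  have Z0: "0 \<le> Z x" for x using g(2)[of x] by linarith
  have ZE: "Z x \<le> exp (Z x)" for x using exp_ge_add_one_self[of "Z x"] by linarith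
  have iZ: "integrable M Z"
    by (rule integrable_exp_le[where k=1 and Z=Z and B=1]) (use g Z0 ZE in auto)
  have EZ: "(\<integral>x. Z x \<partial>M) \<le> E"
    using integral_mono[OF iZ g(3) ZE] E by simp
  have "- (\<integral>x. Z x \<partial>M) \<le> (\<integral>x. g x \<partial>M)"
    using integral_mono[of M "\<lambda>x. - Z x" g] iZ i g(2) by (simp add: abs_le_iff minus_le_iff)
  also have "(\<integral>x. g x \<partial>M) \<le> log_mean m M g"
    unfolding log_mean_le_iff(2)[OF i]
  proof -
    have "(\<integral>x. g x - (\<integral>x. g x \<partial>M) \<partial>M) \<le> (\<integral>x. scaled_expm1 m (g x - (\<integral>x. g x \<partial>M)) \<partial>M)"
      using i g(4) by (intro integral_mono log_mean_root scaled_expm1_lower_linear) auto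
    then show "0 \<le> (\<integral>x. scaled_expm1 m (g x - (\<integral>x. g x \<partial>M)) \<partial>M)" using i by (simp add: prob_space)
  qed
  finally have lo: "- E \<le> log_mean m M g" using EZ by linarith
  have E1: "1 \<le> E"
  proof -
    have "(\<integral>x. 1 \<partial>M) \<le> (\<integral>x. exp (Z x) \<partial>M)" by (intro integral_mono g) (use Z0 in auto)
    then show ?thesis using E by (simp add: prob_space)
  qed
  have "log_mean m M g \<le> ln E"
    unfolding log_mean_le_iff(1)[OF i]
  proof -
    have "(\<integral>x. scaled_expm1 m (g x - ln E) \<partial>M) \<le> (\<integral>x. scaled_expm1 1 (g x - ln E) \<partial>M)"
      using i1 i g by (intro integral_mono log_mean_root scaled_expm1_diff) auto
    also have "\<dots> = (\<integral>x. exp (g x) / E - 1 \<partial>M)"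
      using E1 by (simp add: scaled_expm1_def exp_diff)
    also have "\<dots> = (\<integral>x. exp (g x) \<partial>M) / E - 1"
      using i1 by (simp add: prob_space)
    also have "\<dots> \<le> 0"
    proof -
      have "(\<integral>x. exp (g x) \<partial>M) \<le> (\<integral>x. exp (Z x) \<partial>M)"
        using i1 g abs_ge_self order_trans by (intro integral_mono) (auto intro!: order_trans[OF abs_ge_self g(2)])
      then show ?thesis using E E1 by (simp add: field_simps)
    qed
    finally show "(\<integral>x. scaled_expm1 m (g x - ln E) \<partial>M) \<le> 0" .
  qed
  also have "ln E \<le> E" using E1 ln_le_minus_one[of E] by simp
  finally show ?thesis using lo by auto
qed

text \<open>The cumulant expansion to second order; \<open>X1\<close>, \<open>X2\<close> and
  \<open>R\<close> are the parts of order e, e^2 and e^3. The claimed value is taken as a trial root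
  \<open>k0\<close>: once the mean of \<open>scaled_expm1 m\<close> centred at \<open>k0\<close> is
  O(e^3), so is the distance of \<open>k0\<close> from the true root. \<open>Z\<close> is a common
  random bound, so that the constant involves only its exponential moment. In that constant, 9 = 6 +
  1 + 2 adds the pointwise errors \<open>t2\<close>, \<open>t3\<close> and \<open>t4\<close>, and 14
  = 6 + 4 + 4 comes from the shift in \<open>Y\<close>, from the lower bound \<open>b2\<close> and
  from inverting \<open>scaled_expm1\<close>.\<close>

lemma log_mean_expansion:
  fixes X1 X2 R Z :: "'a \<Rightarrow> real"
  assumes m: "0 \<le> m" "m \<le> 1" and e: "0 \<le> e" "e \<le> 1"
    and meas [measurable]: "X1 \<in> borel_measurable M" "X2 \<in> borel_measurable M"
      "R \<in> borel_measurable M" "Z \<in> borel_measurable M"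
    and X1: "\<And>x. \<bar>X1 x\<bar> \<le> e * Z x" and X2: "\<And>x. \<bar>X2 x\<bar> \<le> e\<^sup>2 * exp (Z x)"
    and R: "\<And>x. \<bar>R x\<bar> \<le> e ^ 3 * exp (Z x)" and sum: "\<And>x. \<bar>X1 x + X2 x + R x\<bar> \<le> e * Z x"
    and Z0: "\<And>x. 0 \<le> Z x"
    and i9: "integrable M (\<lambda>x. exp (9 * Z x))" and E: "(\<integral>x. exp (9 * Z x) \<partial>M) \<le> E"
  shows "\<bar>log_mean m M (\<lambda>x. X1 x + X2 x + R x) -
     ((\<integral>x. X1 x \<partial>M) + (\<integral>x. X2 x \<partial>M) + m / 2 * ((\<integral>x. (X1 x)\<^sup>2 \<partial>M) - (\<integral>x. X1 x \<partial>M)\<^sup>2))\<bar>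
     \<le> 9 * E * exp (14 * E) * e ^ 3"
proof -
  have dom: "integrable M f" if "f \<in> borel_measurable M" "\<And>x. \<bar>f x\<bar> \<le> B * exp (9 * Z x)" for f :: "'a \<Rightarrow> real" and B
    by (rule integrable_exp_le[OF that(1) i9 that(2)])
  have le9: "exp (k * Z x) \<le> exp (9 * Z x)" if "k \<le> 9" for x k
    using that Z0[of x] by (simp add: mult_right_mono)
  have exp1: "exp (Z x) \<le> exp (9 * Z x)" for x using le9[of 1 x] by simp
  have Zle: "Z x \<le> exp (Z x)" for x using exp_ge_add_one_self[of "Z x"] by linarith
  have Z9: "Z x \<le> exp (9 * Z x)" for x using Zle exp1 order_trans by blast
  have Z2: "(Z x)\<^sup>2 \<le> 2 * exp (Z x)" for x
    using exp_lower_Taylor_quadratic[OF Z0[of x]] Z0[of x] by linarith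
  have Z29: "(Z x)\<^sup>2 \<le> 2 * exp (9 * Z x)" for x using Z2[of x] exp1[of x] by linarith
  have e2: "e\<^sup>2 \<le> e" "e\<^sup>2 \<le> 1" "e ^ 3 \<le> e\<^sup>2" "e ^ 3 \<le> 1"
    using e by (auto simp: power2_eq_square power3_eq_cube mult_le_one mult_left_le)
  have X1': "\<bar>X1 x\<bar> \<le> Z x" for x
    using X1[of x] mult_right_mono[OF e(2) Z0[of x]] by linarith
  have X1sq: "(X1 x)\<^sup>2 \<le> e\<^sup>2 * (Z x)\<^sup>2" for x
    using power_mono[OF X1, of x 2] by (simp add: power_mult_distrib)
  have iZ: "integrable M Z" by (rule dom[of _ 1]) (use Z0 Z9 in auto)
  have iX1: "integrable M X1" by (rule dom[of _ 1]) (use order_trans[OF X1' Z9] in auto)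
  have iX1s: "integrable M (\<lambda>x. (X1 x)\<^sup>2)"
  proof (rule dom[of _ 2])
    show "\<bar>(X1 x)\<^sup>2\<bar> \<le> 2 * exp (9 * Z x)" for x
      using power_mono[OF X1', of x 2] Z29[of x] by simp
  qed simp
  have iX2: "integrable M X2"
  proof (rule dom[of _ 1])
    show "\<bar>X2 x\<bar> \<le> 1 * exp (9 * Z x)" for x
      using X2[of x] mult_right_mono[OF e2(2) exp_ge_zero[of "Z x"]] exp1[of x] by linarith
  qed simp
  have iR: "integrable M R"
  proof (rule dom[of _ 1])
    show "\<bar>R x\<bar> \<le> 1 * exp (9 * Z x)" for x
      using R[of x] mult_right_mono[OF e2(4) exp_ge_zero[of "Z x"]] exp1[of x] by linarith
  qed simp
  have iE: "integrable M (\<lambda>x. exp (k * Z x))" if "k \<le> 9" for k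
    by (rule dom[of _ 1]) (use le9[OF that] in auto)
  have EE: "(\<integral>x. exp (k * Z x) \<partial>M) \<le> E" if "k \<le> 9" for k
    using integral_mono[OF iE[OF that] i9 le9[OF that]] E by simp
  have E1: "1 \<le> E" using EE[of 0] by (simp add: prob_space)
  have EZ: "(\<integral>x. Z x \<partial>M) \<le> E" using integral_mono[OF iZ i9 Z9] E by simp
  have EX1: "\<bar>\<integral>x. X1 x \<partial>M\<bar> \<le> e * E"
  proof -
    have "\<bar>\<integral>x. X1 x \<partial>M\<bar> \<le> (\<integral>x. \<bar>X1 x\<bar> \<partial>M)" by (rule integral_abs_bound)
    also have "\<dots> \<le> (\<integral>x. e * Z x \<partial>M)" using iX1 iZ X1 by (intro integral_mono) auto
    also have "\<dots> \<le> e * E" using EZ e by (simp add: mult_left_mono)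
    finally show ?thesis .
  qed
  have EX2: "\<bar>\<integral>x. X2 x \<partial>M\<bar> \<le> e\<^sup>2 * E"
  proof -
    have "\<bar>\<integral>x. X2 x \<partial>M\<bar> \<le> (\<integral>x. \<bar>X2 x\<bar> \<partial>M)" by (rule integral_abs_bound)
    also have "\<dots> \<le> (\<integral>x. e\<^sup>2 * exp (1 * Z x) \<partial>M)" using iX2 iE[of 1] X2 by (intro integral_mono) auto
    also have "\<dots> \<le> e\<^sup>2 * E" using EE[of 1] e by (simp add: mult_left_mono)
    finally show ?thesis .
  qed
  define a1 where "a1 = (\<integral>x. X1 x \<partial>M)"
  define Var where "Var = (\<integral>x. (X1 x)\<^sup>2 \<partial>M) - a1\<^sup>2"
  have Vareq: "Var = (\<integral>x. (X1 x - a1)\<^sup>2 \<partial>M)"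
    unfolding Var_def power2_diff using iX1 iX1s
    by (simp add: prob_space a1_def power2_eq_square)
  have Var: "0 \<le> Var" "Var \<le> 2 * e\<^sup>2 * E"
  proof -
    show "0 \<le> Var" unfolding Vareq by simp
    have "Var \<le> (\<integral>x. (X1 x)\<^sup>2 \<partial>M)" unfolding Var_def by simp
    also have "\<dots> \<le> (\<integral>x. e\<^sup>2 * (2 * exp (9 * Z x)) \<partial>M)"
      using iX1s i9 by (intro integral_mono order_trans[OF X1sq] mult_left_mono Z29) auto
    also have "\<dots> = 2 * e\<^sup>2 * (\<integral>x. exp (9 * Z x) \<partial>M)" by simp
    also have "\<dots> \<le> 2 * e\<^sup>2 * E" using E e by (intro mult_left_mono) auto
    finally show "Var \<le> 2 * e\<^sup>2 * E" .
  qed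
  define c2 where "c2 = (\<integral>x. X2 x \<partial>M) + m / 2 * Var"
  define k0 where "k0 = a1 + c2"
  have mV: "0 \<le> m / 2 * Var" "m / 2 * Var \<le> e\<^sup>2 * E"
  proof -
    have "m / 2 * Var \<le> 1 / 2 * (2 * e\<^sup>2 * E)" using m Var by (intro mult_mono) auto
    then show "m / 2 * Var \<le> e\<^sup>2 * E" by simp
  qed (use m Var in auto)
  have c2: "\<bar>c2\<bar> \<le> 2 * e\<^sup>2 * E" unfolding c2_def using EX2 mV by linarith
  have k0: "\<bar>k0\<bar> \<le> e * (3 * E)"
  proof -
    have "e\<^sup>2 * E \<le> e * E" using e2 E1 by (intro mult_right_mono) auto
    then show ?thesis using EX1 c2 unfolding k0_def a1_def by linarith
  qed
  define D where "D x = X1 x + X2 x + R x" for x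
  define W where "W x = D x - k0" for x
  \<comment> \<open>The shift by 3 E absorbs the trial root: |k0| is at most 3 e E, so |W| is at
    most e Y.\<close>
  define Y where "Y x = Z x + 3 * E" for x
  have Wm [measurable]: "W \<in> borel_measurable M" "D \<in> borel_measurable M" "Y \<in> borel_measurable M"
    unfolding W_def D_def Y_def by measurable
  have Y0: "0 \<le> Y x" for x using Z0[of x] E1 by (simp add: Y_def)
  have WY: "\<bar>W x\<bar> \<le> e * Y x" for x
    using sum[of x] k0 unfolding W_def Y_def D_def by (simp add: algebra_simps)
  have WY1: "\<bar>W x\<bar> \<le> Y x" for x
    using WY[of x] mult_right_mono[OF e(2) Y0[of x]] by linarith
  \<comment> \<open>The second-order Taylor polynomial of \<open>scaled_expm1 m (W x)\<close>
    without its terms of order e^3. The choice of \<open>c2\<close> makes its mean exactly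
    zero.\<close>
  define G where "G x = X1 x - a1 + X2 x - c2 + m / 2 * ((X1 x)\<^sup>2 - 2 * a1 * X1 x + a1\<^sup>2)" for x
  have iG: "integrable M G" unfolding G_def using iX1 iX2 iX1s by auto
  have G0: "(\<integral>x. G x \<partial>M) = 0"
    unfolding G_def using iX1 iX2 iX1s
    by (simp add: prob_space a1_def[symmetric] c2_def Var_def power2_eq_square algebra_simps)
  have expY: "exp (Z x) + E \<le> exp (Y x)" for x
  proof -
    have "exp (Z x) + E \<le> exp (Z x) * (1 + 3 * E)"
    proof -
      have "E * 1 \<le> 3 * E * exp (Z x)" using E1 Z0[of x] by (intro mult_mono) auto
      then show ?thesis by (simp add: algebra_simps)
    qed
    also have "\<dots> \<le> exp (Z x) * exp (3 * E)" by (intro mult_left_mono exp_ge_add_one_self) auto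
    finally show ?thesis by (simp add: Y_def exp_add)
  qed
  have err: "\<bar>scaled_expm1 m (W x) - G x\<bar> \<le> 9 * e ^ 3 * exp (2 * Y x)" for x
  proof -
    define A where "A = X1 x - a1"
    define S where "S = X2 x + R x - c2"
    have A: "\<bar>A\<bar> \<le> e * Y x"
    proof -
      have "e * E \<le> e * (3 * E)" using e E1 by (intro mult_left_mono) auto
      then show ?thesis using X1[of x] EX1 unfolding A_def a1_def Y_def by (simp add: algebra_simps)
    qed
    have S: "\<bar>S\<bar> \<le> 2 * e\<^sup>2 * exp (Y x)"
    proof -
      have "e ^ 3 * exp (Z x) \<le> e\<^sup>2 * exp (Z x)" using e2 by (intro mult_right_mono) auto
      then have "\<bar>S\<bar> \<le> 2 * (e\<^sup>2 * exp (Z x)) + 2 * e\<^sup>2 * E"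
        using X2[of x] R[of x] c2 unfolding S_def by linarith
      also have "\<dots> = 2 * e\<^sup>2 * (exp (Z x) + E)" by (simp add: algebra_simps)
      also have "\<dots> \<le> 2 * e\<^sup>2 * exp (Y x)" using expY[of x] e by (intro mult_left_mono) auto
      finally show ?thesis .
    qed
    have WAS: "W x = A + S" unfolding W_def A_def S_def k0_def D_def by simp
    have Gx: "G x = A + X2 x - c2 + m / 2 * A\<^sup>2"
      unfolding G_def A_def by (simp add: power2_eq_square algebra_simps)
    have Yexp: "Y x \<le> exp (Y x)" using exp_ge_add_one_self[of "Y x"] by linarith
    have t1: "\<bar>(W x)\<^sup>2 - A\<^sup>2\<bar> \<le> 4 * e ^ 3 * exp (2 * Y x)"
    proof -
      have "(W x)\<^sup>2 - A\<^sup>2 = S * (W x + A)" unfolding WAS by (simp add: power2_eq_square algebra_simps)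
      then have "\<bar>(W x)\<^sup>2 - A\<^sup>2\<bar> = \<bar>S\<bar> * \<bar>W x + A\<bar>" by (simp add: abs_mult)
      also have "\<dots> \<le> (2 * e\<^sup>2 * exp (Y x)) * (2 * e * exp (Y x))"
      proof (intro mult_mono S)
        have "e * Y x \<le> e * exp (Y x)" using Yexp e by (intro mult_left_mono) auto
        then show "\<bar>W x + A\<bar> \<le> 2 * e * exp (Y x)" using WY[of x] A by linarith
      qed (use e in auto)
      also have "\<dots> = 4 * e ^ 3 * exp (2 * Y x)"
        by (simp add: power2_eq_square power3_eq_cube exp_double)
      finally show ?thesis .
    qed
    have t2: "\<bar>scaled_expm1 m (W x) - W x - m * (W x)\<^sup>2 / 2\<bar> \<le> 6 * e ^ 3 * exp (2 * Y x)"
    proof -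
      have "\<bar>scaled_expm1 m (W x) - W x - m * (W x)\<^sup>2 / 2\<bar> \<le> \<bar>W x\<bar> ^ 3 * exp \<bar>W x\<bar>" by (rule scaled_expm1_taylor[OF m])
      also have "\<dots> \<le> (e * Y x) ^ 3 * exp (Y x)"
        using WY[of x] WY1[of x] e Y0[of x] by (intro mult_mono power_mono) auto
      also have "\<dots> \<le> e ^ 3 * (6 * exp (Y x)) * exp (Y x)"
      proof -
        obtain t where t: "exp (Y x) = (\<Sum>k<4. (Y x ^ k) / fact k) + (exp t / fact 4) * Y x ^ 4"
          using Maclaurin_exp_le[of "Y x" 4] by blast
        have "(\<Sum>k<4. (Y x ^ k) / fact k) \<ge> Y x ^ 3 / fact 3"
          using Y0[of x] by (intro member_le_sum) auto
        moreover have "0 \<le> (exp t / fact 4) * Y x ^ 4" using Y0[of x] by simp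
        ultimately have "Y x ^ 3 / fact 3 \<le> exp (Y x)" unfolding t by linarith
        then have "Y x ^ 3 \<le> 6 * exp (Y x)" by (simp add: fact_numeral)
        then show ?thesis using e by (simp add: power_mult_distrib mult_right_mono mult_left_mono)
      qed
      also have "\<dots> = 6 * e ^ 3 * exp (2 * Y x)" by (simp add: exp_double power2_eq_square)
      finally show ?thesis .
    qed
    have t3: "\<bar>R x\<bar> \<le> e ^ 3 * exp (2 * Y x)"
    proof -
      have "Z x \<le> 2 * Y x" using Z0[of x] E1 by (simp add: Y_def)
      then have "e ^ 3 * exp (Z x) \<le> e ^ 3 * exp (2 * Y x)" using e by (intro mult_left_mono) auto
      then show ?thesis using R[of x] by linarith
    qed
    have t4: "\<bar>m / 2 * ((W x)\<^sup>2 - A\<^sup>2)\<bar> \<le> 2 * e ^ 3 * exp (2 * Y x)"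
    proof -
      have "\<bar>m / 2 * ((W x)\<^sup>2 - A\<^sup>2)\<bar> = m / 2 * \<bar>(W x)\<^sup>2 - A\<^sup>2\<bar>" using m by (simp add: abs_mult)
      also have "\<dots> \<le> 1 / 2 * (4 * e ^ 3 * exp (2 * Y x))" using m t1 by (intro mult_mono) auto
      finally show ?thesis by simp
    qed
    have "scaled_expm1 m (W x) - G x = (scaled_expm1 m (W x) - W x - m * (W x)\<^sup>2 / 2) + R x + m / 2 * ((W x)\<^sup>2 - A\<^sup>2)"
      unfolding Gx using WAS by (simp add: S_def algebra_simps)
    then show ?thesis using t2 t3 t4 by linarith
  qed
  have iexpY: "integrable M (\<lambda>x. exp (2 * Y x))" "(\<integral>x. exp (2 * Y x) \<partial>M) \<le> exp (6 * E) * E"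
  proof -
    have eq: "exp (2 * Y x) = exp (6 * E) * exp (2 * Z x)" for x
      unfolding Y_def by (simp add: exp_add[symmetric] algebra_simps)
    show "integrable M (\<lambda>x. exp (2 * Y x))" unfolding eq using iE[of 2] by simp
    show "(\<integral>x. exp (2 * Y x) \<partial>M) \<le> exp (6 * E) * E" unfolding eq using EE[of 2] by simp
  qed
  have iD: "integrable M D" unfolding D_def using iX1 iX2 iR by auto
  have DZ: "\<bar>D x\<bar> \<le> Z x" for x
    using sum[of x] mult_right_mono[OF e(2) Z0[of x]] unfolding D_def by linarith
  have iD2: "integrable M (\<lambda>x. exp (m * D x))"
    by (rule integrable_dominated_exp[OF _ DZ]) (use m iE[of 1] in auto)
  note rt = log_mean_root[OF iD iD2]
  let ?k = "log_mean m M D"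
  have b1: "\<bar>\<integral>x. scaled_expm1 m (W x) \<partial>M\<bar> \<le> 9 * e ^ 3 * (exp (6 * E) * E)"
  proof -
    have iW: "integrable M (\<lambda>x. scaled_expm1 m (W x))" unfolding W_def by (rule rt)
    have "\<bar>\<integral>x. scaled_expm1 m (W x) \<partial>M\<bar> = \<bar>\<integral>x. scaled_expm1 m (W x) - G x \<partial>M\<bar>"
      using iW iG G0 by simp
    also have "\<dots> \<le> (\<integral>x. \<bar>scaled_expm1 m (W x) - G x\<bar> \<partial>M)" by (rule integral_abs_bound)
    also have "\<dots> \<le> (\<integral>x. 9 * e ^ 3 * exp (2 * Y x) \<partial>M)"
      using iW iG iexpY err by (intro integral_mono) auto
    also have "\<dots> \<le> 9 * e ^ 3 * (exp (6 * E) * E)"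
      using iexpY e by (simp add: mult_left_mono)
    finally show ?thesis .
  qed
  \<comment> \<open>Jensen by hand: \<open>exp (- Y)\<close> lies above its tangent at Y = 4 E, and
    the mean of \<open>Y\<close> is at most 4 E.\<close>
  have b2: "exp (- 4 * E) \<le> (\<integral>x. exp (m * W x) \<partial>M)"
  proof -
    have iW: "integrable M (\<lambda>x. exp (m * W x))" unfolding W_def by (rule rt)
    have "exp (- 4 * E) \<le> exp (- 4 * E) * (1 + (E - (\<integral>x. Z x \<partial>M)))" using EZ by simp
    also have "\<dots> = (\<integral>x. exp (- 4 * E) * (1 + (4 * E - Y x)) \<partial>M)"
      unfolding Y_def using iZ by (simp add: prob_space)
    also have "\<dots> \<le> (\<integral>x. exp (m * W x) \<partial>M)"
    proof (intro integral_mono iW)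
      fix x
      have "exp (- 4 * E) * (1 + (4 * E - Y x)) \<le> exp (- 4 * E) * exp (4 * E - Y x)"
        by (intro mult_left_mono exp_ge_add_one_self) auto
      also have "\<dots> = exp (- Y x)" by (simp add: exp_add[symmetric])
      also have "\<dots> \<le> exp (m * W x)"
      proof -
        have "\<bar>m * W x\<bar> \<le> 1 * Y x" unfolding abs_mult using m WY1[of x] by (intro mult_mono) auto
        then show ?thesis by simp
      qed
      finally show "exp (- 4 * E) * (1 + (4 * E - Y x)) \<le> exp (m * W x)" .
    qed (use iZ in \<open>auto simp: Y_def\<close>)
    finally show ?thesis .
  qed
  have "\<bar>?k\<bar> \<le> E"
    by (rule log_mean_between[OF _ DZ]) (use m iE[of 1] EE[of 1] in auto)
  then have kk: "\<bar>k0 - ?k\<bar> \<le> 4 * E"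
    using k0 mult_right_mono[OF e(2), of "3 * E"] E1 by linarith
  have "(\<integral>x. scaled_expm1 m (W x) \<partial>M) + scaled_expm1 m (k0 - ?k) * (\<integral>x. exp (m * W x) \<partial>M) = 0"
    unfolding W_def by (rule log_mean_shift_root(2)[OF iD iD2])
  then have "\<bar>scaled_expm1 m (k0 - ?k)\<bar> * \<bar>\<integral>x. exp (m * W x) \<partial>M\<bar> = \<bar>\<integral>x. scaled_expm1 m (W x) \<partial>M\<bar>"
    unfolding abs_mult[symmetric] by linarith
  then have "\<bar>scaled_expm1 m (k0 - ?k)\<bar> * exp (- 4 * E) \<le> 9 * e ^ 3 * (exp (6 * E) * E)"
    using b1 b2 mult_left_mono[OF b2, of "\<bar>scaled_expm1 m (k0 - ?k)\<bar>"] by auto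
  then have "\<bar>scaled_expm1 m (k0 - ?k)\<bar> \<le> 9 * e ^ 3 * (exp (10 * E) * E)"
    by (simp add: exp_minus field_simps exp_add[symmetric])
  then have "exp (4 * E) * \<bar>scaled_expm1 m (k0 - ?k)\<bar> \<le> exp (4 * E) * (9 * e ^ 3 * (exp (10 * E) * E))"
    by (intro mult_left_mono) auto
  moreover have "\<bar>k0 - ?k\<bar> \<le> exp (4 * E) * \<bar>scaled_expm1 m (k0 - ?k)\<bar>"
    using scaled_expm1_abs_lower[OF m, of "k0 - ?k"] kk
      mult_right_mono[of "exp \<bar>k0 - ?k\<bar>" "exp (4 * E)" "\<bar>scaled_expm1 m (k0 - ?k)\<bar>"] by simp
  moreover have "exp (4 * E) * (9 * e ^ 3 * (exp (10 * E) * E)) = 9 * E * exp (14 * E) * e ^ 3"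
  proof -
    have "exp (14 * E) = exp (4 * E) * exp (10 * E)" by (simp add: exp_add[symmetric])
    then show ?thesis by simp
  qed
  ultimately have "\<bar>?k - k0\<bar> \<le> 9 * E * exp (14 * E) * e ^ 3" by linarith
  then show ?thesis unfolding k0_def c2_def Var_def a1_def D_def by (simp add: algebra_simps)
qed

text \<open>Inserting the root for m into the equation for m' leaves only the difference of the two
  functions \<open>scaled_expm1\<close>, which is of second order in the deviation of
  \<open>g\<close> from that root.\<close>

lemma log_mean_parameter:
  assumes m: "0 \<le> m" "m \<le> m'" "m' \<le> 1"
    and g: "g \<in> borel_measurable M" "\<And>x. \<bar>g x\<bar> \<le> Z x" "integrable M (\<lambda>x. exp (Z x))"
    and i2: "integrable M (\<lambda>x. (g x - log_mean m M g)\<^sup>2 * exp \<bar>g x - log_mean m M g\<bar>)"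
  shows "log_mean m M g \<le> log_mean m' M g"
    and "log_mean m' M g \<le> log_mean m M g + (m' - m) / 2 * (\<integral>x. (g x - log_mean m M g)\<^sup>2 * exp \<bar>g x - log_mean m M g\<bar> \<partial>M)"
proof -
  have m': "0 \<le> m'" "m \<le> 1" using m by auto
  note i = integrable_dominated_exp[OF g m(1) m'(2)] and i' = integrable_dominated_exp[OF g m'(1) m(3)]
  let ?y = "log_mean m M g"
  have "(\<integral>x. scaled_expm1 m (g x - ?y) \<partial>M) \<le> (\<integral>x. scaled_expm1 m' (g x - ?y) \<partial>M)"
    by (intro integral_mono log_mean_root i i' scaled_expm1_diff m)
  then show "?y \<le> log_mean m' M g"
    unfolding log_mean_le_iff(2)[OF i'] using log_mean_root[OF i] by simp
  let ?I = "\<integral>x. (g x - ?y)\<^sup>2 * exp \<bar>g x - ?y\<bar> \<partial>M"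
  let ?k = "(m' - m) / 2 * ?I"
  have "scaled_expm1 m' (log_mean m' M g - ?y) = (\<integral>x. scaled_expm1 m' (g x - ?y) \<partial>M)"
    using log_mean_shift_root(1)[OF i', of ?y] log_mean_root(1)[OF i'] by simp
  also have "\<dots> \<le> (\<integral>x. scaled_expm1 m (g x - ?y) + (m' - m) / 2 * ((g x - ?y)\<^sup>2 * exp \<bar>g x - ?y\<bar>) \<partial>M)"
    using i2 log_mean_root[OF i] log_mean_root[OF i'] by (intro integral_mono scaled_expm1_diff m) auto
  also have "\<dots> = ?k"
    using i2 log_mean_root[OF i] by simp
  finally show "log_mean m' M g \<le> ?y + ?k"
    using scaled_expm1_lower_linear[OF m'(1), of "log_mean m' M g - ?y"] by linarith
qed

end

subsection \<open>Gaussian steps\<close>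

interpretation gauss: prob_space std_normal_distribution
  using prob_space_normal_density[of 1 0] by simp

lemma integrable_gauss_exp_abs: "integrable std_normal_distribution (\<lambda>z. exp (a * \<bar>z\<bar>))"
proof -
  have *: "integrable std_normal_distribution (\<lambda>z. exp (b * z))" for b :: real
  proof -
    have eq: "std_normal_density z * exp (b * z) = exp (b\<^sup>2 / 2) * normal_density b 1 z" for z
      by (simp add: normal_density_def exp_add[symmetric] power2_eq_square algebra_simps diff_divide_distrib add_divide_distrib)
    have "integrable lborel (\<lambda>z. std_normal_density z * exp (b * z))"
      unfolding eq by simp
    then show ?thesis by (subst integrable_density) (auto simp: normal_density_nonneg)
  qed
  show ?thesis
  proof (rule Bochner_Integration.integrable_bound[of _ "\<lambda>z. exp (a * z) + exp (- a * z)"])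
    show "AE z in std_normal_distribution. norm (exp (a * \<bar>z\<bar>)) \<le> norm (exp (a * z) + exp (- a * z))"
    proof (intro AE_I2)
      fix z :: real
      have "\<bar>exp (a * z) + exp (- a * z)\<bar> = exp (a * z) + exp (- a * z)"
        by (intro abs_of_pos add_pos_pos) auto
      then show "norm (exp (a * \<bar>z\<bar>)) \<le> norm (exp (a * z) + exp (- a * z))"
        by (cases "0 \<le> z") auto
    qed
  qed (use *[of a] *[of "-a"] in auto)
qed

lemma gauss_moments:
  "(\<integral>z. z \<partial>std_normal_distribution) = 0" "(\<integral>z. z\<^sup>2 \<partial>std_normal_distribution) = 1"
  "integrable std_normal_distribution (\<lambda>z. z)" "integrable std_normal_distribution (\<lambda>z. z\<^sup>2)"
  using integral_std_normal_distribution_moment_odd[of 1] std_normal_distribution_even_moments[of 1]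
    integrable_std_normal_distribution_moment[of 1] integrable_std_normal_distribution_moment[of 2]
  by (auto simp: fact_numeral)

section \<open>Lipschitz functions of many coordinates and Gaussian steps\<close>

definition l1_norm :: "'i set \<Rightarrow> ('i \<Rightarrow> real) \<Rightarrow> real" where
  "l1_norm A y = (\<Sum>a\<in>A. \<bar>y a\<bar>)"

text \<open>Such a function depends on the coordinates in \<open>A\<close> only
  (\<open>lip_cong\<close>). Points may therefore be arbitrary functions on the index type, and no
  restriction to \<open>A\<close> has to be carried along.\<close>

definition lip :: "'i set \<Rightarrow> real \<Rightarrow> (('i \<Rightarrow> real) \<Rightarrow> real) \<Rightarrow> bool" where
  "lip A L f \<longleftrightarrow> 0 \<le> L \<and> (\<forall>x y. \<bar>f x - f y\<bar> \<le> L * l1_norm A (\<lambda>a. x a - y a))"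

lemma l1_norm_nonneg [simp]: "0 \<le> l1_norm A y"
  by (simp add: l1_norm_def sum_nonneg)

lemma l1_norm_scale: "l1_norm A (\<lambda>a. k * y a) = \<bar>k\<bar> * l1_norm A y"
  by (simp add: l1_norm_def abs_mult sum_distrib_left)

lemma l1_norm_scale': "l1_norm A (\<lambda>a. y a * k) = \<bar>k\<bar> * l1_norm A y"
  using l1_norm_scale[of A k y] by (simp add: mult.commute)

lemma l1_norm_triangle: "l1_norm A (\<lambda>a. x a + y a) \<le> l1_norm A x + l1_norm A y"
  unfolding l1_norm_def sum.distrib[symmetric] by (intro sum_mono abs_triangle_ineq)

lemma l1_norm_commute: "l1_norm A (\<lambda>a. x a - y a) = l1_norm A (\<lambda>a. y a - x a)"
  by (simp add: l1_norm_def abs_minus_commute)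

lemma l1_norm_zero [simp]: "l1_norm A (\<lambda>a. 0) = 0"
  by (simp add: l1_norm_def)

lemma abs_le_l1_norm: "finite A \<Longrightarrow> a \<in> A \<Longrightarrow> \<bar>y a\<bar> \<le> l1_norm A y"
  unfolding l1_norm_def by (rule member_le_sum) auto

lemma lipD: "lip A L f \<Longrightarrow> \<bar>f x - f y\<bar> \<le> L * l1_norm A (\<lambda>a. x a - y a)" and lip_nonneg: "lip A L f \<Longrightarrow> 0 \<le> L"
  by (auto simp: lip_def)

lemma lip_ray: "lip A L f \<Longrightarrow> \<bar>f (\<lambda>a. x a + z * c a) - f (\<lambda>a. x a + z' * c a)\<bar> \<le> L * l1_norm A c * \<bar>z - z'\<bar>"
  using lipD[of A L f "\<lambda>a. x a + z * c a" "\<lambda>a. x a + z' * c a"]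
  by (simp add: left_diff_distrib[symmetric] l1_norm_scale' mult_ac)

lemma lip_ray_measurable:
  assumes "lip A L f" shows "(\<lambda>z. f (\<lambda>a. x a + z * c a)) \<in> borel_measurable borel"
proof (rule borel_measurable_continuous_onI)
  have "(L * l1_norm A c)-lipschitz_on UNIV (\<lambda>z. f (\<lambda>a. x a + z * c a))"
    using lip_ray[OF assms] lip_nonneg[OF assms] by (auto intro!: lipschitz_onI simp: dist_real_def)
  then show "continuous_on UNIV (\<lambda>z. f (\<lambda>a. x a + z * c a))"
    by (rule lipschitz_on_continuous_on)
qed

lemma lip_ray_bound:
  assumes "lip A L f" shows "\<bar>f (\<lambda>a. x a + z * c a)\<bar> \<le> \<bar>f x\<bar> + L * l1_norm A c * \<bar>z\<bar>"
  using lip_ray[OF assms, of x z c 0] by simp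

lemma integrable_exp_affine:
  "integrable std_normal_distribution (\<lambda>z. exp (k + b * \<bar>z\<bar>))"
  using integrable_gauss_exp_abs[of b] by (simp add: exp_add)

lemma lip_ray_integrable:
  assumes "lip A L f" "0 \<le> m" "m \<le> 1"
  shows "integrable std_normal_distribution (\<lambda>z. f (\<lambda>a. x a + z * c a))"
    "integrable std_normal_distribution (\<lambda>z. exp (m * f (\<lambda>a. x a + z * c a)))"
  using gauss.integrable_dominated_exp[OF _ lip_ray_bound[OF assms(1)] integrable_exp_affine assms(2,3), of x c]
    lip_ray_measurable[OF assms(1)] by auto

definition gauss_step :: "real \<Rightarrow> ('i \<Rightarrow> real) \<Rightarrow> (('i \<Rightarrow> real) \<Rightarrow> real) \<Rightarrow> ('i \<Rightarrow> real) \<Rightarrow> real" where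
  "gauss_step m c f x = log_mean m std_normal_distribution (\<lambda>z. f (\<lambda>a. x a + z * c a))"

lemma gauss_step_zero [simp]: "gauss_step m (\<lambda>_. 0) f = f"
  by (simp add: gauss_step_def gauss.log_mean_const fun_eq_iff)

text \<open>Index sets, base points and directions may differ on the two sides. One lemma thus
  yields monotonicity, preservation of the Lipschitz constant and, in \<open>tensor_site\<close>,
  the comparison of a function over pairs of configurations with one over a single site.\<close>

lemma gauss_step_diff_le:
  assumes f: "lip A L f" and g: "lip B L' g" and m: "0 \<le> m" "m \<le> 1"
    and le: "\<And>z. f (\<lambda>a. x a + z * c a) \<le> g (\<lambda>a. y a + z * d a) + k"
  shows "gauss_step m c f x \<le> gauss_step m d g y + k"
proof -
  note i = lip_ray_integrable[OF f m, of x c] and j = lip_ray_integrable[OF g m, of y d]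
  have e: "exp (m * (g w + k)) = exp (m * g w) * exp (m * k)" for w
    by (simp add: exp_add[symmetric] algebra_simps)
  have "gauss_step m c f x \<le> log_mean m std_normal_distribution (\<lambda>z. g (\<lambda>a. y a + z * d a) + k)"
    unfolding gauss_step_def using j by (intro gauss.log_mean_mono i le) (auto simp: e)
  also have "\<dots> = gauss_step m d g y + k"
    unfolding gauss_step_def by (rule gauss.log_mean_add_const[OF j])
  finally show ?thesis .
qed

lemma gauss_step_close:
  assumes "lip A L f" "lip B L' g" "0 \<le> m" "m \<le> 1" "\<And>x. \<bar>f x - g x\<bar> \<le> k"
  shows "\<bar>gauss_step m c f x - gauss_step m c g x\<bar> \<le> k"
proof -
  have "f x \<le> g x + k" "g x \<le> f x + k" for x using assms(5)[of x] by linarith+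
  then have "gauss_step m c f x \<le> gauss_step m c g x + k" "gauss_step m c g x \<le> gauss_step m c f x + k"
    by (auto intro!: gauss_step_diff_le[OF assms(1,2,3,4)] gauss_step_diff_le[OF assms(2,1,3,4)])
  then show ?thesis by linarith
qed

lemma lip_gauss_step:
  assumes f: "lip A L f" and m: "0 \<le> m" "m \<le> 1"
  shows "lip A L (gauss_step m c f)"
proof -
  have le: "gauss_step m c f x \<le> gauss_step m c f y + L * l1_norm A (\<lambda>a. x a - y a)" for x y
  proof (rule gauss_step_diff_le[OF f f m])
    fix z
    show "f (\<lambda>a. x a + z * c a) \<le> f (\<lambda>a. y a + z * c a) + L * l1_norm A (\<lambda>a. x a - y a)"
      using lipD[OF f, of "\<lambda>a. x a + z * c a" "\<lambda>a. y a + z * c a"] by simp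
  qed
  show ?thesis unfolding lip_def
  proof (intro conjI allI)
    fix x y
    show "\<bar>gauss_step m c f x - gauss_step m c f y\<bar> \<le> L * l1_norm A (\<lambda>a. x a - y a)"
      using le[of x y] le[of y x] l1_norm_commute[of A x y] by (simp add: abs_le_iff)
  qed (rule lip_nonneg[OF f])
qed

section \<open>Averages under exponentially tilted laws\<close>

definition tilt :: "real \<Rightarrow> ('i \<Rightarrow> real) \<Rightarrow> (('i \<Rightarrow> real) \<Rightarrow> real) \<Rightarrow> ('i \<Rightarrow> real) \<Rightarrow> real measure" where
  "tilt m c f x = density std_normal_distribution
     (\<lambda>z. ennreal (exp (m * (f (\<lambda>a. x a + z * c a) - gauss_step m c f x))))"

text \<open>The first-order change of \<open>gauss_step m c f\<close> at \<open>x\<close> when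
  \<open>f\<close> is perturbed by a small multiple of \<open>\<phi>\<close>.\<close>

definition tilted_avg :: "real \<Rightarrow> ('i \<Rightarrow> real) \<Rightarrow> (('i \<Rightarrow> real) \<Rightarrow> real) \<Rightarrow> (('i \<Rightarrow> real) \<Rightarrow> real) \<Rightarrow> ('i \<Rightarrow> real) \<Rightarrow> real" where
  "tilted_avg m c f \<phi> x = (\<integral>z. \<phi> (\<lambda>a. x a + z * c a) \<partial>tilt m c f x)"

lemma sets_tilt [measurable_cong]: "sets (tilt m c f x) = sets borel"
  by (simp add: tilt_def)

lemma space_tilt [simp]: "space (tilt m c f x) = UNIV"
  by (simp add: tilt_def)

definition bounded_lip :: "'i set \<Rightarrow> real \<Rightarrow> (('i \<Rightarrow> real) \<Rightarrow> real) \<Rightarrow> bool" where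
  "bounded_lip A C \<phi> \<longleftrightarrow> lip A C \<phi> \<and> (\<forall>x. \<bar>\<phi> x\<bar> \<le> C)"

lemma bounded_lipD: "bounded_lip A C \<phi> \<Longrightarrow> lip A C \<phi>" "bounded_lip A C \<phi> \<Longrightarrow> \<bar>\<phi> x\<bar> \<le> C" "bounded_lip A C \<phi> \<Longrightarrow> 0 \<le> C"
  by (auto simp: bounded_lip_def lip_def)

lemma bounded_lip_mono: "bounded_lip A C \<phi> \<Longrightarrow> C \<le> C' \<Longrightarrow> bounded_lip A C' \<phi>"
  unfolding bounded_lip_def lip_def by (meson mult_right_mono l1_norm_nonneg order_trans)

lemma bounded_lip_add: "bounded_lip A C \<phi> \<Longrightarrow> bounded_lip A D \<psi> \<Longrightarrow> bounded_lip A (C + D) (\<lambda>x. \<phi> x + \<psi> x)"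
  unfolding bounded_lip_def lip_def
proof (elim conjE, intro conjI allI)
  fix x y
  assume *: "\<forall>x y. \<bar>\<phi> x - \<phi> y\<bar> \<le> C * l1_norm A (\<lambda>a. x a - y a)" "\<forall>x y. \<bar>\<psi> x - \<psi> y\<bar> \<le> D * l1_norm A (\<lambda>a. x a - y a)"
  show "\<bar>\<phi> x + \<psi> x - (\<phi> y + \<psi> y)\<bar> \<le> (C + D) * l1_norm A (\<lambda>a. x a - y a)"
    using *[rule_format, of x y] unfolding distrib_right by linarith
next
  fix x
  assume *: "\<forall>x. \<bar>\<phi> x\<bar> \<le> C" "\<forall>x. \<bar>\<psi> x\<bar> \<le> D"
  show "\<bar>\<phi> x + \<psi> x\<bar> \<le> C + D" using *[rule_format, of x] by linarith
qed auto

lemma bounded_lip_cmult: "bounded_lip A C \<phi> \<Longrightarrow> bounded_lip A (\<bar>k\<bar> * C) (\<lambda>x. k * \<phi> x)"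
  unfolding bounded_lip_def lip_def
  by (auto simp: abs_mult mult.assoc right_diff_distrib[symmetric] intro!: mult_left_mono)

lemma bounded_lip_mult:
  assumes "bounded_lip A C \<phi>" "bounded_lip A D \<psi>" shows "bounded_lip A (2 * C * D) (\<lambda>x. \<phi> x * \<psi> x)"
proof -
  note a = bounded_lipD[OF assms(1)] and b = bounded_lipD[OF assms(2)]
  have "\<bar>\<phi> x * \<psi> x - \<phi> y * \<psi> y\<bar> \<le> 2 * C * D * l1_norm A (\<lambda>a. x a - y a)" for x y
  proof -
    have "\<bar>\<phi> x * \<psi> x - \<phi> y * \<psi> y\<bar> = \<bar>\<phi> x * (\<psi> x - \<psi> y) + (\<phi> x - \<phi> y) * \<psi> y\<bar>"
      by (simp add: algebra_simps)
    also have "\<dots> \<le> \<bar>\<phi> x\<bar> * \<bar>\<psi> x - \<psi> y\<bar> + \<bar>\<phi> x - \<phi> y\<bar> * \<bar>\<psi> y\<bar>"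
      unfolding abs_mult[symmetric] by (rule abs_triangle_ineq)
    also have "\<dots> \<le> C * (D * l1_norm A (\<lambda>a. x a - y a)) + C * l1_norm A (\<lambda>a. x a - y a) * D"
      using a b lipD[OF a(1)] lipD[OF b(1)] by (intro add_mono mult_mono) auto
    finally show ?thesis by (simp add: algebra_simps)
  qed
  moreover have "\<bar>\<phi> x * \<psi> x\<bar> \<le> 2 * C * D" for x
  proof -
    have "\<bar>\<phi> x * \<psi> x\<bar> \<le> C * D" unfolding abs_mult using a b by (intro mult_mono) auto
    then show ?thesis using mult_nonneg_nonneg[OF a(3) b(3)] by linarith
  qed
  ultimately show ?thesis using a b by (simp add: bounded_lip_def lip_def)
qed

lemma bounded_lip_sum: "(\<And>i. i \<in> S \<Longrightarrow> bounded_lip A (K i) (\<phi> i)) \<Longrightarrow> bounded_lip A (\<Sum>i\<in>S. K i) (\<lambda>x. \<Sum>i\<in>S. \<phi> i x)"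
proof (induction S rule: infinite_finite_induct)
  case (insert i S)
  then show ?case by (simp add: bounded_lip_add)
qed (auto simp: bounded_lip_def lip_def)

lemma bounded_lip_const: "\<bar>k\<bar> \<le> C \<Longrightarrow> bounded_lip A C (\<lambda>_. k)"
  by (auto simp: bounded_lip_def lip_def)

lemma (in prob_space) prob_space_exp_tilt:
  assumes "integrable M g" "integrable M (\<lambda>x. exp (m * g x))"
  shows "prob_space (density M (\<lambda>x. ennreal (exp (m * (g x - log_mean m M g)))))"
proof
  note r = log_mean_root[OF assms]
  have "emeasure (density M (\<lambda>x. ennreal (exp (m * (g x - log_mean m M g))))) (space M)
      = (\<integral>\<^sup>+x. ennreal (exp (m * (g x - log_mean m M g))) \<partial>M)"
    using assms by (subst emeasure_density) (auto intro!: nn_integral_cong)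
  also have "\<dots> = 1"
    using r by (subst nn_integral_eq_integral) auto
  finally show "emeasure (density M (\<lambda>x. ennreal (exp (m * (g x - log_mean m M g)))))
     (space (density M (\<lambda>x. ennreal (exp (m * (g x - log_mean m M g)))))) = 1" by simp
qed

text \<open>A perturbation \<open>D\<close> of \<open>g\<close> splits off as an exponential mean of
  \<open>D\<close> alone under the tilted law. As \<open>D\<close> is bounded,
  \<open>log_mean_expansion\<close> can then be applied with a constant as dominating
  variable.\<close>

lemma (in prob_space) log_mean_tilt:
  assumes g: "integrable M g" "integrable M (\<lambda>x. exp (m * g x))"
    and D [measurable]: "D \<in> borel_measurable M" and DB: "\<And>x. \<bar>D x\<bar> \<le> B"
  shows "log_mean m M (\<lambda>x. g x + D x)
     = log_mean m M g + log_mean m (density M (\<lambda>x. ennreal (exp (m * (g x - log_mean m M g))))) D"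
proof (cases "m = 0")
  case True
  have "integrable M D"
    by (rule integrable_const_bound[of _ B]) (use DB in auto)
  moreover have "density M (\<lambda>x. 1) = M" by (rule density_1)
  ultimately show ?thesis using True g by (simp add: log_mean_def)
next
  case False
  have [measurable]: "g \<in> borel_measurable M" using g by auto
  let ?y = "log_mean m M g"
  interpret t: prob_space "density M (\<lambda>x. ennreal (exp (m * (g x - ?y))))"
    by (rule prob_space_exp_tilt[OF g])
  let ?I = "\<integral>x. exp (m * D x) \<partial>density M (\<lambda>x. ennreal (exp (m * (g x - ?y))))"
  have "integrable (density M (\<lambda>x. ennreal (exp (m * (g x - ?y))))) (\<lambda>x. exp (m * D x))"
  proof (rule t.integrable_const_bound[of _ "exp (\<bar>m\<bar> * B)"])
    have "m * D x \<le> \<bar>m\<bar> * B" for x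
      using abs_ge_self[of "m * D x"] mult_left_mono[OF DB[of x], of "\<bar>m\<bar>"] by (simp add: abs_mult)
    then show "AE x in density M (\<lambda>x. ennreal (exp (m * (g x - ?y)))). norm (exp (m * D x)) \<le> exp (\<bar>m\<bar> * B)"
      by (intro AE_I2) simp
  qed measurable
  then have I: "0 < ?I" by (rule t.integral_exp_pos)
  have "(\<integral>x. exp (m * (g x + D x)) \<partial>M) = (\<integral>x. exp (m * ?y) * (exp (m * (g x - ?y)) * exp (m * D x)) \<partial>M)"
    by (simp add: exp_add[symmetric] algebra_simps)
  also have "\<dots> = exp (m * ?y) * ?I"
    by (subst integral_density) auto
  finally show ?thesis
    using I False unfolding log_mean_def[of m M "\<lambda>x. g x + D x"] log_mean_def[of m "density _ _"]
    by (simp add: ln_mult field_simps)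
qed

lemma prob_space_tilt:
  assumes "lip A L f" "0 \<le> m" "m \<le> 1"
  shows "prob_space (tilt m c f x)"
  unfolding tilt_def gauss_step_def by (rule gauss.prob_space_exp_tilt[OF lip_ray_integrable[OF assms]])

lemma tilted_avg_eq:
  assumes "lip A L f" "lip A C \<phi>"
  shows "tilted_avg m c f \<phi> x = (\<integral>z. exp (m * (f (\<lambda>a. x a + z * c a) - gauss_step m c f x)) * \<phi> (\<lambda>a. x a + z * c a) \<partial>std_normal_distribution)"
  unfolding tilted_avg_def tilt_def
  using lip_ray_measurable[OF assms(1), of x c] lip_ray_measurable[OF assms(2), of x c]
  by (subst integral_density) auto

context
  fixes A :: "'i set" and L m :: real and c :: "'i \<Rightarrow> real" and f :: "('i \<Rightarrow> real) \<Rightarrow> real"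
  assumes f: "lip A L f" and m: "0 \<le> m" "m \<le> 1"
begin

lemma tilted_avg_integrable:
  assumes "bounded_lip A C \<phi>"
  shows "integrable (tilt m c f x) (\<lambda>z. \<phi> (\<lambda>a. x a + z * c a))"
proof -
  interpret t: prob_space "tilt m c f x" by (rule prob_space_tilt[OF f m])
  show ?thesis
    by (rule t.integrable_const_bound[of _ C])
      (use bounded_lipD[OF assms] lip_ray_measurable[OF bounded_lipD(1)[OF assms], of x c] in
        \<open>auto simp: measurable_cong_sets[OF sets_tilt refl]\<close>)
qed

lemma tilted_avg_add:
  "bounded_lip A C \<phi> \<Longrightarrow> bounded_lip A D \<psi> \<Longrightarrow> tilted_avg m c f (\<lambda>x. \<phi> x + \<psi> x) x = tilted_avg m c f \<phi> x + tilted_avg m c f \<psi> x"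
  unfolding tilted_avg_def by (intro Bochner_Integration.integral_add tilted_avg_integrable)

lemma tilted_avg_cmult: "tilted_avg m c f (\<lambda>x. k * \<phi> x) x = k * tilted_avg m c f \<phi> x"
  unfolding tilted_avg_def by simp

lemma tilted_avg_sum:
  assumes "\<And>i. i \<in> S \<Longrightarrow> bounded_lip A (K i) (\<phi> i)"
  shows "tilted_avg m c f (\<lambda>x. \<Sum>i\<in>S. \<phi> i x) x = (\<Sum>i\<in>S. tilted_avg m c f (\<phi> i) x)"
  unfolding tilted_avg_def using assms by (intro Bochner_Integration.integral_sum tilted_avg_integrable) auto

lemma tilted_avg_const: "tilted_avg m c f (\<lambda>_. k) x = k"
proof -
  interpret t: prob_space "tilt m c f x" by (rule prob_space_tilt[OF f m])
  show ?thesis by (simp add: tilted_avg_def t.prob_space[simplified])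
qed

lemma tilted_avg_mono:
  assumes "bounded_lip A C \<phi>" "bounded_lip A D \<psi>" "\<And>x. \<phi> x \<le> \<psi> x" shows "tilted_avg m c f \<phi> x \<le> tilted_avg m c f \<psi> x"
  unfolding tilted_avg_def using assms by (intro integral_mono tilted_avg_integrable) auto

lemma tilted_avg_abs_le: "bounded_lip A C \<phi> \<Longrightarrow> \<bar>tilted_avg m c f \<phi> x\<bar> \<le> C"
  using tilted_avg_mono[of C \<phi> C "\<lambda>_. C" x] tilted_avg_mono[of C "\<lambda>_. - C" C \<phi> x] bounded_lipD[of A C \<phi>]
  by (simp add: tilted_avg_const bounded_lip_const abs_le_iff minus_le_iff)

end

lemma abs_exp_minus_one_le:
  fixes u s :: real
  assumes "\<bar>u\<bar> \<le> 2 * s" "s \<le> 1" shows "\<bar>exp u - 1\<bar> \<le> 18 * s"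
proof -
  have s: "0 \<le> s" using assms by linarith
  obtain t where t: "\<bar>t\<bar> \<le> \<bar>u\<bar>" "scaled_expm1 1 u = exp (1 * t) * u" by (rule scaled_expm1_mvt)
  have "\<bar>exp u - 1\<bar> = exp t * \<bar>u\<bar>" using t(2) by (simp add: scaled_expm1_def abs_mult)
  also have "\<dots> \<le> exp 2 * (2 * s)" using t(1) assms s by (intro mult_mono) auto
  also have "exp 2 \<le> (9 :: real)"
  proof -
    have "exp (2 :: real) = (exp 1)\<^sup>2" by (simp add: exp_double[symmetric])
    also have "\<dots> \<le> 3\<^sup>2" using exp_le by (intro power_mono) auto
    finally show ?thesis by simp
  qed
  finally show ?thesis using s by (simp add: mult_right_mono)
qed

text \<open>The factor 20 depends on neither m nor c, since the directions vary along the
  interpolation. At distance s at most 1 the tilting densities at the two points differ by a factor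
  \<open>exp u\<close> with |u| at most 2 s, because \<open>f\<close> and its step are both
  1-Lipschitz. This contributes 18 C s, and the variation of \<open>\<phi>\<close> itself
  contributes C s. At larger distances the bound on the size of the average suffices.\<close>

lemma bounded_lip_tilted_avg:
  assumes f: "lip A 1 f" and m: "0 \<le> m" "m \<le> 1" and \<phi>: "bounded_lip A C \<phi>"
  shows "bounded_lip A (20 * C) (tilted_avg m c f \<phi>)"
proof -
  note C0 = bounded_lipD(3)[OF \<phi>]
  let ?u = "gauss_step m c f"
  have u: "lip A 1 ?u" by (rule lip_gauss_step[OF f m])
  have "\<bar>tilted_avg m c f \<phi> y - tilted_avg m c f \<phi> x\<bar> \<le> 20 * C * l1_norm A (\<lambda>a. y a - x a)" for x y
  proof (cases "l1_norm A (\<lambda>a. y a - x a) \<le> 1")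
    case False
    have "\<bar>tilted_avg m c f \<phi> y - tilted_avg m c f \<phi> x\<bar> \<le> 2 * C"
      using tilted_avg_abs_le[OF f m \<phi>, of c x] tilted_avg_abs_le[OF f m \<phi>, of c y] by linarith
    also have "\<dots> \<le> 20 * C * l1_norm A (\<lambda>a. y a - x a)"
      using False C0 mult_left_mono[of 1 "l1_norm A (\<lambda>a. y a - x a)" C] by simp
    finally show ?thesis .
  next
    case True
    define s where "s = l1_norm A (\<lambda>a. y a - x a)"
    have s: "0 \<le> s" "s \<le> 1" using True by (auto simp: s_def)
    define r where "r v z = (\<lambda>a. v a + z * c a)" for v z
    define w where "w v z = exp (m * (f (r v z) - ?u v))" for v z
    have rm [measurable]: "(\<lambda>z. f (r v z)) \<in> borel_measurable borel" "(\<lambda>z. \<phi> (r v z)) \<in> borel_measurable borel" for v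
      unfolding r_def using lip_ray_measurable[OF f] lip_ray_measurable[OF bounded_lipD(1)[OF \<phi>]] by auto
    have wm [measurable]: "w v \<in> borel_measurable borel" for v
      unfolding w_def by measurable
    have iw: "integrable std_normal_distribution (w v)" "(\<integral>z. w v z \<partial>std_normal_distribution) = 1" for v
      using gauss.log_mean_root[OF lip_ray_integrable[OF f m, of v c]] unfolding w_def r_def gauss_step_def by auto
    have iwp: "integrable std_normal_distribution (\<lambda>z. w v z * \<phi> (r v z))" for v
    proof (rule Bochner_Integration.integrable_bound[of _ "\<lambda>z. C * w v z"])
      show "AE z in std_normal_distribution. norm (w v z * \<phi> (r v z)) \<le> norm (C * w v z)"
        using bounded_lipD(2)[OF \<phi>] C0 by (auto simp: abs_mult w_def mult.commute intro!: mult_mono AE_I2)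
    qed (use iw in auto)
    have wr: "\<bar>w y z - w x z\<bar> \<le> w x z * (18 * s)" for z
    proof -
      let ?q = "m * ((f (r y z) - f (r x z)) - (?u y - ?u x))"
      have eq: "w y z = w x z * exp ?q"
        unfolding w_def exp_add[symmetric] by (simp add: algebra_simps)
      have "\<bar>(f (r y z) - f (r x z)) - (?u y - ?u x)\<bar> \<le> 2 * s"
        using lipD[OF f, of "r y z" "r x z"] lipD[OF u, of y x] unfolding r_def s_def by simp
      then have "\<bar>?q\<bar> \<le> 1 * (2 * s)" unfolding abs_mult using m by (intro mult_mono) auto
      then have "\<bar>exp ?q - 1\<bar> \<le> 18 * s" using s by (intro abs_exp_minus_one_le) auto
      moreover have "\<bar>w y z - w x z\<bar> = w x z * \<bar>exp ?q - 1\<bar>"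
      proof -
        have "w y z - w x z = w x z * (exp ?q - 1)" unfolding eq by (simp add: algebra_simps)
        then show ?thesis by (simp add: abs_mult w_def)
      qed
      ultimately show ?thesis by (simp add: w_def)
    qed
    have pt: "\<bar>w y z * \<phi> (r y z) - w x z * \<phi> (r x z)\<bar> \<le> w x z * (19 * s * C)" for z
    proof -
      have "\<bar>w y z * \<phi> (r y z) - w x z * \<phi> (r x z)\<bar> = \<bar>(w y z - w x z) * \<phi> (r y z) + w x z * (\<phi> (r y z) - \<phi> (r x z))\<bar>"
        by (simp add: algebra_simps)
      also have "\<dots> \<le> \<bar>w y z - w x z\<bar> * \<bar>\<phi> (r y z)\<bar> + \<bar>w x z\<bar> * \<bar>\<phi> (r y z) - \<phi> (r x z)\<bar>"
        unfolding abs_mult[symmetric] by (rule abs_triangle_ineq)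
      also have "\<dots> \<le> w x z * (18 * s) * C + w x z * (C * s)"
        using wr[of z] bounded_lipD(2)[OF \<phi>] lipD[OF bounded_lipD(1)[OF \<phi>], of "r y z" "r x z"] s C0
        by (intro add_mono mult_mono) (auto simp: w_def r_def s_def)
      finally show ?thesis by (simp add: algebra_simps)
    qed
    have "\<bar>tilted_avg m c f \<phi> y - tilted_avg m c f \<phi> x\<bar> = \<bar>\<integral>z. w y z * \<phi> (r y z) - w x z * \<phi> (r x z) \<partial>std_normal_distribution\<bar>"
      unfolding tilted_avg_eq[OF f bounded_lipD(1)[OF \<phi>]] w_def[symmetric] r_def[symmetric] using iwp by simp
    also have "\<dots> \<le> (\<integral>z. \<bar>w y z * \<phi> (r y z) - w x z * \<phi> (r x z)\<bar> \<partial>std_normal_distribution)"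
      by (rule integral_abs_bound)
    also have "\<dots> \<le> (\<integral>z. w x z * (19 * s * C) \<partial>std_normal_distribution)"
      using iwp iw pt by (intro integral_mono) auto
    also have "\<dots> = 19 * s * C" using iw by simp
    also have "\<dots> \<le> 20 * C * s" using s C0 by (simp add: mult_ac mult_right_mono)
    finally show ?thesis unfolding s_def .
  qed
  moreover have "\<bar>tilted_avg m c f \<phi> x\<bar> \<le> 20 * C" for x
    using tilted_avg_abs_le[OF f m \<phi>, of c x] C0 by linarith
  ultimately show ?thesis using C0 by (simp add: bounded_lip_def lip_def)
qed

text \<open>\<open>p\<close> and \<open>h\<close> act as gradient and Hessian of \<open>f\<close>,
  but no derivative is taken: what is recorded is a Taylor expansion with a remainder uniform in the
  base point, a property that survives integration. As for \<open>log_sum_exp\<close>, the gradient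
  is a probability vector; it later supplies the weights from which replicas are drawn.\<close>

definition taylor_reg :: "'i set \<Rightarrow> real \<Rightarrow> (('i \<Rightarrow> real) \<Rightarrow> real) \<Rightarrow> ('i \<Rightarrow> ('i \<Rightarrow> real) \<Rightarrow> real) \<Rightarrow> ('i \<Rightarrow> 'i \<Rightarrow> ('i \<Rightarrow> real) \<Rightarrow> real) \<Rightarrow> bool" where
  "taylor_reg A C f p h \<longleftrightarrow> lip A 1 f \<and> (\<forall>a\<in>A. bounded_lip A C (p a)) \<and> (\<forall>a\<in>A. \<forall>x. 0 \<le> p a x) \<and> (\<forall>x. (\<Sum>a\<in>A. p a x) = 1) \<and>
     (\<forall>a\<in>A. \<forall>b\<in>A. bounded_lip A C (h a b)) \<and>
     (\<forall>x y. \<bar>f (\<lambda>a. x a + y a) - f x - (\<Sum>a\<in>A. p a x * y a) - 1 / 2 * (\<Sum>a\<in>A. \<Sum>b\<in>A. h a b x * y a * y b)\<bar> \<le> C * l1_norm A y ^ 3)"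

lemma taylor_regD:
  assumes "taylor_reg A C f p h"
  shows "lip A 1 f" "a \<in> A \<Longrightarrow> bounded_lip A C (p a)" "a \<in> A \<Longrightarrow> 0 \<le> p a x" "(\<Sum>a\<in>A. p a x) = 1"
    "a \<in> A \<Longrightarrow> b \<in> A \<Longrightarrow> bounded_lip A C (h a b)"
    "\<bar>f (\<lambda>a. x a + y a) - f x - (\<Sum>a\<in>A. p a x * y a) - 1 / 2 * (\<Sum>a\<in>A. \<Sum>b\<in>A. h a b x * y a * y b)\<bar> \<le> C * l1_norm A y ^ 3"
  using assms unfolding taylor_reg_def by auto

lemma taylor_reg_finite: "taylor_reg A C f p h \<Longrightarrow> finite A" "taylor_reg A C f p h \<Longrightarrow> A \<noteq> {}" "taylor_reg A C f p h \<Longrightarrow> 0 \<le> C"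
proof -
  assume r: "taylor_reg A C f p h"
  show "finite A" "A \<noteq> {}" using taylor_regD(4)[OF r, of undefined] by (metis sum.infinite zero_neq_one, force)
  then show "0 \<le> C" using taylor_regD(2)[OF r] bounded_lipD(3) by blast
qed

lemma abs_linear_le:
  fixes p y :: "'i \<Rightarrow> real"
  assumes "\<And>a. a \<in> A \<Longrightarrow> \<bar>p a\<bar> \<le> C"
  shows "\<bar>\<Sum>a\<in>A. p a * y a\<bar> \<le> C * l1_norm A y"
proof -
  have "\<bar>\<Sum>a\<in>A. p a * y a\<bar> \<le> (\<Sum>a\<in>A. \<bar>p a * y a\<bar>)" by (rule sum_abs)
  also have "\<dots> \<le> (\<Sum>a\<in>A. C * \<bar>y a\<bar>)" unfolding abs_mult using assms by (intro sum_mono mult_right_mono) auto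
  finally show ?thesis by (simp add: l1_norm_def sum_distrib_left)
qed

lemma abs_quadratic_le:
  fixes h :: "'i \<Rightarrow> 'i \<Rightarrow> real"
  assumes "\<And>a b. a \<in> A \<Longrightarrow> b \<in> A \<Longrightarrow> \<bar>h a b\<bar> \<le> C"
  shows "\<bar>\<Sum>a\<in>A. \<Sum>b\<in>A. h a b * y a * y b\<bar> \<le> C * (l1_norm A y)\<^sup>2"
proof -
  have "\<bar>\<Sum>a\<in>A. (\<Sum>b\<in>A. h a b * y b) * y a\<bar> \<le> (C * l1_norm A y) * l1_norm A y"
    using assms by (intro abs_linear_le) auto
  moreover have "(\<Sum>a\<in>A. (\<Sum>b\<in>A. h a b * y b) * y a) = (\<Sum>a\<in>A. \<Sum>b\<in>A. h a b * y a * y b)"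
    unfolding sum_distrib_right by (simp add: mult_ac)
  ultimately show ?thesis by (simp add: power2_eq_square mult_ac)
qed

lemma simplex_le_one:
  fixes p :: "'i \<Rightarrow> real"
  assumes "finite A" "\<And>a. a \<in> A \<Longrightarrow> 0 \<le> p a" "(\<Sum>a\<in>A. p a) = 1" "a \<in> A"
  shows "\<bar>p a\<bar> \<le> 1"
  using member_le_sum[of a A p] assms by auto

lemma taylor_reg_linear_le: "taylor_reg A C f p h \<Longrightarrow> \<bar>\<Sum>a\<in>A. p a x * y a\<bar> \<le> l1_norm A y"
proof -
  assume r: "taylor_reg A C f p h"
  have "\<bar>p a x\<bar> \<le> 1" if "a \<in> A" for a
    by (rule simplex_le_one[OF taylor_reg_finite(1)[OF r] taylor_regD(3)[OF r] taylor_regD(4)[OF r] that])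
  then show ?thesis using abs_linear_le[of A "\<lambda>a. p a x" 1 y] by simp
qed

text \<open>The second derivative of 1/m log E exp (m f): the tilted average of the Hessian plus m
  times the tilted covariance of the gradient.\<close>

definition hess_step where
  "hess_step m c f p h a b x = tilted_avg m c f (\<lambda>x. h a b x + m * p a x * p b x) x - m * tilted_avg m c f (p a) x * tilted_avg m c f (p b) x"

text \<open>For increments of norm at least 1 each term is separately below the cubic bound, so only
  smaller increments call for an expansion.\<close>

lemma taylor_crude:
  fixes d l q n :: real
  assumes L: "\<bar>d\<bar> \<le> n" "\<bar>l\<bar> \<le> n" "\<bar>q\<bar> \<le> C * n\<^sup>2" and n: "1 \<le> n" "0 \<le> C"
  shows "\<bar>d - l - 1 / 2 * q\<bar> \<le> (2 + C) * n ^ 3"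
proof -
  have n3: "n \<le> n ^ 3" "n\<^sup>2 \<le> n ^ 3" using power_increasing[OF _ n(1), of 1 3] power_increasing[OF _ n(1), of 2 3] by simp_all
  have "\<bar>q\<bar> \<le> C * n ^ 3" using L(3) mult_left_mono[OF n3(2) n(2)] by linarith
  moreover have "(2 + C) * n ^ 3 = 2 * n ^ 3 + C * n ^ 3" by (simp add: algebra_simps)
  moreover have "\<bar>q\<bar> \<ge> 0" by simp
  ultimately show ?thesis using L n3 by linarith
qed

text \<open>On every ray the increment of \<open>f\<close> along \<open>y\<close> is a bounded
  perturbation as in \<open>log_mean_tilt\<close>, with parts of order 1, 2 and 3 in the norm of
  \<open>y\<close>. Expanding under the tilted law, with that norm as e, produces the gradient and
  Hessian of the step. The new constant depends on \<open>C\<close> alone, hence is uniform over m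
  and the direction c.\<close>

lemma taylor_reg_step:
  obtains C' where "\<And>m c f p h. taylor_reg A C f p h \<Longrightarrow> 0 \<le> m \<Longrightarrow> m \<le> 1 \<Longrightarrow>
    taylor_reg A C' (gauss_step m c f) (\<lambda>a. tilted_avg m c f (p a)) (hess_step m c f p h)"
proof -
  define E where "E = exp (9 * (C + 1))"
  define C1 where "C1 = 9 * E * exp (14 * E)"
  define Ch where "Ch = 20 * (C + 2 * C * C) + 2 * (20 * C) * (20 * C)"
  define C' where "C' = 20 * C + Ch + 2 + C1"
  have "taylor_reg A C' (gauss_step m c f) (\<lambda>a. tilted_avg m c f (p a)) (hess_step m c f p h)"
    if r: "taylor_reg A C f p h" and m: "0 \<le> m" "m \<le> 1" for m c f p h
  proof -
    note R = taylor_regD[OF r] and F = taylor_reg_finite[OF r]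
    have C0: "0 \<le> C" "0 \<le> C1" "0 \<le> Ch" using F by (auto simp: C1_def E_def Ch_def)
    have bp: "bounded_lip A (20 * C) (tilted_avg m c f (p a))" if "a \<in> A" for a
      by (rule bounded_lip_tilted_avg[OF R(1) m R(2)[OF that]])
    have bpp: "bounded_lip A (2 * C * C) (\<lambda>x. m * p a x * p b x)" if "a \<in> A" "b \<in> A" for a b
      using bounded_lip_mono[OF bounded_lip_cmult[OF bounded_lip_mult[OF R(2)[OF that(1)] R(2)[OF that(2)]], of m], of "2 * C * C"]
        m C0 mult_right_mono[of m 1 "2 * C * C"] by (simp add: mult.assoc)
    have bhp: "bounded_lip A (C + 2 * C * C) (\<lambda>x. h a b x + m * p a x * p b x)" if "a \<in> A" "b \<in> A" for a b
      by (intro bounded_lip_add R bpp that)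
    have bh: "bounded_lip A Ch (hess_step m c f p h a b)" if "a \<in> A" "b \<in> A" for a b
    proof -
      have "bounded_lip A (2 * (20 * C) * (20 * C)) (\<lambda>x. (- m) * (tilted_avg m c f (p a) x * tilted_avg m c f (p b) x))"
        using bounded_lip_mono[OF bounded_lip_cmult[OF bounded_lip_mult[OF bp[OF that(1)] bp[OF that(2)]], of "- m"], of "2 * (20 * C) * (20 * C)"]
          m C0 mult_right_mono[of m 1 "2 * (20 * C) * (20 * C)"] by simp
      from bounded_lip_add[OF bounded_lip_tilted_avg[OF R(1) m bhp[OF that]] this] show ?thesis
        unfolding Ch_def hess_step_def[abs_def] by (simp add: mult.assoc)
    qed
    let ?u = "gauss_step m c f"
    have lu: "lip A 1 ?u" by (rule lip_gauss_step[OF R(1) m])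
    have pos: "0 \<le> tilted_avg m c f (p a) x" if "a \<in> A" for a x
      using tilted_avg_mono[OF R(1) m bounded_lip_const[of 0 C] R(2)[OF that], of c x] tilted_avg_const[OF R(1) m, of c 0 x] R(3)[OF that] C0 by simp
    have sum1: "(\<Sum>a\<in>A. tilted_avg m c f (p a) x) = 1" for x
      unfolding tilted_avg_sum[OF R(1) m R(2), symmetric, of A id, simplified] R(4) by (rule tilted_avg_const[OF R(1) m])
    have taylor: "\<bar>?u (\<lambda>a. x a + y a) - ?u x - (\<Sum>a\<in>A. tilted_avg m c f (p a) x * y a) -
        1 / 2 * (\<Sum>a\<in>A. \<Sum>b\<in>A. hess_step m c f p h a b x * y a * y b)\<bar> \<le> C' * l1_norm A y ^ 3" for x y
    proof (cases "l1_norm A y \<le> 1")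
      case False
      have "\<bar>?u (\<lambda>a. x a + y a) - ?u x - (\<Sum>a\<in>A. tilted_avg m c f (p a) x * y a) -
        1 / 2 * (\<Sum>a\<in>A. \<Sum>b\<in>A. hess_step m c f p h a b x * y a * y b)\<bar> \<le> (2 + Ch) * l1_norm A y ^ 3"
      proof (rule taylor_crude)
        show "\<bar>?u (\<lambda>a. x a + y a) - ?u x\<bar> \<le> l1_norm A y"
          using lipD[OF lu, of "\<lambda>a. x a + y a" x] by simp
        show "\<bar>\<Sum>a\<in>A. tilted_avg m c f (p a) x * y a\<bar> \<le> l1_norm A y"
          using abs_linear_le[of A "\<lambda>a. tilted_avg m c f (p a) x" 1 y] simplex_le_one[OF F(1) pos sum1] by auto
        show "\<bar>\<Sum>a\<in>A. \<Sum>b\<in>A. hess_step m c f p h a b x * y a * y b\<bar> \<le> Ch * (l1_norm A y)\<^sup>2"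
          using bh bounded_lipD(2) by (intro abs_quadratic_le) blast
      qed (use False C0 in auto)
      also have "\<dots> \<le> C' * l1_norm A y ^ 3"
        unfolding C'_def using C0 by (intro mult_right_mono) auto
      finally show ?thesis .
    next
      case True
      define e where "e = l1_norm A y"
      have e: "0 \<le> e" "e \<le> 1" using True by (auto simp: e_def)
      define r where "r v z = (\<lambda>a. v a + z * c a)" for v z
      define D where "D z = f (r (\<lambda>a. x a + y a) z) - f (r x z)" for z
      define X1 where "X1 z = (\<Sum>a\<in>A. p a (r x z) * y a)" for z
      define X2 where "X2 z = 1 / 2 * (\<Sum>a\<in>A. \<Sum>b\<in>A. h a b (r x z) * y a * y b)" for z
      define Rm where "Rm z = D z - X1 z - X2 z" for z
      interpret t: prob_space "tilt m c f x" by (rule prob_space_tilt[OF R(1) m])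
      have ms: "borel_measurable (tilt m c f x) = borel_measurable (borel :: real measure)"
        by (intro measurable_cong_sets) (auto simp: sets_tilt)
      have mr: "(\<lambda>z. \<phi> (r v z)) \<in> borel_measurable borel" if "lip A K \<phi>" for \<phi> v K
        unfolding r_def by (rule lip_ray_measurable[OF that])
      have m1: "X1 \<in> borel_measurable borel" unfolding X1_def
        by (intro borel_measurable_sum borel_measurable_times mr[OF bounded_lipD(1)[OF R(2)]]) auto
      have m2: "X2 \<in> borel_measurable borel" unfolding X2_def
        by (intro borel_measurable_sum borel_measurable_times mr[OF bounded_lipD(1)[OF R(5)]]) auto
      have mD: "D \<in> borel_measurable borel" unfolding D_def by (intro borel_measurable_diff mr[OF R(1)])
      have mR: "Rm \<in> borel_measurable borel" unfolding Rm_def by (intro borel_measurable_diff mD m1 m2)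
      have Dle: "\<bar>D z\<bar> \<le> e" for z
        using lipD[OF R(1), of "r (\<lambda>a. x a + y a) z" "r x z"] unfolding D_def e_def r_def by (simp add: algebra_simps)
      have X1le: "\<bar>X1 z\<bar> \<le> e" for z unfolding X1_def e_def
        using taylor_reg_linear_le[OF r] by blast
      have Cexp: "C \<le> exp (C + 1)" using exp_ge_add_one_self[of "C + 1"] by linarith
      have X2le: "\<bar>X2 z\<bar> \<le> e\<^sup>2 * exp (C + 1)" for z
      proof -
        have "\<bar>\<Sum>a\<in>A. \<Sum>b\<in>A. h a b (r x z) * y a * y b\<bar> \<le> C * e\<^sup>2"
          unfolding e_def using R(5) bounded_lipD(2) by (intro abs_quadratic_le) blast
        then have "\<bar>X2 z\<bar> \<le> C * e\<^sup>2" unfolding X2_def by (simp add: abs_mult)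
        then show ?thesis using mult_left_mono[OF Cexp, of "e\<^sup>2"] by (simp add: mult.commute)
      qed
      have Rle: "\<bar>Rm z\<bar> \<le> e ^ 3 * exp (C + 1)" for z
      proof -
        have "r (\<lambda>a. x a + y a) z = (\<lambda>a. r x z a + y a)" by (auto simp: r_def)
        then have "\<bar>Rm z\<bar> \<le> C * e ^ 3"
          using R(6)[of "r x z" y] unfolding Rm_def D_def X1_def X2_def e_def by simp
        then show ?thesis using mult_left_mono[OF Cexp, of "e ^ 3"] e by (simp add: mult.commute)
      qed
      have eZ: "e \<le> e * (C + 1)" using e C0 by (simp add: algebra_simps)
      \<comment> \<open>The increment has norm at most 1, so the constant C + 1 dominates all three
        parts.\<close>
      have exp1: "\<bar>log_mean m (tilt m c f x) (\<lambda>z. X1 z + X2 z + Rm z) -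
        ((\<integral>z. X1 z \<partial>tilt m c f x) + (\<integral>z. X2 z \<partial>tilt m c f x) +
          m / 2 * ((\<integral>z. (X1 z)\<^sup>2 \<partial>tilt m c f x) - (\<integral>z. X1 z \<partial>tilt m c f x)\<^sup>2))\<bar> \<le> C1 * e ^ 3"
        unfolding C1_def
      proof (rule t.log_mean_expansion[OF m e, where Z = "\<lambda>_. C + 1"])
        show "\<bar>X1 z\<bar> \<le> e * (C + 1)" for z using X1le[of z] eZ by linarith
        show "\<bar>X1 z + X2 z + Rm z\<bar> \<le> e * (C + 1)" for z using Dle[of z] eZ by (simp add: Rm_def)
        show "(\<integral>z. exp (9 * (C + 1)) \<partial>tilt m c f x) \<le> E"
          using t.prob_space by (simp add: E_def)
      qed (use X2le Rle C0 m1 m2 mR ms in auto)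
      have lm: "?u (\<lambda>a. x a + y a) - ?u x = log_mean m (tilt m c f x) (\<lambda>z. X1 z + X2 z + Rm z)"
      proof -
        have "?u (\<lambda>a. x a + y a) = log_mean m std_normal_distribution (\<lambda>z. f (r x z) + D z)"
          by (simp add: gauss_step_def D_def r_def)
        also have "\<dots> = ?u x + log_mean m (tilt m c f x) D"
          unfolding gauss_step_def[of m c f x] tilt_def r_def
          by (rule gauss.log_mean_tilt[OF lip_ray_integrable[OF R(1) m]]) (use mD Dle in auto)
        finally show ?thesis by (simp add: Rm_def)
      qed
      have i1: "(\<integral>z. X1 z \<partial>tilt m c f x) = (\<Sum>a\<in>A. tilted_avg m c f (p a) x * y a)"
      proof -
        have "(\<integral>z. X1 z \<partial>tilt m c f x) = tilted_avg m c f (\<lambda>v. \<Sum>a\<in>A. y a * p a v) x"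
          unfolding tilted_avg_def X1_def r_def by (simp add: mult.commute)
        also have "\<dots> = (\<Sum>a\<in>A. y a * tilted_avg m c f (p a) x)"
          by (subst tilted_avg_sum[OF R(1) m bounded_lip_cmult[OF R(2)]]) (auto simp: tilted_avg_cmult[OF R(1) m])
        finally show ?thesis by (simp add: mult.commute)
      qed
      have i2: "(\<integral>z. X2 z \<partial>tilt m c f x) + m / 2 * (\<integral>z. (X1 z)\<^sup>2 \<partial>tilt m c f x)
         = 1 / 2 * (\<Sum>a\<in>A. \<Sum>b\<in>A. tilted_avg m c f (\<lambda>x. h a b x + m * p a x * p b x) x * y a * y b)"
      proof -
        have bq: "bounded_lip A (\<bar>y a * y b\<bar> * (C + 2 * C * C)) (\<lambda>v. y a * y b * (h a b v + m * p a v * p b v))"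
          if "a \<in> A" "b \<in> A" for a b by (rule bounded_lip_cmult[OF bhp[OF that]])
        have b1: "bounded_lip A (\<Sum>a\<in>A. \<bar>y a\<bar> * C) (\<lambda>v. \<Sum>a\<in>A. y a * p a v)"
          by (intro bounded_lip_sum bounded_lip_cmult R)
        have b2: "bounded_lip A (\<Sum>a\<in>A. \<Sum>b\<in>A. \<bar>y a * y b\<bar> * C) (\<lambda>v. \<Sum>a\<in>A. \<Sum>b\<in>A. y a * y b * h a b v)"
          by (intro bounded_lip_sum bounded_lip_cmult R)
        have "(\<integral>z. X2 z \<partial>tilt m c f x) + m / 2 * (\<integral>z. (X1 z)\<^sup>2 \<partial>tilt m c f x)
          = 1 / 2 * tilted_avg m c f (\<lambda>v. \<Sum>a\<in>A. \<Sum>b\<in>A. y a * y b * h a b v) x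
            + m / 2 * tilted_avg m c f (\<lambda>v. (\<Sum>a\<in>A. y a * p a v) * (\<Sum>a\<in>A. y a * p a v)) x"
          unfolding tilted_avg_def X1_def X2_def r_def by (simp add: mult_ac power2_eq_square)
        also have "\<dots> = 1 / 2 * (tilted_avg m c f (\<lambda>v. \<Sum>a\<in>A. \<Sum>b\<in>A. y a * y b * h a b v) x
            + tilted_avg m c f (\<lambda>v. m * ((\<Sum>a\<in>A. y a * p a v) * (\<Sum>a\<in>A. y a * p a v))) x)"
          by (simp add: tilted_avg_cmult[OF R(1) m])
        also have "\<dots> = 1 / 2 * tilted_avg m c f (\<lambda>v. (\<Sum>a\<in>A. \<Sum>b\<in>A. y a * y b * h a b v) +
             m * ((\<Sum>a\<in>A. y a * p a v) * (\<Sum>a\<in>A. y a * p a v))) x"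
          by (subst tilted_avg_add[OF R(1) m b2 bounded_lip_cmult[OF bounded_lip_mult[OF b1 b1]]]) simp
        also have "(\<lambda>v. (\<Sum>a\<in>A. \<Sum>b\<in>A. y a * y b * h a b v) + m * ((\<Sum>a\<in>A. y a * p a v) * (\<Sum>a\<in>A. y a * p a v)))
          = (\<lambda>v. \<Sum>a\<in>A. \<Sum>b\<in>A. y a * y b * (h a b v + m * p a v * p b v))"
        proof
          fix v
          have "(\<Sum>a\<in>A. y a * p a v) * (\<Sum>a\<in>A. y a * p a v) = (\<Sum>a\<in>A. \<Sum>b\<in>A. (y a * p a v) * (y b * p b v))"
            by (rule sum_product)
          then show "(\<Sum>a\<in>A. \<Sum>b\<in>A. y a * y b * h a b v) + m * ((\<Sum>a\<in>A. y a * p a v) * (\<Sum>a\<in>A. y a * p a v))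
            = (\<Sum>a\<in>A. \<Sum>b\<in>A. y a * y b * (h a b v + m * p a v * p b v))"
            by (simp only: sum_distrib_left sum.distrib[symmetric]) (simp add: algebra_simps)
        qed
        also have "tilted_avg m c f \<dots> x = (\<Sum>a\<in>A. \<Sum>b\<in>A. y a * y b * tilted_avg m c f (\<lambda>x. h a b x + m * p a x * p b x) x)"
          apply (subst tilted_avg_sum[OF R(1) m bounded_lip_sum[OF bq]], assumption, assumption)
          apply (rule sum.cong[OF refl])
          apply (subst tilted_avg_sum[OF R(1) m bq], assumption, assumption)
          apply (simp only: tilted_avg_cmult[OF R(1) m])
          done
        finally show ?thesis by (simp add: mult_ac)
      qed
      \<comment> \<open>The squared mean of \<open>X1\<close> is the subtracted product in
        \<open>hess_step\<close>; together with \<open>i2\<close> the second-order terms become the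
        new Hessian.\<close>
      have i3: "1 / 2 * (\<Sum>a\<in>A. \<Sum>b\<in>A. hess_step m c f p h a b x * y a * y b) =
         1 / 2 * (\<Sum>a\<in>A. \<Sum>b\<in>A. tilted_avg m c f (\<lambda>x. h a b x + m * p a x * p b x) x * y a * y b)
         - m / 2 * (\<integral>z. X1 z \<partial>tilt m c f x)\<^sup>2"
        unfolding i1 power2_eq_square sum_product hess_step_def
        by (simp add: sum_subtractf[symmetric] sum_distrib_left algebra_simps)
      have "\<bar>?u (\<lambda>a. x a + y a) - ?u x - (\<Sum>a\<in>A. tilted_avg m c f (p a) x * y a) -
        1 / 2 * (\<Sum>a\<in>A. \<Sum>b\<in>A. hess_step m c f p h a b x * y a * y b)\<bar> \<le> C1 * e ^ 3"
        using exp1 i2 unfolding lm i1[symmetric] i3 by (simp add: algebra_simps)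
      also have "\<dots> \<le> C' * l1_norm A y ^ 3"
        unfolding C'_def e_def using C0 by (intro mult_right_mono) auto
      finally show ?thesis .
    qed
    show ?thesis
      unfolding taylor_reg_def
      using lu pos sum1 taylor C0 by (auto intro: bounded_lip_mono[OF bp] bounded_lip_mono[OF bh] simp: C'_def)
  qed
  then show ?thesis using that by blast
qed

subsection \<open>Perturbation of Gibbs measures\<close>

definition log_sum_exp :: "'i set \<Rightarrow> ('i \<Rightarrow> real) \<Rightarrow> real" where
  "log_sum_exp A x = ln (\<Sum>a\<in>A. exp (x a))"

definition gibbs :: "'i set \<Rightarrow> 'i \<Rightarrow> ('i \<Rightarrow> real) \<Rightarrow> real" where
  "gibbs A a x = exp (x a - log_sum_exp A x)"

definition gibbs_cov :: "'i set \<Rightarrow> 'i \<Rightarrow> 'i \<Rightarrow> ('i \<Rightarrow> real) \<Rightarrow> real" where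
  "gibbs_cov A a b x = (if a = b then gibbs A a x else 0) - gibbs A a x * gibbs A b x"

context
  fixes A :: "'i set"
  assumes A: "finite A" "A \<noteq> {}"
begin

lemma sum_exp_pos: "0 < (\<Sum>a\<in>A. exp (x a :: real))"
  using A by (intro sum_pos) auto

lemma exp_log_sum_exp: "exp (log_sum_exp A x) = (\<Sum>a\<in>A. exp (x a))"
  using sum_exp_pos by (simp add: log_sum_exp_def)

lemma sum_gibbs: "(\<Sum>a\<in>A. gibbs A a x) = 1"
  using sum_exp_pos[of x] by (simp add: gibbs_def exp_diff exp_log_sum_exp sum_divide_distrib[symmetric])

lemma gibbs_pos: "0 < gibbs A a x"
  by (simp add: gibbs_def)

lemma log_sum_exp_le: "log_sum_exp A x \<le> log_sum_exp A y + l1_norm A (\<lambda>a. x a - y a)"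
proof -
  let ?s = "l1_norm A (\<lambda>a. x a - y a)"
  have "exp (log_sum_exp A x) \<le> (\<Sum>a\<in>A. exp (y a) * exp ?s)"
    unfolding exp_log_sum_exp
  proof (rule sum_mono)
    fix a assume "a \<in> A"
    then have "x a - y a \<le> ?s" using abs_le_l1_norm[OF A(1), of a "\<lambda>a. x a - y a"] by linarith
    then show "exp (x a) \<le> exp (y a) * exp ?s" by (simp add: exp_add[symmetric])
  qed
  also have "\<dots> = exp (log_sum_exp A y + ?s)" by (simp add: exp_add exp_log_sum_exp sum_distrib_right)
  finally show ?thesis by simp
qed

lemma lip_log_sum_exp: "lip A 1 (log_sum_exp A)"
  unfolding lip_def
proof (intro conjI allI)
  show "\<bar>log_sum_exp A x - log_sum_exp A y\<bar> \<le> 1 * l1_norm A (\<lambda>a. x a - y a)" for x y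
    using log_sum_exp_le[of x y] log_sum_exp_le[of y x] l1_norm_commute[of A x y] by (simp add: abs_le_iff)
qed simp

lemma bounded_lip_gibbs:
  assumes a: "a \<in> A" shows "bounded_lip A 20 (gibbs A a)"
proof -
  have le1: "\<bar>gibbs A a x\<bar> \<le> 1" for x
    by (rule simplex_le_one[OF A(1) _ sum_gibbs a]) (simp add: gibbs_def)
  have "\<bar>gibbs A a y - gibbs A a x\<bar> \<le> 20 * l1_norm A (\<lambda>a. y a - x a)" for x y
  proof (cases "l1_norm A (\<lambda>a. y a - x a) \<le> 1")
    case True
    let ?u = "(y a - x a) - (log_sum_exp A y - log_sum_exp A x)"
    have "\<bar>?u\<bar> \<le> 2 * l1_norm A (\<lambda>a. y a - x a)"
      using lipD[OF lip_log_sum_exp, of y x] abs_le_l1_norm[OF A(1) a, of "\<lambda>a. y a - x a"] by linarith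
    then have *: "\<bar>exp ?u - 1\<bar> \<le> 18 * l1_norm A (\<lambda>a. y a - x a)"
      using True by (rule abs_exp_minus_one_le)
    have "gibbs A a y - gibbs A a x = gibbs A a x * (exp ?u - 1)"
      by (simp add: gibbs_def right_diff_distrib exp_add[symmetric])
    then have "\<bar>gibbs A a y - gibbs A a x\<bar> = \<bar>gibbs A a x\<bar> * \<bar>exp ?u - 1\<bar>" by (simp add: abs_mult)
    also have "\<dots> \<le> 1 * (18 * l1_norm A (\<lambda>a. y a - x a))" using le1 * by (intro mult_mono) auto
    finally show ?thesis using l1_norm_nonneg[of A "\<lambda>a. y a - x a"] by linarith
  qed (use le1[of x] le1[of y] in linarith)
  moreover have "\<bar>gibbs A a x\<bar> \<le> 20" for x using le1[of x] by linarith
  ultimately show ?thesis by (simp add: bounded_lip_def lip_def)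
qed

text \<open>Passing from x to x + y is an exponential mean of y with m = 1 under the Gibbs weights
  at x. So the base case is another instance of \<open>log_mean_expansion\<close>, with y as its
  linear part and nothing else.\<close>

lemma taylor_reg_log_sum_exp: "\<exists>C. taylor_reg A C (log_sum_exp A) (gibbs A) (gibbs_cov A)"
proof -
  define E where "E = exp (9::real)"
  define C1 where "C1 = 9 * E * exp (14 * E)"
  define Ch :: real where "Ch = 20 + 2 * 20 * 20"
  define C where "C = 2 + Ch + C1 + 20"
  have C0: "0 \<le> C1" "0 \<le> Ch" by (auto simp: C1_def E_def Ch_def)
  have bh: "bounded_lip A Ch (gibbs_cov A a b)" if "a \<in> A" "b \<in> A" for a b
  proof -
    have "bounded_lip A 20 (\<lambda>x. if a = b then gibbs A a x else 0)"
      using bounded_lip_gibbs[OF that(1)] by (cases "a = b") (auto intro: bounded_lip_const)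
    from bounded_lip_add[OF this bounded_lip_cmult[OF bounded_lip_mult[OF bounded_lip_gibbs[OF that(1)] bounded_lip_gibbs[OF that(2)]], of "-1"]]
    show ?thesis unfolding gibbs_cov_def[abs_def] Ch_def by simp
  qed
  have taylor: "\<bar>log_sum_exp A (\<lambda>a. x a + y a) - log_sum_exp A x - (\<Sum>a\<in>A. gibbs A a x * y a) -
      1 / 2 * (\<Sum>a\<in>A. \<Sum>b\<in>A. gibbs_cov A a b x * y a * y b)\<bar> \<le> C * l1_norm A y ^ 3" for x y
  proof (cases "l1_norm A y \<le> 1")
    case False
    have "\<bar>log_sum_exp A (\<lambda>a. x a + y a) - log_sum_exp A x - (\<Sum>a\<in>A. gibbs A a x * y a) -
      1 / 2 * (\<Sum>a\<in>A. \<Sum>b\<in>A. gibbs_cov A a b x * y a * y b)\<bar> \<le> (2 + Ch) * l1_norm A y ^ 3"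
    proof (rule taylor_crude)
      show "\<bar>log_sum_exp A (\<lambda>a. x a + y a) - log_sum_exp A x\<bar> \<le> l1_norm A y"
        using lipD[OF lip_log_sum_exp, of "\<lambda>a. x a + y a" x] by simp
      have "\<bar>gibbs A a x\<bar> \<le> 1" if "a \<in> A" for a
        by (rule simplex_le_one[OF A(1) _ sum_gibbs that]) (simp add: gibbs_def)
      then show "\<bar>\<Sum>a\<in>A. gibbs A a x * y a\<bar> \<le> l1_norm A y"
        using abs_linear_le[of A "\<lambda>a. gibbs A a x" 1 y] by simp
      show "\<bar>\<Sum>a\<in>A. \<Sum>b\<in>A. gibbs_cov A a b x * y a * y b\<bar> \<le> Ch * (l1_norm A y)\<^sup>2"
        using bounded_lipD(2)[OF bh] by (intro abs_quadratic_le)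
    qed (use False C0 in auto)
    also have "\<dots> \<le> C * l1_norm A y ^ 3"
      unfolding C_def using C0 by (intro mult_right_mono) auto
    finally show ?thesis .
  next
    case True
    define e where "e = l1_norm A y"
    have e: "0 \<le> e" "e \<le> 1" using True by (auto simp: e_def)
    define P where "P = point_measure A (\<lambda>a. ennreal (gibbs A a x))"
    have ms: "borel_measurable P = (UNIV :: ('i \<Rightarrow> real) set)"
      by (auto simp: P_def point_measure_def)
    interpret prob_space P
    proof
      have "emeasure P (space P) = ennreal (\<Sum>a\<in>A. gibbs A a x)"
        unfolding P_def using A by (simp add: space_point_measure emeasure_point_measure_finite sum_ennreal gibbs_def)
      then show "emeasure P (space P) = 1" by (simp add: sum_gibbs)
    qed
    have int: "(\<integral>a. g a \<partial>P) = (\<Sum>a\<in>A. gibbs A a x * g a)" for g :: "'i \<Rightarrow> real"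
      unfolding P_def using A by (subst lebesgue_integral_point_measure_finite) (auto simp: gibbs_def)
    \<comment> \<open>\<open>log_mean_expansion\<close> asks for its bounds at every point of the
      type, so y is cut off outside \<open>A\<close>.\<close>
    let ?y = "\<lambda>a. if a \<in> A then y a else 0"
    have le: "\<bar>?y a\<bar> \<le> e" for a using abs_le_l1_norm[OF A(1), of a y] e by (auto simp: e_def)
    have "log_mean 1 P ?y = ln (\<Sum>a\<in>A. exp (x a + y a - log_sum_exp A x))"
      by (simp add: log_mean_def int gibbs_def exp_add[symmetric] algebra_simps cong: sum.cong)
    also have "\<dots> = ln ((\<Sum>a\<in>A. exp (x a + y a)) / exp (log_sum_exp A x))"
      by (simp add: exp_diff sum_divide_distrib[symmetric])
    also have "\<dots> = log_sum_exp A (\<lambda>a. x a + y a) - log_sum_exp A x"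
      using sum_exp_pos[of "\<lambda>a. x a + y a"] by (simp add: ln_div log_sum_exp_def[of A "\<lambda>a. x a + y a"])
    finally have lm: "log_mean 1 P ?y = log_sum_exp A (\<lambda>a. x a + y a) - log_sum_exp A x" .
    have q1: "\<bar>log_mean 1 P (\<lambda>a. ?y a + 0 + 0) - ((\<integral>a. ?y a \<partial>P) + (\<integral>a. 0 \<partial>P) +
          1 / 2 * ((\<integral>a. (?y a)\<^sup>2 \<partial>P) - (\<integral>a. ?y a \<partial>P)\<^sup>2))\<bar> \<le> C1 * e ^ 3"
      unfolding C1_def
    proof (rule log_mean_expansion[OF _ _ e, where Z = "\<lambda>_. 1"])
      show "(\<integral>a. exp (9 * 1) \<partial>P) \<le> E" using prob_space by (simp add: E_def)
    qed (use le e in \<open>auto simp: ms\<close>)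
    have m1: "(\<integral>a. ?y a \<partial>P) = (\<Sum>a\<in>A. gibbs A a x * y a)" unfolding int by (rule sum.cong) auto
    have "(\<integral>a. (?y a)\<^sup>2 \<partial>P) - (\<integral>a. ?y a \<partial>P)\<^sup>2 = (\<Sum>a\<in>A. \<Sum>b\<in>A. gibbs_cov A a b x * y a * y b)"
    proof -
      have "(\<integral>a. (?y a)\<^sup>2 \<partial>P) - (\<integral>a. ?y a \<partial>P)\<^sup>2 =
        (\<Sum>a\<in>A. gibbs A a x * (y a)\<^sup>2) - (\<Sum>a\<in>A. gibbs A a x * y a) * (\<Sum>a\<in>A. gibbs A a x * y a)"
        unfolding int power2_eq_square by (intro arg_cong2[where f="(-)"] arg_cong2[where f="(*)"] sum.cong) auto
      also have "(\<Sum>a\<in>A. gibbs A a x * y a) * (\<Sum>a\<in>A. gibbs A a x * y a)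
        = (\<Sum>a\<in>A. \<Sum>b\<in>A. (gibbs A a x * y a) * (gibbs A b x * y b))" by (rule sum_product)
      also have "(\<Sum>a\<in>A. gibbs A a x * (y a)\<^sup>2) = (\<Sum>a\<in>A. \<Sum>b\<in>A. if a = b then gibbs A a x * y a * y b else 0)"
        using A by (simp add: power2_eq_square mult.assoc)
      finally show ?thesis
        unfolding sum_subtractf[symmetric] gibbs_cov_def
        by (simp only:) (intro sum.cong refl, auto simp: algebra_simps)
    qed
    then have m2: "(\<integral>a. (?y a)\<^sup>2 \<partial>P) = (\<integral>a. ?y a \<partial>P)\<^sup>2 + (\<Sum>a\<in>A. \<Sum>b\<in>A. gibbs_cov A a b x * y a * y b)"
      by linarith
    from q1 have "\<bar>(log_sum_exp A (\<lambda>a. x a + y a) - log_sum_exp A x) - ((\<Sum>a\<in>A. gibbs A a x * y a) +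
        1 / 2 * (\<Sum>a\<in>A. \<Sum>b\<in>A. gibbs_cov A a b x * y a * y b))\<bar> \<le> C1 * e ^ 3"
      unfolding m2 m1 add_0_right lm by simp
    then have "\<bar>log_sum_exp A (\<lambda>a. x a + y a) - log_sum_exp A x - (\<Sum>a\<in>A. gibbs A a x * y a) -
      1 / 2 * (\<Sum>a\<in>A. \<Sum>b\<in>A. gibbs_cov A a b x * y a * y b)\<bar> \<le> C1 * e ^ 3"
      by (simp only: diff_diff_eq)
    also have "\<dots> \<le> C * l1_norm A y ^ 3"
      unfolding C_def e_def using C0 by (intro mult_right_mono) auto
    finally show ?thesis .
  qed
  have "taylor_reg A C (log_sum_exp A) (gibbs A) (gibbs_cov A)"
    unfolding taylor_reg_def
    using lip_log_sum_exp sum_gibbs taylor C0 bounded_lip_mono[OF bounded_lip_gibbs] bounded_lip_mono[OF bh] gibbs_pos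
    by (auto simp: C_def less_imp_le)
  then show ?thesis by blast
qed

end

text \<open>\<open>fe e\<close> is \<open>f\<close> with centered noise of size e added inside.
  Being centered, the noise leaves no term of order e, and \<open>v\<close> is the velocity with
  respect to e^2, the elapsed time.\<close>

definition quad_perturb :: "'i set \<Rightarrow> real \<Rightarrow> (('i \<Rightarrow> real) \<Rightarrow> real) \<Rightarrow> (('i \<Rightarrow> real) \<Rightarrow> real) \<Rightarrow> (real \<Rightarrow> ('i \<Rightarrow> real) \<Rightarrow> real) \<Rightarrow> bool" where
  "quad_perturb A C f v fe \<longleftrightarrow> bounded_lip A C v \<and>
     (\<forall>e. 0 \<le> e \<and> e \<le> 1 \<longrightarrow> lip A 1 (fe e) \<and> (\<forall>x. \<bar>fe e x - f x - e\<^sup>2 * v x\<bar> \<le> C * e ^ 3))"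

lemma quad_perturbD:
  assumes "quad_perturb A C f v fe"
  shows "bounded_lip A C v" "0 \<le> e \<Longrightarrow> e \<le> 1 \<Longrightarrow> lip A 1 (fe e)"
    "0 \<le> e \<Longrightarrow> e \<le> 1 \<Longrightarrow> \<bar>fe e x - f x - e\<^sup>2 * v x\<bar> \<le> C * e ^ 3"
  using assms unfolding quad_perturb_def by auto

lemma quad_perturbD_crude:
  assumes "quad_perturb A C f v fe" "0 \<le> e" "e \<le> 1"
  shows "\<bar>fe e x - f x\<bar> \<le> 2 * C * e"
proof -
  note p = quad_perturbD[OF assms(1)]
  have C: "0 \<le> C" by (rule bounded_lipD(3)[OF p(1)])
  have "e\<^sup>2 \<le> e" "e ^ 3 \<le> e" using assms power_decreasing[of 1 2 e] power_decreasing[of 1 3 e] by auto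
  then have "C * e ^ 3 \<le> C * e" "\<bar>e\<^sup>2 * v x\<bar> \<le> e * C"
    using C assms(2) bounded_lipD(2)[OF p(1), of x] by (auto simp: abs_mult intro!: mult_mono)
  moreover have "e * C = C * e" "2 * C * e = C * e + C * e" by simp_all
  ultimately show ?thesis using p(3)[OF assms(2,3), of x] by linarith
qed

text \<open>A step that does not itself change with e merely averages the velocity under its tilted
  law.\<close>

lemma quad_perturb_base:
  obtains C' where "\<And>m c f v fe. lip A 1 f \<Longrightarrow> quad_perturb A C f v fe \<Longrightarrow> 0 \<le> m \<Longrightarrow> m \<le> 1 \<Longrightarrow>
    quad_perturb A C' (gauss_step m c f) (tilted_avg m c f v) (\<lambda>e. gauss_step m c (fe e))"
proof -
  define E where "E = exp (9 * (2 * C + 1))"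
  define C1 where "C1 = 9 * E * exp (14 * E)"
  define C' where "C' = 20 * C + C1"
  have "quad_perturb A C' (gauss_step m c f) (tilted_avg m c f v) (\<lambda>e. gauss_step m c (fe e))"
    if f: "lip A 1 f" and p: "quad_perturb A C f v fe" and m: "0 \<le> m" "m \<le> 1" for m c f v fe
  proof -
    note P = quad_perturbD[OF p]
    have C: "0 \<le> C" by (rule bounded_lipD(3)[OF P(1)])
    have C1: "0 \<le> C1" by (simp add: C1_def E_def)
    have bv: "bounded_lip A C' (tilted_avg m c f v)"
      by (rule bounded_lip_mono[OF bounded_lip_tilted_avg[OF f m P(1)]]) (use C1 in \<open>simp add: C'_def\<close>)
    have "\<bar>gauss_step m c (fe e) x - gauss_step m c f x - e\<^sup>2 * tilted_avg m c f v x\<bar> \<le> C' * e ^ 3"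
      if e: "0 \<le> e" "e \<le> 1" for e x
    proof -
      define r where "r z = (\<lambda>a. x a + z * c a)" for z
      define D where "D z = fe e (r z) - f (r z)" for z
      define X2 where "X2 z = e\<^sup>2 * v (r z)" for z
      define Rm where "Rm z = D z - X2 z" for z
      interpret t: prob_space "tilt m c f x" by (rule prob_space_tilt[OF f m])
      have ms: "borel_measurable (tilt m c f x) = borel_measurable (borel :: real measure)"
        by (intro measurable_cong_sets) (auto simp: sets_tilt)
      have mr: "(\<lambda>z. \<phi> (r z)) \<in> borel_measurable borel" if "lip A K \<phi>" for \<phi> K
        unfolding r_def by (rule lip_ray_measurable[OF that])
      have m2: "X2 \<in> borel_measurable borel" unfolding X2_def
        using mr[OF bounded_lipD(1)[OF P(1)]] by simp
      have mD: "D \<in> borel_measurable borel" unfolding D_def by (intro borel_measurable_diff mr[OF f] mr[OF P(2)[OF e]])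
      have mR: "Rm \<in> borel_measurable borel" unfolding Rm_def by (intro borel_measurable_diff mD m2)
      have Dle: "\<bar>D z\<bar> \<le> e * (2 * C + 1)" for z
        using quad_perturbD_crude[OF p e, of "r z"] e unfolding D_def by (simp add: algebra_simps)
      have Cexp: "C \<le> exp (2 * C + 1)" using exp_ge_add_one_self[of "2 * C + 1"] C by linarith
      have X2le: "\<bar>X2 z\<bar> \<le> e\<^sup>2 * exp (2 * C + 1)" for z
        unfolding X2_def abs_mult using order_trans[OF bounded_lipD(2)[OF P(1)] Cexp] by (intro mult_mono) auto
      have Rle: "\<bar>Rm z\<bar> \<le> e ^ 3 * exp (2 * C + 1)" for z
        using P(3)[OF e, of "r z"] mult_left_mono[OF Cexp, of "e ^ 3"] e
        unfolding Rm_def X2_def D_def by (simp add: mult.commute)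
      have ex: "\<bar>log_mean m (tilt m c f x) (\<lambda>z. 0 + X2 z + Rm z) -
        ((\<integral>z. 0 \<partial>tilt m c f x) + (\<integral>z. X2 z \<partial>tilt m c f x) +
          m / 2 * ((\<integral>z. 0\<^sup>2 \<partial>tilt m c f x) - (\<integral>z. 0 \<partial>tilt m c f x)\<^sup>2))\<bar> \<le> C1 * e ^ 3"
        unfolding C1_def
      proof (rule t.log_mean_expansion[OF m e, where Z = "\<lambda>_. 2 * C + 1"])
        show "\<bar>0 + X2 z + Rm z\<bar> \<le> e * (2 * C + 1)" for z using Dle[of z] by (simp add: Rm_def)
        show "(\<integral>z. exp (9 * (2 * C + 1)) \<partial>tilt m c f x) \<le> E"
          using t.prob_space by (simp add: E_def)
      qed (use X2le Rle C e m2 mR ms in auto)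
      have "gauss_step m c (fe e) x = log_mean m std_normal_distribution (\<lambda>z. f (r z) + D z)"
        by (simp add: gauss_step_def D_def r_def)
      also have "\<dots> = gauss_step m c f x + log_mean m (tilt m c f x) D"
        unfolding gauss_step_def[of m c f x] tilt_def r_def
        by (rule gauss.log_mean_tilt[OF lip_ray_integrable[OF f m]]) (use mD Dle in auto)
      finally have "log_mean m (tilt m c f x) (\<lambda>z. 0 + X2 z + Rm z) = gauss_step m c (fe e) x - gauss_step m c f x"
        by (simp add: Rm_def)
      moreover have "(\<integral>z. X2 z \<partial>tilt m c f x) = e\<^sup>2 * tilted_avg m c f v x"
        by (simp add: X2_def tilted_avg_def r_def)
      ultimately have "\<bar>gauss_step m c (fe e) x - gauss_step m c f x - e\<^sup>2 * tilted_avg m c f v x\<bar> \<le> C1 * e ^ 3"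
        using ex by simp
      also have "\<dots> \<le> C' * e ^ 3" using C e unfolding C'_def by (intro mult_right_mono) auto
      finally show ?thesis .
    qed
    then show ?thesis unfolding quad_perturb_def using bv lip_gauss_step[OF P(2) m] by auto
  qed
  then show ?thesis using that by blast
qed

text \<open>Half the contraction of \<open>D\<close> with Hessian plus m times gradient tensor
  gradient: the right-hand side of the Hopf-Cole equation, up to sign, for a function with gradient
  \<open>p\<close> and Hessian \<open>h\<close>.\<close>

definition quad :: "'i set \<Rightarrow> ('i \<Rightarrow> 'i \<Rightarrow> real) \<Rightarrow> real \<Rightarrow> ('i \<Rightarrow> ('i \<Rightarrow> real) \<Rightarrow> real) \<Rightarrow>
    ('i \<Rightarrow> 'i \<Rightarrow> ('i \<Rightarrow> real) \<Rightarrow> real) \<Rightarrow> ('i \<Rightarrow> real) \<Rightarrow> real" where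
  "quad A D m p h x = 1 / 2 * (\<Sum>a\<in>A. \<Sum>b\<in>A. D a b * (h a b x + m * p a x * p b x))"

lemma bounded_lip_hess:
  assumes r: "taylor_reg A C f p h" and m: "0 \<le> m" "m \<le> 1" and "a \<in> A" "b \<in> A"
  shows "bounded_lip A (C + 2 * C * C) (\<lambda>x. h a b x + m * p a x * p b x)"
proof -
  note R = taylor_regD[OF r]
  have "bounded_lip A (2 * C * C) (\<lambda>x. m * p a x * p b x)"
    using bounded_lip_mono[OF bounded_lip_cmult[OF bounded_lip_mult[OF R(2)[OF assms(4)] R(2)[OF assms(5)]], of m], of "2 * C * C"]
      m taylor_reg_finite(3)[OF r] mult_right_mono[of m 1 "2 * C * C"] by (simp add: mult.assoc)
  then show ?thesis by (intro bounded_lip_add R assms)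
qed

lemma bounded_lip_quad:
  assumes r: "taylor_reg A C f p h" and m: "0 \<le> m" "m \<le> 1"
  shows "bounded_lip A (1 / 2 * (\<Sum>a\<in>A. \<Sum>b\<in>A. \<bar>D a b\<bar> * (C + 2 * C * C))) (quad A D m p h)"
proof -
  have "bounded_lip A (\<Sum>a\<in>A. \<Sum>b\<in>A. \<bar>D a b\<bar> * (C + 2 * C * C)) (\<lambda>x. \<Sum>a\<in>A. \<Sum>b\<in>A. D a b * (h a b x + m * p a x * p b x))"
    by (intro bounded_lip_sum bounded_lip_cmult bounded_lip_hess[OF r m])
  from bounded_lip_cmult[OF this, of "1/2"] show ?thesis unfolding quad_def[abs_def] by simp
qed

text \<open>One additional Gaussian step of size e. Its linear part e l z contributes through its
  variance, giving m l^2 / 2, and its quadratic part through its mean, giving k / 2; the sum is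
  \<open>quad\<close>. The increments are now unbounded, so the dominating variable grows like
  |z|.\<close>

lemma quad_perturb_insert:
  obtains C' where "\<And>m d f p h v fe. taylor_reg A C f p h \<Longrightarrow> quad_perturb A C f v fe \<Longrightarrow> 0 \<le> m \<Longrightarrow> m \<le> 1 \<Longrightarrow> l1_norm A d \<le> B \<Longrightarrow>
    quad_perturb A C' f (\<lambda>x. v x + quad A (\<lambda>a b. d a * d b) m p h x) (\<lambda>e. gauss_step m (\<lambda>a. e * d a) (fe e))"
proof -
  \<comment> \<open>With t = (C + B + 1) (1 + |z|) every quantity to be bounded is at most 3 t^4,
    and 3 t^4 is at most exp (8 t); hence the 8.\<close>
  define s where "s = 8 * (C + B + 1)"
  define E where "E = (\<integral>z. exp (9 * (s * (1 + \<bar>z\<bar>))) \<partial>std_normal_distribution)"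
  define C1 where "C1 = 9 * E * exp (14 * E)"
  define C' where "C' = C + (C + 2 * C * C) * B\<^sup>2 + C1"
  have "quad_perturb A C' f (\<lambda>x. v x + quad A (\<lambda>a b. d a * d b) m p h x) (\<lambda>e. gauss_step m (\<lambda>a. e * d a) (fe e))"
    if r: "taylor_reg A C f p h" and pe: "quad_perturb A C f v fe" and m: "0 \<le> m" "m \<le> 1" and d: "l1_norm A d \<le> B" for m d f p h v fe
  proof -
    note R = taylor_regD[OF r] and F = taylor_reg_finite[OF r] and P = quad_perturbD[OF pe]
    note C = F(3)
    have B: "0 \<le> B" using d l1_norm_nonneg[of A d] by linarith
    have E0: "0 \<le> E" by (simp add: E_def)
    have C1: "0 \<le> C1" using E0 by (simp add: C1_def)
    let ?q = "quad A (\<lambda>a b. d a * d b) m p h"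
    have bv: "bounded_lip A C' (\<lambda>x. v x + ?q x)"
    proof (rule bounded_lip_mono[OF bounded_lip_add[OF P(1) bounded_lip_quad[OF r m]]])
      have "1 / 2 * (\<Sum>a\<in>A. \<Sum>b\<in>A. \<bar>d a * d b\<bar> * (C + 2 * C * C)) = 1 / 2 * ((C + 2 * C * C) * (l1_norm A d)\<^sup>2)"
      proof -
        have "(l1_norm A d)\<^sup>2 = (\<Sum>a\<in>A. \<Sum>b\<in>A. \<bar>d a * d b\<bar>)"
          unfolding l1_norm_def power2_eq_square abs_mult by (rule sum_product)
        then show ?thesis by (simp only: sum_distrib_left sum_distrib_right mult_ac)
      qed
      also have "\<dots> \<le> (C + 2 * C * C) * B\<^sup>2"
      proof -
        have "(C + 2 * C * C) * (l1_norm A d)\<^sup>2 \<le> (C + 2 * C * C) * B\<^sup>2"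
          using C d by (intro mult_left_mono power_mono) auto
        moreover have "0 \<le> (C + 2 * C * C) * (l1_norm A d)\<^sup>2" using C by simp
        ultimately show ?thesis by linarith
      qed
      finally show "C + 1 / 2 * (\<Sum>a\<in>A. \<Sum>b\<in>A. \<bar>d a * d b\<bar> * (C + 2 * C * C)) \<le> C'"
        unfolding C'_def using C1 by linarith
    qed
    have "\<bar>gauss_step m (\<lambda>a. e * d a) (fe e) x - f x - e\<^sup>2 * (v x + ?q x)\<bar> \<le> C' * e ^ 3"
      if e: "0 \<le> e" "e \<le> 1" for e x
    proof -
      define l where "l = (\<Sum>a\<in>A. p a x * d a)"
      define k where "k = (\<Sum>a\<in>A. \<Sum>b\<in>A. h a b x * d a * d b)"
      define r where "r z = (\<lambda>a. x a + z * (e * d a))" for z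
      define D where "D z = fe e (r z) - f x" for z
      define X1 where "X1 z = e * l * z" for z
      define X2 where "X2 z = e\<^sup>2 * (1 / 2 * k * z\<^sup>2 + v x)" for z
      define Rm where "Rm z = D z - X1 z - X2 z" for z
      have ms: "borel_measurable std_normal_distribution = borel_measurable (borel :: real measure)"
        by (intro measurable_cong_sets) auto
      have mD: "D \<in> borel_measurable borel" unfolding D_def r_def
        using lip_ray_measurable[OF P(2)[OF e], of x "\<lambda>a. e * d a"] by simp
      have m12: "X1 \<in> borel_measurable borel" "X2 \<in> borel_measurable borel"
        unfolding X1_def X2_def by auto
      have mR: "Rm \<in> borel_measurable borel" unfolding Rm_def by (intro borel_measurable_diff mD m12)
      have nr: "l1_norm A (\<lambda>a. z * (e * d a)) = e * \<bar>z\<bar> * l1_norm A d" for z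
        using e by (simp add: l1_norm_scale mult_ac)
      have ne: "e * \<bar>z\<bar> * l1_norm A d \<le> e * (\<bar>z\<bar> * B)" for z
        using e d by (simp add: mult.assoc mult_left_mono)
      have l: "\<bar>l\<bar> \<le> B" unfolding l_def using taylor_reg_linear_le[OF r, of x d] d by linarith
      have k: "\<bar>k\<bar> \<le> C * B\<^sup>2"
      proof -
        have "\<bar>k\<bar> \<le> C * (l1_norm A d)\<^sup>2" unfolding k_def using bounded_lipD(2)[OF R(5)] by (intro abs_quadratic_le)
        also have "\<dots> \<le> C * B\<^sup>2" using C d by (intro mult_left_mono power_mono) auto
        finally show ?thesis .
      qed
      define t where "t z = (C + B + 1) * (1 + \<bar>z\<bar>)" for z
      have sz: "s * (1 + \<bar>z\<bar>) = 8 * t z" for z by (simp add: s_def t_def)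
      have t: "1 \<le> t z" "C \<le> t z" "B \<le> t z" "B * \<bar>z\<bar> \<le> t z" "C + B * \<bar>z\<bar> \<le> t z" "\<bar>z\<bar> \<le> t z" for z
        using C B mult_nonneg_nonneg[OF C abs_ge_zero[of z]] mult_nonneg_nonneg[OF B abs_ge_zero[of z]]
        by (auto simp: t_def algebra_simps)
      have t0: "0 \<le> t z" for z using t(1)[of z] by linarith
      have tp: "t z ^ i \<le> t z ^ 4" if "i \<le> 4" for i z using t(1)[of z] that by (intro power_increasing)
      have et: "3 * t z ^ 4 \<le> exp (8 * t z)" for z
      proof -
        have "2 * t z \<le> exp (2 * t z)" using exp_ge_add_one_self[of "2 * t z"] by linarith
        then have "(2 * t z) ^ 4 \<le> exp (2 * t z) ^ 4"
          using t0[of z] by (intro power_mono) auto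
        also have "\<dots> = exp (8 * t z)" by (simp add: exp_of_nat_mult[symmetric])
        finally have "16 * t z ^ 4 \<le> exp (8 * t z)" by (simp add: power_mult_distrib)
        moreover have "0 \<le> t z ^ 4" by simp
        ultimately show ?thesis by linarith
      qed
      have X1le: "\<bar>X1 z\<bar> \<le> e * (s * (1 + \<bar>z\<bar>))" for z
      proof -
        have "\<bar>X1 z\<bar> = e * (\<bar>l\<bar> * \<bar>z\<bar>)" using e by (simp add: X1_def abs_mult)
        also have "\<dots> \<le> e * (B * \<bar>z\<bar>)" using l e by (intro mult_left_mono mult_right_mono) auto
        also have "\<dots> \<le> e * (8 * t z)" using t(4)[of z] t0[of z] e by (intro mult_left_mono) auto
        finally show ?thesis unfolding sz .
      qed
      have Dle: "\<bar>D z\<bar> \<le> e * (s * (1 + \<bar>z\<bar>))" for z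
      proof -
        have "\<bar>fe e (r z) - fe e x\<bar> \<le> e * (\<bar>z\<bar> * B)"
          using lipD[OF P(2)[OF e], of "r z" x] ne[of z] nr[of z] by (simp add: r_def)
        then have "\<bar>D z\<bar> \<le> e * (\<bar>z\<bar> * B) + 2 * C * e"
          using quad_perturbD_crude[OF pe e, of x] unfolding D_def by linarith
        also have "\<dots> = e * (B * \<bar>z\<bar> + 2 * C)" by (simp add: algebra_simps)
        also have "\<dots> \<le> e * (8 * t z)"
          using t(4,2)[of z] t0[of z] e by (intro mult_left_mono) auto
        finally show ?thesis unfolding sz .
      qed
      have X2le: "\<bar>X2 z\<bar> \<le> e\<^sup>2 * exp (s * (1 + \<bar>z\<bar>))" for z
      proof -
        have "\<bar>k\<bar> * z\<^sup>2 \<le> C * B\<^sup>2 * z\<^sup>2" using k by (intro mult_right_mono) auto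
        also have "\<dots> = C * (B * \<bar>z\<bar>)\<^sup>2" by (simp add: power_mult_distrib)
        also have "\<dots> \<le> t z * (t z)\<^sup>2" using t(2,4)[of z] C B t0[of z] by (intro mult_mono power_mono) auto
        also have "\<dots> = t z ^ 3" by (simp add: power3_eq_cube power2_eq_square)
        also have "\<dots> \<le> t z ^ 4" by (rule tp) simp
        finally have "\<bar>k * z\<^sup>2\<bar> \<le> t z ^ 4" by (simp add: abs_mult)
        moreover have "\<bar>v x\<bar> \<le> t z ^ 4"
          using bounded_lipD(2)[OF P(1), of x] t(2)[of z] tp[of 1 z] by simp
        ultimately have "\<bar>1 / 2 * k * z\<^sup>2 + v x\<bar> \<le> 3 * t z ^ 4" by linarith
        then have "\<bar>1 / 2 * k * z\<^sup>2 + v x\<bar> \<le> exp (8 * t z)" using et[of z] by linarith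
        then show ?thesis unfolding X2_def sz abs_mult using e by (intro mult_mono) auto
      qed
      have Rle: "\<bar>Rm z\<bar> \<le> e ^ 3 * exp (s * (1 + \<bar>z\<bar>))" for z
      proof -
        have a1: "\<bar>fe e (r z) - f (r z) - e\<^sup>2 * v (r z)\<bar> \<le> e ^ 3 * C"
          using P(3)[OF e, of "r z"] by (simp add: mult.commute)
        have a2: "\<bar>e\<^sup>2 * (v (r z) - v x)\<bar> \<le> e ^ 3 * (C * (B * \<bar>z\<bar>))"
        proof -
          have "\<bar>v (r z) - v x\<bar> \<le> C * (e * \<bar>z\<bar> * l1_norm A d)"
            using lipD[OF bounded_lipD(1)[OF P(1)], of "r z" x] nr[of z] by (simp add: r_def)
          also have "\<dots> \<le> C * (e * (\<bar>z\<bar> * B))" using ne C by (intro mult_left_mono) auto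
          finally have "\<bar>e\<^sup>2 * (v (r z) - v x)\<bar> \<le> e\<^sup>2 * (C * (e * (\<bar>z\<bar> * B)))"
            by (simp add: abs_mult mult_left_mono)
          then show ?thesis by (simp add: power2_eq_square power3_eq_cube mult_ac)
        qed
        have a3: "\<bar>f (r z) - f x - X1 z - e\<^sup>2 * (1 / 2 * k * z\<^sup>2)\<bar> \<le> e ^ 3 * (C * (B * \<bar>z\<bar>) ^ 3)"
        proof -
          have "\<bar>f (r z) - f x - X1 z - e\<^sup>2 * (1 / 2 * k * z\<^sup>2)\<bar> \<le> C * (e * \<bar>z\<bar> * l1_norm A d) ^ 3"
          proof -
            have "(\<Sum>a\<in>A. p a x * (z * (e * d a))) = X1 z"
              unfolding X1_def l_def by (simp add: sum_distrib_left mult_ac)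
            moreover have "(\<Sum>a\<in>A. \<Sum>b\<in>A. h a b x * (z * (e * d a)) * (z * (e * d b))) = e\<^sup>2 * (k * z\<^sup>2)"
              unfolding k_def by (simp add: sum_distrib_left mult_ac power2_eq_square)
            ultimately show ?thesis using R(6)[of x "\<lambda>a. z * (e * d a)"] unfolding nr r_def by simp
          qed
          also have "\<dots> \<le> C * (e * (\<bar>z\<bar> * B)) ^ 3" using ne C e by (intro mult_left_mono power_mono) auto
          finally show ?thesis by (simp add: power_mult_distrib mult_ac)
        qed
        have "Rm z = (fe e (r z) - f (r z) - e\<^sup>2 * v (r z)) + e\<^sup>2 * (v (r z) - v x)
           + (f (r z) - f x - X1 z - e\<^sup>2 * (1 / 2 * k * z\<^sup>2))"
          unfolding Rm_def D_def X2_def by (simp add: algebra_simps)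
        then have "\<bar>Rm z\<bar> \<le> e ^ 3 * C + e ^ 3 * (C * (B * \<bar>z\<bar>)) + e ^ 3 * (C * (B * \<bar>z\<bar>) ^ 3)"
          using a1 a2 a3 by linarith
        also have "\<dots> = e ^ 3 * (C + C * (B * \<bar>z\<bar>) + C * (B * \<bar>z\<bar>) ^ 3)" by (simp add: algebra_simps)
        also have "\<dots> \<le> e ^ 3 * exp (8 * t z)"
        proof (rule mult_left_mono)
          have "C * (B * \<bar>z\<bar>) \<le> t z * t z" using t(2,4)[of z] C B t0[of z] by (intro mult_mono) auto
          moreover have "C * (B * \<bar>z\<bar>) ^ 3 \<le> t z * t z ^ 3"
            using t(2,4)[of z] C B t0[of z] by (intro mult_mono power_mono) auto
          moreover have "t z * t z = t z ^ 2" "t z * t z ^ 3 = t z ^ 4"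
            by (auto simp: power_eq_if)
          ultimately have "C + C * (B * \<bar>z\<bar>) + C * (B * \<bar>z\<bar>) ^ 3 \<le> 3 * t z ^ 4"
            using tp[of 1 z] tp[of 2 z] t(2)[of z] by simp
          then show "C + C * (B * \<bar>z\<bar>) + C * (B * \<bar>z\<bar>) ^ 3 \<le> exp (8 * t z)" using et[of z] by linarith
        qed (use e in auto)
        finally show ?thesis unfolding sz .
      qed
      have i9: "integrable std_normal_distribution (\<lambda>z. exp (9 * (s * (1 + \<bar>z\<bar>))))"
        using integrable_exp_affine[of "9 * s" "9 * s"] by (simp add: algebra_simps)
      have sumD: "X1 z + X2 z + Rm z = D z" for z by (simp add: Rm_def)
      have s0: "0 \<le> s * (1 + \<bar>z\<bar>)" for z unfolding sz using t0[of z] by simp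
      have ex: "\<bar>log_mean m std_normal_distribution (\<lambda>z. X1 z + X2 z + Rm z) -
        ((\<integral>z. X1 z \<partial>std_normal_distribution) + (\<integral>z. X2 z \<partial>std_normal_distribution) +
          m / 2 * ((\<integral>z. (X1 z)\<^sup>2 \<partial>std_normal_distribution) - (\<integral>z. X1 z \<partial>std_normal_distribution)\<^sup>2))\<bar> \<le> C1 * e ^ 3"
        unfolding C1_def
        by (rule gauss.log_mean_expansion[OF m e, where Z = "\<lambda>z. s * (1 + \<bar>z\<bar>)"])
           (use X1le X2le Rle Dle i9 m12 mR s0 sumD in \<open>auto simp: E_def ms\<close>)
      have lm: "log_mean m std_normal_distribution (\<lambda>z. X1 z + X2 z + Rm z) = gauss_step m (\<lambda>a. e * d a) (fe e) x - f x"
      proof -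
        have "gauss_step m (\<lambda>a. e * d a) (fe e) x = log_mean m std_normal_distribution (\<lambda>z. D z + f x)"
          by (simp add: gauss_step_def D_def r_def)
        also have "\<dots> = log_mean m std_normal_distribution D + f x"
        proof (rule gauss.log_mean_add_const)
          have "integrable std_normal_distribution (\<lambda>z. exp (s * (1 + \<bar>z\<bar>)))"
            using integrable_exp_affine[of s s] by (simp add: algebra_simps)
          moreover have "\<bar>D z\<bar> \<le> s * (1 + \<bar>z\<bar>)" for z
            using Dle[of z] e t0[of z] sz[of z] mult_right_mono[of e 1 "s * (1 + \<bar>z\<bar>)"] by linarith
          ultimately show "integrable std_normal_distribution D" "integrable std_normal_distribution (\<lambda>z. exp (m * D z))"
            using gauss.integrable_dominated_exp[of D "\<lambda>z. s * (1 + \<bar>z\<bar>)" m] mD ms m by auto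
        qed
        finally show ?thesis by (simp add: Rm_def)
      qed
      have "(\<integral>z. X1 z \<partial>std_normal_distribution) = 0" "(\<integral>z. (X1 z)\<^sup>2 \<partial>std_normal_distribution) = e\<^sup>2 * l\<^sup>2"
        "(\<integral>z. X2 z \<partial>std_normal_distribution) = e\<^sup>2 * (1 / 2 * k + v x)"
        using gauss_moments gauss.prob_space unfolding X1_def X2_def
        by (simp_all add: power_mult_distrib)
      moreover have "quad A (\<lambda>a b. d a * d b) m p h x = 1 / 2 * k + m / 2 * l\<^sup>2"
      proof -
        have "l\<^sup>2 = (\<Sum>a\<in>A. \<Sum>b\<in>A. (p a x * d a) * (p b x * d b))"
          unfolding l_def power2_eq_square by (rule sum_product)
        then show ?thesis unfolding quad_def k_def
          by (simp add: sum_distrib_left sum.distrib[symmetric] algebra_simps)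
      qed
      ultimately have "\<bar>gauss_step m (\<lambda>a. e * d a) (fe e) x - f x - e\<^sup>2 * (v x + ?q x)\<bar> \<le> C1 * e ^ 3"
        using ex unfolding lm by (simp add: algebra_simps)
      also have "\<dots> \<le> C' * e ^ 3" using C e unfolding C'_def by (intro mult_right_mono) auto
      finally show ?thesis .
    qed
    then show ?thesis unfolding quad_perturb_def using bv lip_gauss_step[OF P(2) m] by auto
  qed
  then show ?thesis using that by blast
qed

subsection \<open>Gaussian laws and their covariances\<close>

lemma (in prob_space) integrable_bounded_real:
  fixes f :: "'a \<Rightarrow> 'b::{banach, second_countable_topology}"
  assumes "f \<in> borel_measurable M" "\<And>x. norm (f x) \<le> B" shows "integrable M f"
  by (rule integrable_const_bound[of _ B]) (use assms in auto)

text \<open>One-dimensional Levy uniqueness for the laws with densities proportional to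
  \<open>G\<close> and \<open>G'\<close>. The test functions are 1 + cos, not complex exponentials:
  they are nonnegative, so that those in other coordinates can be absorbed into the weight.
  Frequency 0 with phase pi / 2 gives the total mass, after which the phases 0 and - pi / 2 give
  real and imaginary part of the characteristic function.\<close>

lemma weighted_distr_eqI:
  fixes G X :: "'a \<Rightarrow> real" and G' Y :: "'b \<Rightarrow> real"
  assumes "prob_space M" "prob_space M'"
    and meas [measurable]: "G \<in> borel_measurable M" "X \<in> borel_measurable M" "G' \<in> borel_measurable M'" "Y \<in> borel_measurable M'"
    and G: "\<And>x. 0 \<le> G x" "\<And>x. G x \<le> B" and G': "\<And>x. 0 \<le> G' x" "\<And>x. G' x \<le> B"
    and eq: "\<And>s \<psi>. (\<integral>x. G x * (1 + cos (s * X x + \<psi>)) \<partial>M) = (\<integral>x. G' x * (1 + cos (s * Y x + \<psi>)) \<partial>M')"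
    and S [measurable]: "S \<in> sets borel"
  shows "(\<integral>x. indicator S (X x) * G x \<partial>M) = (\<integral>x. indicator S (Y x) * G' x \<partial>M')"
proof -
  interpret M: prob_space M by fact
  interpret M': prob_space M' by fact
  have iG: "integrable M (\<lambda>x. G x)" "integrable M' (\<lambda>x. G' x)"
    by (auto intro!: M.integrable_bounded_real[of _ B] M'.integrable_bounded_real[of _ B] simp: G G')
  have B0: "0 \<le> B" using G(1,2) order_trans by blast
  have iGc: "integrable M (\<lambda>x. G x * cos (s * X x + \<psi>))" "integrable M' (\<lambda>x. G' x * cos (s * Y x + \<psi>))" for s \<psi>
    by (auto intro!: M.integrable_bounded_real[of _ "B * 1"] M'.integrable_bounded_real[of _ "B * 1"] mult_mono
        simp: G G' abs_mult B0 simp del: mult_1_right)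
  define w where "w = (\<integral>x. G x \<partial>M)"
  have w': "w = (\<integral>x. G' x \<partial>M')" using eq[of 0 "pi/2"] by (simp add: w_def)
  have w0: "0 \<le> w" unfolding w_def using G by simp
  have c: "(\<integral>x. G x * cos (s * X x + \<psi>) \<partial>M) = (\<integral>x. G' x * cos (s * Y x + \<psi>) \<partial>M')" for s \<psi>
    using eq[of s \<psi>] w' iG iGc[of s \<psi>] by (simp add: w_def distrib_left)
  have iS: "integrable M (\<lambda>x. indicator S (X x) * G x)" "integrable M' (\<lambda>x. indicator S (Y x) * G' x)"
    by (auto intro!: M.integrable_bounded_real[of _ B] M'.integrable_bounded_real[of _ B] simp: G G' B0 indicator_def)
  show ?thesis
  proof (cases "w = 0")
    case True
    have "(\<integral>x. indicator S (X x) * G x \<partial>M) \<le> w"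
      unfolding w_def by (intro integral_mono iS iG) (auto simp: G indicator_def)
    moreover have "(\<integral>x. indicator S (Y x) * G' x \<partial>M') \<le> w"
      unfolding w' by (intro integral_mono iS iG) (auto simp: G' indicator_def)
    moreover have "0 \<le> (\<integral>x. indicator S (X x) * G x \<partial>M)" "0 \<le> (\<integral>x. indicator S (Y x) * G' x \<partial>M')"
      using G G' by auto
    ultimately show ?thesis using True by linarith
  next
    case False
    with w0 have w: "0 < w" by simp
    define P where "P = distr (density M (\<lambda>x. ennreal (G x / w))) borel X"
    define P' where "P' = distr (density M' (\<lambda>x. ennreal (G' x / w))) borel Y"
    have "prob_space (density M (\<lambda>x. ennreal (G x / w)))"
    proof
      have "emeasure (density M (\<lambda>x. ennreal (G x / w))) (space M) = (\<integral>\<^sup>+x. ennreal (G x / w) \<partial>M)"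
        by (subst emeasure_density) (auto intro!: nn_integral_cong)
      also have "\<dots> = ennreal (\<integral>x. G x / w \<partial>M)"
        using iG G w by (intro nn_integral_eq_integral) auto
      also have "\<dots> = 1" using w by (simp add: w_def)
      finally show "emeasure (density M (\<lambda>x. ennreal (G x / w))) (space (density M (\<lambda>x. ennreal (G x / w)))) = 1" by simp
    qed
    then have P: "real_distribution P" unfolding P_def
      by (intro prob_space.real_distribution_distr) auto
    have "prob_space (density M' (\<lambda>x. ennreal (G' x / w)))"
    proof
      have "emeasure (density M' (\<lambda>x. ennreal (G' x / w))) (space M') = (\<integral>\<^sup>+x. ennreal (G' x / w) \<partial>M')"
        by (subst emeasure_density) (auto intro!: nn_integral_cong)
      also have "\<dots> = ennreal (\<integral>x. G' x / w \<partial>M')"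
        using iG G' w by (intro nn_integral_eq_integral) auto
      also have "\<dots> = 1" using w by (simp add: w')
      finally show "emeasure (density M' (\<lambda>x. ennreal (G' x / w))) (space (density M' (\<lambda>x. ennreal (G' x / w)))) = 1" by simp
    qed
    then have P': "real_distribution P'" unfolding P'_def
      by (intro prob_space.real_distribution_distr) auto
    have int: "(\<integral>x. f x \<partial>P) = (\<integral>x. (G x / w) *\<^sub>R f (X x) \<partial>M)" "(\<integral>x. f x \<partial>P') = (\<integral>x. (G' x / w) *\<^sub>R f (Y x) \<partial>M')"
      if [measurable]: "f \<in> borel_measurable borel" for f :: "real \<Rightarrow> 'c::{banach, second_countable_topology}"
      unfolding P_def P'_def using G G' w by (auto simp: integral_distr integral_density)
    interpret P: real_distribution P by fact
    interpret P': real_distribution P' by fact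
    have "char P s = char P' s" for s
    proof (rule complex_eqI)
      have i: "integrable P (\<lambda>x. iexp (s * x))" "integrable P' (\<lambda>x. iexp (s * x))"
        by (auto intro!: P.integrable_bounded_real[of _ 1] P'.integrable_bounded_real[of _ 1])
      have "Re (char P s) = (\<integral>x. cos (s * x) \<partial>P)" "Re (char P' s) = (\<integral>x. cos (s * x) \<partial>P')"
        unfolding char_def using i by (simp_all add: integral_Re[symmetric] Re_exp)
      moreover have "(\<integral>x. cos (s * x) \<partial>P) = (\<integral>x. cos (s * x) \<partial>P')"
        using c[of s 0] by (simp add: int)
      ultimately show "Re (char P s) = Re (char P' s)" by simp
      have "Im (char P s) = (\<integral>x. sin (s * x) \<partial>P)" "Im (char P' s) = (\<integral>x. sin (s * x) \<partial>P')"
        unfolding char_def using i by (simp_all add: integral_Im[symmetric] Im_exp)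
      moreover have "(\<integral>x. sin (s * x) \<partial>P) = (\<integral>x. sin (s * x) \<partial>P')"
      proof -
        have "sin (s * x) = cos (s * x + (- pi / 2))" for x :: real by (simp add: cos_diff)
        then show ?thesis using c[of s "- pi / 2"] by (simp add: int)
      qed
      ultimately show "Im (char P s) = Im (char P' s)" by simp
    qed
    then have "P = P'" by (intro Levy_uniqueness P P' ext)
    then have "(\<integral>x. indicator S x \<partial>P) = (\<integral>x. indicator S x \<partial>P' :: real)" by (simp only:)
    then have "(\<integral>x. (G x / w) *\<^sub>R indicator S (X x) \<partial>M) = (\<integral>x. (G' x / w) *\<^sub>R indicator S (Y x) \<partial>M' :: real)"
      unfolding int[OF borel_measurable_indicator[OF S]] .
    then show ?thesis using w by (simp add: mult.commute)
  qed
qed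

text \<open>Uniqueness in several dimensions from the one-dimensional case. Expanding the cosines
  reduces products of factors 1 + cos to characteristic functions; then the factors are exchanged
  for indicators one coordinate at a time, the remaining ones serving as weight. This ends with
  rectangles, which determine the law.\<close>

theorem distr_eqI_char:
  fixes X :: "'i \<Rightarrow> 'a \<Rightarrow> real" and Y :: "'i \<Rightarrow> 'b \<Rightarrow> real"
  assumes M: "prob_space M" and M': "prob_space M'" and A: "finite A"
    and X [measurable]: "\<And>a. a \<in> A \<Longrightarrow> X a \<in> borel_measurable M"
    and Y [measurable]: "\<And>a. a \<in> A \<Longrightarrow> Y a \<in> borel_measurable M'"
    and char: "\<And>\<theta>. (\<integral>\<omega>. iexp (\<Sum>a\<in>A. \<theta> a * X a \<omega>) \<partial>M) = (\<integral>\<omega>. iexp (\<Sum>a\<in>A. \<theta> a * Y a \<omega>) \<partial>M')"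
  shows "distr M (PiM A (\<lambda>_. borel)) (\<lambda>\<omega>. \<lambda>a\<in>A. X a \<omega>) = distr M' (PiM A (\<lambda>_. borel)) (\<lambda>\<omega>. \<lambda>a\<in>A. Y a \<omega>)"
proof -
  interpret M: prob_space M by fact
  interpret M': prob_space M' by fact
  define W where "W C \<theta> \<phi> x = (\<Prod>c\<in>C. 1 + cos (\<theta> c * x c + \<phi> c))" for C and \<theta> \<phi> x :: "'i \<Rightarrow> real"
  have W0: "0 \<le> W C \<theta> \<phi> x" for C \<theta> \<phi> x
    unfolding W_def using cos_ge_minus_one by (intro prod_nonneg) (smt (verit))
  have WB: "W C \<theta> \<phi> x \<le> 2 ^ card C" for C \<theta> \<phi> x
  proof -
    have "W C \<theta> \<phi> x \<le> (\<Prod>c\<in>C. 2)" unfolding W_def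
    proof (rule prod_mono)
      fix i
      show "0 \<le> 1 + cos (\<theta> i * x i + \<phi> i) \<and> 1 + cos (\<theta> i * x i + \<phi> i) \<le> 2"
        using cos_ge_minus_one[of "\<theta> i * x i + \<phi> i"] cos_le_one[of "\<theta> i * x i + \<phi> i"] by linarith
    qed
    then show ?thesis by simp
  qed
  have Wm: "(\<lambda>\<omega>. W C \<theta> \<phi> (\<lambda>a. X a \<omega>)) \<in> borel_measurable M" "(\<lambda>\<omega>. W C \<theta> \<phi> (\<lambda>a. Y a \<omega>)) \<in> borel_measurable M'"
    if "C \<subseteq> A" for C \<theta> \<phi>
  proof -
    have [measurable]: "c \<in> C \<Longrightarrow> X c \<in> borel_measurable M" "c \<in> C \<Longrightarrow> Y c \<in> borel_measurable M'" for c
      using that X Y by auto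
    show "(\<lambda>\<omega>. W C \<theta> \<phi> (\<lambda>a. X a \<omega>)) \<in> borel_measurable M" "(\<lambda>\<omega>. W C \<theta> \<phi> (\<lambda>a. Y a \<omega>)) \<in> borel_measurable M'"
      unfolding W_def by (rule borel_measurable_prod, measurable)+
  qed
  \<comment> \<open>The exponential with arbitrary frequencies \<open>\<eta>\<close> is carried
    along because expanding one cosine shifts the frequency of its coordinate.\<close>
  have step1: "(\<integral>\<omega>. of_real (W C \<theta> \<phi> (\<lambda>a. X a \<omega>)) * iexp (\<Sum>a\<in>A. \<eta> a * X a \<omega>) \<partial>M) =
      (\<integral>\<omega>. of_real (W C \<theta> \<phi> (\<lambda>a. Y a \<omega>)) * iexp (\<Sum>a\<in>A. \<eta> a * Y a \<omega>) \<partial>M')"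
    if "finite C" "C \<subseteq> A" for C \<theta> \<phi> \<eta>
    using that
  proof (induction C arbitrary: \<eta> rule: finite_induct)
    case empty
    then show ?case using char by (simp add: W_def)
  next
    case (insert c C)
    then have cA: "c \<in> A" and CA: "C \<subseteq> A" by auto
    note [measurable] = Wm[OF CA]
    define ex where "ex \<eta> x = iexp (\<Sum>a\<in>A. \<eta> a * x a)" for \<eta> x :: "'i \<Rightarrow> real"
    have eq: "of_real (W (insert c C) \<theta> \<phi> x) * ex \<eta> x = of_real (W C \<theta> \<phi> x) * ex \<eta> x
       + iexp (\<phi> c) / 2 * (of_real (W C \<theta> \<phi> x) * ex (\<eta>(c := \<eta> c + \<theta> c)) x)
       + iexp (- \<phi> c) / 2 * (of_real (W C \<theta> \<phi> x) * ex (\<eta>(c := \<eta> c - \<theta> c)) x)" for x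
    proof -
      have s: "(\<Sum>a\<in>A. (\<eta>(c := \<eta> c + t)) a * x a) = (\<Sum>a\<in>A. \<eta> a * x a) + t * x c" for t
        using A cA by (simp add: sum.remove[of A c] algebra_simps)
      have e1: "ex (\<eta>(c := \<eta> c + \<theta> c)) x = ex \<eta> x * iexp (\<theta> c * x c)"
        unfolding ex_def s by (simp add: exp_add[symmetric] algebra_simps)
      have e2: "ex (\<eta>(c := \<eta> c - \<theta> c)) x = ex \<eta> x * iexp (- (\<theta> c * x c))"
      proof -
        have s': "(\<Sum>a\<in>A. (\<eta>(c := \<eta> c - \<theta> c)) a * x a) = (\<Sum>a\<in>A. \<eta> a * x a) + - \<theta> c * x c"
          using s[of "- \<theta> c"] by (simp only: diff_conv_add_uminus)
        show ?thesis unfolding ex_def s' by (simp add: exp_add[symmetric] algebra_simps)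
      qed
      have e3: "complex_of_real (1 + cos (\<theta> c * x c + \<phi> c)) =
          1 + iexp (\<phi> c) / 2 * iexp (\<theta> c * x c) + iexp (- \<phi> c) / 2 * iexp (- (\<theta> c * x c))"
        by (simp add: cos_of_real[symmetric] cos_exp_eq exp_add[symmetric] algebra_simps add_divide_distrib)
      have e4: "complex_of_real (W (insert c C) \<theta> \<phi> x) = complex_of_real (1 + cos (\<theta> c * x c + \<phi> c)) * of_real (W C \<theta> \<phi> x)"
        using insert by (simp add: W_def)
      show ?thesis unfolding e1 e2 e4 e3 by (simp add: algebra_simps)
    qed
    have nex: "norm (ex \<eta> x) = 1" for \<eta> x unfolding ex_def by simp
    have exm [measurable]: "(\<lambda>\<omega>. ex \<eta> (\<lambda>a. X a \<omega>)) \<in> borel_measurable M" "(\<lambda>\<omega>. ex \<eta> (\<lambda>a. Y a \<omega>)) \<in> borel_measurable M'" for \<eta>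
      unfolding ex_def by auto
    have i: "integrable M (\<lambda>\<omega>. of_real (W C \<theta> \<phi> (\<lambda>a. X a \<omega>)) * ex \<eta> (\<lambda>a. X a \<omega>))"
      "integrable M' (\<lambda>\<omega>. of_real (W C \<theta> \<phi> (\<lambda>a. Y a \<omega>)) * ex \<eta> (\<lambda>a. Y a \<omega>))" for \<eta>
      by (auto intro!: M.integrable_bounded_real[of _ "2 ^ card C"] M'.integrable_bounded_real[of _ "2 ^ card C"]
          simp: norm_mult nex abs_of_nonneg W0 WB)
    have IH: "(\<integral>\<omega>. of_real (W C \<theta> \<phi> (\<lambda>a. X a \<omega>)) * ex \<eta> (\<lambda>a. X a \<omega>) \<partial>M) =
      (\<integral>\<omega>. of_real (W C \<theta> \<phi> (\<lambda>a. Y a \<omega>)) * ex \<eta> (\<lambda>a. Y a \<omega>) \<partial>M')" for \<eta>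
      using insert.IH[OF CA] unfolding ex_def .
    show ?case
      unfolding ex_def[symmetric] eq using i IH by simp
  qed
  define Ind where "Ind B S x = (\<Prod>b\<in>B. indicator (S b) (x b) :: real)" for B and S :: "'i \<Rightarrow> real set" and x
  \<comment> \<open>Indicators in the coordinates of \<open>B\<close>, trigonometric factors in all
    others. Frequencies and phases stay arbitrary, since the next exchange needs every frequency and
    phase in its coordinate.\<close>
  have step2: "(\<integral>\<omega>. Ind B S (\<lambda>a. X a \<omega>) * W (A - B) \<theta> \<phi> (\<lambda>a. X a \<omega>) \<partial>M) =
      (\<integral>\<omega>. Ind B S (\<lambda>a. Y a \<omega>) * W (A - B) \<theta> \<phi> (\<lambda>a. Y a \<omega>) \<partial>M')"
    if "B \<subseteq> A" "\<And>b. S b \<in> sets borel" for B S \<theta> \<phi>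
    using finite_subset[OF that(1) A] that(1)
  proof (induction B arbitrary: \<theta> \<phi> rule: finite_induct)
    case empty
    have "complex_of_real (\<integral>\<omega>. W A \<theta> \<phi> (\<lambda>a. X a \<omega>) \<partial>M) = of_real (\<integral>\<omega>. W A \<theta> \<phi> (\<lambda>a. Y a \<omega>) \<partial>M')"
      using step1[OF A order_refl, of \<theta> \<phi> "\<lambda>_. 0"] by simp
    then show ?case by (simp add: Ind_def of_real_eq_iff)
  next
    case (insert b B)
    then have bA: "b \<in> A" and BA: "B \<subseteq> A" and bB: "b \<notin> B" by auto
    define C where "C = A - insert b B"
    have Am: "A - B = insert b C" "b \<notin> C" "finite C" "C \<subseteq> A" using bA bB A by (auto simp: C_def)
    define G where "G x = Ind B S x * W C \<theta> \<phi> x" for x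
    have I01: "0 \<le> Ind B S x" "Ind B S x \<le> 1" for x
      unfolding Ind_def by (auto intro!: prod_nonneg prod_le_1 simp: indicator_def)
    have G: "0 \<le> G x" "G x \<le> 1 * 2 ^ card C" for x
    proof -
      show "0 \<le> G x" unfolding G_def using W0 I01 by simp
      show "G x \<le> 1 * 2 ^ card C" unfolding G_def by (rule mult_mono) (use W0 WB I01 in auto)
    qed
    note [measurable] = Wm[OF Am(4)] that(2)
    have [measurable]: "(\<lambda>\<omega>. Ind B S (\<lambda>a. X a \<omega>)) \<in> borel_measurable M" "(\<lambda>\<omega>. Ind B S (\<lambda>a. Y a \<omega>)) \<in> borel_measurable M'"
      unfolding Ind_def using BA by (auto intro!: borel_measurable_prod borel_measurable_indicator' measurable_compose[OF X] measurable_compose[OF Y])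
    have "(\<integral>\<omega>. indicator (S b) (X b \<omega>) * G (\<lambda>a. X a \<omega>) \<partial>M) = (\<integral>\<omega>. indicator (S b) (Y b \<omega>) * G (\<lambda>a. Y a \<omega>) \<partial>M')"
    proof (rule weighted_distr_eqI[OF M M' _ X[OF bA] _ Y[OF bA] G G _ that(2)])
      fix s \<psi> :: real
      have hW: "W (A - B) (\<theta>(b := s)) (\<phi>(b := \<psi>)) x = W C \<theta> \<phi> x * (1 + cos (s * x b + \<psi>))" for x
        unfolding Am(1) W_def using Am(2,3)
        by (subst prod.insert) (auto simp: mult.commute intro!: arg_cong2[where f="(*)"] prod.cong)
      show "(\<integral>\<omega>. G (\<lambda>a. X a \<omega>) * (1 + cos (s * X b \<omega> + \<psi>)) \<partial>M) = (\<integral>\<omega>. G (\<lambda>a. Y a \<omega>) * (1 + cos (s * Y b \<omega> + \<psi>)) \<partial>M')"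
        using insert.IH[OF BA, of "\<theta>(b := s)" "\<phi>(b := \<psi>)"] unfolding G_def hW by (simp only: mult.assoc)
    qed (auto simp: G_def)
    then show ?case using insert(1,2) unfolding G_def C_def Ind_def by (simp add: mult.assoc)
  qed
  let ?Q = "PiM A (\<lambda>_. borel :: real measure)"
  have mX [measurable]: "(\<lambda>\<omega>. \<lambda>a\<in>A. X a \<omega>) \<in> measurable M ?Q" "(\<lambda>\<omega>. \<lambda>a\<in>A. Y a \<omega>) \<in> measurable M' ?Q"
    by (auto intro!: measurable_restrict)
  show ?thesis
  proof (rule measure_eqI_PiM_finite[OF A])
    fix S :: "'i \<Rightarrow> real set" assume S: "\<And>i. i \<in> A \<Longrightarrow> S i \<in> sets borel"
    define S' where "S' i = (if i \<in> A then S i else {})" for i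
    have S': "S' i \<in> sets borel" for i using S by (simp add: S'_def)
    have PS: "Pi\<^sub>E A S = Pi\<^sub>E A S'" by (rule PiE_cong) (simp add: S'_def)
    have mS: "Pi\<^sub>E A S' \<in> sets ?Q" using S' A by (intro sets_PiM_I_finite) auto
    have ind: "Ind A S' x = indicator (Pi\<^sub>E A S') (restrict x A)" for x
      using A by (auto simp: Ind_def indicator_def PiE_iff prod_zero_iff intro!: prod.neutral)
    have e: "(\<integral>\<omega>. indicator (Pi\<^sub>E A S') (\<lambda>a\<in>A. X a \<omega>) \<partial>M) = (\<integral>\<omega>. indicator (Pi\<^sub>E A S') (\<lambda>a\<in>A. Y a \<omega>) \<partial>M' :: real)"
    proof -
      have "(\<integral>\<omega>. Ind A S' (\<lambda>a. X a \<omega>) * W (A - A) (\<lambda>_. 0) (\<lambda>_. 0) (\<lambda>a. X a \<omega>) \<partial>M) =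
        (\<integral>\<omega>. Ind A S' (\<lambda>a. Y a \<omega>) * W (A - A) (\<lambda>_. 0) (\<lambda>_. 0) (\<lambda>a. Y a \<omega>) \<partial>M')"
        by (rule step2[OF order_refl S'])
      then show ?thesis unfolding ind by (simp add: W_def)
    qed
    interpret DX: prob_space "distr M ?Q (\<lambda>\<omega>. \<lambda>a\<in>A. X a \<omega>)" by (rule M.prob_space_distr) simp
    interpret DY: prob_space "distr M' ?Q (\<lambda>\<omega>. \<lambda>a\<in>A. Y a \<omega>)" by (rule M'.prob_space_distr) simp
    have "(\<integral>y. indicator (Pi\<^sub>E A S') y \<partial>distr M ?Q (\<lambda>\<omega>. \<lambda>a\<in>A. X a \<omega>))
       = (\<integral>y. indicator (Pi\<^sub>E A S') y \<partial>distr M' ?Q (\<lambda>\<omega>. \<lambda>a\<in>A. Y a \<omega>) :: real)"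
      unfolding integral_distr[OF mX(1) borel_measurable_indicator[OF mS]]
        integral_distr[OF mX(2) borel_measurable_indicator[OF mS]] by (rule e)
    then show "emeasure (distr M ?Q (\<lambda>\<omega>. \<lambda>a\<in>A. X a \<omega>)) (Pi\<^sub>E A S) = emeasure (distr M' ?Q (\<lambda>\<omega>. \<lambda>a\<in>A. Y a \<omega>)) (Pi\<^sub>E A S)"
      unfolding PS using mS by (simp add: DX.emeasure_eq_measure DY.emeasure_eq_measure)
  next
    show "range (\<lambda>n::nat. space ?Q) \<subseteq> prod_algebra A (\<lambda>_. borel)"
      using A by (auto simp: space_PiM intro!: prod_algebraI_finite)
    show "emeasure (distr M ?Q (\<lambda>\<omega>. \<lambda>a\<in>A. X a \<omega>)) (space ?Q) \<noteq> \<infinity>"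
      by (subst emeasure_distr) (auto simp: M.emeasure_eq_measure)
  qed auto
qed

section \<open>Gaussian vectors as sums of independent rank-one pieces\<close>

primrec gauss_law :: "'i set \<Rightarrow> ('i \<Rightarrow> real) list \<Rightarrow> ('i \<Rightarrow> real) measure" where
  "gauss_law A [] = return (PiM A (\<lambda>_. borel)) (\<lambda>a\<in>A. 0)"
| "gauss_law A (c # cs) = distr (std_normal_distribution \<Otimes>\<^sub>M gauss_law A cs) (PiM A (\<lambda>_. borel))
     (\<lambda>(z, y). \<lambda>a\<in>A. z * c a + y a)"

definition cov :: "('i \<Rightarrow> real) list \<Rightarrow> 'i \<Rightarrow> 'i \<Rightarrow> real" where
  "cov cs a b = (\<Sum>c\<leftarrow>cs. c a * c b)"

lemma sets_gauss_law [measurable_cong]: "sets (gauss_law A cs) = sets (PiM A (\<lambda>_. borel))"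
  by (cases cs) auto

lemma space_gauss_law: "space (gauss_law A cs) = space (PiM A (\<lambda>_. borel))"
  by (rule sets_eq_imp_space_eq[OF sets_gauss_law])

lemma measurable_shift:
  "(\<lambda>(z, y). \<lambda>a\<in>A. z * c a + y a) \<in> measurable (std_normal_distribution \<Otimes>\<^sub>M gauss_law A cs) (PiM A (\<lambda>_. borel))"
  unfolding case_prod_beta by measurable

lemma prob_space_gauss_law: "prob_space (gauss_law A cs)"
proof (induction cs)
  case Nil
  show ?case by (simp, rule prob_space_return) (auto simp: space_PiM)
next
  case (Cons c cs)
  interpret p: prob_space "gauss_law A cs" by fact
  interpret pair_prob_space std_normal_distribution "gauss_law A cs" ..
  show ?case unfolding gauss_law.simps by (intro prob_space_distr measurable_shift)
qed

lemma char_gauss_law: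
  assumes A: "finite A"
  shows "(\<integral>y. iexp (\<Sum>a\<in>A. \<theta> a * y a) \<partial>gauss_law A cs)
     = of_real (exp (- (\<Sum>c\<leftarrow>cs. (\<Sum>a\<in>A. \<theta> a * c a)\<^sup>2) / 2))"
proof (induction cs)
  case Nil
  have "(\<integral>y. iexp (\<Sum>a\<in>A. \<theta> a * y a) \<partial>gauss_law A []) = iexp (\<Sum>a\<in>A. \<theta> a * (\<lambda>a\<in>A. 0) a)"
    unfolding gauss_law.simps by (rule integral_return) (auto simp: space_PiM)
  then show ?case by simp
next
  case (Cons c cs)
  interpret p: prob_space "gauss_law A cs" by (rule prob_space_gauss_law)
  interpret pair_prob_space std_normal_distribution "gauss_law A cs" ..
  let ?t = "\<Sum>a\<in>A. \<theta> a * c a"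
  have eq: "iexp (\<Sum>a\<in>A. \<theta> a * (\<lambda>a\<in>A. z * c a + y a) a) = iexp (?t * z) * iexp (\<Sum>a\<in>A. \<theta> a * y a)" for z y
  proof -
    have s: "(\<Sum>a\<in>A. \<theta> a * (\<lambda>a\<in>A. z * c a + y a) a) = ?t * z + (\<Sum>a\<in>A. \<theta> a * y a)"
      by (simp add: distrib_left sum.distrib sum_distrib_right sum_distrib_left mult_ac cong: sum.cong)
    show ?thesis unfolding s by (simp add: distrib_left exp_add del: of_real_sum)
  qed
  have "(\<integral>y. iexp (\<Sum>a\<in>A. \<theta> a * y a) \<partial>gauss_law A (c # cs))
     = (\<integral>p. iexp (?t * fst p) * iexp (\<Sum>a\<in>A. \<theta> a * snd p a) \<partial>(std_normal_distribution \<Otimes>\<^sub>M gauss_law A cs))"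
    unfolding gauss_law.simps
  proof (subst integral_distr[OF measurable_shift])
    show "(\<lambda>y. iexp (\<Sum>a\<in>A. \<theta> a * y a)) \<in> borel_measurable (PiM A (\<lambda>_. borel))" by measurable
  qed (simp only: case_prod_beta eq)
  also have "\<dots> = (\<integral>z. (\<integral>y. iexp (?t * z) * iexp (\<Sum>a\<in>A. \<theta> a * y a) \<partial>gauss_law A cs) \<partial>std_normal_distribution)"
  proof (subst integral_fst'[symmetric])
    show "integrable (std_normal_distribution \<Otimes>\<^sub>M gauss_law A cs) (\<lambda>p. iexp (?t * fst p) * iexp (\<Sum>a\<in>A. \<theta> a * snd p a))"
      by (rule integrable_bounded_real[of _ 1]) (auto simp: norm_mult)
  qed simp
  also have "\<dots> = (\<integral>z. iexp (?t * z) \<partial>std_normal_distribution) * (\<integral>y. iexp (\<Sum>a\<in>A. \<theta> a * y a) \<partial>gauss_law A cs)"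
    by simp
  also have "(\<integral>z. iexp (?t * z) \<partial>std_normal_distribution) = of_real (exp (- ?t\<^sup>2 / 2))"
    using fun_cong[OF char_std_normal_distribution, of ?t] by (simp add: char_def)
  finally show ?case unfolding Cons by (simp add: exp_add[symmetric] of_real_mult[symmetric] add_divide_distrib del: of_real_mult)
qed

lemma sum_squares_cov:
  "(\<Sum>c\<leftarrow>cs. (\<Sum>a\<in>A. \<theta> a * c a)\<^sup>2) = (\<Sum>a\<in>A. \<Sum>b\<in>A. \<theta> a * \<theta> b * cov cs a b)"
proof (induction cs)
  case (Cons c cs)
  have "(\<Sum>a\<in>A. \<theta> a * c a)\<^sup>2 = (\<Sum>a\<in>A. \<Sum>b\<in>A. (\<theta> a * c a) * (\<theta> b * c b))"
    unfolding power2_eq_square by (rule sum_product)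
  then show ?case using Cons by (simp add: cov_def sum.distrib[symmetric] algebra_simps)
qed (simp add: cov_def)

lemma gauss_law_eqI:
  assumes A: "finite A" and "prob_space M"
    and X [measurable]: "\<And>a. a \<in> A \<Longrightarrow> X a \<in> borel_measurable M"
    and char: "\<And>\<theta>. (\<integral>\<omega>. iexp (\<Sum>a\<in>A. \<theta> a * X a \<omega>) \<partial>M) = of_real (exp (- (\<Sum>a\<in>A. \<Sum>b\<in>A. \<theta> a * \<theta> b * cov cs a b) / 2))"
  shows "distr M (PiM A (\<lambda>_. borel)) (\<lambda>\<omega>. \<lambda>a\<in>A. X a \<omega>) = gauss_law A cs"
proof -
  have "distr M (PiM A (\<lambda>_. borel)) (\<lambda>\<omega>. \<lambda>a\<in>A. X a \<omega>) = distr (gauss_law A cs) (PiM A (\<lambda>_. borel)) (\<lambda>y. \<lambda>a\<in>A. y a)"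
  proof (rule distr_eqI_char[OF assms(2) prob_space_gauss_law A X])
    show "(\<lambda>y. y a) \<in> borel_measurable (gauss_law A cs)" if "a \<in> A" for a using that by measurable
    show "(\<integral>\<omega>. iexp (\<Sum>a\<in>A. \<theta> a * X a \<omega>) \<partial>M) = (\<integral>y. iexp (\<Sum>a\<in>A. \<theta> a * y a) \<partial>gauss_law A cs)" for \<theta>
      unfolding char char_gauss_law[OF A] sum_squares_cov ..
  qed
  also have "\<dots> = distr (gauss_law A cs) (gauss_law A cs) (\<lambda>y. y)"
    by (rule distr_cong) (auto simp: sets_gauss_law space_gauss_law space_PiM PiE_def extensional_restrict)
  finally show ?thesis by (simp add: distr_id)
qed

lemma gauss_law_cong:
  assumes A: "finite A" and "\<And>a b. a \<in> A \<Longrightarrow> b \<in> A \<Longrightarrow> cov cs a b = cov ds a b"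
  shows "gauss_law A cs = gauss_law A ds"
proof -
  have "distr (gauss_law A cs) (PiM A (\<lambda>_. borel)) (\<lambda>y. \<lambda>a\<in>A. y a) = gauss_law A ds"
  proof (rule gauss_law_eqI[OF A prob_space_gauss_law])
    show "(\<lambda>y. y a) \<in> borel_measurable (gauss_law A cs)" if "a \<in> A" for a using that by measurable
    have "(\<Sum>a\<in>A. \<Sum>b\<in>A. \<theta> a * \<theta> b * cov cs a b) = (\<Sum>a\<in>A. \<Sum>b\<in>A. \<theta> a * \<theta> b * cov ds a b)" for \<theta>
      by (intro sum.cong) (auto simp: assms(2))
    then show "(\<integral>y. iexp (\<Sum>a\<in>A. \<theta> a * y a) \<partial>gauss_law A cs) = of_real (exp (- (\<Sum>a\<in>A. \<Sum>b\<in>A. \<theta> a * \<theta> b * cov ds a b) / 2))" for \<theta>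
      unfolding char_gauss_law[OF A] sum_squares_cov by (simp only:)
  qed
  moreover have "distr (gauss_law A cs) (PiM A (\<lambda>_. borel)) (\<lambda>y. \<lambda>a\<in>A. y a) = distr (gauss_law A cs) (gauss_law A cs) (\<lambda>y. y)"
    by (rule distr_cong) (auto simp: sets_gauss_law space_gauss_law space_PiM PiE_def extensional_restrict)
  ultimately show ?thesis by (simp add: distr_id)
qed

lemma lip_cong: "lip A L f \<Longrightarrow> (\<And>a. a \<in> A \<Longrightarrow> x a = y a) \<Longrightarrow> f x = f y"
  using lipD[of A L f x y] by (simp add: l1_norm_def)

text \<open>Rounding the coordinates down to a grid makes the function factor through a discrete
  countable space, on which everything is measurable. The Lipschitz bound gives convergence as the
  mesh shrinks.\<close>

lemma lip_measurable:
  assumes A: "finite A" and f: "lip A L f"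
  shows "f \<in> borel_measurable (PiM A (\<lambda>_. borel))"
proof (rule borel_measurable_LIMSEQ_real)
  define r where "r n x = (\<lambda>a\<in>A. \<lfloor>real (Suc n) * x a\<rfloor>)" for n and x :: "'a \<Rightarrow> real"
  define g where "g n k = f (\<lambda>a. real_of_int (k a) / real (Suc n))" for n k
  show "(\<lambda>x. g n (r n x)) \<in> borel_measurable (PiM A (\<lambda>_. borel))" for n
  proof -
    have "r n \<in> measurable (PiM A (\<lambda>_. borel)) (PiM A (\<lambda>_. count_space (UNIV :: int set)))"
      unfolding r_def by (intro measurable_restrict) measurable
    also have "PiM A (\<lambda>_. count_space (UNIV :: int set)) = count_space (PiE A (\<lambda>_. UNIV))"
      by (rule count_space_PiM_finite[OF A]) auto
    finally show ?thesis
      by (rule measurable_compose) simp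
  qed
  fix x :: "'a \<Rightarrow> real"
  have b: "\<bar>g n (r n x) - f x\<bar> \<le> (L * real (card A)) / real (Suc n)" for n
  proof -
    have "\<bar>g n (r n x) - f x\<bar> \<le> L * l1_norm A (\<lambda>a. real_of_int (r n x a) / real (Suc n) - x a)"
      unfolding g_def by (rule lipD[OF f])
    also have "l1_norm A (\<lambda>a. real_of_int (r n x a) / real (Suc n) - x a) \<le> (\<Sum>a\<in>A. 1 / real (Suc n))"
      unfolding l1_norm_def
    proof (rule sum_mono)
      fix a assume a: "a \<in> A"
      have "\<bar>real_of_int \<lfloor>real (Suc n) * x a\<rfloor> - real (Suc n) * x a\<bar> \<le> 1" by linarith
      then have "\<bar>real_of_int \<lfloor>real (Suc n) * x a\<rfloor> - real (Suc n) * x a\<bar> / real (Suc n) \<le> 1 / real (Suc n)"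
        by (intro divide_right_mono) auto
      moreover have "\<bar>u / t - v\<bar> = \<bar>u - t * v\<bar> / t" if "0 < t" for u t v :: real
      proof -
        have "u / t - v = (u - t * v) / t" using that by (simp add: field_simps)
        then show ?thesis using that by simp
      qed
      note this[of "real (Suc n)" "real_of_int \<lfloor>real (Suc n) * x a\<rfloor>" "x a"]
      ultimately show "\<bar>real_of_int (r n x a) / real (Suc n) - x a\<bar> \<le> 1 / real (Suc n)"
        using a unfolding r_def by (simp del: of_nat_Suc)
    qed
    finally show ?thesis using lip_nonneg[OF f] by (simp add: mult_left_mono)
  qed
  have "(\<lambda>n. g n (r n x) - f x) \<longlonglongrightarrow> 0"
  proof (rule Lim_null_comparison)
    show "(\<lambda>n. (L * real (card A)) / real (Suc n)) \<longlonglongrightarrow> 0"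
      using tendsto_mult_right_zero[OF lim_inverse_n', of "L * real (card A)"]
        LIMSEQ_Suc[of "\<lambda>n. (L * real (card A)) * (1 / real n)" 0] by simp
  qed (use b in auto)
  then show "(\<lambda>n. g n (r n x)) \<longlonglongrightarrow> f x" by (rule LIM_zero_cancel)
qed

lemma lip_shift:
  assumes f: "lip A L f" shows "lip A L (\<lambda>y. f (\<lambda>a. x a + y a))"
  unfolding lip_def
proof (intro conjI allI)
  show "\<bar>f (\<lambda>a. x a + u a) - f (\<lambda>a. x a + v a)\<bar> \<le> L * l1_norm A (\<lambda>a. u a - v a)" for u v
    using lipD[OF f, of "\<lambda>a. x a + u a" "\<lambda>a. x a + v a"] by simp
qed (rule lip_nonneg[OF f])

lemma lip_l1_norm: "lip A 1 (l1_norm A)"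
  unfolding lip_def l1_norm_def sum_subtractf[symmetric]
  by (auto intro!: order_trans[OF sum_abs] sum_mono simp: sum_subtractf[symmetric])

lemma integrable_exp_l1_norm:
  assumes A: "finite A" and B: "0 \<le> B" shows "integrable (gauss_law A cs) (\<lambda>y. exp (B * l1_norm A y))"
proof (induction cs)
  case Nil
  then show ?case
    using lip_measurable[OF A lip_l1_norm] by (auto intro!: integrableI_bounded simp: nn_integral_return space_PiM)
next
  case (Cons c cs)
  interpret p: prob_space "gauss_law A cs" by (rule prob_space_gauss_law)
  interpret pair_prob_space std_normal_distribution "gauss_law A cs" ..
  have nm [measurable]: "l1_norm A \<in> borel_measurable (PiM A (\<lambda>_. borel))" by (rule lip_measurable[OF A lip_l1_norm])
  have i1: "integrable std_normal_distribution (\<lambda>z. exp (B * l1_norm A c * \<bar>z\<bar>))" by (rule integrable_gauss_exp_abs)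
  have "integrable (std_normal_distribution \<Otimes>\<^sub>M gauss_law A cs) (\<lambda>p. exp (B * l1_norm A c * \<bar>fst p\<bar>) * exp (B * l1_norm A (snd p)))"
  proof (rule Fubini_integrable)
    show "integrable std_normal_distribution
      (\<lambda>x. \<integral>y. norm (exp (B * l1_norm A c * \<bar>fst (x, y)\<bar>) * exp (B * l1_norm A (snd (x, y)))) \<partial>gauss_law A cs)"
      using i1 by simp
  qed (use Cons in simp_all)
  then have "integrable (std_normal_distribution \<Otimes>\<^sub>M gauss_law A cs)
     (\<lambda>p. exp (B * l1_norm A ((\<lambda>(z, y). \<lambda>a\<in>A. z * c a + y a) p)))"
  proof (rule Bochner_Integration.integrable_bound)
    show "(\<lambda>p. exp (B * l1_norm A ((\<lambda>(z, y). \<lambda>a\<in>A. z * c a + y a) p))) \<in> borel_measurable (std_normal_distribution \<Otimes>\<^sub>M gauss_law A cs)"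
      using measurable_compose[OF measurable_shift nm] by measurable
    have "exp (B * l1_norm A (\<lambda>a\<in>A. z * c a + y a)) \<le> exp (B * l1_norm A c * \<bar>z\<bar>) * exp (B * l1_norm A y)" for z y
    proof -
      have "l1_norm A (\<lambda>a\<in>A. z * c a + y a) = l1_norm A (\<lambda>a. z * c a + y a)" by (simp add: l1_norm_def)
      also have "\<dots> \<le> \<bar>z\<bar> * l1_norm A c + l1_norm A y" using l1_norm_triangle[of A "\<lambda>a. z * c a" y] by (simp add: l1_norm_scale)
      finally have "B * l1_norm A (\<lambda>a\<in>A. z * c a + y a) \<le> B * (\<bar>z\<bar> * l1_norm A c + l1_norm A y)" using B by (rule mult_left_mono)
      then show ?thesis by (simp add: exp_add[symmetric] algebra_simps)
    qed
    then show "AE p in std_normal_distribution \<Otimes>\<^sub>M gauss_law A cs.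
      norm (exp (B * l1_norm A ((\<lambda>(z, y). \<lambda>a\<in>A. z * c a + y a) p))) \<le> norm (exp (B * l1_norm A c * \<bar>fst p\<bar>) * exp (B * l1_norm A (snd p)))"
      by (intro AE_I2) (auto simp: case_prod_beta)
  qed
  then show ?case unfolding gauss_law.simps
    by (subst integrable_distr_eq[OF measurable_shift]) measurable
qed

lemma gauss_law_integrable:
  assumes A: "finite A" and f: "lip A L f" and m: "0 \<le> m" "m \<le> 1"
  shows "integrable (gauss_law A cs) (\<lambda>y. f (\<lambda>a. x a + y a))"
    "integrable (gauss_law A cs) (\<lambda>y. exp (m * f (\<lambda>a. x a + y a)))"
proof -
  interpret p: prob_space "gauss_law A cs" by (rule prob_space_gauss_law)
  have m': "(\<lambda>y. f (\<lambda>a. x a + y a)) \<in> borel_measurable (gauss_law A cs)"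
    using lip_measurable[OF A lip_shift[OF f]] by (simp cong: measurable_cong_sets add: sets_gauss_law)
  have b: "\<bar>f (\<lambda>a. x a + y a)\<bar> \<le> \<bar>f x\<bar> + L * l1_norm A y" for y
    using lipD[OF f, of "\<lambda>a. x a + y a" x] by simp
  have i: "integrable (gauss_law A cs) (\<lambda>y. exp (\<bar>f x\<bar> + L * l1_norm A y))"
    using integrable_exp_l1_norm[OF A lip_nonneg[OF f]] by (simp add: exp_add)
  show "integrable (gauss_law A cs) (\<lambda>y. f (\<lambda>a. x a + y a))"
    "integrable (gauss_law A cs) (\<lambda>y. exp (m * f (\<lambda>a. x a + y a)))"
    using p.integrable_dominated_exp[OF m' b i m] by auto
qed

lemma log_mean_distr:
  assumes "T \<in> measurable M N" "g \<in> borel_measurable N"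
  shows "log_mean m (distr M N T) g = log_mean m M (\<lambda>x. g (T x))"
  using assms by (simp add: log_mean_def integral_distr)

text \<open>Inner and outer parameter agree, so the exponential undoes the inner logarithm and
  Fubini applies.\<close>

lemma (in pair_prob_space) log_mean_pair:
  assumes g: "integrable (M1 \<Otimes>\<^sub>M M2) g" "integrable (M1 \<Otimes>\<^sub>M M2) (\<lambda>p. exp (m * g p))"
    and i: "\<And>x. integrable M2 (\<lambda>y. exp (m * g (x, y)))"
  shows "log_mean m (M1 \<Otimes>\<^sub>M M2) g = log_mean m M1 (\<lambda>x. log_mean m M2 (\<lambda>y. g (x, y)))"
proof (cases "m = 0")
  case True
  then show ?thesis using integral_fst'[OF g(1)] by (simp add: log_mean_def)
next
  case False
  have "exp (m * log_mean m M2 (\<lambda>y. g (x, y))) = (\<integral>y. exp (m * g (x, y)) \<partial>M2)" for x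
    using False M2.integral_exp_pos[OF i[of x]] by (simp add: log_mean_def)
  then show ?thesis using False integral_fst'[OF g(2)] by (simp add: log_mean_def[of m M1] log_mean_def[of m "M1 \<Otimes>\<^sub>M M2"])
qed

lemma lip_foldr_gauss_step:
  assumes "lip A L f" "0 \<le> m" "m \<le> 1" shows "lip A L (foldr (gauss_step m) cs f)"
  by (induction cs) (auto intro: lip_gauss_step assms)

lemma foldr_gauss_step_eq_log_mean:
  assumes A: "finite A" and f: "lip A L f" and m: "0 \<le> m" "m \<le> 1"
  shows "foldr (gauss_step m) cs f x = log_mean m (gauss_law A cs) (\<lambda>y. f (\<lambda>a. x a + y a))"
proof (induction cs arbitrary: x)
  case Nil
  have *: "(\<lambda>y. f (\<lambda>a. x a + y a)) \<in> borel_measurable (PiM A (\<lambda>_. borel))"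
    by (rule lip_measurable[OF A lip_shift[OF f]])
  have "log_mean m (gauss_law A []) (\<lambda>y. f (\<lambda>a. x a + y a)) = f (\<lambda>a. x a + (\<lambda>a\<in>A. 0) a)"
    using * by (cases "m = 0") (auto simp: log_mean_def integral_return space_PiM)
  also have "\<dots> = f x" by (rule lip_cong[OF f]) simp
  finally show ?case by simp
next
  case (Cons c cs)
  interpret p: prob_space "gauss_law A cs" by (rule prob_space_gauss_law)
  interpret pair_prob_space std_normal_distribution "gauss_law A cs" ..
  let ?T = "\<lambda>(z, y). \<lambda>a\<in>A. z * c a + y a"
  let ?f = "\<lambda>y. f (\<lambda>a. x a + y a)"
  have eq: "?f (\<lambda>a\<in>A. z * c a + y a) = f (\<lambda>a. (x a + z * c a) + y a)" for z y
    by (rule lip_cong[OF f]) simp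
  have ms: "?f \<in> borel_measurable (PiM A (\<lambda>_. borel))" by (rule lip_measurable[OF A lip_shift[OF f]])
  have "log_mean m (gauss_law A (c # cs)) ?f = log_mean m (std_normal_distribution \<Otimes>\<^sub>M gauss_law A cs) (\<lambda>p. ?f (?T p))"
    unfolding gauss_law.simps by (rule log_mean_distr[OF measurable_shift ms])
  also have "\<dots> = log_mean m std_normal_distribution (\<lambda>z. log_mean m (gauss_law A cs) (\<lambda>y. ?f (?T (z, y))))"
  proof (rule log_mean_pair)
    have i: "integrable (gauss_law A (c # cs)) ?f" "integrable (gauss_law A (c # cs)) (\<lambda>y. exp (m * ?f y))"
      by (rule gauss_law_integrable[OF A f m])+
    show "integrable (std_normal_distribution \<Otimes>\<^sub>M gauss_law A cs) (\<lambda>p. ?f (?T p))"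
      "integrable (std_normal_distribution \<Otimes>\<^sub>M gauss_law A cs) (\<lambda>p. exp (m * ?f (?T p)))"
      using i ms unfolding gauss_law.simps by (auto simp: integrable_distr_eq[OF measurable_shift])
    show "integrable (gauss_law A cs) (\<lambda>y. exp (m * ?f (?T (z, y))))" for z
      by (simp only: prod.case eq) (rule gauss_law_integrable(2)[OF A f m])
  qed
  also have "\<dots> = gauss_step m c (foldr (gauss_step m) cs f) x"
    by (simp only: prod.case eq gauss_step_def Cons)
  finally show ?case by (simp only: foldr.simps o_apply)
qed

text \<open>Consecutive steps with the same m form a single exponential mean over a Gaussian vector,
  so they may be permuted, merged and split as long as the total covariance is kept.\<close>

lemma foldr_gauss_step_cong:
  assumes A: "finite A" and f: "lip A L f" and m: "0 \<le> m" "m \<le> 1"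
    and "\<And>a b. a \<in> A \<Longrightarrow> b \<in> A \<Longrightarrow> cov cs a b = cov ds a b"
  shows "foldr (gauss_step m) cs f = foldr (gauss_step m) ds f"
  using gauss_law_cong[OF A assms(5)] by (auto simp: foldr_gauss_step_eq_log_mean[OF A f m] fun_eq_iff)

text \<open>Variances add, not amplitudes. In \<open>perturbed_cascade_from_to\<close> this turns a
  change of time into an inserted step.\<close>

lemma gauss_step_split:
  assumes A: "finite A" and f: "lip A L f" and m: "0 \<le> m" "m \<le> 1" and "0 \<le> s" "0 \<le> t"
  shows "gauss_step m (\<lambda>a. sqrt s * c a) (gauss_step m (\<lambda>a. sqrt t * c a) f) = gauss_step m (\<lambda>a. sqrt (s + t) * c a) f"
proof -
  have "cov [\<lambda>a. sqrt s * c a, \<lambda>a. sqrt t * c a] a b = cov [\<lambda>a. sqrt (s + t) * c a] a b" for a b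
  proof -
    have e: "(sqrt u * v) * (sqrt u * w) = u * (v * w)" if "0 \<le> u" for u v w :: real
    proof -
      have "(sqrt u * v) * (sqrt u * w) = (sqrt u * sqrt u) * (v * w)" by (simp only: mult_ac)
      then show ?thesis using that by simp
    qed
    show ?thesis unfolding cov_def using assms(5,6)
      by (simp only: list.map sum_list.Cons sum_list.Nil e add_nonneg_nonneg) (simp add: distrib_right)
  qed
  from foldr_gauss_step_cong[OF A f m this] show ?thesis by simp
qed

text \<open>Cholesky factorization by induction on the index set: the row of the pivot
  \<open>a0\<close> becomes a direction \<open>c\<close>, and the induction hypothesis is applied to
  the Schur complement \<open>K a b - c a * c b\<close>.\<close>

lemma psd_factor:
  fixes K :: "'i \<Rightarrow> 'i \<Rightarrow> real"
  assumes "finite A" "\<And>a b. a \<in> A \<Longrightarrow> b \<in> A \<Longrightarrow> K a b = K b a"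
    and "\<And>x. 0 \<le> (\<Sum>a\<in>A. \<Sum>b\<in>A. x a * x b * K a b)"
  shows "\<exists>cs. \<forall>a\<in>A. \<forall>b\<in>A. cov cs a b = K a b"
  using assms
proof (induction A arbitrary: K rule: finite_induct)
  case (insert a0 A)
  note sym = insert.prems(1) and psd = insert.prems(2)
  have expand: "(\<Sum>a\<in>insert a0 A. \<Sum>b\<in>insert a0 A. x a * x b * K a b) =
      x a0 * x a0 * K a0 a0 + 2 * x a0 * (\<Sum>b\<in>A. x b * K a0 b) + (\<Sum>a\<in>A. \<Sum>b\<in>A. x a * x b * K a b)" for x
  proof -
    have "(\<Sum>a\<in>A. x a * x a0 * K a a0) = x a0 * (\<Sum>b\<in>A. x b * K a0 b)"
      using sym by (auto simp: sum_distrib_left mult_ac intro!: sum.cong)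
    moreover have "(\<Sum>b\<in>A. x a0 * x b * K a0 b) = x a0 * (\<Sum>b\<in>A. x b * K a0 b)"
      by (simp add: sum_distrib_left mult_ac)
    ultimately show ?thesis using insert(1,2) by (simp add: sum.distrib)
  qed
  have d0: "0 \<le> K a0 a0"
  proof -
    have "(\<Sum>b\<in>A. (if b = a0 then 1 else 0) * K a0 b) = 0" "(\<Sum>a\<in>A. \<Sum>b\<in>A. (if a = a0 then 1 else 0) * (if b = a0 then 1 else 0) * K a b) = 0"
      using insert(2) by (auto intro!: sum.neutral)
    then show ?thesis using psd[of "\<lambda>a. if a = a0 then 1 else 0"] unfolding expand by simp
  qed
  \<comment> \<open>A zero pivot forces a zero row: otherwise the form takes the value -1 at the
    vector with entry \<open>t\<close> at \<open>a0\<close> and 1 at \<open>b\<close>.\<close>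
  have z: "K a0 b = 0" if K0: "K a0 a0 = 0" and b: "b \<in> A" for b
  proof (rule ccontr)
    assume nz: "K a0 b \<noteq> 0"
    define t where "t = - (K b b + 1) / (2 * K a0 b)"
    let ?x = "\<lambda>a. if a = a0 then t else if a = b then 1 else 0"
    have "(\<Sum>b'\<in>A. ?x b' * K a0 b') = (\<Sum>b'\<in>A. if b' = b then K a0 b' else 0)"
      using insert(2) by (intro sum.cong) auto
    moreover have "(\<Sum>a\<in>A. \<Sum>b'\<in>A. ?x a * ?x b' * K a b') = (\<Sum>a\<in>A. \<Sum>b'\<in>A. if b' = b then (if a = b then K a b' else 0) else 0)"
      using insert(2) by (intro sum.cong) auto
    ultimately have "0 \<le> 2 * t * K a0 b + K b b"
      using psd[of ?x] b insert(1) unfolding expand by (simp add: K0)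
    moreover have "2 * t * K a0 b = - (K b b + 1)" using nz by (simp add: t_def)
    ultimately show False by linarith
  qed
  define c where "c b = (if b = a0 then sqrt (K a0 a0) else K a0 b / sqrt (K a0 a0))" for b
  have cc: "c a0 * c b = K a0 b" if "b \<in> insert a0 A" for b
    using d0 z that by (cases "K a0 a0 = 0") (auto simp: c_def)
  have ca: "c b * sqrt (K a0 a0) = K a0 b" if "b \<in> A" for b
    using cc[of b] that by (simp add: c_def mult.commute)
  have "\<exists>cs. \<forall>a\<in>A. \<forall>b\<in>A. cov cs a b = K a b - c a * c b"
  proof (rule insert.IH)
    show "K a b - c a * c b = K b a - c b * c a" if "a \<in> A" "b \<in> A" for a b using sym that by simp
    show "0 \<le> (\<Sum>a\<in>A. \<Sum>b\<in>A. x a * x b * (K a b - c a * c b))" for x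
    proof -
      define S where "S = (\<Sum>b\<in>A. x b * c b)"
      have S2: "(\<Sum>a\<in>A. \<Sum>b\<in>A. x a * x b * (c a * c b)) = S * S"
        unfolding S_def sum_product by (simp add: mult_ac)
      have eq: "(\<Sum>a\<in>A. \<Sum>b\<in>A. x a * x b * (K a b - c a * c b)) = (\<Sum>a\<in>A. \<Sum>b\<in>A. x a * x b * K a b) - S * S"
        unfolding S2[symmetric] by (simp add: right_diff_distrib sum_subtractf)
      show ?thesis
      proof (cases "K a0 a0 = 0")
        case True
        then have "S = 0" unfolding S_def using z insert(2) by (auto intro!: sum.neutral simp: c_def)
        have "(\<Sum>b\<in>A. x b * K a0 b) = 0" using z True by (auto intro!: sum.neutral)
        with psd[of x] True \<open>S = 0\<close> show ?thesis unfolding eq expand by simp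
      next
        case False
        then have k: "0 < sqrt (K a0 a0)" using d0 by simp
        \<comment> \<open>The entry at \<open>a0\<close> minimizes the quadratic form for given
          entries on \<open>A\<close>; the minimum is the form of the Schur complement.\<close>
        define y where "y = (\<lambda>a. if a = a0 then - S / sqrt (K a0 a0) else x a)"
        have y: "y a = x a" if "a \<in> A" for a using that insert(2) by (auto simp: y_def)
        have 1: "(\<Sum>b\<in>A. y b * K a0 b) = sqrt (K a0 a0) * S"
          unfolding S_def sum_distrib_left using y ca by (auto intro!: sum.cong simp: mult_ac)
        have 2: "(\<Sum>a\<in>A. \<Sum>b\<in>A. y a * y b * K a b) = (\<Sum>a\<in>A. \<Sum>b\<in>A. x a * x b * K a b)"
          using y by (auto intro!: sum.cong)
        have "y a0 * y a0 * K a0 a0 = S * S" "y a0 * (sqrt (K a0 a0) * S) = - (S * S)"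
          using k d0 by (auto simp: y_def field_simps)
        then show ?thesis using psd[of y] unfolding expand 1 2 eq by (simp add: mult.assoc)
      qed
    qed
  qed
  then obtain cs where cs: "\<And>a b. a \<in> A \<Longrightarrow> b \<in> A \<Longrightarrow> cov cs a b = K a b - c a * c b" by blast
  \<comment> \<open>The induction hypothesis says nothing about the values of its directions at
    \<open>a0\<close>. Setting them to 0 there leaves the pivot row to \<open>c\<close>
    alone.\<close>
  define cs' where "cs' = c # map (\<lambda>d. d(a0 := 0)) cs"
  have m: "cov (map (\<lambda>d. d(a0 := 0)) cs) a b = (if a = a0 \<or> b = a0 then 0 else cov cs a b)" for a b
    by (induction cs) (auto simp: cov_def)
  have "cov cs' a b = K a b" if "a \<in> insert a0 A" "b \<in> insert a0 A" for a b
  proof -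
    have "cov cs' a b = c a * c b + (if a = a0 \<or> b = a0 then 0 else cov cs a b)"
      unfolding cs'_def using m[of a b] by (simp add: cov_def)
    then show ?thesis using that cc[of a] cc[of b] cs[of a b] sym[of a b] by (auto simp: mult.commute)
  qed
  then show ?case by blast
qed simp

subsection \<open>Gaussian interpolation\<close>

text \<open>The head of the list is the outermost step. A block with parameter 0 at the front is
  therefore the expectation over the disorder, taken outside the logarithm.\<close>

primrec cascade :: "(('i \<Rightarrow> real) \<Rightarrow> real) \<Rightarrow> (real \<times> ('i \<Rightarrow> real)) list \<Rightarrow> ('i \<Rightarrow> real) \<Rightarrow> real" where
  "cascade F [] = F"
| "cascade F (s # L) = gauss_step (fst s) (snd s) (cascade F L)"

primrec grad :: "'i set \<Rightarrow> (real \<times> ('i \<Rightarrow> real)) list \<Rightarrow> 'i \<Rightarrow> ('i \<Rightarrow> real) \<Rightarrow> real" where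
  "grad A [] = gibbs A"
| "grad A (s # L) = (\<lambda>a. tilted_avg (fst s) (snd s) (cascade (log_sum_exp A) L) (grad A L a))"

primrec hess :: "'i set \<Rightarrow> (real \<times> ('i \<Rightarrow> real)) list \<Rightarrow> 'i \<Rightarrow> 'i \<Rightarrow> ('i \<Rightarrow> real) \<Rightarrow> real" where
  "hess A [] = gibbs_cov A"
| "hess A (s # L) = hess_step (fst s) (snd s) (cascade (log_sum_exp A) L) (grad A L) (hess A L)"

text \<open>In a step \<open>(m, c, d)\<close> the direction \<open>d\<close> is an infinitesimal addition to the Gaussian noise
  along \<open>c\<close>.\<close>

abbreviation steps :: "(real \<times> ('i \<Rightarrow> real) \<times> ('i \<Rightarrow> real)) list \<Rightarrow> (real \<times> ('i \<Rightarrow> real)) list" where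
  "steps \<equiv> map (\<lambda>(m, c, d). (m, c))"

text \<open>The coefficient of e^2 in \<open>perturbed_cascade e\<close>, by
  \<open>quad_perturb_cascade\<close>: each inserted noise adds a \<open>quad\<close> term, and the
  steps further out only average it.\<close>

primrec velocity :: "'i set \<Rightarrow> (real \<times> ('i \<Rightarrow> real) \<times> ('i \<Rightarrow> real)) list \<Rightarrow> ('i \<Rightarrow> real) \<Rightarrow> real" where
  "velocity A [] = (\<lambda>_. 0)"
| "velocity A (s # L) = tilted_avg (fst s) (fst (snd s)) (cascade (log_sum_exp A) (steps L))
     (\<lambda>x. velocity A L x + quad A (\<lambda>a b. snd (snd s) a * snd (snd s) b) (fst s) (grad A (steps L)) (hess A (steps L)) x)"

primrec perturbed_cascade :: "real \<Rightarrow> (('i \<Rightarrow> real) \<Rightarrow> real) \<Rightarrow> (real \<times> ('i \<Rightarrow> real) \<times> ('i \<Rightarrow> real)) list \<Rightarrow> ('i \<Rightarrow> real) \<Rightarrow> real" where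
  "perturbed_cascade e F [] = F"
| "perturbed_cascade e F (s # L) = gauss_step (fst s) (fst (snd s)) (gauss_step (fst s) (\<lambda>a. e * snd (snd s) a) (perturbed_cascade e F L))"

lemma lip_cascade:
  "lip A L F \<Longrightarrow> (\<And>s. s \<in> set I \<Longrightarrow> 0 \<le> fst s \<and> fst s \<le> 1) \<Longrightarrow> lip A L (cascade F I)"
  by (induction I) (auto intro!: lip_gauss_step)

lemma cascade_append: "cascade F (I @ J) = cascade (cascade F J) I"
  by (induction I) auto

lemma cascade_map_eq_foldr: "cascade F (map (Pair m) cs) = foldr (gauss_step m) cs F"
  by (induction cs) auto

text \<open>For given \<open>A\<close> the constant depends only on the number of steps. Parameters
  and directions are free, so it is the same at all times of the interpolation.\<close>

lemma taylor_reg_cascade: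
  assumes A: "finite A" "A \<noteq> {}"
  shows "\<exists>C. \<forall>L. length L = n \<longrightarrow> (\<forall>s\<in>set L. 0 \<le> fst s \<and> fst s \<le> 1) \<longrightarrow> taylor_reg A C (cascade (log_sum_exp A) L) (grad A L) (hess A L)"
proof (induction n)
  case 0
  then show ?case using taylor_reg_log_sum_exp[OF A] by auto
next
  case (Suc n)
  then obtain C where C: "\<And>L. length L = n \<Longrightarrow> (\<forall>s\<in>set L. 0 \<le> fst s \<and> fst s \<le> 1) \<Longrightarrow> taylor_reg A C (cascade (log_sum_exp A) L) (grad A L) (hess A L)" by blast
  obtain C' where C': "\<And>m c f p h. taylor_reg A C f p h \<Longrightarrow> 0 \<le> m \<Longrightarrow> m \<le> 1 \<Longrightarrow>
    taylor_reg A C' (gauss_step m c f) (\<lambda>a. tilted_avg m c f (p a)) (hess_step m c f p h)" using taylor_reg_step by blast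
  show ?case
  proof (intro exI[of _ C'] allI impI)
    fix L :: "(real \<times> ('a \<Rightarrow> real)) list" assume L: "length L = Suc n" "\<forall>s\<in>set L. 0 \<le> fst s \<and> fst s \<le> 1"
    then obtain s L' where [simp]: "L = s # L'" by (cases L) auto
    show "taylor_reg A C' (cascade (log_sum_exp A) L) (grad A L) (hess A L)"
      using C'[OF C[of L'], of "fst s" "snd s"] L by simp
  qed
qed

lemma taylor_reg_casE:
  assumes "finite A" "A \<noteq> {}" "\<And>s. s \<in> set L \<Longrightarrow> 0 \<le> fst s \<and> fst s \<le> 1"
  obtains C where "taylor_reg A C (cascade (log_sum_exp A) L) (grad A L) (hess A L)"
  using taylor_reg_cascade[OF assms(1,2), of "length L"] assms(3) by blast

lemma taylor_reg_mono:
  assumes r: "taylor_reg A C f p h" and C: "C \<le> C'" shows "taylor_reg A C' f p h"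
proof -
  note R = taylor_regD[OF r]
  have "C * l1_norm A y ^ 3 \<le> C' * l1_norm A y ^ 3" for y by (intro mult_right_mono C) simp
  from order_trans[OF R(6) this] show ?thesis
    unfolding taylor_reg_def using R bounded_lip_mono[OF R(2) C] bounded_lip_mono[OF R(5) C] by blast
qed

lemma quad_perturb_cascade:
  assumes A: "finite A" "A \<noteq> {}"
  shows "\<exists>C. \<forall>L. length L = n \<longrightarrow> (\<forall>s\<in>set L. 0 \<le> fst s \<and> fst s \<le> 1 \<and> l1_norm A (snd (snd s)) \<le> B) \<longrightarrow>
    quad_perturb A C (cascade (log_sum_exp A) (steps L)) (velocity A L) (\<lambda>e. perturbed_cascade e (log_sum_exp A) L)"
proof (induction n)
  case 0
  have "quad_perturb A 0 (log_sum_exp A) (\<lambda>_. 0) (\<lambda>e. log_sum_exp A)"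
    unfolding quad_perturb_def using lip_log_sum_exp[OF A] by (auto intro: bounded_lip_const)
  then show ?case by auto
next
  case (Suc n)
  then obtain C where C: "\<And>L. length L = n \<Longrightarrow> (\<forall>s\<in>set L. 0 \<le> fst s \<and> fst s \<le> 1 \<and> l1_norm A (snd (snd s)) \<le> B) \<Longrightarrow>
      quad_perturb A C (cascade (log_sum_exp A) (steps L)) (velocity A L) (\<lambda>e. perturbed_cascade e (log_sum_exp A) L)" by blast
  obtain C1 where C1: "\<And>L. length L = n \<Longrightarrow> (\<forall>s\<in>set L. 0 \<le> fst s \<and> fst s \<le> 1) \<Longrightarrow> taylor_reg A C1 (cascade (log_sum_exp A) L) (grad A L) (hess A L)"
    using taylor_reg_cascade[OF A] by blast
  define C2 where "C2 = max C C1"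
  obtain C3 where C3: "\<And>m d f p h v fe. taylor_reg A C2 f p h \<Longrightarrow> quad_perturb A C2 f v fe \<Longrightarrow> 0 \<le> m \<Longrightarrow> m \<le> 1 \<Longrightarrow> l1_norm A d \<le> B \<Longrightarrow>
    quad_perturb A C3 f (\<lambda>x. v x + quad A (\<lambda>a b. d a * d b) m p h x) (\<lambda>e. gauss_step m (\<lambda>a. e * d a) (fe e))"
    using quad_perturb_insert by blast
  obtain C4 where C4: "\<And>m c f v fe. lip A 1 f \<Longrightarrow> quad_perturb A C3 f v fe \<Longrightarrow> 0 \<le> m \<Longrightarrow> m \<le> 1 \<Longrightarrow>
    quad_perturb A C4 (gauss_step m c f) (tilted_avg m c f v) (\<lambda>e. gauss_step m c (fe e))"
    using quad_perturb_base by blast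
  have regm: "taylor_reg A C2 f p h" if "taylor_reg A C1 f p h" for f p h
    by (rule taylor_reg_mono[OF that]) (simp add: C2_def)
  have pertm: "quad_perturb A C2 f v fe" if "quad_perturb A C f v fe" for f v fe
  proof -
    have "C * e ^ 3 \<le> C2 * e ^ 3" if "0 \<le> e" for e :: real using that by (intro mult_right_mono) (auto simp: C2_def)
    then show ?thesis using that unfolding quad_perturb_def
      by (auto intro: bounded_lip_mono order_trans simp: C2_def)
  qed
  show ?case
  proof (intro exI[of _ C4] allI impI)
    fix L :: "(real \<times> ('a \<Rightarrow> real) \<times> ('a \<Rightarrow> real)) list"
    assume L: "length L = Suc n" "\<forall>s\<in>set L. 0 \<le> fst s \<and> fst s \<le> 1 \<and> l1_norm A (snd (snd s)) \<le> B"
    then obtain s L' where [simp]: "L = s # L'" by (cases L) auto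
    have s: "0 \<le> fst s" "fst s \<le> 1" "l1_norm A (snd (snd s)) \<le> B" and L': "length L' = n"
      "\<forall>s\<in>set L'. 0 \<le> fst s \<and> fst s \<le> 1 \<and> l1_norm A (snd (snd s)) \<le> B" using L by auto
    have r: "taylor_reg A C2 (cascade (log_sum_exp A) (steps L')) (grad A (steps L')) (hess A (steps L'))"
      using L' by (intro regm C1) auto
    have "quad_perturb A C4 (gauss_step (fst s) (fst (snd s)) (cascade (log_sum_exp A) (steps L'))) (velocity A L)
       (\<lambda>e. gauss_step (fst s) (fst (snd s)) (gauss_step (fst s) (\<lambda>a. e * snd (snd s) a) (perturbed_cascade e (log_sum_exp A) L')))"
      unfolding \<open>L = s # L'\<close> velocity.simps
      by (rule C4[OF taylor_regD(1)[OF r] C3[OF r pertm[OF C[OF L']] s] s(1,2)])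
    then show "quad_perturb A C4 (cascade (log_sum_exp A) (steps L)) (velocity A L) (\<lambda>e. perturbed_cascade e (log_sum_exp A) L)"
      by (simp add: case_prod_beta)
  qed
qed

definition weights :: "'i set \<Rightarrow> ('i \<Rightarrow> real) \<Rightarrow> bool" where
  "weights A p \<longleftrightarrow> (\<forall>a\<in>A. 0 \<le> p a) \<and> (\<Sum>a\<in>A. p a) = 1"

text \<open>The mean of \<open>D\<close> over two independent replicas drawn from
  \<open>p\<close>.\<close>

definition bilin :: "'i set \<Rightarrow> ('i \<Rightarrow> 'i \<Rightarrow> real) \<Rightarrow> ('i \<Rightarrow> real) \<Rightarrow> real" where
  "bilin A D p = (\<Sum>a\<in>A. \<Sum>b\<in>A. D a b * (p a * p b))"

text \<open>A step \<open>(m, g, c)\<close> has noise \<open>\<surd>t c\<close> or \<open>\<surd>(1 - t) c\<close> at time \<open>t\<close>, according as \<open>g\<close> holds or not;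
  \<open>D\<close> is the derivative in \<open>t\<close> of the covariance accumulated in the preceding steps.\<close>

primrec drift_le :: "'i set \<Rightarrow> (real \<times> bool \<times> ('i \<Rightarrow> real)) list \<Rightarrow> ('i \<Rightarrow> 'i \<Rightarrow> real) \<Rightarrow> real \<Rightarrow> real \<Rightarrow> bool" where
  "drift_le A [] D m' \<gamma> = (\<forall>p. weights A p \<longrightarrow> 1 / 2 * ((\<Sum>a\<in>A. p a * D a a) - (1 - m') * bilin A D p) \<le> \<gamma>)"
| "drift_le A (s # L) D m' \<gamma> = (\<exists>\<gamma>'. drift_le A L (\<lambda>a b. D a b + (if fst (snd s) then 1 else - 1) * (snd (snd s) a * snd (snd s) b)) (fst s) \<gamma>' \<and>
     (\<forall>p. weights A p \<longrightarrow> \<gamma>' - 1 / 2 * (fst s - m') * bilin A D p \<le> \<gamma>))"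

definition at_time :: "real \<Rightarrow> (real \<times> bool \<times> ('i \<Rightarrow> real)) list \<Rightarrow> (real \<times> ('i \<Rightarrow> real)) list" where
  "at_time t = map (\<lambda>s. (fst s, \<lambda>a. (if fst (snd s) then sqrt t else sqrt (1 - t)) * snd (snd s) a))"

text \<open>The base noise, with variances t and 1 - u, is common to the times t and u. Adding
  variance u - t to the steps with flag \<open>True\<close> leads to time u, adding it to those with
  flag \<open>False\<close> leads to time t. Both times are thus perturbations of one cascade, of
  the same size \<open>sqrt (u - t)\<close>, and can be compared through their velocities.\<close>

definition from_to :: "real \<Rightarrow> real \<Rightarrow> bool \<Rightarrow> (real \<times> bool \<times> ('i \<Rightarrow> real)) list \<Rightarrow> (real \<times> ('i \<Rightarrow> real) \<times> ('i \<Rightarrow> real)) list" where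
  "from_to t u g = map (\<lambda>s. (fst s, \<lambda>a. (if fst (snd s) then sqrt t else sqrt (1 - u)) * snd (snd s) a,
      if fst (snd s) = g then snd (snd s) else (\<lambda>_. 0)))"

lemma steps_from_to: "steps (from_to t u g I) = steps (from_to t u g' I)"
  by (simp add: from_to_def)

lemma quad_add: "quad A (\<lambda>a b. D a b + k * E a b) m p h x = quad A D m p h x + k * quad A E m p h x"
proof -
  have e: "(\<Sum>a\<in>A. \<Sum>b\<in>A. (D a b + k * E a b) * H a b) = (\<Sum>a\<in>A. \<Sum>b\<in>A. D a b * H a b) + k * (\<Sum>a\<in>A. \<Sum>b\<in>A. E a b * H a b)" for H
    by (simp add: distrib_right sum.distrib sum_distrib_left mult.assoc)
  have "1 / 2 * (u + k * v) = 1 / 2 * u + k * (1 / 2 * v)" for u v :: real by (simp add: algebra_simps)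
  then show ?thesis unfolding quad_def e .
qed

text \<open>This takes the place of Gaussian integration by parts. The covariance derivative
  \<open>D\<close> collected from the outer steps is carried inwards as a \<open>quad\<close> term.
  Crossing a step with parameter m, it becomes the average of \<open>quad\<close> with m in place of
  m', at the cost of (m - m') / 2 times \<open>bilin\<close>, the contribution of two replicas that
  separate at this step. At the bottom the Gibbs covariance leaves the diagonal of \<open>D\<close>
  and one last replica term.\<close>

lemma velocity_diff_le:
  assumes A: "finite A" "A \<noteq> {}"
    and I: "\<And>s. s \<in> set I \<Longrightarrow> 0 \<le> fst s \<and> fst s \<le> 1" and "0 \<le> m'" "m' \<le> 1" and "drift_le A I D m' \<gamma>"
  shows "velocity A (from_to t u True I) x - velocity A (from_to t u False I) x
     + quad A D m' (grad A (steps (from_to t u True I))) (hess A (steps (from_to t u True I))) x \<le> \<gamma>"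
  using assms(3-)
proof (induction I arbitrary: D m' \<gamma> x)
  case Nil
  have "weights A (\<lambda>a. gibbs A a x)"
    using sum_gibbs[OF A] gibbs_pos[OF A] by (auto simp: weights_def less_imp_le)
  then have "1 / 2 * ((\<Sum>a\<in>A. gibbs A a x * D a a) - (1 - m') * bilin A D (\<lambda>a. gibbs A a x)) \<le> \<gamma>"
    using Nil by simp
  moreover have "quad A D m' (gibbs A) (gibbs_cov A) x = 1 / 2 * ((\<Sum>a\<in>A. gibbs A a x * D a a) - (1 - m') * bilin A D (\<lambda>a. gibbs A a x))"
  proof -
    have "(\<Sum>a\<in>A. gibbs A a x * D a a) = (\<Sum>a\<in>A. \<Sum>b\<in>A. D a b * (if a = b then gibbs A a x else 0))"
      using A by (simp add: if_distrib mult.commute cong: if_cong)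
    then show ?thesis
      unfolding quad_def bilin_def gibbs_cov_def
      by (simp add: sum_distrib_left sum_subtractf[symmetric] sum.distrib[symmetric] algebra_simps)
  qed
  ultimately show ?case by (simp add: from_to_def)
next
  case (Cons s I)
  define Lp where "Lp = from_to t u True I"
  define Lm where "Lm = from_to t u False I"
  define S where "S = steps Lp"
  have Sm: "steps Lm = S" unfolding S_def Lp_def Lm_def by (rule steps_from_to)
  define c where "c = snd (snd s)"
  define m where "m = fst s"
  define k where "k = (if fst (snd s) then sqrt t else sqrt (1 - u))"
  define eps :: real where "eps = (if fst (snd s) then 1 else - 1)"
  define cc where "cc a b = c a * c b" for a b
  have m: "0 \<le> m" "m \<le> 1" using Cons.prems by (auto simp: m_def)
  have I: "\<And>s. s \<in> set I \<Longrightarrow> 0 \<le> fst s \<and> fst s \<le> 1" using Cons.prems by auto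
  have setS: "0 \<le> fst r \<and> fst r \<le> 1" if "r \<in> set S" for r
    using that I unfolding S_def Lp_def from_to_def by auto
  obtain C where r: "taylor_reg A C (cascade (log_sum_exp A) S) (grad A S) (hess A S)" using taylor_reg_casE[OF A setS] by metis
  let ?f = "cascade (log_sum_exp A) S" and ?p = "grad A S" and ?h = "hess A S"
  note R = taylor_regD[OF r]
  \<comment> \<open>A common bound on the inserted directions, with which
    \<open>quad_perturb_cascade\<close> shows both velocities to be bounded and Lipschitz, so that
    their tilted averages can be split.\<close>
  define B where "B = (\<Sum>q\<in>set (Lp @ Lm). l1_norm A (snd (snd q)))"
  have PL: "\<forall>q\<in>set L. 0 \<le> fst q \<and> fst q \<le> 1 \<and> l1_norm A (snd (snd q)) \<le> B" if "L = Lp \<or> L = Lm" for L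
  proof
    fix q assume q: "q \<in> set L"
    have "l1_norm A (snd (snd q)) \<le> B" unfolding B_def using q that by (intro member_le_sum) auto
    moreover have "0 \<le> fst q \<and> fst q \<le> 1" using q that I unfolding Lp_def Lm_def from_to_def by auto
    ultimately show "0 \<le> fst q \<and> fst q \<le> 1 \<and> l1_norm A (snd (snd q)) \<le> B" by auto
  qed
  have bvp: "\<exists>C. bounded_lip A C (velocity A Lp)" "\<exists>C. bounded_lip A C (velocity A Lm)"
    using quad_perturb_cascade[OF A, of "length Lp" B] quad_perturb_cascade[OF A, of "length Lm" B] PL quad_perturbD(1) by blast+
  then obtain Cp Cm where bv: "bounded_lip A Cp (velocity A Lp)" "bounded_lip A Cm (velocity A Lm)" by blast
  let ?K = "\<lambda>D. 1 / 2 * (\<Sum>a\<in>A. \<Sum>b\<in>A. \<bar>D a b\<bar> * (C + 2 * C * C))"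
  have bq: "bounded_lip A (?K D') (quad A D' m ?p ?h)" for D' by (rule bounded_lip_quad[OF r m])
  obtain \<gamma>' where g': "drift_le A I (\<lambda>a b. D a b + eps * cc a b) m \<gamma>'"
    and g: "\<And>p. weights A p \<Longrightarrow> \<gamma>' - 1 / 2 * (m - m') * bilin A D p \<le> \<gamma>"
    using Cons.prems(4) unfolding eps_def cc_def c_def m_def by auto
  let ?a = "tilted_avg m (\<lambda>a. k * c a) ?f"
  have quad0: "quad A (\<lambda>a b. 0) m ?p ?h x = 0" for x by (simp add: quad_def)
  have ft: "from_to t u g (s # I) = (m, \<lambda>a. k * c a, if fst (snd s) = g then c else (\<lambda>_. 0)) # from_to t u g I" for g
    by (simp add: from_to_def m_def k_def c_def)
  have vp: "velocity A (from_to t u True (s # I)) x = ?a (velocity A Lp) x + (if fst (snd s) then ?a (quad A cc m ?p ?h) x else 0)" for x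
    unfolding ft velocity.simps fst_conv snd_conv Lp_def[symmetric] S_def[symmetric]
    using tilted_avg_add[OF R(1) m bv(1) bq, of "\<lambda>a. k * c a" cc x]
    by (cases "fst (snd s)") (simp_all add: cc_def[abs_def] quad0)
  have vm: "velocity A (from_to t u False (s # I)) x = ?a (velocity A Lm) x + (if fst (snd s) then 0 else ?a (quad A cc m ?p ?h) x)" for x
    unfolding ft velocity.simps fst_conv snd_conv Lm_def[symmetric] Sm
    using tilted_avg_add[OF R(1) m bv(2) bq, of "\<lambda>a. k * c a" cc x]
    by (cases "fst (snd s)") (simp_all add: cc_def[abs_def] quad0)
  have bneg: "bounded_lip A (1 * Cm) (\<lambda>x. (-1) * velocity A Lm x)" using bounded_lip_cmult[OF bv(2), of "-1"] by simp
  have beps: "bounded_lip A (\<bar>eps\<bar> * ?K cc) (\<lambda>x. eps * quad A cc m ?p ?h x)" by (rule bounded_lip_cmult[OF bq])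
  have vd: "velocity A (from_to t u True (s # I)) x - velocity A (from_to t u False (s # I)) x
     = ?a (\<lambda>x. (velocity A Lp x + (-1) * velocity A Lm x) + eps * quad A cc m ?p ?h x) x" for x
    unfolding vp vm tilted_avg_add[OF R(1) m bounded_lip_add[OF bv(1) bneg] beps] tilted_avg_add[OF R(1) m bv(1) bneg] tilted_avg_cmult[OF R(1) m]
    by (simp add: eps_def)
  have st: "steps (from_to t u True (s # I)) = (m, \<lambda>a. k * c a) # S"
    by (simp add: ft S_def Lp_def)
  have pp: "weights A (\<lambda>a. ?a (?p a) x)" for x
  proof -
    obtain C' where "taylor_reg A C' (gauss_step m (\<lambda>a. k * c a) ?f) (\<lambda>a. ?a (?p a)) (hess_step m (\<lambda>a. k * c a) ?f ?p ?h)"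
      using taylor_reg_step[of A C] r m by metis
    from taylor_regD(3,4)[OF this] show ?thesis by (auto simp: weights_def)
  qed
  \<comment> \<open>In \<open>hess_step\<close> the product of averages carries - m, while
    \<open>quad\<close> adds it with m'. The difference is the replica term.\<close>
  have qd: "quad A D m' (grad A ((m, \<lambda>a. k * c a) # S)) (hess A ((m, \<lambda>a. k * c a) # S)) x
     = ?a (quad A D m ?p ?h) x - 1 / 2 * (m - m') * bilin A D (\<lambda>a. ?a (?p a) x)" for x
  proof -
    have b: "bounded_lip A (\<bar>D a b\<bar> * (C + 2 * C * C)) (\<lambda>x. D a b * (?h a b x + m * ?p a x * ?p b x))" if "a \<in> A" "b \<in> A" for a b
      by (rule bounded_lip_cmult[OF bounded_lip_hess[OF r m that]])
    have "?a (quad A D m ?p ?h) x = 1 / 2 * (\<Sum>a\<in>A. \<Sum>b\<in>A. D a b * ?a (\<lambda>x. ?h a b x + m * ?p a x * ?p b x) x)"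
      unfolding quad_def[abs_def] tilted_avg_cmult[OF R(1) m]
      apply (subst tilted_avg_sum[OF R(1) m bounded_lip_sum[OF b]], assumption, assumption)
      apply (rule arg_cong[where f="\<lambda>y. 1 / 2 * y"])
      apply (rule sum.cong[OF refl])
      apply (subst tilted_avg_sum[OF R(1) m b], assumption, assumption)
      apply (simp only: tilted_avg_cmult[OF R(1) m])
      done
    moreover have half: "1 / 2 * (u - v * w) = 1 / 2 * u - 1 / 2 * (v * w)" for u v w :: real
      by (rule right_diff_distrib)
    moreover have "D a b * (hess_step m (\<lambda>a. k * c a) ?f ?p ?h a b x + m' * ?a (?p a) x * ?a (?p b) x) =
        D a b * ?a (\<lambda>x. ?h a b x + m * ?p a x * ?p b x) x - (m - m') * (D a b * (?a (?p a) x * ?a (?p b) x))" for a b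
      unfolding hess_step_def by (simp only: algebra_simps)
    ultimately show ?thesis
      unfolding quad_def[of A D m'] bilin_def
      by (simp only: hess.simps grad.simps fst_conv snd_conv sum_subtractf sum_distrib_left[symmetric] half mult.assoc)
  qed
  have E1: "velocity A (from_to t u True (s # I)) x - velocity A (from_to t u False (s # I)) x
     + quad A D m' (grad A (steps (from_to t u True (s # I)))) (hess A (steps (from_to t u True (s # I)))) x
    = ?a (\<lambda>x. ((velocity A Lp x + (-1) * velocity A Lm x) + eps * quad A cc m ?p ?h x) + quad A D m ?p ?h x) x
      - 1 / 2 * (m - m') * bilin A D (\<lambda>a. ?a (?p a) x)"
    unfolding vd st qd tilted_avg_add[OF R(1) m bounded_lip_add[OF bounded_lip_add[OF bv(1) bneg] beps] bq] by simp
  have E2: "?a (\<lambda>x. ((velocity A Lp x + (-1) * velocity A Lm x) + eps * quad A cc m ?p ?h x) + quad A D m ?p ?h x) x \<le> ?a (\<lambda>_. \<gamma>') x"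
  proof (rule tilted_avg_mono[OF R(1) m bounded_lip_add[OF bounded_lip_add[OF bounded_lip_add[OF bv(1) bneg] beps] bq] bounded_lip_const[OF order_refl]])
    fix x
    show "((velocity A Lp x + (-1) * velocity A Lm x) + eps * quad A cc m ?p ?h x) + quad A D m ?p ?h x \<le> \<gamma>'"
      using Cons.IH[OF I m g', of x] unfolding quad_add Lp_def[symmetric] Lm_def[symmetric] S_def[symmetric] by simp
  qed
  show ?case unfolding E1 using E2 g[OF pp[of x]] unfolding tilted_avg_const[OF R(1) m] by linarith
qed

lemma perturbed_cascade_from_to:
  assumes A: "finite A" "A \<noteq> {}" and t: "0 \<le> t" "t \<le> u" "u \<le> 1"
    and I: "\<And>s. s \<in> set I \<Longrightarrow> 0 \<le> fst s \<and> fst s \<le> 1"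
  shows "perturbed_cascade (sqrt (u - t)) (log_sum_exp A) (from_to t u g I) = cascade (log_sum_exp A) (at_time (if g then u else t) I)"
  using I
proof (induction I)
  case Nil
  show ?case by (simp add: from_to_def at_time_def)
next
  case (Cons s I)
  have I: "\<And>s. s \<in> set I \<Longrightarrow> 0 \<le> fst s \<and> fst s \<le> 1" using Cons.prems by simp
  have l: "lip A 1 (cascade (log_sum_exp A) (at_time v I))" for v
    using I by (intro lip_cascade lip_log_sum_exp[OF A]) (auto simp: at_time_def)
  have m: "0 \<le> fst s" "fst s \<le> 1" using Cons.prems by auto
  have IH: "perturbed_cascade (sqrt (u - t)) (log_sum_exp A) (from_to t u g I) = cascade (log_sum_exp A) (at_time (if g then u else t) I)"
    by (rule Cons.IH[OF I])
  note sp = gauss_step_split[OF A(1) l m]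
  have e: "from_to t u g (s # I) = (fst s, \<lambda>a. (if fst (snd s) then sqrt t else sqrt (1 - u)) * snd (snd s) a,
      if fst (snd s) = g then snd (snd s) else (\<lambda>_. 0)) # from_to t u g I" by (simp add: from_to_def)
  have e': "at_time v (s # I) = (fst s, \<lambda>a. (if fst (snd s) then sqrt v else sqrt (1 - v)) * snd (snd s) a) # at_time v I" for v
    by (simp add: at_time_def)
  show ?case unfolding e e' perturbed_cascade.simps cascade.simps fst_conv snd_conv IH
    using t sp[of t "u - t" "snd (snd s)" u] sp[of "1 - u" "u - t" "snd (snd s)" t]
    by (cases "fst (snd s)"; cases g) auto
qed

theorem interpolation:
  assumes A: "finite A" "A \<noteq> {}"
    and I: "\<And>s. s \<in> set I \<Longrightarrow> 0 \<le> fst s \<and> fst s \<le> 1" and b: "drift_le A I (\<lambda>_ _. 0) 0 \<gamma>"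
  shows "cascade (log_sum_exp A) (at_time 1 I) x - cascade (log_sum_exp A) (at_time 0 I) x \<le> \<gamma>"
proof -
  define B where "B = (\<Sum>q\<in>set I. l1_norm A (snd (snd q)))"
  have B: "l1_norm A (snd (snd q)) \<le> B" if "q \<in> set I" for q
    unfolding B_def using that by (intro member_le_sum) auto
  have B0: "0 \<le> B" unfolding B_def by (intro sum_nonneg) auto
  obtain C where C: "\<And>L. length L = length I \<Longrightarrow> (\<forall>s\<in>set L. 0 \<le> fst s \<and> fst s \<le> 1 \<and> l1_norm A (snd (snd s)) \<le> B) \<Longrightarrow>
    quad_perturb A C (cascade (log_sum_exp A) (steps L)) (velocity A L) (\<lambda>e. perturbed_cascade e (log_sum_exp A) L)"
    using quad_perturb_cascade[OF A, of "length I" B] by blast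
  define \<Phi> where "\<Phi> t = cascade (log_sum_exp A) (at_time t I) x" for t
  have step: "\<Phi> u - \<Phi> t \<le> \<gamma> * (u - t) + 2 * C * sqrt (u - t) ^ 3" if t: "0 \<le> t" "t \<le> u" "u \<le> 1" for t u
  proof -
    define e where "e = sqrt (u - t)"
    have e: "0 \<le> e" "e \<le> 1" "e\<^sup>2 = u - t" using t by (auto simp: e_def)
    let ?L = "from_to t u"
    have p: "quad_perturb A C (cascade (log_sum_exp A) (steps (?L g I))) (velocity A (?L g I)) (\<lambda>e. perturbed_cascade e (log_sum_exp A) (?L g I))" for g
      by (rule C) (use I B B0 in \<open>auto simp: from_to_def\<close>)
    have 1: "\<bar>\<Phi> u - cascade (log_sum_exp A) (steps (?L True I)) x - e\<^sup>2 * velocity A (?L True I) x\<bar> \<le> C * e ^ 3"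
      using quad_perturbD(3)[OF p[of True] e(1,2), of x] perturbed_cascade_from_to[OF A t I, where g = True] unfolding e_def \<Phi>_def by simp
    have 2: "\<bar>\<Phi> t - cascade (log_sum_exp A) (steps (?L True I)) x - e\<^sup>2 * velocity A (?L False I) x\<bar> \<le> C * e ^ 3"
      using quad_perturbD(3)[OF p[of False] e(1,2), of x] perturbed_cascade_from_to[OF A t I, where g = False]
      unfolding e_def \<Phi>_def steps_from_to[of t u False I True] by simp
    have "velocity A (?L True I) x - velocity A (?L False I) x \<le> \<gamma>"
      using velocity_diff_le[OF A I _ _ b, of t u x] by (simp add: quad_def)
    then have "e\<^sup>2 * (velocity A (?L True I) x - velocity A (?L False I) x) \<le> e\<^sup>2 * \<gamma>" by (intro mult_left_mono) auto
    then have "\<Phi> u - \<Phi> t \<le> e\<^sup>2 * \<gamma> + 2 * (C * e ^ 3)"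
      using 1 2 unfolding right_diff_distrib by linarith
    then show ?thesis unfolding e(3) by (simp add: e_def mult_ac)
  qed
  have tele: "\<Phi> 1 - \<Phi> 0 \<le> \<gamma> + 2 * C * sqrt (1 / real (Suc n))" for n
  proof -
    let ?N = "real (Suc n)"
    let ?b = "\<gamma> * (1 / ?N) + 2 * C * sqrt (1 / ?N) ^ 3"
    have "\<Phi> 1 - \<Phi> 0 = (\<Sum>k<Suc n. \<Phi> (real (Suc k) / ?N) - \<Phi> (real k / ?N))"
      unfolding sum_lessThan_telescope[of "\<lambda>k. \<Phi> (real k / ?N)"] by simp
    also have "\<dots> \<le> (\<Sum>k<Suc n. ?b)"
    proof (rule sum_mono)
      fix k assume "k \<in> {..<Suc n}"
      then have k: "real k / ?N \<le> real (Suc k) / ?N" "real (Suc k) / ?N \<le> 1" "0 \<le> real k / ?N"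
        by (auto simp: divide_right_mono)
      have d: "real (Suc k) / ?N - real k / ?N = 1 / ?N" by (simp add: diff_divide_distrib[symmetric])
      show "\<Phi> (real (Suc k) / ?N) - \<Phi> (real k / ?N) \<le> ?b"
        using step[OF k(3,1,2)] unfolding d .
    qed
    also have "\<dots> = ?N * ?b" by simp
    also have "\<dots> = \<gamma> + 2 * C * sqrt (1 / ?N)"
    proof -
      have "sqrt (1 / ?N) ^ 3 = (1 / ?N) * sqrt (1 / ?N)"
        by (simp add: power3_eq_cube del: of_nat_Suc)
      then show ?thesis by (simp add: distrib_left del: of_nat_Suc)
    qed
    finally show ?thesis .
  qed
  have "(\<lambda>n. \<gamma> + 2 * C * sqrt (1 / real (Suc n))) \<longlonglongrightarrow> \<gamma> + 2 * C * sqrt 0"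
    by (intro tendsto_intros LIMSEQ_Suc[OF lim_1_over_n])
  then have "\<Phi> 1 - \<Phi> 0 \<le> \<gamma>"
    using tele by (intro LIMSEQ_le_const[where X="\<lambda>n. \<gamma> + 2 * C * sqrt (1 / real (Suc n))"]) auto
  then show ?thesis by (simp add: \<Phi>_def)
qed

subsection \<open>The Hopf-Cole recursion\<close>

lemma abs_sum_2: "l1_norm (UNIV :: 2 set) y = \<bar>y 1\<bar> + \<bar>y 2\<bar>"
  by (simp add: l1_norm_def sum_2)

text \<open>Guarantees that the choice in \<open>centered_gaussian\<close> picks an actual factor.
  The lower triangular factor is written down explicitly; a vanishing first pivot makes the
  off-diagonal entry vanish too.\<close>

lemma pos_semidef_factor:
  fixes C :: "real^2^2"
  assumes "pos_semidef C" shows "\<exists>A :: real^2^2. A ** transpose A = C"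
proof -
  have sym: "C $ 1 $ 2 = C $ 2 $ 1"
  proof -
    have "transpose C = C" using assms by (simp add: pos_semidef_def)
    then have "transpose C $ 1 $ 2 = C $ 1 $ 2" by (simp only:)
    then show ?thesis by (simp add: transpose_def)
  qed
  have q: "0 \<le> u * (C $ 1 $ 1 * u + C $ 1 $ 2 * v) + v * (C $ 1 $ 2 * u + C $ 2 $ 2 * v)" for u v
    using assms[unfolded pos_semidef_def, THEN conjunct2, rule_format, of "vector [u, v]"] sym
    by (simp add: inner_vec_def matrix_vector_mult_def sum_2)
  define a where "a = sqrt (C $ 1 $ 1)"
  define b where "b = C $ 1 $ 2 / a"
  define c where "c = sqrt (C $ 2 $ 2 - b\<^sup>2)"
  have a0: "0 \<le> C $ 1 $ 1" using q[of 1 0] by simp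
  have a2: "a * a = C $ 1 $ 1" using a0 by (simp add: a_def)
  have z: "C $ 1 $ 2 = 0" if "C $ 1 $ 1 = 0"
  proof (rule ccontr)
    assume nz: "C $ 1 $ 2 \<noteq> 0"
    define t where "t = - (C $ 2 $ 2 + 1) / (2 * C $ 1 $ 2)"
    have "2 * t * C $ 1 $ 2 = - (C $ 2 $ 2 + 1)" using nz by (simp add: t_def)
    then show False using q[of t 1] that by (simp add: algebra_simps)
  qed
  have ab: "a * b = C $ 1 $ 2" using z a2 by (cases "a = 0") (auto simp: b_def)
  have "0 \<le> C $ 2 $ 2 - b\<^sup>2"
  proof (cases "a = 0")
    case True
    then show ?thesis using q[of 0 1] by (simp add: b_def)
  next
    case False
    have "0 \<le> - b / a * (a * a * (- b / a) + a * b * 1) + 1 * (a * b * (- b / a) + C $ 2 $ 2 * 1)"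
      using q[of "- b / a" 1] unfolding a2[symmetric] ab[symmetric] .
    also have "\<dots> = C $ 2 $ 2 - b\<^sup>2" using False by (simp add: field_simps power2_eq_square)
    finally show ?thesis .
  qed
  then have c2: "b * b + c * c = C $ 2 $ 2" by (simp add: c_def power2_eq_square)
  let ?A = "vector [vector [a, 0], vector [b, c]] :: real^2^2"
  have "?A ** transpose ?A = C"
    using a2 ab c2 sym by (simp add: vec_eq_iff forall_2 matrix_matrix_mult_def transpose_def sum_2 mult.commute)
  then show ?thesis by blast
qed

definition factor :: "real^'n^'n \<Rightarrow> real^'n^'n" where
  "factor C = (SOME A. A ** transpose A = C)"

text \<open>The columns of the factor: the Gaussian vector with covariance \<open>C\<close> is the
  sum of these two, each multiplied by its own independent standard normal variable.\<close>

definition dirs :: "real^2^2 \<Rightarrow> (2 \<Rightarrow> real) list" where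
  "dirs C = [\<lambda>i. factor C $ i $ 1, \<lambda>i. factor C $ i $ 2]"

lemma cov_dirs:
  assumes "pos_semidef C" shows "cov (dirs C) i j = C $ i $ j"
proof -
  have "factor C ** transpose (factor C) = C"
    unfolding factor_def by (rule someI_ex[OF pos_semidef_factor[OF assms]])
  then have "(factor C ** transpose (factor C)) $ i $ j = C $ i $ j" by simp
  then show ?thesis by (simp add: cov_def dirs_def matrix_matrix_mult_def transpose_def sum_2)
qed

lemma vector2_measurable [measurable]:
  assumes [measurable]: "f \<in> borel_measurable M" "g \<in> borel_measurable M"
  shows "(\<lambda>x. vector [f x, g x] :: real^2) \<in> borel_measurable M"
proof -
  have "(\<lambda>x. vector [f x, g x] :: real^2) = (\<lambda>x. f x *\<^sub>R axis 1 1 + g x *\<^sub>R axis 2 1)"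
    by (simp add: fun_eq_iff vec_eq_iff forall_2 axis_def)
  then show ?thesis by simp
qed

text \<open>Needed to iterate integrals against \<open>std_gaussian\<close> one coordinate at a
  time. Both measures give boxes the product of their side lengths.\<close>

lemma lborel_vec2: "(lborel :: (real^2) measure) = distr (lborel \<Otimes>\<^sub>M lborel) borel (\<lambda>(x, y). vector [x, y])"
proof (rule lborel_eqI)
  interpret pair_sigma_finite "lborel :: real measure" "lborel :: real measure" ..
  have m: "(\<lambda>(x, y). vector [x, y] :: real^2) \<in> measurable (lborel \<Otimes>\<^sub>M lborel) borel"
    by measurable
  fix l u :: "real^2" assume le: "\<And>b. b \<in> Basis \<Longrightarrow> l \<bullet> b \<le> u \<bullet> b"
  have le': "l $ 1 \<le> u $ 1" "l $ 2 \<le> u $ 2"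
    using le[of "axis 1 1"] le[of "axis 2 1"] by (auto simp: inner_axis Basis_vec_def)
  have pre: "(\<lambda>(x, y). vector [x, y] :: real^2) -` box l u \<inter> space (lborel \<Otimes>\<^sub>M lborel)
      = {l $ 1 <..< u $ 1} \<times> {l $ 2 <..< u $ 2}"
    by (auto simp: mem_box_cart forall_2 space_pair_measure)
  have "emeasure (distr (lborel \<Otimes>\<^sub>M lborel) borel (\<lambda>(x, y). vector [x, y])) (box l u)
      = emeasure (lborel \<Otimes>\<^sub>M lborel) ({l $ 1 <..< u $ 1} \<times> {l $ 2 <..< u $ 2})"
    using m by (subst emeasure_distr) (auto simp: pre)
  also have "\<dots> = emeasure lborel {l $ 1 <..< u $ 1} * emeasure lborel {l $ 2 <..< u $ 2}"
    by (rule lborel.emeasure_pair_measure_Times) auto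
  also have "\<dots> = ennreal ((u $ 1 - l $ 1) * (u $ 2 - l $ 2))"
    using le' by (simp add: ennreal_mult)
  also have "(u $ 1 - l $ 1) * (u $ 2 - l $ 2) = (\<Prod>b\<in>Basis. (u - l) \<bullet> b)"
  proof -
    have B: "(Basis :: (real^2) set) = {axis 1 1, axis 2 1}"
      by (auto simp: Basis_vec_def) (metis exhaust_2)
    have ne: "axis 1 1 \<noteq> (axis 2 1 :: real^2)" by (simp add: axis_eq_axis)
    have "(\<Prod>b\<in>{axis 1 1, axis 2 1}. (u - l) \<bullet> b) = ((u - l) \<bullet> axis 1 1) * ((u - l) \<bullet> axis 2 1)"
      using ne by (subst prod.insert) auto
    then show ?thesis unfolding B by (simp add: inner_axis)
  qed
  finally show "emeasure (distr (lborel \<Otimes>\<^sub>M lborel) borel (\<lambda>(x, y). vector [x, y])) (box l u) = ennreal (\<Prod>b\<in>Basis. (u - l) \<bullet> b)" .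
qed simp

lemma std_gaussian_vec2:
  "(std_gaussian :: (real^2) measure) = distr (std_normal_distribution \<Otimes>\<^sub>M std_normal_distribution) borel (\<lambda>(x, y). vector [x, y])"
proof -
  have m: "(\<lambda>(x, y). vector [x, y] :: real^2) \<in> measurable (lborel \<Otimes>\<^sub>M lborel) borel"
    by measurable
  have "(std_gaussian :: (real^2) measure) = density (distr (lborel \<Otimes>\<^sub>M lborel) borel (\<lambda>(x, y). vector [x, y]))
      (\<lambda>z. ennreal (std_normal_density (z $ 1) * std_normal_density (z $ 2)))"
    unfolding std_gaussian_def lborel_vec2[symmetric] by (simp add: UNIV_2)
  also have "\<dots> = distr (density (lborel \<Otimes>\<^sub>M lborel) (\<lambda>p. ennreal (std_normal_density (fst p) * std_normal_density (snd p)))) borel (\<lambda>(x, y). vector [x, y])"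
    using m by (subst density_distr) (auto simp: case_prod_beta)
  also have "density (lborel \<Otimes>\<^sub>M lborel) (\<lambda>p. ennreal (std_normal_density (fst p) * std_normal_density (snd p)))
     = std_normal_distribution \<Otimes>\<^sub>M std_normal_distribution"
    by (subst pair_measure_density)
      (auto simp: case_prod_unfold ennreal_mult normal_density_nonneg lborel.sigma_finite_measure_axioms gauss.sigma_finite_measure_axioms)
  finally show ?thesis .
qed

text \<open>Bridges the vectors of the Hopf-Cole recursion and the coordinate functions on which
  \<open>gauss_step\<close> acts, here with the two-element type as index set.\<close>

definition coord_fun :: "(real^'n \<Rightarrow> real) \<Rightarrow> ('n \<Rightarrow> real) \<Rightarrow> real" where
  "coord_fun f v = f (\<chi> i. v i)"

lemma coord_fun_inject: "coord_fun f = coord_fun g \<longleftrightarrow> f = g"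
  unfolding coord_fun_def fun_eq_iff by (metis vec_lambda_eta)

lemma coord_fun_vec_nth: "f x = coord_fun f (\<lambda>i. x $ i)"
  by (simp add: coord_fun_def)

lemma lip_coord_fun_measurable:
  fixes f :: "real^2 \<Rightarrow> real"
  assumes f: "lip UNIV L (coord_fun f)" shows "f \<in> borel_measurable borel"
proof (rule borel_measurable_continuous_onI)
  have "(L * 2)-lipschitz_on UNIV f"
  proof (rule lipschitz_onI)
    fix x y :: "real^2"
    have "\<bar>f x - f y\<bar> \<le> L * l1_norm UNIV (\<lambda>i. x $ i - y $ i)"
      using lipD[OF f, of "\<lambda>i. x $ i" "\<lambda>i. y $ i"] by (simp add: coord_fun_def)
    also have "\<dots> \<le> L * (2 * norm (x - y))"
      using component_le_norm_cart[of "x - y" 1] component_le_norm_cart[of "x - y" 2] lip_nonneg[OF f]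
      by (intro mult_left_mono) (auto simp: abs_sum_2)
    finally show "dist (f x) (f y) \<le> L * 2 * dist x y" by (simp add: dist_norm mult.assoc)
  qed (use lip_nonneg[OF f] in simp)
  then show "continuous_on UNIV f" by (rule lipschitz_on_continuous_on)
qed

lemma hopf_cole_step_eq_log_mean:
  "hopf_cole_step m C f x = log_mean m (centered_gaussian C) (\<lambda>y. f (x + y))"
  by (simp add: hopf_cole_step_def log_mean_def)

lemma coord_fun_hopf_cole_step:
  assumes f: "lip UNIV L (coord_fun f)" and m: "0 \<le> m" "m \<le> 1"
  shows "coord_fun (hopf_cole_step m C f) = foldr (gauss_step m) (dirs C) (coord_fun f)"
proof
  fix v :: "2 \<Rightarrow> real"
  interpret pair_prob_space std_normal_distribution std_normal_distribution ..
  let ?A = "factor C"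
  let ?c1 = "\<lambda>i. ?A $ i $ 1" and ?c2 = "\<lambda>i. ?A $ i $ 2"
  let ?P = "std_normal_distribution \<Otimes>\<^sub>M std_normal_distribution"
  let ?g = "\<lambda>p. coord_fun f (\<lambda>i. v i + fst p * ?c1 i + snd p * ?c2 i)"
  note fm [measurable] = lip_coord_fun_measurable[OF f]
  have Am [measurable]: "(\<lambda>z. ?A *v z) \<in> borel_measurable borel"
    by (intro borel_measurable_continuous_onI linear_continuous_on linear_conv_bounded_linear[THEN iffD1]) simp
  have geq: "f ((\<chi> i. v i) + ?A *v vector [fst p, snd p]) = ?g p" for p
    unfolding coord_fun_def by (rule arg_cong[where f=f]) (simp add: vec_eq_iff matrix_vector_mult_def sum_2 mult.commute)
  have "coord_fun (hopf_cole_step m C f) v = log_mean m (distr (distr ?P borel (\<lambda>(x, y). vector [x, y])) borel (\<lambda>z. ?A *v z)) (\<lambda>y. f ((\<chi> i. v i) + y))"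
    unfolding coord_fun_def hopf_cole_step_eq_log_mean centered_gaussian_def std_gaussian_vec2 factor_def ..
  also have "\<dots> = log_mean m ?P (\<lambda>p. f ((\<chi> i. v i) + ?A *v (case p of (x, y) \<Rightarrow> vector [x, y])))"
    by (subst log_mean_distr, measurable) (subst log_mean_distr, measurable)
  also have "\<dots> = log_mean m ?P ?g"
    unfolding case_prod_beta geq ..
  also have "\<dots> = log_mean m std_normal_distribution (\<lambda>z. log_mean m std_normal_distribution (\<lambda>w. ?g (z, w)))"
  proof (rule log_mean_pair)
    have gm: "?g \<in> borel_measurable ?P" unfolding geq[symmetric] by measurable
    let ?Z = "\<lambda>p. (\<bar>coord_fun f v\<bar> + L * l1_norm UNIV ?c1 * \<bar>fst p\<bar>) + (0 + L * l1_norm UNIV ?c2 * \<bar>snd p\<bar>)"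
    have le: "\<bar>?g p\<bar> \<le> ?Z p" for p
      using lip_ray[OF f, of "\<lambda>i. v i + fst p * ?c1 i" "snd p" ?c2 0] lip_ray[OF f, of v "fst p" ?c1 0] by simp
    have iZ: "integrable ?P (\<lambda>p. exp (?Z p))"
      unfolding exp_add[of "_ + _" "0 + _"]
    proof (rule Fubini_integrable)
      show "AE x in std_normal_distribution. integrable std_normal_distribution
        (\<lambda>y. exp (\<bar>coord_fun f v\<bar> + L * l1_norm UNIV ?c1 * \<bar>fst (x, y)\<bar>) * exp (0 + L * l1_norm UNIV ?c2 * \<bar>snd (x, y)\<bar>))"
        using integrable_exp_affine[of 0 "L * l1_norm UNIV ?c2"] by simp
      show "integrable std_normal_distribution
        (\<lambda>x. \<integral>y. norm (exp (\<bar>coord_fun f v\<bar> + L * l1_norm UNIV ?c1 * \<bar>fst (x, y)\<bar>) * exp (0 + L * l1_norm UNIV ?c2 * \<bar>snd (x, y)\<bar>)) \<partial>std_normal_distribution)"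
        using integrable_exp_affine[of "\<bar>coord_fun f v\<bar>" "L * l1_norm UNIV ?c1"] by simp
    qed measurable
    show "integrable ?P ?g" "integrable ?P (\<lambda>p. exp (m * ?g p))"
      using integrable_dominated_exp[OF gm le iZ m] by auto
    show "integrable std_normal_distribution (\<lambda>w. exp (m * ?g (z, w)))" for z
      using lip_ray_integrable(2)[OF f m, of "\<lambda>i. v i + z * ?c1 i" ?c2] by simp
  qed
  also have "\<dots> = foldr (gauss_step m) (dirs C) (coord_fun f) v"
    by (simp add: dirs_def gauss_step_def)
  finally show "coord_fun (hopf_cole_step m C f) v = foldr (gauss_step m) (dirs C) (coord_fun f) v" .
qed

lemma lip_hopf_cole_step:
  "lip UNIV L (coord_fun f) \<Longrightarrow> 0 \<le> m \<Longrightarrow> m \<le> 1 \<Longrightarrow> lip UNIV L (coord_fun (hopf_cole_step m C f))"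
  by (simp add: coord_fun_hopf_cole_step lip_foldr_gauss_step)

lemma lip_hopf_cole:
  assumes "lip UNIV L (coord_fun f)" "\<And>u. 0 \<le> a u \<and> a u \<le> 1"
  shows "lip UNIV L (coord_fun (hopf_cole a T f bs s))"
  by (induction bs arbitrary: s) (use assms in \<open>auto intro!: lip_hopf_cole_step\<close>)

lemma hopf_cole_step_add:
  assumes f: "lip UNIV L (coord_fun f)" and m: "0 \<le> m" "m \<le> 1"
    and C: "pos_semidef C" "pos_semidef D" "pos_semidef (C + D)"
  shows "hopf_cole_step m C (hopf_cole_step m D f) = hopf_cole_step m (C + D) f"
proof -
  have "foldr (gauss_step m) (dirs C @ dirs D) (coord_fun f) = foldr (gauss_step m) (dirs (C + D)) (coord_fun f)"
  proof (rule foldr_gauss_step_cong[OF finite f m])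
    fix i j
    have "cov (dirs C @ dirs D) i j = cov (dirs C) i j + cov (dirs D) i j" by (simp add: cov_def)
    then show "cov (dirs C @ dirs D) i j = cov (dirs (C + D)) i j" by (simp add: cov_dirs C)
  qed
  then have "coord_fun (hopf_cole_step m C (hopf_cole_step m D f)) = coord_fun (hopf_cole_step m (C + D) f)"
    using coord_fun_hopf_cole_step[OF f m] coord_fun_hopf_cole_step[OF lip_hopf_cole_step[OF f m] m] by simp
  then show ?thesis by (simp add: coord_fun_inject)
qed

lemma exp_convex_le: "0 \<le> \<theta> \<Longrightarrow> \<theta> \<le> 1 \<Longrightarrow> exp (\<theta> * u) \<le> 1 + \<theta> * (exp u - 1)" for \<theta> u :: real
  using convex_onD[OF exp_convex, of \<theta> 0 u] by (simp add: algebra_simps)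

text \<open>The bound is quadratic in the noise, hence proportional to its variance and so to the
  length of the time interval; summed over intervals it becomes an integral of |m - m'|. With t = L
  |c| the deviation of g from its exponential mean y is at most t (|z| + K / B); squaring yields t^2
  and leaves the fixed integrable function \<open>H\<close>.\<close>

lemma gauss_step_parameter:
  assumes B: "0 < B"
  obtains \<kappa> where "0 \<le> \<kappa>" "\<And>A f m m' c x. lip A L f \<Longrightarrow> L * l1_norm A c \<le> B \<Longrightarrow> 0 \<le> m \<Longrightarrow> m \<le> 1 \<Longrightarrow> 0 \<le> m' \<Longrightarrow> m' \<le> 1 \<Longrightarrow>
    \<bar>gauss_step m c f x - gauss_step m' c f x\<bar> \<le> \<kappa> * \<bar>m - m'\<bar> * (L * l1_norm A c)\<^sup>2"
proof -
  define K where "K = (\<integral>z. exp (B * \<bar>z\<bar>) \<partial>std_normal_distribution)"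
  define H where "H z = (\<bar>z\<bar> + K / B)\<^sup>2 * exp (B * \<bar>z\<bar> + K)" for z
  define \<kappa> where "\<kappa> = (\<integral>z. H z \<partial>std_normal_distribution)"
  have iK: "integrable std_normal_distribution (\<lambda>z. exp (B * \<bar>z\<bar>))" by (rule integrable_gauss_exp_abs)
  have K1: "1 \<le> K"
  proof -
    have "(\<integral>z. 1 \<partial>std_normal_distribution) \<le> K"
      unfolding K_def by (intro integral_mono iK) (use B in auto)
    then show ?thesis using gauss.prob_space by simp
  qed
  have Hm: "H \<in> borel_measurable borel" unfolding H_def[abs_def] by measurable
  have iH: "integrable std_normal_distribution H"
  proof (rule gauss.integrable_exp_le[where k = 1 and B = "2" and Z = "\<lambda>z. (K / B + K) + (1 + B) * \<bar>z\<bar>"])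
    show "integrable std_normal_distribution (\<lambda>z. exp (1 * ((K / B + K) + (1 + B) * \<bar>z\<bar>)))"
      using integrable_exp_affine by simp
    show "\<bar>H z\<bar> \<le> 2 * exp (1 * (K / B + K + (1 + B) * \<bar>z\<bar>))" for z
    proof -
      have y: "0 \<le> \<bar>z\<bar> + K / B" using B K1 by simp
      have "(\<bar>z\<bar> + K / B)\<^sup>2 \<le> 2 * exp (\<bar>z\<bar> + K / B)"
        using exp_lower_Taylor_quadratic[OF y] y by linarith
      then have "H z \<le> 2 * exp (\<bar>z\<bar> + K / B) * exp (B * \<bar>z\<bar> + K)"
        unfolding H_def by (intro mult_right_mono) auto
      also have "\<dots> = 2 * exp (1 * (K / B + K + (1 + B) * \<bar>z\<bar>))"
        by (simp add: exp_add[symmetric] algebra_simps)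
      finally show ?thesis by (simp add: H_def)
    qed
  qed (simp add: Hm)
  have k0: "0 \<le> \<kappa>" unfolding \<kappa>_def H_def by simp
  have main: "\<bar>gauss_step m c f x - gauss_step m' c f x\<bar> \<le> \<kappa> * (m' - m) * (L * l1_norm A c)\<^sup>2"
    if f: "lip A L f" and c: "L * l1_norm A c \<le> B" and m: "0 \<le> m" "m \<le> m'" "m' \<le> 1" for A f m m' c x
  proof -
    define t where "t = L * l1_norm A c"
    have t: "0 \<le> t" "t \<le> B" using c lip_nonneg[OF f] by (auto simp: t_def)
    define g where "g z = f (\<lambda>a. x a + z * c a)" for z
    define y where "y = log_mean m std_normal_distribution g"
    have m1: "m \<le> 1" using m by simp
    have gb: "\<bar>g z - f x\<bar> \<le> t * \<bar>z\<bar>" for z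
      using lip_ray[OF f, of x z c 0] by (simp add: g_def t_def)
    have gb': "\<bar>g z\<bar> \<le> \<bar>f x\<bar> + t * \<bar>z\<bar>" for z using gb[of z] by linarith
    have gm [measurable]: "g \<in> borel_measurable std_normal_distribution"
      unfolding g_def using lip_ray_measurable[OF f, of x c] by simp
    note ig = lip_ray_integrable[OF f m(1) m1, of x c, folded g_def]
    have il: "integrable std_normal_distribution (\<lambda>z. exp (t * \<bar>z\<bar>))" by (rule integrable_gauss_exp_abs)
    \<comment> \<open>The trial value on the right is shown to lie above the root; raising the
      parameter to 1 makes the exponential integrals explicit.\<close>
    have hi: "y \<le> f x + t * (K / B)"
    proof -
      have "(\<integral>z. scaled_expm1 m (g z - (f x + t * (K / B))) \<partial>std_normal_distribution) \<le> (\<integral>z. exp (t * \<bar>z\<bar>) * exp (- t * (K / B)) - 1 \<partial>std_normal_distribution)"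
      proof (intro integral_mono gauss.log_mean_root ig)
        fix z
        have "scaled_expm1 m (g z - (f x + t * (K / B))) \<le> scaled_expm1 1 (g z - (f x + t * (K / B)))" using m m1 by (intro scaled_expm1_diff) auto
        also have "\<dots> \<le> scaled_expm1 1 (t * \<bar>z\<bar> - t * (K / B))" using gb[of z] by (intro scaled_expm1_mono) (auto simp: abs_le_iff)
        also have "\<dots> = exp (t * \<bar>z\<bar>) * exp (- t * (K / B)) - 1" by (simp add: scaled_expm1_def exp_add[symmetric])
        finally show "scaled_expm1 m (g z - (f x + t * (K / B))) \<le> exp (t * \<bar>z\<bar>) * exp (- t * (K / B)) - 1" .
      qed (use il in auto)
      also have "\<dots> = (\<integral>z. exp (t * \<bar>z\<bar>) \<partial>std_normal_distribution) * exp (- t * (K / B)) - 1"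
        using il gauss.prob_space by simp
      \<comment> \<open>Convexity between exponents 0 and B gives a bound linear in t, so that the
        deviation of y from f x is of order t.\<close>
      also have "(\<integral>z. exp (t * \<bar>z\<bar>) \<partial>std_normal_distribution) \<le> (\<integral>z. 1 + (t / B) * (exp (B * \<bar>z\<bar>) - 1) \<partial>std_normal_distribution)"
      proof (intro integral_mono il)
        show "exp (t * \<bar>z\<bar>) \<le> 1 + t / B * (exp (B * \<bar>z\<bar>) - 1)" for z
          using exp_convex_le[of "t / B" "B * \<bar>z\<bar>"] t B by simp
      qed (use iK in auto)
      also have "\<dots> = 1 + (t / B) * (K - 1)" using iK gauss.prob_space by (simp add: K_def)
      also have "\<dots> \<le> 1 + t * (K / B)" using t B by (simp add: field_simps)
      also have "\<dots> \<le> exp (t * (K / B))" by (rule exp_ge_add_one_self)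
      finally have "(\<integral>z. scaled_expm1 m (g z - (f x + t * (K / B))) \<partial>std_normal_distribution) \<le> 0"
        by (simp add: exp_minus)
      then show ?thesis unfolding y_def gauss.log_mean_le_iff(1)[OF ig] .
    qed
    have lo: "f x - t * (K / B) \<le> y"
    proof -
      have "B * (\<integral>z. \<bar>z\<bar> \<partial>std_normal_distribution) \<le> K"
      proof -
        have "(\<integral>z. B * \<bar>z\<bar> \<partial>std_normal_distribution) \<le> K" unfolding K_def
        proof (intro integral_mono iK)
          show "B * \<bar>z\<bar> \<le> exp (B * \<bar>z\<bar>)" for z using exp_ge_add_one_self[of "B * \<bar>z\<bar>"] by linarith
        qed (use gauss_moments in auto)
        then show ?thesis by simp
      qed
      then have z: "(\<integral>z. \<bar>z\<bar> \<partial>std_normal_distribution) \<le> K / B" using B by (simp add: field_simps)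
      have "f x - t * (K / B) \<le> f x - t * (\<integral>z. \<bar>z\<bar> \<partial>std_normal_distribution)" using mult_left_mono[OF z t(1)] by linarith
      also have "\<dots> = (\<integral>z. f x - t * \<bar>z\<bar> \<partial>std_normal_distribution)" using gauss_moments gauss.prob_space by simp
      also have "\<dots> \<le> (\<integral>z. g z \<partial>std_normal_distribution)"
      proof (intro integral_mono ig)
        show "f x - t * \<bar>z\<bar> \<le> g z" for z using gb[of z] by linarith
      qed (use gauss_moments in auto)
      also have "\<dots> \<le> y"
      proof -
        let ?k = "\<integral>z. g z \<partial>std_normal_distribution"
        have "(\<integral>z. g z - ?k \<partial>std_normal_distribution) \<le> (\<integral>z. scaled_expm1 m (g z - ?k) \<partial>std_normal_distribution)"
          using ig m by (intro integral_mono gauss.log_mean_root scaled_expm1_lower_linear) auto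
        then show ?thesis unfolding y_def gauss.log_mean_le_iff(2)[OF ig] using ig gauss.prob_space by simp
      qed
      finally show ?thesis .
    qed
    have W: "\<bar>g z - y\<bar> \<le> t * (\<bar>z\<bar> + K / B)" for z
      using gb[of z] hi lo by (simp add: distrib_left abs_le_iff)
    have WH: "(g z - y)\<^sup>2 * exp \<bar>g z - y\<bar> \<le> t\<^sup>2 * H z" for z
    proof -
      have "(g z - y)\<^sup>2 \<le> (t * (\<bar>z\<bar> + K / B))\<^sup>2" using power_mono[OF W[of z], of 2] by simp
      moreover have "t * (\<bar>z\<bar> + K / B) \<le> B * \<bar>z\<bar> + K"
        using mult_right_mono[OF t(2), of "\<bar>z\<bar> + K / B"] K1 B by (simp add: distrib_left)
      then have "exp \<bar>g z - y\<bar> \<le> exp (B * \<bar>z\<bar> + K)" using W[of z] by simp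
      ultimately have "(g z - y)\<^sup>2 * exp \<bar>g z - y\<bar> \<le> (t * (\<bar>z\<bar> + K / B))\<^sup>2 * exp (B * \<bar>z\<bar> + K)"
        by (intro mult_mono) auto
      then show ?thesis by (simp add: H_def power_mult_distrib mult.assoc)
    qed
    have iW: "integrable std_normal_distribution (\<lambda>z. (g z - y)\<^sup>2 * exp \<bar>g z - y\<bar>)"
    proof (rule Bochner_Integration.integrable_bound[of _ "\<lambda>z. t\<^sup>2 * H z"])
      show "AE z in std_normal_distribution. norm ((g z - y)\<^sup>2 * exp \<bar>g z - y\<bar>) \<le> norm (t\<^sup>2 * H z)"
      proof (intro AE_I2)
        show "norm ((g z - y)\<^sup>2 * exp \<bar>g z - y\<bar>) \<le> norm (t\<^sup>2 * H z)" for z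
          using WH[of z] abs_ge_self[of "t\<^sup>2 * H z"] by simp
      qed
    qed (use iH in auto)
    have "(\<integral>z. (g z - y)\<^sup>2 * exp \<bar>g z - y\<bar> \<partial>std_normal_distribution) \<le> (\<integral>z. t\<^sup>2 * H z \<partial>std_normal_distribution)"
      using iW iH by (intro integral_mono WH) auto
    also have "\<dots> = t\<^sup>2 * \<kappa>" by (simp add: \<kappa>_def)
    finally have I: "(\<integral>z. (g z - y)\<^sup>2 * exp \<bar>g z - y\<bar> \<partial>std_normal_distribution) \<le> t\<^sup>2 * \<kappa>" .
    have iZ: "integrable std_normal_distribution (\<lambda>z. exp (\<bar>f x\<bar> + t * \<bar>z\<bar>))" by (rule integrable_exp_affine)
    note par = gauss.log_mean_parameter[OF m gm gb' iZ, folded y_def, OF iW]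
    have "(m' - m) / 2 * (\<integral>z. (g z - y)\<^sup>2 * exp \<bar>g z - y\<bar> \<partial>std_normal_distribution) \<le> (m' - m) / 2 * (t\<^sup>2 * \<kappa>)"
      using I m by (intro mult_left_mono) auto
    also have "\<dots> \<le> (m' - m) * (t\<^sup>2 * \<kappa>)" using m k0 by (intro mult_right_mono) auto
    finally have "\<bar>y - log_mean m' std_normal_distribution g\<bar> \<le> (m' - m) * (t\<^sup>2 * \<kappa>)" using par by linarith
    then show ?thesis unfolding gauss_step_def g_def[symmetric] y_def[symmetric] t_def[symmetric] by (simp add: mult_ac)
  qed
  show ?thesis
  proof (rule that[OF k0])
    fix A :: "'a set" and f and m m' :: real and c x
    assume *: "lip A L f" "L * l1_norm A c \<le> B" "0 \<le> m" "m \<le> 1" "0 \<le> m'" "m' \<le> 1"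
    show "\<bar>gauss_step m c f x - gauss_step m' c f x\<bar> \<le> \<kappa> * \<bar>m - m'\<bar> * (L * l1_norm A c)\<^sup>2"
    proof (cases "m \<le> m'")
      case True
      then show ?thesis using main[OF *(1,2,3) True *(6), of x] by simp
    next
      case False
      then show ?thesis using main[OF *(1,2,5) _ *(4), of x] by (simp add: abs_minus_commute)
    qed
  qed
qed

text \<open>The average of exp (e x1 + f x2 + lam e f) over the four sign pairs (e, f). Up to ln 4,
  the terminal value is the log-partition function of one site whose two spins are coupled by
  lam.\<close>

lemma exp_terminal:
  "exp (terminal lam x) = (exp (x $ 1 + x $ 2 + lam) + exp (x $ 1 - x $ 2 - lam) + exp (- x $ 1 + x $ 2 - lam) + exp (- x $ 1 - x $ 2 + lam)) / 4"
proof -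
  have e: "cosh (x $ 1) * cosh (x $ 2) * cosh lam + sinh (x $ 1) * sinh (x $ 2) * sinh lam =
     (exp (x $ 1 + x $ 2 + lam) + exp (x $ 1 - x $ 2 - lam) + exp (- x $ 1 + x $ 2 - lam) + exp (- x $ 1 - x $ 2 + lam)) / 4"
    by (simp add: cosh_field_def sinh_field_def exp_add exp_diff exp_minus divide_simps) (simp add: algebra_simps)
  have "0 < (exp (x $ 1 + x $ 2 + lam) + exp (x $ 1 - x $ 2 - lam) + exp (- x $ 1 + x $ 2 - lam) + exp (- x $ 1 - x $ 2 + lam)) / 4"
    by (intro divide_pos_pos add_pos_pos) auto
  then show ?thesis unfolding terminal_def e by simp
qed

lemma lip_terminal: "lip UNIV 1 (coord_fun (terminal lam))"
proof -
  have le: "coord_fun (terminal lam) u \<le> coord_fun (terminal lam) v + l1_norm UNIV (\<lambda>i. u i - v i)" for u v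
  proof -
    let ?n = "l1_norm UNIV (\<lambda>i. u i - v i)"
    have n: "\<bar>u 1 - v 1\<bar> + \<bar>u 2 - v 2\<bar> = ?n" by (simp add: abs_sum_2)
    have "exp (coord_fun (terminal lam) u) \<le> exp (coord_fun (terminal lam) v) * exp ?n"
      unfolding coord_fun_def exp_terminal vec_lambda_beta distrib_right[symmetric] times_divide_eq_left
    proof (intro divide_right_mono)
      have "exp (u 1 + u 2 + lam) \<le> exp (v 1 + v 2 + lam) * exp ?n"
        "exp (u 1 - u 2 - lam) \<le> exp (v 1 - v 2 - lam) * exp ?n"
        "exp (- u 1 + u 2 - lam) \<le> exp (- v 1 + v 2 - lam) * exp ?n"
        "exp (- u 1 - u 2 + lam) \<le> exp (- v 1 - v 2 + lam) * exp ?n"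
        unfolding exp_add[symmetric] exp_le_cancel_iff using n by linarith+
      then show "exp (u 1 + u 2 + lam) + exp (u 1 - u 2 - lam) + exp (- u 1 + u 2 - lam) + exp (- u 1 - u 2 + lam)
        \<le> (exp (v 1 + v 2 + lam) + exp (v 1 - v 2 - lam) + exp (- v 1 + v 2 - lam) + exp (- v 1 - v 2 + lam)) * exp ?n"
        unfolding distrib_right by linarith
    qed simp
    then show ?thesis by (simp add: exp_add[symmetric])
  qed
  show ?thesis unfolding lip_def
  proof (intro conjI allI)
    show "\<bar>coord_fun (terminal lam) u - coord_fun (terminal lam) v\<bar> \<le> 1 * l1_norm UNIV (\<lambda>i. u i - v i)" for u v
      using le[of u v] le[of v u] l1_norm_commute[of UNIV u v] by (simp add: abs_le_iff)
  qed simp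
qed

primrec chain :: "real \<Rightarrow> real list \<Rightarrow> bool" where
  "chain s [] \<longleftrightarrow> s = 1"
| "chain s (b # bs) \<longleftrightarrow> s < b \<and> chain b bs"

primrec const_between :: "(real \<Rightarrow> real) \<Rightarrow> real \<Rightarrow> real list \<Rightarrow> bool" where
  "const_between a s [] \<longleftrightarrow> True"
| "const_between a s (b # bs) \<longleftrightarrow> (\<forall>u\<in>{s..<b}. a u = a s) \<and> const_between a b bs"

lemma chain_le: "chain s bs \<Longrightarrow> s \<le> 1"
  by (induction bs arbitrary: s) force+

text \<open>Collects what the recursion needs of \<open>T\<close>: its integrals over intervals are
  covariance matrices with diagonal entries at most proportional to the length.\<close>

locale cov_density =
  fixes T :: "real \<Rightarrow> real^2^2" and K :: real
  assumes T_integrable: "\<And>s b. 0 \<le> s \<Longrightarrow> s \<le> b \<Longrightarrow> b \<le> 1 \<Longrightarrow> T integrable_on {s..b}"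
    and T_psd: "\<And>s b. 0 \<le> s \<Longrightarrow> s \<le> b \<Longrightarrow> b \<le> 1 \<Longrightarrow> pos_semidef (integral {s..b} T)"
    and T_trace: "\<And>s b i. 0 \<le> s \<Longrightarrow> s \<le> b \<Longrightarrow> b \<le> 1 \<Longrightarrow> integral {s..b} T $ i $ i \<le> K * (b - s)"
    and K_pos: "0 < K"
begin

text \<open>Where \<open>a\<close> is constant, the steps on the two sides of the new point have the
  same parameter and merge into the old one.\<close>

lemma hopf_cole_insort:
  assumes f: "lip UNIV L (coord_fun f)" and a: "\<And>u. 0 \<le> a u \<and> a u \<le> 1"
    and "chain s bs" "const_between a s bs" "0 \<le> s" "s < p" "p < 1" "p \<notin> set bs"
  shows "hopf_cole a T f (insort p bs) s = hopf_cole a T f bs s"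
  using assms(3-)
proof (induction bs arbitrary: s)
  case (Cons b bs)
  have ch: "s < b" "chain b bs" "0 \<le> s" "s < p" "p < 1" "p \<noteq> b" "p \<notin> set bs"
    using Cons.prems(1,3-) by auto
  have cb: "const_between a b bs" and c: "\<And>u. u \<in> {s..<b} \<Longrightarrow> a u = a s"
    using Cons.prems(2) by (simp_all only: const_between.simps Ball_def)
  have b1: "b \<le> 1" by (rule chain_le[OF ch(2)])
  show ?case
  proof (cases "p < b")
    case True
    have ap: "a p = a s" by (rule c) (use ch True in simp)
    have int: "integral {s..p} T + integral {p..b} T = integral {s..b} T"
      using ch True b1 by (intro Henstock_Kurzweil_Integration.integral_combine T_integrable) auto
    have "hopf_cole_step (a s) (integral {s..p} T) (hopf_cole_step (a s) (integral {p..b} T) (hopf_cole a T f bs b))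
       = hopf_cole_step (a s) (integral {s..p} T + integral {p..b} T) (hopf_cole a T f bs b)"
      by (rule hopf_cole_step_add[OF lip_hopf_cole[OF f a]]) (use a ch True b1 int in \<open>auto intro!: T_psd\<close>)
    then show ?thesis using True ap int by simp
  next
    case False
    then have "b < p" using ch by simp
    then have "hopf_cole a T f (insort p bs) b = hopf_cole a T f bs b"
      using ch cb by (intro Cons.IH) auto
    then show ?thesis using False ch(6) by simp
  qed
qed auto

text \<open>The square of each entry of a column is at most the corresponding diagonal entry of the
  covariance; the factor 4 comes from passing to the l1 norm of two coordinates.\<close>

lemma dirs_bound:
  assumes s: "0 \<le> s" "s \<le> b" "b \<le> 1" and c: "c \<in> set (dirs (integral {s..b} T))"
  shows "(l1_norm UNIV c)\<^sup>2 \<le> 4 * K * (b - s)"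
proof -
  let ?C = "integral {s..b} T"
  have psd: "pos_semidef ?C" by (rule T_psd[OF s])
  have "(c i)\<^sup>2 \<le> K * (b - s)" for i
  proof -
    have "(c i)\<^sup>2 \<le> cov (dirs ?C) i i" using c by (auto simp: cov_def dirs_def power2_eq_square)
    also have "\<dots> \<le> K * (b - s)" using cov_dirs[OF psd] T_trace[OF s] by simp
    finally show ?thesis .
  qed
  from this[of 1] this[of 2] have "2 * ((c 1)\<^sup>2 + (c 2)\<^sup>2) \<le> 4 * K * (b - s)" by simp
  moreover have "(l1_norm UNIV c)\<^sup>2 \<le> 2 * ((c 1)\<^sup>2 + (c 2)\<^sup>2)"
    using sum_squares_bound[of "\<bar>c 1\<bar>" "\<bar>c 2\<bar>"] by (simp add: abs_sum_2 power2_sum)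
  ultimately show ?thesis by linarith
qed

text \<open>On a common partition \<open>a\<close> and \<open>a'\<close> are constant on each
  interval [s, b), where the change of parameter costs at most k |a - a'| 4 K (b - s) for each of
  the two directions; this is the factor 2 in \<open>\<kappa>\<close>. Steps further out do not
  enlarge a uniform difference.\<close>

lemma hopf_cole_lipschitz:
  obtains \<kappa> where "0 \<le> \<kappa>" "\<And>f a a' s bs x. lip UNIV 1 (coord_fun f) \<Longrightarrow> (\<And>u. 0 \<le> a u \<and> a u \<le> 1) \<Longrightarrow> (\<And>u. 0 \<le> a' u \<and> a' u \<le> 1) \<Longrightarrow>
    chain s bs \<Longrightarrow> const_between a s bs \<Longrightarrow> const_between a' s bs \<Longrightarrow> 0 \<le> s \<Longrightarrow> (\<lambda>u. \<bar>a u - a' u\<bar>) integrable_on {0..1} \<Longrightarrow>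
    \<bar>hopf_cole a T f bs s x - hopf_cole a' T f bs s x\<bar> \<le> \<kappa> * integral {s..1} (\<lambda>u. \<bar>a u - a' u\<bar>)"
proof -
  define B where "B = sqrt (4 * K)"
  have B: "0 < B" using K_pos by (simp add: B_def)
  obtain k where k: "0 \<le> k" "\<And>(A :: 2 set) f m m' c x. lip A 1 f \<Longrightarrow> 1 * l1_norm A c \<le> B \<Longrightarrow> 0 \<le> m \<Longrightarrow> m \<le> 1 \<Longrightarrow> 0 \<le> m' \<Longrightarrow> m' \<le> 1 \<Longrightarrow>
    \<bar>gauss_step m c f x - gauss_step m' c f x\<bar> \<le> k * \<bar>m - m'\<bar> * (1 * l1_norm A c)\<^sup>2"
    using gauss_step_parameter[OF B] by metis
  define \<kappa> where "\<kappa> = 2 * (k * (4 * K))"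
  have "\<bar>hopf_cole a T f bs s x - hopf_cole a' T f bs s x\<bar> \<le> \<kappa> * integral {s..1} (\<lambda>u. \<bar>a u - a' u\<bar>)"
    if f: "lip UNIV 1 (coord_fun f)" and a: "\<And>u. 0 \<le> a u \<and> a u \<le> 1" and a': "\<And>u. 0 \<le> a' u \<and> a' u \<le> 1"
      and prems: "chain s bs" "const_between a s bs" "const_between a' s bs" "0 \<le> s"
      and int: "(\<lambda>u. \<bar>a u - a' u\<bar>) integrable_on {0..1}" for f a a' s bs x
    using prems
  proof (induction bs arbitrary: s x)
    case Nil
    then show ?case by simp
  next
    case (Cons b bs)
    have s: "0 \<le> s" "s < b" "b \<le> 1" and ch: "chain b bs"
      using Cons.prems(1,4) chain_le[of b bs] by simp_all
    have cb: "const_between a b bs" "const_between a' b bs" "\<And>u. u \<in> {s..<b} \<Longrightarrow> a u = a s" "\<And>u. u \<in> {s..<b} \<Longrightarrow> a' u = a' s"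
      using Cons.prems(2,3) by (simp_all only: const_between.simps Ball_def)
    let ?C = "integral {s..b} T"
    let ?\<delta> = "\<bar>a s - a' s\<bar>"
    define f1 where "f1 = coord_fun (hopf_cole a T f bs b)"
    define f2 where "f2 = coord_fun (hopf_cole a' T f bs b)"
    have l: "lip UNIV 1 f1" "lip UNIV 1 f2" unfolding f1_def f2_def by (rule lip_hopf_cole[OF f]; rule a a')+
    define I where "I = integral {b..1} (\<lambda>u. \<bar>a u - a' u\<bar>)"
    have close: "\<bar>f1 v - f2 v\<bar> \<le> \<kappa> * I" for v
      unfolding f1_def f2_def coord_fun_def I_def by (rule Cons.IH[OF ch cb(1,2)]) (use s in simp)
    have k1: "\<bar>gauss_step (a s) c g v - gauss_step (a' s) c g v\<bar> \<le> k * ?\<delta> * (4 * K * (b - s))"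
      if c: "c \<in> set (dirs ?C)" and g: "lip UNIV 1 g" for c g v
    proof -
      have n: "(l1_norm UNIV c)\<^sup>2 \<le> 4 * K * (b - s)" by (rule dirs_bound[OF _ _ _ c]) (use s in auto)
      also have "\<dots> \<le> 4 * K * 1" using s K_pos by (intro mult_left_mono) auto
      finally have "l1_norm UNIV c \<le> B" unfolding B_def by (simp add: real_le_rsqrt)
      then have "\<bar>gauss_step (a s) c g v - gauss_step (a' s) c g v\<bar> \<le> k * ?\<delta> * (1 * l1_norm UNIV c)\<^sup>2"
        by (intro k(2)[OF g]) (simp_all add: a a')
      also have "\<dots> \<le> k * ?\<delta> * (4 * K * (b - s))" using n k(1) by (intro mult_left_mono) auto
      finally show ?thesis .
    qed
    let ?e = "k * ?\<delta> * (4 * K * (b - s))"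
    obtain c1 c2 where d: "dirs ?C = [c1, c2]" by (simp add: dirs_def)
    have A: "0 \<le> a s" "a s \<le> 1" "0 \<le> a' s" "a' s \<le> 1" using a a' by auto
    have 1: "\<bar>gauss_step (a s) c2 f1 v - gauss_step (a' s) c2 f2 v\<bar> \<le> ?e + \<kappa> * I" for v
      using k1[of c2 f1 v] gauss_step_close[OF l A(3,4) close, of c2 v] l(1) d by simp
    have 2: "\<bar>gauss_step (a s) c1 (gauss_step (a s) c2 f1) v - gauss_step (a' s) c1 (gauss_step (a' s) c2 f2) v\<bar> \<le> ?e + (?e + \<kappa> * I)" for v
    proof -
      have "\<bar>gauss_step (a s) c1 (gauss_step (a s) c2 f1) v - gauss_step (a' s) c1 (gauss_step (a s) c2 f1) v\<bar> \<le> ?e"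
        by (rule k1[OF _ lip_gauss_step[OF l(1) A(1,2)]]) (simp add: d)
      moreover have "\<bar>gauss_step (a' s) c1 (gauss_step (a s) c2 f1) v - gauss_step (a' s) c1 (gauss_step (a' s) c2 f2) v\<bar> \<le> ?e + \<kappa> * I"
        by (rule gauss_step_close[OF lip_gauss_step[OF l(1) A(1,2)] lip_gauss_step[OF l(2) A(3,4)] A(3,4) 1])
      ultimately show ?thesis by linarith
    qed
    have h: "hopf_cole a T f (b # bs) s x = gauss_step (a s) c1 (gauss_step (a s) c2 f1) (\<lambda>i. x $ i)"
      "hopf_cole a' T f (b # bs) s x = gauss_step (a' s) c1 (gauss_step (a' s) c2 f2) (\<lambda>i. x $ i)"
      using coord_fun_hopf_cole_step[OF l(1)[unfolded f1_def] A(1,2), of ?C] coord_fun_hopf_cole_step[OF l(2)[unfolded f2_def] A(3,4), of ?C]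
      unfolding d f1_def[symmetric] f2_def[symmetric] by (simp_all add: coord_fun_vec_nth[of _ x])
    have I2: "integral {s..1} (\<lambda>u. \<bar>a u - a' u\<bar>) = ?\<delta> * (b - s) + I"
    proof -
      have i: "(\<lambda>u. \<bar>a u - a' u\<bar>) integrable_on {s..1}" by (rule integrable_subinterval_real[OF int]) (use s in auto)
      have "integral {s..1} (\<lambda>u. \<bar>a u - a' u\<bar>) = integral {s..b} (\<lambda>u. \<bar>a u - a' u\<bar>) + I"
        unfolding I_def using s i by (intro Henstock_Kurzweil_Integration.integral_combine[symmetric]) auto
      also have "integral {s..b} (\<lambda>u. \<bar>a u - a' u\<bar>) = integral {s..b} (\<lambda>u. ?\<delta>)"
      proof (rule integral_spike[of "{b}"])
        fix u assume "u \<in> {s..b} - {b}"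
        then have "u \<in> {s..<b}" by auto
        from cb(3)[OF this] cb(4)[OF this] show "?\<delta> = \<bar>a u - a' u\<bar>" by (simp only:)
      qed simp
      also have "\<dots> = ?\<delta> * (b - s)" using s by simp
      finally show ?thesis .
    qed
    have "?e + (?e + \<kappa> * I) = \<kappa> * (?\<delta> * (b - s) + I)" by (simp add: \<kappa>_def algebra_simps)
    then show ?case using 2[of "\<lambda>i. x $ i"] unfolding h I2 by simp
  qed
  moreover have "0 \<le> \<kappa>" using k(1) K_pos by (simp add: \<kappa>_def)
  ultimately show ?thesis using that by blast
qed

end

subsection \<open>The covariance functions\<close>

lemma has_real_derivative_cong_on:
  "(\<And>x. x \<in> S \<Longrightarrow> f x = g x) \<Longrightarrow> x \<in> S \<Longrightarrow> (f has_real_derivative d) (at x within S) \<Longrightarrow> (g has_real_derivative d) (at x within S)"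
  using has_field_derivative_transform_within[of f d x S 1 g] by auto

lemma summable_power_bound:
  fixes c :: "nat \<Rightarrow> real" and x :: real
  assumes "summable c" "\<And>n. 0 \<le> c n" "\<bar>x\<bar> \<le> 1"
  shows "summable (\<lambda>n. c n * x ^ (k n))"
proof (rule summable_comparison_test'[OF assms(1)])
  show "norm (c n * x ^ k n) \<le> c n" for n
    using assms power_le_one[of "\<bar>x\<bar>" "k n"] mult_left_le[of "\<bar>x\<bar> ^ k n" "c n"] by (simp add: abs_mult power_abs)
qed

context
  fixes b :: "nat \<Rightarrow> real"
  assumes b: "summable (\<lambda>p. (real p)\<^sup>2 * (b p)\<^sup>2)"
begin

lemma summable_shift2: "summable (\<lambda>p. (real (p + 2))\<^sup>2 * (b (p + 2))\<^sup>2)"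
  using b by (subst summable_iff_shift)

lemma summable_lower:
  assumes "\<And>p. 0 \<le> c p" "\<And>p. c p \<le> (real (p + 2))\<^sup>2" shows "summable (\<lambda>p. c p * (b (p + 2))\<^sup>2)"
  by (rule summable_comparison_test'[OF summable_shift2]) (use assms in \<open>simp add: mult_right_mono del: of_nat_add\<close>)

definition xi_series_deriv :: "real \<Rightarrow> real" where
  "xi_series_deriv s = (\<Sum>p. (real (p + 2) * (b (p + 2))\<^sup>2) * s ^ (p + 1))"

text \<open>Termwise differentiation up to the endpoints of [-1, 1]: there the differentiated series
  is dominated by the summable squares p^2 b_p^2. With c = 1 and k = 2 this differentiates
  \<open>xi\<close>; with c p = p + 2 and k = 1 it differentiates
  \<open>xi_series_deriv\<close>.\<close>

lemma series_deriv:
  fixes c :: "nat \<Rightarrow> real"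
  assumes "\<And>p. 0 \<le> c p" "\<And>p. c p * real (p + k) \<le> (real (p + 2))\<^sup>2" "1 \<le> k" "s \<in> {-1..1}"
    and "summable (\<lambda>p. c p * (b (p + 2))\<^sup>2)"
  shows "((\<lambda>s. \<Sum>p. (c p * (b (p + 2))\<^sup>2) * s ^ (p + k)) has_real_derivative
     (\<Sum>p. (c p * (b (p + 2))\<^sup>2) * (real (p + k) * s ^ (p + k - 1)))) (at s within {-1..1})"
proof -
  let ?f = "\<lambda>p s. (c p * (b (p + 2))\<^sup>2) * s ^ (p + k)"
  let ?f' = "\<lambda>p s. (c p * (b (p + 2))\<^sup>2) * (real (p + k) * s ^ (p + k - 1))"
  have ul: "uniform_limit {-1..1} (\<lambda>n s. \<Sum>i<n. ?f' i s) (\<lambda>s. suminf (\<lambda>i. ?f' i s)) sequentially"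
  proof (rule Weierstrass_m_test[OF _ summable_shift2])
    fix n and s :: real assume "s \<in> {-1..1}"
    then have s: "\<bar>s\<bar> \<le> 1" by auto
    have "norm (?f' n s) = (c n * real (n + k)) * (b (n + 2))\<^sup>2 * \<bar>s\<bar> ^ (n + k - 1)"
      using assms(1)[of n] by (simp add: abs_mult power_abs)
    also have "\<dots> \<le> (c n * real (n + k)) * (b (n + 2))\<^sup>2 * 1"
      using assms(1)[of n] power_le_one[OF _ s] by (intro mult_left_mono) auto
    also have "\<dots> \<le> (real (n + 2))\<^sup>2 * (b (n + 2))\<^sup>2"
      using assms(2)[of n] by (simp add: mult_right_mono)
    finally show "norm (?f' n s) \<le> (real (n + 2))\<^sup>2 * (b (n + 2))\<^sup>2" .
  qed
  have fd: "(?f n has_real_derivative ?f' n s) (at s within {-1..1})" for n s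
    by (auto intro!: derivative_eq_intros)
  have sm: "summable (\<lambda>n. ?f n 0)"
    by (rule summable_power_bound[OF assms(5)]) (use assms(1) in auto)
  have "\<exists>g. \<forall>s\<in>{-1..1}. (\<lambda>n. ?f n s) sums g s \<and> (g has_real_derivative (\<Sum>n. ?f' n s)) (at s within {-1..1})"
    by (rule has_field_derivative_series[OF _ fd ul _ sm]) auto
  then obtain g where g: "\<And>s. s \<in> {-1..1} \<Longrightarrow> (\<lambda>n. ?f n s) sums g s"
    "\<And>s. s \<in> {-1..1} \<Longrightarrow> (g has_real_derivative (\<Sum>n. ?f' n s)) (at s within {-1..1})"
    by blast
  show ?thesis
    by (rule has_real_derivative_cong_on[OF _ assms(4) g(2)[OF assms(4)]]) (use g(1) sums_unique in blast)
qed

lemma xi_has_derivative: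
  assumes "s \<in> {-1..1}" shows "(xi b has_real_derivative xi_series_deriv s) (at s within {-1..1})"
proof -
  have 1: "real (p + 2) \<le> (real (p + 2))\<^sup>2" for p
    by (simp add: power2_eq_square del: of_nat_add)
  have "summable (\<lambda>p. 1 * (b (p + 2))\<^sup>2)" by (rule summable_lower) (auto simp: power2_eq_square algebra_simps)
  from series_deriv[of "\<lambda>_. 1" 2 s, OF _ _ _ assms this] 1
  have "((\<lambda>s. \<Sum>p. (1 * (b (p + 2))\<^sup>2) * s ^ (p + 2)) has_real_derivative
     (\<Sum>p. (1 * (b (p + 2))\<^sup>2) * (real (p + 2) * s ^ (p + 2 - 1)))) (at s within {-1..1})" by simp
  moreover have "(\<Sum>p. (1 * (b (p + 2))\<^sup>2) * (real (p + 2) * s ^ (p + 2 - 1))) = xi_series_deriv s"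
    unfolding xi_series_deriv_def by (intro suminf_cong) simp
  ultimately show ?thesis by (simp only: xi_def[abs_def] mult_1)
qed

lemma xi_deriv_eq:
  assumes "s \<in> {-1..1}" shows "xi_deriv b s = xi_series_deriv s"
  unfolding xi_deriv_def
  by (rule vector_derivative_within_closed_interval[OF _ assms])
     (use xi_has_derivative[OF assms] in \<open>auto simp: has_real_derivative_iff_has_vector_derivative\<close>)

lemma xi_deriv_differentiable:
  assumes "s \<in> {-1..1}" shows "\<exists>d. (xi_deriv b has_real_derivative d) (at s within {-1..1})"
proof -
  have "real (p + 2) \<le> (real (p + 2))\<^sup>2" for p
    by (simp add: power2_eq_square del: of_nat_add)
  then have "summable (\<lambda>p. real (p + 2) * (b (p + 2))\<^sup>2)" by (intro summable_lower) auto
  moreover have "real (p + 2) * real (p + 1) \<le> (real (p + 2))\<^sup>2" for p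
    by (simp add: power2_eq_square)
  ultimately have "\<exists>d. (xi_series_deriv has_real_derivative d) (at s within {-1..1})"
    using series_deriv[of "\<lambda>p. real (p + 2)" 1 s, OF _ _ _ assms] unfolding xi_series_deriv_def[abs_def] by auto
  then obtain d where d: "(xi_series_deriv has_real_derivative d) (at s within {-1..1})" by blast
  have "(xi_deriv b has_real_derivative d) (at s within {-1..1})"
    by (rule has_real_derivative_cong_on[OF _ assms d]) (simp add: xi_deriv_eq)
  then show ?thesis by blast
qed

lemma xi_deriv_has_derivative:
  "s \<in> {-1..1} \<Longrightarrow> (xi b has_real_derivative xi_deriv b s) (at s within {-1..1})"
  using xi_has_derivative xi_deriv_eq by simp

lemma xi_deriv_zero [simp]: "xi_deriv b 0 = 0"
proof -
  have "xi_series_deriv 0 = 0" unfolding xi_series_deriv_def by simp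
  then show ?thesis using xi_deriv_eq[of 0] by simp
qed

end

text \<open>The point x may be an endpoint, as happens for overlap 1, where only a one-sided
  derivative exists. Difference quotients are taken at points of the segment from x to y, which stay
  in \<open>S\<close>, and each is compared with the chord.\<close>

lemma convex_on_above_tangent_within:
  fixes f :: "real \<Rightarrow> real"
  assumes f: "convex_on S f" and d: "(f has_real_derivative d) (at x within S)" and xy: "x \<in> S" "y \<in> S"
  shows "f x + d * (y - x) \<le> f y"
proof (cases "y = x")
  case False
  have S: "convex S" by (rule convex_on_imp_convex[OF f])
  let ?g = "\<lambda>n::nat. x + (y - x) / real (Suc n)"
  have gS: "?g n \<in> S - {x}" for n
  proof -
    have "(1 - 1 / real (Suc n)) *\<^sub>R x + (1 / real (Suc n)) *\<^sub>R y \<in> S"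
      by (rule convexD_alt[OF S xy]) (auto simp: field_simps)
    moreover have "(1 - 1 / real (Suc n)) *\<^sub>R x + (1 / real (Suc n)) *\<^sub>R y = ?g n"
      by (simp add: left_diff_distrib diff_divide_distrib del: of_nat_Suc)
    ultimately show ?thesis using False by (simp del: of_nat_Suc)
  qed
  have lim: "((\<lambda>u. (f u - f x) / (u - x)) \<longlongrightarrow> d) (at x within S)"
    using d by (simp add: has_field_derivative_iff)
  have "?g \<longlonglongrightarrow> x + 0"
  proof (intro tendsto_add tendsto_const)
    show "(\<lambda>n. (y - x) / real (Suc n)) \<longlonglongrightarrow> 0"
      using LIMSEQ_Suc[OF lim_const_over_n[of "y - x"]] .
  qed
  then have g0: "?g \<longlonglongrightarrow> x" by (simp del: of_nat_Suc)
  have "filterlim ?g (at x within S) sequentially"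
    unfolding filterlim_at
  proof (intro conjI always_eventually allI g0)
    show "?g n \<in> S" "?g n \<noteq> x" for n using gS[of n] unfolding Diff_iff singleton_iff by blast+
  qed
  from filterlim_compose[OF lim this] have "(\<lambda>n. (f (?g n) - f x) / (?g n - x)) \<longlonglongrightarrow> d" .
  then have "(\<lambda>n. (f (?g n) - f x) / (?g n - x) * (y - x)) \<longlonglongrightarrow> d * (y - x)"
    by (rule tendsto_mult_right)
  moreover have "(f (?g n) - f x) / (?g n - x) * (y - x) \<le> f y - f x" for n
  proof -
    let ?t = "1 / real (Suc n)"
    have "f ((1 - ?t) *\<^sub>R x + ?t *\<^sub>R y) \<le> (1 - ?t) * f x + ?t * f y"
      by (rule convex_onD[OF f _ _ xy]) (auto simp: field_simps)
    moreover have "(1 - ?t) *\<^sub>R x + ?t *\<^sub>R y = ?g n"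
      by (simp add: left_diff_distrib diff_divide_distrib del: of_nat_Suc)
    moreover have "(1 - t) * u + t * v = u + t * (v - u)" for t u v :: real
      by (simp add: algebra_simps)
    ultimately have "f (?g n) \<le> f x + ?t * (f y - f x)" by (simp only:)
    then have *: "f (?g n) - f x \<le> ?t * (f y - f x)" by linarith
    have "(f (?g n) - f x) / (?g n - x) * (y - x) = (f (?g n) - f x) * real (Suc n)"
      using False by (simp del: of_nat_Suc)
    also have "\<dots> \<le> (?t * (f y - f x)) * real (Suc n)" by (intro mult_right_mono *) simp
    also have "\<dots> = f y - f x" by (simp del: of_nat_Suc)
    finally show ?thesis .
  qed
  ultimately have "d * (y - x) \<le> f y - f x" by (intro LIMSEQ_le_const2) auto
  then show ?thesis by simp
qed simp

section \<open>Overlap paths and the integrals of T\<close>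

locale rsb =
  fixes \<beta> :: "2 \<Rightarrow> 2 \<Rightarrow> nat \<Rightarrow> real" and \<rho> :: "2 \<Rightarrow> 2 \<Rightarrow> real \<Rightarrow> real" and q K :: real and D :: "real set"
  assumes \<beta>_summable: "\<And>l l'. summable (\<lambda>p. (real p)\<^sup>2 * (\<beta> l l' p)\<^sup>2)"
    and \<xi>_convex: "\<And>l l'. convex_on {-1..1} (xi (\<beta> l l'))"
    and q1: "\<bar>q\<bar> \<le> 1"
    and \<rho>_mono: "\<And>l l'. mono_on {0..1} (\<rho> l l')"
    and \<rho>_cont: "\<And>l l'. continuous_on {0..1} (\<rho> l l')"
    and \<rho>_0: "\<And>l l'. \<rho> l l' 0 = 0"
    and \<rho>_1: "\<And>l l'. \<rho> l l' 1 = (if l = l' then 1 else \<bar>q\<bar>)"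
    and D_finite: "finite D"
    and \<rho>_diff: "\<And>l l' s. s \<in> {0..1} - D \<Longrightarrow> \<rho> l l' differentiable (at s within {0..1})"
    and K_pos: "K > 0"
    and T_onorm: "\<And>s. s \<in> {0..1} \<Longrightarrow> onorm ((*v) (T_mat \<beta> \<rho> q s)) \<le> K"
    and T_pos_semidef: "\<And>s. s \<in> {0..1} \<Longrightarrow> pos_semidef (T_mat \<beta> \<rho> q s)"
begin

abbreviation "T \<equiv> T_mat \<beta> \<rho> q"

definition r :: "2 \<Rightarrow> 2 \<Rightarrow> real \<Rightarrow> real" where
  "r l l' s = (if l = l' then 1 else iota q) * \<rho> l l' s"

definition Q :: "2 \<Rightarrow> 2 \<Rightarrow> real \<Rightarrow> real" where
  "Q l l' s = xi_deriv (\<beta> l l') (r l l' s)"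

text \<open>An antiderivative of \<open>G\<close>, because the derivative of r xi'(r) - xi(r) is r
  times that of xi'(r). At the same time \<open>- \<Theta> s\<close> is the sum of the values at 0
  of the tangents to the xi functions at the points of the path. The two readings connect the
  integral in the bound with the convexity estimate.\<close>

definition \<Theta> :: "real \<Rightarrow> real" where
  "\<Theta> s = (\<Sum>l\<in>UNIV. \<Sum>l'\<in>UNIV. r l l' s * Q l l' s - xi (\<beta> l l') (r l l' s))"

definition G :: "real \<Rightarrow> real" where
  "G s = (\<Sum>l\<in>UNIV. \<Sum>l'\<in>UNIV. r l l' s * T s $ l $ l')"

lemma iota_abs: "\<bar>iota q\<bar> = 1" "iota q * \<bar>q\<bar> = q"
  by (auto simp: iota_def)

lemma \<rho>_range: "s \<in> {0..1} \<Longrightarrow> 0 \<le> \<rho> l l' s \<and> \<rho> l l' s \<le> 1"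
  using mono_onD[OF \<rho>_mono, of 0 s l l'] mono_onD[OF \<rho>_mono, of s 1 l l'] \<rho>_0[of l l'] \<rho>_1[of l l'] q1
  by (auto split: if_splits)

lemma r_range: "s \<in> {0..1} \<Longrightarrow> r l l' s \<in> {-1..1}"
proof -
  assume s: "s \<in> {0..1}"
  have "\<bar>r l l' s\<bar> = \<rho> l l' s" using \<rho>_range[OF s, of l l'] iota_abs by (auto simp: r_def abs_mult)
  then show ?thesis using \<rho>_range[OF s, of l l'] by auto
qed

lemma r_0: "r l l' 0 = 0" and r_1: "r l l' 1 = (if l = l' then 1 else q)"
  using iota_abs by (auto simp: r_def \<rho>_0 \<rho>_1)

lemma Q_0: "Q l l' 0 = 0"
  by (simp add: Q_def r_0 xi_deriv_zero[OF \<beta>_summable])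

lemma r_cont: "continuous_on {0..1} (r l l')"
  unfolding r_def[abs_def] by (intro continuous_intros \<rho>_cont)

lemma xi_cont: "continuous_on {-1..1} (xi (\<beta> l l'))" "continuous_on {-1..1} (xi_deriv (\<beta> l l'))"
proof -
  show "continuous_on {-1..1} (xi (\<beta> l l'))"
    unfolding continuous_on_eq_continuous_within
    by (intro ballI DERIV_continuous[OF xi_deriv_has_derivative[OF \<beta>_summable]])
  show "continuous_on {-1..1} (xi_deriv (\<beta> l l'))"
    unfolding continuous_on_eq_continuous_within
  proof
    fix s :: real assume "s \<in> {-1..1}"
    then obtain d where "(xi_deriv (\<beta> l l') has_real_derivative d) (at s within {-1..1})"
      using xi_deriv_differentiable[OF \<beta>_summable] by blast
    then show "continuous (at s within {-1..1}) (xi_deriv (\<beta> l l'))" by (rule DERIV_continuous)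
  qed
qed

lemma comp_cont: "continuous_on {0..1} (\<lambda>s. xi (\<beta> l l') (r l l' s))" "continuous_on {0..1} (Q l l')"
  unfolding Q_def[abs_def]
  by (rule continuous_on_compose2[OF xi_cont(1) r_cont], use r_range in blast)
     (rule continuous_on_compose2[OF xi_cont(2) r_cont], use r_range in blast)

lemma \<Theta>_cont: "continuous_on {0..1} \<Theta>"
  unfolding \<Theta>_def[abs_def] by (intro continuous_intros comp_cont r_cont)

lemma T_component: "T s $ l $ l' = deriv_or_right (Q l l') s"
  by (simp add: T_mat_def Q_def[abs_def] r_def)

lemma derivatives:
  assumes "s \<in> {0<..<1} - D"
  shows "(Q l l' has_real_derivative T s $ l $ l') (at s)"
    "\<exists>d. (r l l' has_real_derivative d) (at s) \<and> ((\<lambda>s. xi (\<beta> l l') (r l l' s)) has_real_derivative Q l l' s * d) (at s)"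
proof -
  have s: "s \<in> {0..1}" "s \<in> {0..1} - D" using assms by auto
  have w: "at s within {0..1} = at s" using assms by (intro at_within_interior) auto
  obtain d0 where "(\<rho> l l' has_real_derivative d0) (at s within {0..1})"
    using \<rho>_diff[OF s(2), of l l'] by (auto simp: real_differentiable_def)
  then have d: "(r l l' has_real_derivative (if l = l' then 1 else iota q) * d0) (at s within {0..1})"
    unfolding r_def[abs_def] by (rule DERIV_cmult)
  let ?d = "(if l = l' then 1 else iota q) * d0"
  have im: "r l l' ` {0..1} \<subseteq> {-1..1}" using r_range by blast
  have "((\<lambda>s. xi (\<beta> l l') (r l l' s)) has_real_derivative Q l l' s * ?d) (at s within {0..1})"
    unfolding Q_def using DERIV_image_chain[OF DERIV_subset[OF xi_deriv_has_derivative[OF \<beta>_summable r_range[OF s(1)]] im] d]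
    by (simp add: o_def)
  then show "\<exists>d. (r l l' has_real_derivative d) (at s) \<and> ((\<lambda>s. xi (\<beta> l l') (r l l' s)) has_real_derivative Q l l' s * d) (at s)"
    using d unfolding w by blast
  obtain e where "(xi_deriv (\<beta> l l') has_real_derivative e) (at (r l l' s) within {-1..1})"
    using xi_deriv_differentiable[OF \<beta>_summable r_range[OF s(1)]] by blast
  from DERIV_image_chain[OF DERIV_subset[OF this im] d]
  have Qd: "(Q l l' has_real_derivative e * ?d) (at s within {0..1})" by (simp add: Q_def[abs_def] o_def)
  then have "vector_derivative (Q l l') (at s within {0..1}) = e * ?d"
    using s by (intro vector_derivative_within_closed_interval) (auto simp: has_real_derivative_iff_has_vector_derivative)
  moreover have "Q l l' differentiable (at s within {0..1})" using Qd by (auto simp: real_differentiable_def)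
  ultimately show "(Q l l' has_real_derivative T s $ l $ l') (at s)"
    using Qd unfolding T_component deriv_or_right_def w by simp
qed

lemma T_component_has_integral:
  assumes "0 \<le> a" "a \<le> b" "b \<le> 1"
  shows "((\<lambda>s. T s $ l $ l') has_integral Q l l' b - Q l l' a) {a..b}"
proof (rule fundamental_theorem_of_calculus_interior_strong[OF D_finite assms(2)])
  show "(Q l l' has_vector_derivative T s $ l $ l') (at s)" if "s \<in> {a<..<b} - D" for s
    using derivatives(1)[of s l l'] that assms by (auto simp: has_real_derivative_iff_has_vector_derivative)
  show "continuous_on {a..b} (Q l l')" by (rule continuous_on_subset[OF comp_cont(2)]) (use assms in auto)
qed

lemma G_has_integral:
  assumes "0 \<le> a" "a \<le> b" "b \<le> 1"
  shows "(G has_integral \<Theta> b - \<Theta> a) {a..b}"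
proof (rule fundamental_theorem_of_calculus_interior_strong[OF D_finite assms(2)])
  show "continuous_on {a..b} \<Theta>" by (rule continuous_on_subset[OF \<Theta>_cont]) (use assms in auto)
  fix s assume "s \<in> {a<..<b} - D"
  then have s: "s \<in> {0<..<1} - D" using assms by auto
  have "((\<lambda>s. r l l' s * Q l l' s - xi (\<beta> l l') (r l l' s)) has_real_derivative r l l' s * T s $ l $ l') (at s)" for l l'
  proof -
    obtain d where d: "(r l l' has_real_derivative d) (at s)" "((\<lambda>s. xi (\<beta> l l') (r l l' s)) has_real_derivative Q l l' s * d) (at s)"
      using derivatives(2)[OF s] by blast
    from DERIV_diff[OF DERIV_mult[OF d(1) derivatives(1)[OF s, of l l']] d(2)] show ?thesis by (simp add: mult.commute)
  qed
  then have "(\<Theta> has_real_derivative G s) (at s)"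
    unfolding \<Theta>_def[abs_def] G_def by (intro DERIV_sum)
  then show "(\<Theta> has_vector_derivative G s) (at s)" by (simp add: has_real_derivative_iff_has_vector_derivative)
qed

lemma T_has_integral:
  assumes "0 \<le> a" "a \<le> b" "b \<le> 1"
  shows "(T has_integral (\<chi> l l'. Q l l' b - Q l l' a)) {a..b}"
proof -
  define E :: "2 \<Rightarrow> 2 \<Rightarrow> real^2^2" where "E l l' = (\<chi> i j. if i = l \<and> j = l' then 1 else 0)" for l l'
  have eq: "(\<Sum>l\<in>UNIV. \<Sum>l'\<in>UNIV. M $ l $ l' *\<^sub>R E l l') = M" for M :: "real^2^2"
    by (simp add: vec_eq_iff forall_2 sum_2 E_def)
  have "((\<lambda>s. \<Sum>l\<in>UNIV. \<Sum>l'\<in>UNIV. T s $ l $ l' *\<^sub>R E l l') has_integral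
     (\<Sum>l\<in>UNIV. \<Sum>l'\<in>UNIV. (\<chi> l l'. Q l l' b - Q l l' a) $ l $ l' *\<^sub>R E l l')) {a..b}"
    by (intro has_integral_sum finite has_integral_scaleR_left) (simp add: T_component_has_integral[OF assms])
  then show ?thesis unfolding eq .
qed

lemma T_integral: "0 \<le> a \<Longrightarrow> a \<le> b \<Longrightarrow> b \<le> 1 \<Longrightarrow> integral {a..b} T $ l $ l' = Q l l' b - Q l l' a"
  using integral_unique[OF T_has_integral, of a b] by simp

lemma T_abs_le:
  assumes "s \<in> {0..1}" shows "\<bar>T s $ l $ l'\<bar> \<le> K"
proof -
  have "\<bar>T s $ l $ l'\<bar> = \<bar>(T s *v axis l' 1) $ l\<bar>" by (simp add: matrix_vector_mult_basis column_def)
  also have "\<dots> \<le> norm (T s *v axis l' 1)" by (rule component_le_norm_cart)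
  also have "\<dots> \<le> onorm ((*v) (T s)) * norm (axis l' 1 :: real^2)"
    by (rule onorm[OF matrix_vector_mul_bounded_linear])
  also have "\<dots> \<le> K" using T_onorm[OF assms] by simp
  finally show ?thesis .
qed

sublocale cov_density T K
proof
  fix s b :: real and i :: 2 assume s: "0 \<le> s" "s \<le> b" "b \<le> 1"
  note I = T_has_integral[OF s]
  show "T integrable_on {s..b}" using I by blast
  show "integral {s..b} T $ i $ i \<le> K * (b - s)"
  proof -
    have "((\<lambda>_. K) has_integral K * (b - s)) {s..b}" using has_integral_const_real[of K s b] s by (simp add: mult.commute)
    moreover have "T u $ i $ i \<le> K" if "u \<in> {s..b}" for u using T_abs_le[of u i i] that s by auto
    ultimately show ?thesis
      using has_integral_le[OF T_component_has_integral[OF s, of i i]] T_integral[OF s] by auto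
  qed
  show "pos_semidef (integral {s..b} T)"
    unfolding pos_semidef_def
  proof
    have sym: "T u $ l $ l' = T u $ l' $ l" if "u \<in> {s..b}" for u l l'
    proof -
      have "transpose (T u) = T u" using T_pos_semidef[of u] that s by (auto simp: pos_semidef_def)
      then have "transpose (T u) $ l $ l' = T u $ l $ l'" by (simp only:)
      then show ?thesis by (simp add: transpose_def)
    qed
    have "integral {s..b} T $ l $ l' = integral {s..b} T $ l' $ l" for l l'
    proof -
      have "((\<lambda>u. T u $ l $ l') has_integral Q l' l b - Q l' l s) {s..b}"
        using T_component_has_integral[OF s, of l' l] by (rule has_integral_eq[rotated]) (rule sym)
      then have "Q l' l b - Q l' l s = Q l l' b - Q l l' s"
        by (rule has_integral_unique[OF _ T_component_has_integral[OF s]])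
      then show ?thesis by (simp add: T_integral[OF s])
    qed
    then show "transpose (integral {s..b} T) = integral {s..b} T" by (simp add: vec_eq_iff transpose_def)
    show "\<forall>x. 0 \<le> x \<bullet> (integral {s..b} T *v x)"
    proof
      fix x :: "real^2"
      have lin: "x \<bullet> (M *v x) = (\<Sum>l\<in>UNIV. \<Sum>l'\<in>UNIV. (x $ l * x $ l') * M $ l $ l')" for M :: "real^2^2"
        by (simp add: inner_vec_def matrix_vector_mult_def sum_2 algebra_simps)
      have "((\<lambda>u. x \<bullet> (T u *v x)) has_integral x \<bullet> (integral {s..b} T *v x)) {s..b}"
        unfolding lin T_integral[OF s]
        by (intro has_integral_sum finite has_integral_mult_right T_component_has_integral s)
      then show "0 \<le> x \<bullet> (integral {s..b} T *v x)"
      proof (rule has_integral_nonneg)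
        show "0 \<le> x \<bullet> (T u *v x)" if "u \<in> {s..b}" for u
          using T_pos_semidef[of u] that s by (auto simp: pos_semidef_def)
      qed
    qed
  qed
qed (rule K_pos)

lemma G_eq:
  "(\<Sum>l\<in>UNIV. \<rho> l l s * T s $ l $ l) + iota q * (\<Sum>(l, l') \<in> {(l, l'). l \<noteq> l'}. \<rho> l l' s * T s $ l $ l') = G s"
proof -
  have "{(l, l'). l \<noteq> (l' :: 2)} = {(1, 2), (2, 1)}"
    by auto (metis exhaust_2)+
  then show ?thesis by (simp add: G_def r_def sum_2 algebra_simps)
qed

lemma G_abs_le: "s \<in> {0..1} \<Longrightarrow> \<bar>G s\<bar> \<le> 4 * K"
proof -
  assume s: "s \<in> {0..1}"
  have "\<bar>r l l' s * T s $ l $ l'\<bar> \<le> 1 * K" for l l'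
    unfolding abs_mult using T_abs_le[OF s] r_range[OF s, of l l'] by (intro mult_mono) auto
  from this[of 1 1] this[of 1 2] this[of 2 1] this[of 2 2] show ?thesis by (simp add: G_def sum_2)
qed

text \<open>Convexity enters here: with r fixed, xi(R) - R xi'(r) is smallest at R = r.\<close>

lemma tangent_bound:
  assumes "s \<in> {0..1}" "R \<in> {-1..1}"
  shows "xi (\<beta> l l') (r l l' s) - r l l' s * Q l l' s \<le> xi (\<beta> l l') R - R * Q l l' s"
  using convex_on_above_tangent_within[OF \<xi>_convex xi_deriv_has_derivative[OF \<beta>_summable r_range[OF assms(1)]] r_range[OF assms(1)] assms(2)]
  by (simp add: Q_def algebra_simps)

end

subsection \<open>Tensorization over the sites\<close>

type_synonym pair_config = "(nat \<Rightarrow> real) \<times> (nat \<Rightarrow> real)"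

definition spin :: "pair_config \<Rightarrow> 2 \<Rightarrow> nat \<Rightarrow> real" where
  "spin a l = (if l = 1 then fst a else snd a)"

text \<open>A field c in the plane acting at site i: its value at a pair (sigma, tau) is sigma_i c_1
  + tau_i c_2. Independent fields at the sites thereby generate Gaussian processes over
  pairs.\<close>

definition dir :: "nat \<Rightarrow> (2 \<Rightarrow> real) \<Rightarrow> pair_config \<Rightarrow> real" where
  "dir i c a = (\<Sum>l\<in>UNIV. spin a l i * c l)"

definition field_of :: "nat \<Rightarrow> (nat \<Rightarrow> 2 \<Rightarrow> real) \<Rightarrow> pair_config \<Rightarrow> real" where
  "field_of N y a = (\<Sum>i=1..N. dir i (y i) a)"

definition site_dirs :: "nat \<Rightarrow> real^2^2 \<Rightarrow> (pair_config \<Rightarrow> real) list" where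
  "site_dirs N C = concat (map (\<lambda>i. map (dir i) (dirs C)) [1..<Suc N])"

lemma cov_append: "cov (xs @ ys) a b = cov xs a b + cov ys a b"
  by (simp add: cov_def)

lemma cov_concat: "cov (concat xss) a b = (\<Sum>xs\<leftarrow>xss. cov xs a b)"
  by (induction xss) (auto simp: cov_append, simp add: cov_def)

lemma cov_map_dir:
  "cov (map (dir i) cs) a b = (\<Sum>l\<in>UNIV. \<Sum>l'\<in>UNIV. spin a l i * spin b l' i * cov cs l l')"
proof (induction cs)
  case (Cons c cs)
  have "dir i c a * dir i c b = (\<Sum>l\<in>UNIV. \<Sum>l'\<in>UNIV. spin a l i * spin b l' i * (c l * c l'))"
    unfolding dir_def sum_product by (simp add: mult_ac)
  then show ?case using Cons by (simp add: cov_def sum.distrib distrib_left)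
qed (simp add: cov_def)

text \<open>The products of spins at the N sites add up to N times the overlaps, so the covariance
  of the cascade is linear in the overlap where that of the disorder is a function xi of it.\<close>

lemma cov_site_dirs:
  assumes N: "1 \<le> N" and C: "pos_semidef C"
  shows "cov (site_dirs N C) a b = real N * (\<Sum>l\<in>UNIV. \<Sum>l'\<in>UNIV. overlap N (spin a l) (spin b l') * C $ l $ l')"
proof -
  have "cov (site_dirs N C) a b = (\<Sum>i=1..N. \<Sum>l\<in>UNIV. \<Sum>l'\<in>UNIV. spin a l i * spin b l' i * C $ l $ l')"
    unfolding site_dirs_def cov_concat map_map o_def cov_map_dir cov_dirs[OF C]
    by (subst interv_sum_list_conv_sum_set_nat) (simp only: set_upt atLeastLessThanSuc_atLeastAtMost)
  also have "\<dots> = (\<Sum>l\<in>UNIV. \<Sum>l'\<in>UNIV. (\<Sum>i=1..N. spin a l i * spin b l' i) * C $ l $ l')"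
    by (simp add: sum_2 sum.distrib sum_distrib_right)
  also have "\<dots> = (\<Sum>l\<in>UNIV. \<Sum>l'\<in>UNIV. real N * (overlap N (spin a l) (spin b l') * C $ l $ l'))"
    using N by (simp add: overlap_def)
  finally show ?thesis by (simp add: sum_distrib_left)
qed

lemma field_of_upd:
  assumes "j \<in> {1..N}"
  shows "field_of N (y(j := \<lambda>l. y j l + z * c l)) = (\<lambda>a. field_of N y a + z * dir j c a)"
proof
  fix a
  let ?y = "y(j := \<lambda>l. y j l + z * c l)"
  have "field_of N ?y a = dir j (?y j) a + (\<Sum>i\<in>{1..N} - {j}. dir i (?y i) a)"
    unfolding field_of_def using assms by (intro sum.remove) auto
  also have "(\<Sum>i\<in>{1..N} - {j}. dir i (?y i) a) = (\<Sum>i\<in>{1..N} - {j}. dir i (y i) a)"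
    by (intro sum.cong) auto
  also have "dir j (?y j) a = dir j (y j) a + z * dir j c a"
    by (simp add: dir_def distrib_left sum.distrib sum_distrib_left mult_ac)
  also have "dir j (y j) a + z * dir j c a + (\<Sum>i\<in>{1..N} - {j}. dir i (y i) a) = field_of N y a + z * dir j c a"
    unfolding field_of_def using assms by (subst sum.remove[of "{1..N}" j]) auto
  finally show "field_of N ?y a = field_of N y a + z * dir j c a" .
qed

text \<open>With the fields at the other sites fixed, noise at site j acts on the j-th summand only.
  An inequality is propagated, since at the bottom the constraint is dropped and only an inequality
  is available.\<close>

lemma tensor_site:
  fixes f :: "nat \<Rightarrow> (2 \<Rightarrow> real) \<Rightarrow> real"
  assumes m: "0 \<le> m" "m \<le> 1" and u: "lip A L u" and f: "\<And>i. lip UNIV L' (f i)" and j: "j \<in> {1..N}"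
    and le: "\<And>y. u (field_of N y) \<le> (\<Sum>i=1..N. f i (y i)) + k"
  shows "foldr (gauss_step m) (map (dir j) cs) u (field_of N y)
    \<le> (\<Sum>i=1..N. (f(j := foldr (gauss_step m) cs (f j))) i (y i)) + k"
proof (induction cs arbitrary: y)
  case Nil
  then show ?case using le by simp
next
  case (Cons c cs)
  let ?u = "foldr (gauss_step m) (map (dir j) cs) u"
  let ?g = "foldr (gauss_step m) cs (f j)"
  let ?S = "\<lambda>y. \<Sum>i\<in>{1..N} - {j}. f i (y i)"
  have sp: "(\<Sum>i=1..N. (f(j := g)) i (y i)) = g (y j) + ?S y" for g y
    using j by (subst sum.remove[of "{1..N}" j]) (auto intro!: sum.cong)
  have "gauss_step m (dir j c) ?u (field_of N y) \<le> gauss_step m c ?g (y j) + (?S y + k)"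
  proof (rule gauss_step_diff_le[OF lip_foldr_gauss_step[OF u m] lip_foldr_gauss_step[OF f m] m])
    fix z
    let ?y = "y(j := \<lambda>l. y j l + z * c l)"
    have "?u (field_of N ?y) \<le> ?g (?y j) + ?S ?y + k"
      using Cons[of ?y] unfolding sp .
    moreover have "?S ?y = ?S y" by (intro sum.cong) auto
    ultimately show "?u (\<lambda>a. field_of N y a + z * dir j c a) \<le> ?g (\<lambda>l. y j l + z * c l) + (?S y + k)"
      unfolding field_of_upd[OF j] by simp
  qed
  then show ?case unfolding sp by simp
qed

lemma tensor_sites:
  assumes m: "0 \<le> m" "m \<le> 1" and u: "lip A L u" and f: "lip UNIV L' f"
    and le: "\<And>y. u (field_of N y) \<le> (\<Sum>i=1..N. f (y i)) + k"
    and js: "distinct js" "set js \<subseteq> {1..N}"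
  shows "foldr (gauss_step m) (concat (map (\<lambda>i. map (dir i) cs) js)) u (field_of N y)
    \<le> (\<Sum>i=1..N. (if i \<in> set js then foldr (gauss_step m) cs f else f) (y i)) + k"
  using js
proof (induction js arbitrary: y)
  case Nil
  then show ?case using le by simp
next
  case (Cons j js)
  let ?f = "\<lambda>i. if i \<in> set js then foldr (gauss_step m) cs f else f"
  have *: "foldr (gauss_step m) (map (dir j) cs) (foldr (gauss_step m) (concat (map (\<lambda>i. map (dir i) cs) js)) u) (field_of N y)
     \<le> (\<Sum>i=1..N. (?f(j := foldr (gauss_step m) cs (?f j))) i (y i)) + k"
    by (rule tensor_site[OF m lip_foldr_gauss_step[OF u m], where L' = L'])
       (use Cons lip_foldr_gauss_step[OF f m] f in auto)
  have "(?f(j := foldr (gauss_step m) cs (?f j))) = (\<lambda>i. if i \<in> set (j # js) then foldr (gauss_step m) cs f else f)"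
    using Cons.prems by (auto simp: fun_eq_iff)
  with * show ?case by simp
qed

text \<open>The counterpart of \<open>hopf_cole\<close> for the whole system: same breakpoints and
  parameters, with independent noise of the same covariance at every site.\<close>

primrec levels :: "(real \<Rightarrow> real) \<Rightarrow> (real \<Rightarrow> real^2^2) \<Rightarrow> nat \<Rightarrow> real list \<Rightarrow> real \<Rightarrow> (real \<times> (pair_config \<Rightarrow> real)) list" where
  "levels a T N [] s = []"
| "levels a T N (b # bs) s = map (Pair (a s)) (site_dirs N (integral {s..b} T)) @ levels a T N bs b"

lemma levels_fst: "(\<And>u. 0 \<le> a u \<and> a u \<le> 1) \<Longrightarrow> x \<in> set (levels a T N bs s) \<Longrightarrow> 0 \<le> fst x \<and> fst x \<le> 1"
  by (induction bs arbitrary: s) auto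

lemma tensor_levels:
  assumes F: "lip A L F" and f: "lip UNIV L' (coord_fun f)" and a: "\<And>u. 0 \<le> a u \<and> a u \<le> 1"
    and le: "\<And>y. F (field_of N y) \<le> (\<Sum>i=1..N. coord_fun f (y i)) + k"
  shows "cascade F (levels a T N bs s) (field_of N y) \<le> (\<Sum>i=1..N. coord_fun (hopf_cole a T f bs s) (y i)) + k"
proof (induction bs arbitrary: s y)
  case Nil
  then show ?case using le by simp
next
  case (Cons b bs)
  have m: "0 \<le> a s" "a s \<le> 1" using a by auto
  have l: "lip A L (cascade F (levels a T N bs b))"
    by (rule lip_cascade[OF F]) (rule levels_fst[OF a])
  have "foldr (gauss_step (a s)) (site_dirs N (integral {s..b} T)) (cascade F (levels a T N bs b)) (field_of N y)
     \<le> (\<Sum>i=1..N. (if i \<in> set [1..<Suc N] then foldr (gauss_step (a s)) (dirs (integral {s..b} T)) (coord_fun (hopf_cole a T f bs b)) else coord_fun (hopf_cole a T f bs b)) (y i)) + k"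
    unfolding site_dirs_def by (rule tensor_sites[OF m l lip_hopf_cole[OF f a] Cons]) auto
  also have "\<dots> = (\<Sum>i=1..N. coord_fun (hopf_cole a T f (b # bs) s) (y i)) + k"
    using coord_fun_hopf_cole_step[OF lip_hopf_cole[OF f a] m] by (auto intro!: sum.cong)
  finally show ?case by (simp add: cascade_append cascade_map_eq_foldr)
qed

section \<open>Pairs of configurations with prescribed overlap\<close>

definition pairs :: "nat \<Rightarrow> real \<Rightarrow> pair_config set" where
  "pairs N q = {(\<sigma>, \<tau>) \<in> spin_configs N \<times> spin_configs N. overlap N \<sigma> \<tau> = q}"

lemma finite_spin_configs: "finite (spin_configs N)"
  unfolding spin_configs_def by (intro finite_PiE) auto

lemma finite_pairs: "finite (pairs N q)"
  by (rule finite_subset[of _ "spin_configs N \<times> spin_configs N"]) (auto simp: pairs_def finite_spin_configs)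

lemma pairs_nonempty: "q \<in> overlap_values N \<Longrightarrow> pairs N q \<noteq> {}"
  by (auto simp: overlap_values_def pairs_def)

lemma spin_config: "a \<in> pairs N q \<Longrightarrow> spin a l \<in> spin_configs N"
  by (auto simp: pairs_def spin_def)

lemma spin_square: "\<sigma> \<in> spin_configs N \<Longrightarrow> i \<in> {1..N} \<Longrightarrow> \<sigma> i * \<sigma> i = 1"
  unfolding spin_configs_def by (drule PiE_mem) auto

lemma overlap_self: "1 \<le> N \<Longrightarrow> \<sigma> \<in> spin_configs N \<Longrightarrow> overlap N \<sigma> \<sigma> = 1"
  by (simp add: overlap_def spin_square)

lemma overlap_commute: "overlap N \<sigma> \<tau> = overlap N \<tau> \<sigma>"
  by (simp add: overlap_def mult.commute)

lemma overlap_range: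
  assumes N: "1 \<le> N" and "\<sigma> \<in> spin_configs N" "\<tau> \<in> spin_configs N"
  shows "overlap N \<sigma> \<tau> \<in> {-1..1}"
proof -
  have "\<bar>\<Sum>i=1..N. \<sigma> i * \<tau> i\<bar> \<le> (\<Sum>i=1..N. 1)"
  proof (rule order_trans[OF sum_abs], rule sum_mono)
    fix i assume i: "i \<in> {1..N}"
    have "\<bar>\<sigma> i\<bar> = 1" "\<bar>\<tau> i\<bar> = 1"
      using assms(2,3) i unfolding spin_configs_def by (auto dest!: PiE_mem)
    then show "\<bar>\<sigma> i * \<tau> i\<bar> \<le> 1" by (simp add: abs_mult)
  qed
  then have "\<bar>overlap N \<sigma> \<tau>\<bar> \<le> 1" using N by (simp add: overlap_def)
  then show ?thesis by auto
qed

lemma overlap_values_abs: "1 \<le> N \<Longrightarrow> q \<in> overlap_values N \<Longrightarrow> \<bar>q\<bar> \<le> 1"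
  using overlap_range by (fastforce simp: overlap_values_def)

text \<open>On the constraint set the overlaps of a pair with itself equal the end values of the
  path; \<open>kernel_diag\<close> rests on this.\<close>

lemma overlap_pair:
  assumes "1 \<le> N" "a \<in> pairs N q" shows "overlap N (spin a l) (spin a l') = (if l = l' then 1 else q)"
proof -
  have s: "fst a \<in> spin_configs N" "snd a \<in> spin_configs N" "overlap N (fst a) (snd a) = q"
    using assms(2) by (auto simp: pairs_def)
  have "l = 1 \<or> l = 2" "l' = 1 \<or> l' = 2" by (rule exhaust_2)+
  then show ?thesis
    using s overlap_self[OF assms(1)] overlap_commute[of N "fst a" "snd a"] by (auto simp: spin_def)
qed

text \<open>On pairs with overlap \<open>q\<close> the factor \<open>exp (lam (\<Sum>\<^sub>i \<sigma>\<^sub>i \<tau>\<^sub>i - N q))\<close> is 1; inserting it and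
  dropping the constraint makes the sum over configurations factorize over the sites.\<close>

lemma log_sum_exp_terminal:
  assumes N: "1 \<le> N" and q: "q \<in> overlap_values N"
  shows "log_sum_exp (pairs N q) (field_of N y) \<le> (\<Sum>i=1..N. coord_fun (terminal lam) (y i)) + real N * (ln 4 - lam * q)"
proof -
  define g where "g i e f = exp (e * y i 1 + f * y i 2 + lam * (e * f))" for i and e f :: real
  have ne: "pairs N q \<noteq> {}" by (rule pairs_nonempty[OF q])
  have "(\<Sum>a\<in>pairs N q. exp (field_of N y a)) = (\<Sum>a\<in>pairs N q. (\<Prod>i=1..N. g i (fst a i) (snd a i)) * exp (- lam * (real N * q)))"
  proof (rule sum.cong[OF refl])
    fix a assume a: "a \<in> pairs N q"
    then have ov: "real N * q = (\<Sum>i=1..N. fst a i * snd a i)" using N by (auto simp: pairs_def overlap_def)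
    have "(\<Prod>i=1..N. g i (fst a i) (snd a i)) = exp (field_of N y a + lam * (real N * q))"
      unfolding g_def exp_sum[symmetric, OF finite_atLeastAtMost] ov field_of_def dir_def
      by (simp add: sum_2 spin_def sum.distrib sum_distrib_left)
    then show "exp (field_of N y a) = (\<Prod>i=1..N. g i (fst a i) (snd a i)) * exp (- lam * (real N * q))"
      by (simp add: exp_add[symmetric])
  qed
  also have "\<dots> = (\<Sum>a\<in>pairs N q. \<Prod>i=1..N. g i (fst a i) (snd a i)) * exp (- lam * (real N * q))"
    by (simp add: sum_distrib_right)
  also have "(\<Sum>a\<in>pairs N q. \<Prod>i=1..N. g i (fst a i) (snd a i)) \<le> (\<Sum>a\<in>spin_configs N \<times> spin_configs N. \<Prod>i=1..N. g i (fst a i) (snd a i))"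
    by (intro sum_mono2) (auto simp: finite_spin_configs pairs_def g_def intro!: prod_nonneg)
  also have "\<dots> = (\<Sum>\<sigma>\<in>spin_configs N. \<Sum>\<tau>\<in>spin_configs N. \<Prod>i=1..N. g i (\<sigma> i) (\<tau> i))"
    by (subst sum.cartesian_product) (simp add: case_prod_beta)
  also have "\<dots> = (\<Sum>\<sigma>\<in>spin_configs N. \<Prod>i=1..N. \<Sum>f\<in>{-1, 1}. g i (\<sigma> i) f)"
    unfolding spin_configs_def by (subst prod_sum_PiE) auto
  also have "\<dots> = (\<Prod>i=1..N. \<Sum>e\<in>{-1, 1}. \<Sum>f\<in>{-1, 1}. g i e f)"
    unfolding spin_configs_def by (subst prod_sum_PiE) auto
  also have "\<dots> = (\<Prod>i=1..N. exp (ln 4 + coord_fun (terminal lam) (y i)))"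
  proof (rule prod.cong[OF refl])
    fix i
    have "exp (ln 4 + coord_fun (terminal lam) (y i)) = 4 * exp (coord_fun (terminal lam) (y i))" by (simp add: exp_add)
    also have "\<dots> = (\<Sum>e\<in>{-1, 1}. \<Sum>f\<in>{-1, 1}. g i e f)"
      unfolding coord_fun_def exp_terminal g_def by (simp add: algebra_simps)
    finally show "(\<Sum>e\<in>{-1, 1}. \<Sum>f\<in>{-1, 1}. g i e f) = exp (ln 4 + coord_fun (terminal lam) (y i))" ..
  qed
  also have "\<dots> = exp (\<Sum>i=1..N. ln 4 + coord_fun (terminal lam) (y i))" by (simp add: exp_sum)
  finally have "(\<Sum>a\<in>pairs N q. exp (field_of N y a)) \<le> exp ((\<Sum>i=1..N. coord_fun (terminal lam) (y i)) + real N * (ln 4 - lam * q))"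
    by (simp add: exp_add[symmetric] sum.distrib algebra_simps)
  then have "exp (log_sum_exp (pairs N q) (field_of N y)) \<le> exp ((\<Sum>i=1..N. coord_fun (terminal lam) (y i)) + real N * (ln 4 - lam * q))"
    by (simp add: exp_log_sum_exp[OF finite_pairs ne])
  then show ?thesis by simp
qed

lemma bilin_ge:
  assumes "weights A p" "\<And>a b. a \<in> A \<Longrightarrow> b \<in> A \<Longrightarrow> c \<le> D a b" shows "c \<le> bilin A D p"
proof -
  have "c = c * ((\<Sum>a\<in>A. p a) * (\<Sum>b\<in>A. p b))" using assms(1) by (simp add: weights_def)
  also have "(\<Sum>a\<in>A. p a) * (\<Sum>b\<in>A. p b) = (\<Sum>a\<in>A. \<Sum>b\<in>A. p a * p b)" by (rule sum_product)
  also have "c * \<dots> = (\<Sum>a\<in>A. \<Sum>b\<in>A. c * (p a * p b))" by (simp only: sum_distrib_left)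
  also have "\<dots> \<le> bilin A D p"
    unfolding bilin_def using assms by (intro sum_mono mult_right_mono) (auto simp: weights_def)
  finally show ?thesis .
qed

lemma drift_le_cong:
  "(\<And>a b. a \<in> A \<Longrightarrow> b \<in> A \<Longrightarrow> D a b = D' a b) \<Longrightarrow> drift_le A L D m \<gamma> = drift_le A L D' m \<gamma>"
proof (induction L arbitrary: D D' m \<gamma>)
  case Nil
  then have "bilin A D p = bilin A D' p" "(\<Sum>a\<in>A. p a * D a a) = (\<Sum>a\<in>A. p a * D' a a)" for p
    unfolding bilin_def by (auto intro!: sum.cong)
  then show ?case by simp
next
  case (Cons s L)
  have b: "bilin A D p = bilin A D' p" for p
    unfolding bilin_def using Cons.prems by (auto intro!: sum.cong)
  have "drift_le A L (\<lambda>a b. D a b + k * (snd (snd s) a * snd (snd s) b)) (fst s) \<gamma>' = drift_le A L (\<lambda>a b. D' a b + k * (snd (snd s) a * snd (snd s) b)) (fst s) \<gamma>'" for k \<gamma>'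
    by (rule Cons.IH) (use Cons.prems in simp)
  then show ?case unfolding drift_le.simps b by simp
qed

text \<open>The first step of \<open>L\<close>, or the bottom, enters only through the distance of
  its parameter from the outer one. Going from m' to m and on to that parameter splits this
  distance, so the costs add.\<close>

lemma drift_le_change:
  assumes "drift_le A L D m \<gamma>'" "\<And>p. weights A p \<Longrightarrow> \<gamma>' - 1 / 2 * (m - m') * bilin A D p \<le> \<gamma>"
  shows "drift_le A L D m' \<gamma>"
proof (cases L)
  case Nil
  show ?thesis unfolding Nil drift_le.simps
  proof (intro allI impI)
    fix p assume p: "weights A p"
    have *: "1 / 2 * ((\<Sum>a\<in>A. p a * D a a) - (1 - m) * bilin A D p) \<le> \<gamma>'" using assms(1) p Nil by simp
    show "1 / 2 * ((\<Sum>a\<in>A. p a * D a a) - (1 - m') * bilin A D p) \<le> \<gamma>"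
    proof -
      have "1 / 2 * ((\<Sum>a\<in>A. p a * D a a) - (1 - m') * bilin A D p)
        = 1 / 2 * ((\<Sum>a\<in>A. p a * D a a) - (1 - m) * bilin A D p) - 1 / 2 * (m - m') * bilin A D p"
        by (simp add: field_simps)
      then show ?thesis using * assms(2)[OF p] by linarith
    qed
  qed
next
  case (Cons s L')
  then obtain g where g: "drift_le A L' (\<lambda>a b. D a b + (if fst (snd s) then 1 else - 1) * (snd (snd s) a * snd (snd s) b)) (fst s) g"
    "\<And>p. weights A p \<Longrightarrow> g - 1 / 2 * (fst s - m) * bilin A D p \<le> \<gamma>'"
    using assms(1) by auto
  have "g - 1 / 2 * (fst s - m') * bilin A D p \<le> \<gamma>" if p: "weights A p" for p
    using g(2)[OF p] assms(2)[OF p] by (simp add: field_simps)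
  then show ?thesis using g(1) Cons by auto
qed

text \<open>Inside a block of equal parameters the replica term has the factor m - m = 0, so only
  the total covariance of the block counts.\<close>

lemma drift_le_block:
  "drift_le A L (\<lambda>a b. D a b + (if g then 1 else -1) * cov cs a b) m \<gamma> \<Longrightarrow> drift_le A (map (\<lambda>c. (m, g, c)) cs @ L) D m \<gamma>"
proof (induction cs arbitrary: D)
  case Nil
  then show ?case by (simp add: cov_def)
next
  case (Cons c cs)
  let ?k = "if g then 1 else - 1 :: real"
  have eq: "(\<lambda>a b. (D a b + ?k * (c a * c b)) + ?k * cov cs a b) = (\<lambda>a b. D a b + ?k * cov (c # cs) a b)"
    by (simp add: cov_def fun_eq_iff distrib_left)
  have "drift_le A (map (\<lambda>c. (m, g, c)) cs @ L) (\<lambda>a b. D a b + ?k * (c a * c b)) m \<gamma>"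
    by (rule Cons.IH) (use Cons.prems in \<open>simp only: eq\<close>)
  then show ?case by (auto simp: if_distrib cong: if_cong)
qed

subsection \<open>The interpolation bound for atomic measures\<close>

context rsb
begin

text \<open>The integral of \<open>a * G\<close> over [s, 1] when \<open>a\<close> is constant
  between the breakpoints; see \<open>level_sum_has_integral\<close>.\<close>

primrec level_sum :: "(real \<Rightarrow> real) \<Rightarrow> real list \<Rightarrow> real \<Rightarrow> real" where
  "level_sum a [] s = 0"
| "level_sum a (b # bs) s = a s * (\<Theta> b - \<Theta> s) + level_sum a bs b"

text \<open>The time derivative of the covariance accumulated from the disorder, which grows, and
  from the cascade noise up to level s, which shrinks. Since \<open>Q\<close> vanishes at 0,
  \<open>Q l l' s\<close> is the integral of an entry of \<open>T\<close> over [0, s].\<close>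

definition kernel :: "nat \<Rightarrow> real \<Rightarrow> pair_config \<Rightarrow> pair_config \<Rightarrow> real" where
  "kernel N s a b = real N * (\<Sum>l\<in>UNIV. \<Sum>l'\<in>UNIV. xi (\<beta> l l') (overlap N (spin a l) (spin b l')) - overlap N (spin a l) (spin b l') * Q l l' s)"

lemma kernel_ge:
  assumes N: "1 \<le> N" and s: "s \<in> {0..1}" and "a \<in> pairs N q" "b \<in> pairs N q"
  shows "- real N * \<Theta> s \<le> kernel N s a b"
proof -
  have "- \<Theta> s = (\<Sum>l\<in>UNIV. \<Sum>l'\<in>UNIV. xi (\<beta> l l') (r l l' s) - r l l' s * Q l l' s)"
    unfolding \<Theta>_def by (simp add: sum_negf[symmetric] del: sum_negf)
  also have "\<dots> \<le> (\<Sum>l\<in>UNIV. \<Sum>l'\<in>UNIV. xi (\<beta> l l') (overlap N (spin a l) (spin b l')) - overlap N (spin a l) (spin b l') * Q l l' s)"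
    using assms by (intro sum_mono tangent_bound overlap_range spin_config) auto
  finally have "real N * - \<Theta> s \<le> kernel N s a b" unfolding kernel_def by (intro mult_left_mono) auto
  then show ?thesis by simp
qed

lemma kernel_diag: "1 \<le> N \<Longrightarrow> a \<in> pairs N q \<Longrightarrow> kernel N 1 a a = - real N * \<Theta> 1"
  unfolding kernel_def \<Theta>_def by (simp add: overlap_pair r_1 sum_2 algebra_simps)

lemma kernel_step:
  assumes "1 \<le> N" "0 \<le> s" "s \<le> b" "b \<le> 1"
  shows "kernel N s a a' - cov (site_dirs N (integral {s..b} T)) a a' = kernel N b a a'"
  unfolding kernel_def cov_site_dirs[OF assms(1) T_psd[OF assms(2-)]] T_integral[OF assms(2-)]
  by (simp add: right_diff_distrib[symmetric] sum_subtractf[symmetric]) (simp add: algebra_simps)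

text \<open>Abel summation from the innermost level outwards. At s = 1 the diagonal is
  \<open>- N * \<Theta> 1\<close> by the constraint, and the replica average, which enters with
  weight 1 - m', is at least as large. At a breakpoint the jump \<open>a s - m'\<close> is
  nonnegative because \<open>a\<close> increases, and \<open>bilin\<close> is at least
  \<open>- N * \<Theta> s\<close> by convexity. The terms recombine into \<open>level_sum\<close>
  and a boundary term m' \<open>\<Theta> s\<close>.\<close>

lemma drift_le_levels:
  assumes N: "1 \<le> N" and a: "\<And>u. 0 \<le> a u \<and> a u \<le> 1" and mono: "\<And>u v. s0 \<le> u \<Longrightarrow> u \<le> v \<Longrightarrow> v \<le> 1 \<Longrightarrow> a u \<le> a v"
    and "chain s bs" "0 \<le> s0" "s0 \<le> s" "m' \<le> a s" "m' \<le> 1"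
  shows "drift_le (pairs N q) (map (\<lambda>x. (fst x, False, snd x)) (levels a T N bs s)) (kernel N s) m' (- real N / 2 * (level_sum a bs s + m' * \<Theta> s))"
  using assms(4-)
proof (induction bs arbitrary: s m')
  case Nil
  then have s: "s = 1" by simp
  show ?case unfolding s levels.simps list.map drift_le.simps level_sum.simps
  proof (intro allI impI)
    fix p assume p: "weights (pairs N q) p"
    have "(\<Sum>a\<in>pairs N q. p a * kernel N 1 a a) = (\<Sum>a\<in>pairs N q. p a * (- real N * \<Theta> 1))"
      by (intro sum.cong refl) (simp add: kernel_diag[OF N])
    also have "\<dots> = (\<Sum>a\<in>pairs N q. p a) * (- real N * \<Theta> 1)" by (simp only: sum_distrib_right)
    also have "\<dots> = - real N * \<Theta> 1" using p by (simp add: weights_def)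
    finally have 1: "(\<Sum>a\<in>pairs N q. p a * kernel N 1 a a) = - real N * \<Theta> 1" .
    have "- real N * \<Theta> 1 \<le> bilin (pairs N q) (kernel N 1) p" by (rule bilin_ge[OF p kernel_ge[OF N]]) auto
    then have "(1 - m') * (- real N * \<Theta> 1) \<le> (1 - m') * bilin (pairs N q) (kernel N 1) p"
      using Nil by (intro mult_left_mono) auto
    then show "1 / 2 * ((\<Sum>a\<in>pairs N q. p a * kernel N 1 a a) - (1 - m') * bilin (pairs N q) (kernel N 1) p) \<le> - real N / 2 * (0 + m' * \<Theta> 1)"
      unfolding 1 by (simp add: algebra_simps)
  qed
next
  case (Cons b bs)
  have ch: "s < b" "chain b bs" "b \<le> 1" "0 \<le> s" "s0 \<le> b" using Cons.prems chain_le[of b bs] by auto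
  let ?L = "map (\<lambda>x. (fst x, False, snd x)) (levels a T N bs b)"
  let ?cs = "site_dirs N (integral {s..b} T)"
  have IH: "drift_le (pairs N q) ?L (kernel N b) (a s) (- real N / 2 * (level_sum a bs b + a s * \<Theta> b))"
    by (rule Cons.IH) (use ch Cons.prems mono[of s b] a in auto)
  have k: "kernel N b = (\<lambda>c d. kernel N s c d + (if False then 1 else - 1) * cov ?cs c d)"
    using kernel_step[OF N, of s b] ch by (simp add: fun_eq_iff)
  have "drift_le (pairs N q) (map (\<lambda>c. (a s, False, c)) ?cs @ ?L) (kernel N s) (a s) (- real N / 2 * (level_sum a bs b + a s * \<Theta> b))"
    by (rule drift_le_block) (use IH in \<open>simp only: k\<close>)
  then have "drift_le (pairs N q) (map (\<lambda>c. (a s, False, c)) ?cs @ ?L) (kernel N s) m' (- real N / 2 * (level_sum a (b # bs) s + m' * \<Theta> s))"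
  proof (rule drift_le_change)
    fix p assume p: "weights (pairs N q) p"
    have "- real N * \<Theta> s \<le> bilin (pairs N q) (kernel N s) p" by (rule bilin_ge[OF p kernel_ge[OF N]]) (use ch in auto)
    then have "(a s - m') * (- real N * \<Theta> s) \<le> (a s - m') * bilin (pairs N q) (kernel N s) p"
      using Cons.prems by (intro mult_left_mono) auto
    then show "- real N / 2 * (level_sum a bs b + a s * \<Theta> b) - 1 / 2 * (a s - m') * bilin (pairs N q) (kernel N s) p
       \<le> - real N / 2 * (level_sum a (b # bs) s + m' * \<Theta> s)"
      by (simp add: field_simps)
  qed
  then show ?case by (simp add: o_def)
qed

text \<open>The disorder is a block of steps with parameter 0 in front of the levels; its covariance
  is \<open>kernel N 0\<close>, as \<open>Q\<close> vanishes at 0. It is switched on while the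
  cascade noise is switched off, so time 1 is the free energy and time 0 the cascade, the steps
  scaled by 0 being trivial.\<close>

lemma interpolation_bound:
  assumes N: "1 \<le> N" and q: "q \<in> overlap_values N"
    and a: "\<And>u. 0 \<le> a u \<and> a u \<le> 1" and mono: "\<And>u v. 0 \<le> u \<Longrightarrow> u \<le> v \<Longrightarrow> v \<le> 1 \<Longrightarrow> a u \<le> a v"
    and ch: "chain 0 bs"
    and cs: "\<And>c d. c \<in> pairs N q \<Longrightarrow> d \<in> pairs N q \<Longrightarrow>
      cov cs c d = real N * (\<Sum>l\<in>UNIV. \<Sum>l'\<in>UNIV. xi (\<beta> l l') (overlap N (spin c l) (spin d l')))"
  shows "foldr (gauss_step 0) cs (log_sum_exp (pairs N q)) x \<le> cascade (log_sum_exp (pairs N q)) (levels a T N bs 0) x - real N / 2 * level_sum a bs 0"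
proof -
  let ?A = "pairs N q"
  let ?L = "map (\<lambda>x. (fst x, False, snd x)) (levels a T N bs 0)"
  let ?I = "map (\<lambda>c. (0, True, c)) cs @ ?L"
  have A: "finite ?A" "?A \<noteq> {}" using finite_pairs pairs_nonempty[OF q] by auto
  have I: "0 \<le> fst s \<and> fst s \<le> 1" if "s \<in> set ?I" for s
    using that levels_fst[OF a] by auto
  have b: "drift_le ?A ?I (\<lambda>_ _. 0) 0 (- real N / 2 * (level_sum a bs 0 + 0 * \<Theta> 0))"
  proof (rule drift_le_block)
    have "drift_le ?A ?L (kernel N 0) 0 (- real N / 2 * (level_sum a bs 0 + 0 * \<Theta> 0))"
      by (rule drift_le_levels[OF N a mono ch]) (use a in auto)
    moreover have "kernel N 0 c d = 0 + (if True then 1 else - 1) * cov cs c d" if "c \<in> ?A" "d \<in> ?A" for c d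
      unfolding cs[OF that] kernel_def by (simp add: Q_0)
    ultimately show "drift_le ?A ?L (\<lambda>c d. 0 + (if True then 1 else - 1) * cov cs c d) 0 (- real N / 2 * (level_sum a bs 0 + 0 * \<Theta> 0))"
      using drift_le_cong[of ?A "kernel N 0" "\<lambda>c d. 0 + (if True then 1 else - 1) * cov cs c d" ?L 0] by simp
  qed
  have z: "cascade F (map (\<lambda>s. (fst s, \<lambda>a. 0)) L) = F" for F :: "(pair_config \<Rightarrow> real) \<Rightarrow> real" and L :: "(real \<times> bool \<times> (pair_config \<Rightarrow> real)) list"
    by (induction L) auto
  have t1: "at_time 1 ?I = map (Pair 0) cs @ map (\<lambda>s. (fst s, \<lambda>a. 0)) ?L"
    by (simp add: at_time_def)
  have t0: "at_time 0 ?I = map (\<lambda>s. (fst s, \<lambda>a. 0)) (map (\<lambda>c. (0, True, c)) cs) @ levels a T N bs 0"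
    by (simp add: at_time_def o_def)
  have "cascade (log_sum_exp ?A) (at_time 1 ?I) x - cascade (log_sum_exp ?A) (at_time 0 ?I) x \<le> - real N / 2 * (level_sum a bs 0 + 0 * \<Theta> 0)"
    by (rule interpolation[OF A I b])
  then show ?thesis unfolding t1 t0 cascade_append z cascade_map_eq_foldr by simp
qed

lemma levels_bound:
  assumes N: "1 \<le> N" and q: "q \<in> overlap_values N" and a: "\<And>u. 0 \<le> a u \<and> a u \<le> 1"
  shows "cascade (log_sum_exp (pairs N q)) (levels a T N bs 0) (field_of N (\<lambda>_ l. h $ l))
    \<le> real N * (2 * ln 2 + hopf_cole a T (terminal lam) bs 0 h - lam * q)"
proof -
  have "cascade (log_sum_exp (pairs N q)) (levels a T N bs 0) (field_of N (\<lambda>_ l. h $ l))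
    \<le> (\<Sum>i=1..N. coord_fun (hopf_cole a T (terminal lam) bs 0) (\<lambda>l. h $ l)) + real N * (ln 4 - lam * q)"
    by (rule tensor_levels[OF lip_log_sum_exp[OF finite_pairs pairs_nonempty[OF q]] lip_terminal a log_sum_exp_terminal[OF N q]])
  moreover have "ln (4 :: real) = 2 * ln 2" using ln_realpow[of 2 2] by simp
  ultimately show ?thesis by (simp add: coord_fun_vec_nth[of _ h, symmetric] algebra_simps)
qed

end

section \<open>Gaussian processes as iterated steps\<close>

context prob_space
begin

lemma gaussian_rv_integrable:
  assumes "gaussian_rv M Y"
  shows "integrable M Y" "integrable M (\<lambda>x. (Y x)\<^sup>2)"
proof -
  have m [measurable]: "Y \<in> borel_measurable M" using assms by (simp add: gaussian_rv_def)
  have "integrable M Y \<and> integrable M (\<lambda>x. (Y x)\<^sup>2)"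
    using assms[unfolded gaussian_rv_def, THEN conjunct2]
  proof (elim disjE exE conjE)
    fix \<mu> s assume s: "0 < s" and D: "distributed M lborel Y (\<lambda>x. ennreal (normal_density \<mu> s x))"
    have i: "integrable M (\<lambda>x. (Y x - \<mu>) ^ k)" for k
      using distributed_integrable[OF D, of "\<lambda>x. (x - \<mu>) ^ k"] integrable_normal_moment[OF s, of \<mu> k]
      by (simp add: normal_density_nonneg)
    have "integrable M (\<lambda>x. (Y x - \<mu>) ^ 1 + \<mu>)"
      by (intro Bochner_Integration.integrable_add i integrable_const)
    moreover have "(\<lambda>x. (Y x - \<mu>) ^ 1 + \<mu>) = Y" by (simp add: fun_eq_iff)
    moreover have "integrable M (\<lambda>x. (Y x - \<mu>) ^ 2 + 2 * \<mu> * (Y x - \<mu>) ^ 1 + \<mu>\<^sup>2)"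
      by (intro Bochner_Integration.integrable_add integrable_mult_right i integrable_const)
    moreover have "(\<lambda>x. (Y x - \<mu>) ^ 2 + 2 * \<mu> * (Y x - \<mu>) ^ 1 + \<mu>\<^sup>2) = (\<lambda>x. (Y x)\<^sup>2)"
      by (simp add: fun_eq_iff power2_eq_square algebra_simps)
    ultimately show ?thesis by (simp only: simp_thms)
  next
    fix \<mu> assume ae: "AE \<omega> in M. Y \<omega> = \<mu>"
    have "integrable M Y \<longleftrightarrow> integrable M (\<lambda>_. \<mu>)" "integrable M (\<lambda>x. (Y x)\<^sup>2) \<longleftrightarrow> integrable M (\<lambda>_. \<mu>\<^sup>2)"
      by (intro integrable_cong_AE; use ae in auto)+
    then show ?thesis by simp
  qed
  then show "integrable M Y" "integrable M (\<lambda>x. (Y x)\<^sup>2)" by auto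
qed

lemma gaussian_rv_char:
  assumes "gaussian_rv M Y" "(\<integral>x. Y x \<partial>M) = 0"
  shows "(\<integral>x. iexp (Y x) \<partial>M) = of_real (exp (- (\<integral>x. (Y x)\<^sup>2 \<partial>M) / 2))"
proof -
  have m [measurable]: "Y \<in> borel_measurable M" using assms by (simp add: gaussian_rv_def)
  show ?thesis
    using assms(1)[unfolded gaussian_rv_def, THEN conjunct2]
  proof (elim disjE exE conjE)
    fix \<mu> s assume s: "0 < s" and D: "distributed M lborel Y (\<lambda>x. ennreal (normal_density \<mu> s x))"
    have \<mu>: "\<mu> = 0" using normal_distributed_expectation[OF s D] assms(2) by simp
    have v: "(\<integral>x. (Y x)\<^sup>2 \<partial>M) = s\<^sup>2" using normal_distributed_variance[OF s D] assms(2) by simp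
    have D': "distributed M lborel (\<lambda>x. Y x / s) (\<lambda>x. ennreal (std_normal_density x))"
      using D unfolding normal_standard_normal_convert[OF s] \<mu> by simp
    have "(\<integral>x. iexp (Y x) \<partial>M) = (\<integral>x. iexp (s * (Y x / s)) \<partial>M)" using s by simp
    also have "\<dots> = (\<integral>z. iexp (s * z) \<partial>distr M lborel (\<lambda>x. Y x / s))"
      by (subst integral_distr) auto
    also have "\<dots> = char std_normal_distribution s"
      unfolding distributed_distr_eq_density[OF D'] char_def by simp
    also have "\<dots> = of_real (exp (- s\<^sup>2 / 2))" using fun_cong[OF char_std_normal_distribution] by simp
    finally show ?thesis unfolding v .
  next
    fix \<mu> assume ae: "AE \<omega> in M. Y \<omega> = \<mu>"
    have c: "(\<integral>x. f (Y x) \<partial>M) = f \<mu>" if [measurable]: "f \<in> borel_measurable borel"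
      for f :: "real \<Rightarrow> 'b::{banach, second_countable_topology}"
    proof -
      have "(\<integral>x. f (Y x) \<partial>M) = (\<integral>x. f \<mu> \<partial>M)" by (rule integral_cong_AE) (use ae in auto)
      then show ?thesis by (simp add: prob_space)
    qed
    have "\<mu> = 0" using c[of "\<lambda>x. x"] assms(2) by simp
    then show ?thesis using c[of "\<lambda>x. x\<^sup>2"] c[of iexp] by simp
  qed
qed

end

text \<open>Only the sums X^1(sigma) + X^2(tau) enter the free energy. Their covariance over
  \<open>pairs\<close> is positive semi-definite, being a matrix of second moments, so it has a
  factorization \<open>cs\<close>; comparison of characteristic functions then identifies the law
  with that of the corresponding steps.\<close>

lemma gaussian_process_law:
  fixes X :: "2 \<Rightarrow> (nat \<Rightarrow> real) \<Rightarrow> 'a \<Rightarrow> real"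
  assumes "prob_space M"
    and jg: "jointly_gaussian M (UNIV \<times> spin_configs N) (\<lambda>(l, \<sigma>). X l \<sigma>)"
    and mean: "\<And>l \<sigma>. \<sigma> \<in> spin_configs N \<Longrightarrow> (\<integral>\<omega>. X l \<sigma> \<omega> \<partial>M) = 0"
    and cv: "\<And>l l' \<sigma> \<tau>. \<sigma> \<in> spin_configs N \<Longrightarrow> \<tau> \<in> spin_configs N \<Longrightarrow> (\<integral>\<omega>. X l \<sigma> \<omega> * X l' \<tau> \<omega> \<partial>M) = V l l' \<sigma> \<tau>"
  obtains cs where "\<And>a b. a \<in> pairs N q \<Longrightarrow> b \<in> pairs N q \<Longrightarrow>
      cov cs a b = (\<Sum>l\<in>UNIV. \<Sum>l'\<in>UNIV. V l l' (spin a l) (spin b l'))"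
    "\<And>f L x. lip (pairs N q) L f \<Longrightarrow>
      (\<integral>\<omega>. f (\<lambda>a. x a + (\<Sum>l\<in>UNIV. X l (spin a l) \<omega>)) \<partial>M) = foldr (gauss_step 0) cs f x"
proof -
  interpret prob_space M by fact
  let ?A = "pairs N q"
  let ?J = "(UNIV :: 2 set) \<times> spin_configs N"
  let ?V = "\<lambda>a b. \<Sum>l\<in>UNIV. \<Sum>l'\<in>UNIV. V l l' (spin a l) (spin b l')"
  define Y where "Y a \<omega> = (\<Sum>l\<in>UNIV. X l (spin a l) \<omega>)" for a \<omega>
  have fJ: "finite ?J" using finite_spin_configs by auto
  have gX: "gaussian_rv M (X l \<sigma>)" if "\<sigma> \<in> spin_configs N" for l \<sigma>
    using jg[unfolded jointly_gaussian_def, rule_format, of "{(l, \<sigma>)}" "\<lambda>_. 1"] that by simp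
  note iX = gaussian_rv_integrable[OF gX]
  have mX: "X l \<sigma> \<in> borel_measurable M" if "\<sigma> \<in> spin_configs N" for l \<sigma>
    using gX[OF that, of l] by (simp add: gaussian_rv_def)
  have iXX: "integrable M (\<lambda>\<omega>. X l \<sigma> \<omega> * X l' \<tau> \<omega>)" if "\<sigma> \<in> spin_configs N" "\<tau> \<in> spin_configs N" for l l' \<sigma> \<tau>
  proof (rule Bochner_Integration.integrable_bound[of _ "\<lambda>\<omega>. (X l \<sigma> \<omega>)\<^sup>2 + (X l' \<tau> \<omega>)\<^sup>2"])
    show "AE \<omega> in M. norm (X l \<sigma> \<omega> * X l' \<tau> \<omega>) \<le> norm ((X l \<sigma> \<omega>)\<^sup>2 + (X l' \<tau> \<omega>)\<^sup>2)"
    proof (intro AE_I2)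
      fix \<omega>
      have "2 * \<bar>X l \<sigma> \<omega>\<bar> * \<bar>X l' \<tau> \<omega>\<bar> \<le> \<bar>X l \<sigma> \<omega>\<bar>\<^sup>2 + \<bar>X l' \<tau> \<omega>\<bar>\<^sup>2" by (rule sum_squares_bound)
      moreover have "0 \<le> \<bar>X l \<sigma> \<omega>\<bar> * \<bar>X l' \<tau> \<omega>\<bar>" by simp
      moreover have "norm (X l \<sigma> \<omega> * X l' \<tau> \<omega>) = \<bar>X l \<sigma> \<omega>\<bar> * \<bar>X l' \<tau> \<omega>\<bar>" by (simp add: abs_mult)
      moreover have "norm ((X l \<sigma> \<omega>)\<^sup>2 + (X l' \<tau> \<omega>)\<^sup>2) = \<bar>X l \<sigma> \<omega>\<bar>\<^sup>2 + \<bar>X l' \<tau> \<omega>\<bar>\<^sup>2" by simp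
      ultimately show "norm (X l \<sigma> \<omega> * X l' \<tau> \<omega>) \<le> norm ((X l \<sigma> \<omega>)\<^sup>2 + (X l' \<tau> \<omega>)\<^sup>2)"
        by linarith
    qed
  qed (use iX that mX in auto)
  have YY: "(\<integral>\<omega>. Y a \<omega> * Y b \<omega> \<partial>M) = ?V a b" "integrable M (\<lambda>\<omega>. Y a \<omega> * Y b \<omega>)" if "a \<in> ?A" "b \<in> ?A" for a b
  proof -
    have e: "Y a \<omega> * Y b \<omega> = (\<Sum>l\<in>UNIV. \<Sum>l'\<in>UNIV. X l (spin a l) \<omega> * X l' (spin b l') \<omega>)" for \<omega>
      unfolding Y_def by (rule sum_product)
    note i = iXX[OF spin_config[OF that(1)] spin_config[OF that(2)]]
    show "integrable M (\<lambda>\<omega>. Y a \<omega> * Y b \<omega>)" unfolding e by (intro Bochner_Integration.integrable_sum i)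
    show "(\<integral>\<omega>. Y a \<omega> * Y b \<omega> \<partial>M) = ?V a b"
      unfolding e using i cv[OF spin_config[OF that(1)] spin_config[OF that(2)]] by simp
  qed
  define S where "S \<theta> \<omega> = (\<Sum>a\<in>?A. \<theta> a * Y a \<omega>)" for \<theta> \<omega>
  have S2: "(\<integral>\<omega>. (S \<theta> \<omega>)\<^sup>2 \<partial>M) = (\<Sum>a\<in>?A. \<Sum>b\<in>?A. \<theta> a * \<theta> b * ?V a b)" for \<theta>
  proof -
    have e: "(S \<theta> \<omega>)\<^sup>2 = (\<Sum>a\<in>?A. \<Sum>b\<in>?A. \<theta> a * \<theta> b * (Y a \<omega> * Y b \<omega>))" for \<omega>
      unfolding S_def power2_eq_square sum_product by (simp add: mult_ac)
    have "(\<integral>\<omega>. (S \<theta> \<omega>)\<^sup>2 \<partial>M) = (\<Sum>a\<in>?A. \<Sum>b\<in>?A. \<integral>\<omega>. \<theta> a * \<theta> b * (Y a \<omega> * Y b \<omega>) \<partial>M)"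
      unfolding e by (subst Bochner_Integration.integral_sum; (intro sum.cong refl Bochner_Integration.integral_sum)?)
        (auto intro!: Bochner_Integration.integrable_sum integrable_mult_right YY)
    then show ?thesis using YY by (simp cong: sum.cong)
  qed
  have Sg: "gaussian_rv M (S \<theta>)" for \<theta>
  proof -
    \<comment> \<open>Joint Gaussianity is given over configurations, not over pairs, and several
      pairs may share a configuration. The coefficient of \<open>X l \<sigma>\<close> collects all
      pairs whose l-th component is \<open>\<sigma>\<close>.\<close>
    define c where "c = (\<lambda>(l, \<sigma>). \<Sum>a\<in>?A. if spin a l = \<sigma> then \<theta> a else 0)"
    have "gaussian_rv M (\<lambda>\<omega>. \<Sum>j\<in>?J. c j * (case j of (l, \<sigma>) \<Rightarrow> X l \<sigma>) \<omega>)"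
      using jg fJ unfolding jointly_gaussian_def by blast
    also have "(\<lambda>\<omega>. \<Sum>j\<in>?J. c j * (case j of (l, \<sigma>) \<Rightarrow> X l \<sigma>) \<omega>) = S \<theta>"
    proof
      fix \<omega>
      have "(\<Sum>j\<in>?J. c j * (case j of (l, \<sigma>) \<Rightarrow> X l \<sigma>) \<omega>) = (\<Sum>l\<in>UNIV. \<Sum>\<sigma>\<in>spin_configs N. c (l, \<sigma>) * X l \<sigma> \<omega>)"
        by (subst sum.cartesian_product) (auto intro!: sum.cong)
      also have "\<dots> = (\<Sum>l\<in>UNIV. \<Sum>\<sigma>\<in>spin_configs N. \<Sum>a\<in>?A. if spin a l = \<sigma> then \<theta> a * X l \<sigma> \<omega> else 0)"
        unfolding c_def by (simp add: sum_distrib_right) (intro sum.cong refl, simp)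
      also have "\<dots> = (\<Sum>l\<in>UNIV. \<Sum>a\<in>?A. \<Sum>\<sigma>\<in>spin_configs N. if spin a l = \<sigma> then \<theta> a * X l \<sigma> \<omega> else 0)"
        by (intro sum.cong refl sum.swap)
      also have "\<dots> = (\<Sum>l\<in>UNIV. \<Sum>a\<in>?A. \<theta> a * X l (spin a l) \<omega>)"
        using finite_spin_configs spin_config by (intro sum.cong refl) (simp add: sum.delta)
      also have "\<dots> = S \<theta> \<omega>"
        unfolding S_def Y_def sum_distrib_left by (rule sum.swap)
      finally show "(\<Sum>j\<in>?J. c j * (case j of (l, \<sigma>) \<Rightarrow> X l \<sigma>) \<omega>) = S \<theta> \<omega>" .
    qed
    finally show ?thesis .
  qed
  have S0: "(\<integral>\<omega>. S \<theta> \<omega> \<partial>M) = 0" for \<theta>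
  proof -
    have "integrable M (Y a)" "(\<integral>\<omega>. Y a \<omega> \<partial>M) = 0" if "a \<in> ?A" for a
      unfolding Y_def[abs_def] using iX(1)[OF spin_config[OF that]] mean[OF spin_config[OF that]] by auto
    then show ?thesis unfolding S_def by (subst Bochner_Integration.integral_sum) auto
  qed
  have "\<exists>cs. \<forall>a\<in>?A. \<forall>b\<in>?A. cov cs a b = ?V a b"
  proof (rule psd_factor[OF finite_pairs])
    show "?V a b = ?V b a" if "a \<in> ?A" "b \<in> ?A" for a b
      using YY(1)[OF that] YY(1)[OF that(2,1)] by (simp add: mult.commute)
    show "0 \<le> (\<Sum>a\<in>?A. \<Sum>b\<in>?A. x a * x b * ?V a b)" for x
      unfolding S2[symmetric] by simp
  qed
  then obtain cs where cs: "\<And>a b. a \<in> ?A \<Longrightarrow> b \<in> ?A \<Longrightarrow> cov cs a b = ?V a b" by blast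
  show ?thesis
  proof (rule that[of cs, OF cs])
    fix f L x assume f: "lip ?A L f"
    have mY: "Y a \<in> borel_measurable M" if "a \<in> ?A" for a
      unfolding Y_def[abs_def] by (intro borel_measurable_sum mX spin_config[OF that])
    have law: "distr M (PiM ?A (\<lambda>_. borel)) (\<lambda>\<omega>. \<lambda>a\<in>?A. Y a \<omega>) = gauss_law ?A cs"
    proof (rule gauss_law_eqI[OF finite_pairs prob_space_axioms mY])
      fix \<theta>
      have "(\<Sum>a\<in>?A. \<Sum>b\<in>?A. \<theta> a * \<theta> b * cov cs a b) = (\<Sum>a\<in>?A. \<Sum>b\<in>?A. \<theta> a * \<theta> b * ?V a b)"
        by (intro sum.cong refl) (simp add: cs)
      then show "(\<integral>\<omega>. iexp (\<Sum>a\<in>?A. \<theta> a * Y a \<omega>) \<partial>M) = of_real (exp (- (\<Sum>a\<in>?A. \<Sum>b\<in>?A. \<theta> a * \<theta> b * cov cs a b) / 2))"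
        using gaussian_rv_char[OF Sg S0, of \<theta>] unfolding S2 unfolding S_def by (simp only:)
    qed
    have ms: "(\<lambda>y. f (\<lambda>a. x a + y a)) \<in> borel_measurable (PiM ?A (\<lambda>_. borel))"
      by (rule lip_measurable[OF finite_pairs lip_shift[OF f]])
    have mT: "(\<lambda>\<omega>. \<lambda>a\<in>?A. Y a \<omega>) \<in> measurable M (PiM ?A (\<lambda>_. borel))"
      by (intro measurable_restrict mY)
    have "foldr (gauss_step 0) cs f x = (\<integral>y. f (\<lambda>a. x a + y a) \<partial>gauss_law ?A cs)"
      by (subst foldr_gauss_step_eq_log_mean[OF finite_pairs f]) (auto simp: log_mean_def)
    also have "\<dots> = (\<integral>\<omega>. f (\<lambda>a. x a + (\<lambda>a\<in>?A. Y a \<omega>) a) \<partial>M)"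
      unfolding law[symmetric] by (rule integral_distr[OF mT ms])
    also have "\<dots> = (\<integral>\<omega>. f (\<lambda>a. x a + Y a \<omega>) \<partial>M)"
      by (intro Bochner_Integration.integral_cong refl lip_cong[OF f]) simp
    finally show "(\<integral>\<omega>. f (\<lambda>a. x a + (\<Sum>l\<in>UNIV. X l (spin a l) \<omega>)) \<partial>M) = foldr (gauss_step 0) cs f x"
      unfolding Y_def by simp
  qed
qed

subsection \<open>Extension to general measures\<close>

lemma chain_sorted:
  "sorted_wrt (<) xs \<Longrightarrow> (\<And>x. x \<in> set xs \<Longrightarrow> s < x \<and> x \<le> 1) \<Longrightarrow> 1 \<in> set xs \<Longrightarrow> chain s xs"
proof (induction xs arbitrary: s)
  case (Cons x xs)
  show ?case
  proof (cases "xs = []")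
    case True
    then show ?thesis using Cons.prems by simp
  next
    case False
    then have "x \<noteq> 1" using Cons.prems by (cases xs) force+
    then show ?thesis using Cons by auto
  qed
qed simp

lemma const_between_sorted:
  assumes "\<And>u v. 0 \<le> u \<Longrightarrow> u \<le> v \<Longrightarrow> v \<le> 1 \<Longrightarrow> J \<inter> {u<..v} = {} \<Longrightarrow> a u = a v"
  shows "0 \<le> s \<Longrightarrow> sorted_wrt (<) xs \<Longrightarrow> (\<And>x. x \<in> set xs \<Longrightarrow> s < x \<and> x \<le> 1) \<Longrightarrow> J \<inter> {s<..1} \<subseteq> set xs \<Longrightarrow> const_between a s xs"
proof (induction xs arbitrary: s)
  case (Cons x xs)
  have x: "s < x" "x \<le> 1" and xs: "\<And>y. y \<in> set xs \<Longrightarrow> x < y \<and> y \<le> 1" "sorted_wrt (<) xs"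
    using Cons.prems by auto
  have J: "J \<inter> {s<..1} \<subseteq> insert x (set xs)" using Cons.prems(4) by simp
  have "a u = a s" if u: "u \<in> {s..<x}" for u
  proof -
    have "J \<inter> {s<..u} = {}" using J xs(1) x u by fastforce
    then show ?thesis using assms[of s u] u x Cons.prems(1) by auto
  qed
  moreover have "const_between a x xs"
    by (rule Cons.IH) (use xs x Cons.prems(1) J in \<open>auto dest: subsetD\<close>)
  ultimately show ?case by (simp only: const_between.simps) blast
qed simp

text \<open>Allows two atomic measures to be evaluated on the union of their breakpoints, the common
  partition that \<open>hopf_cole_lipschitz\<close> demands.\<close>

lemma (in cov_density) hopf_cole_refine:
  assumes f: "lip UNIV L (coord_fun f)" and a: "\<And>u. 0 \<le> a u \<and> a u \<le> 1"
    and J: "\<And>u v. 0 \<le> u \<Longrightarrow> u \<le> v \<Longrightarrow> v \<le> 1 \<Longrightarrow> J \<inter> {u<..v} = {} \<Longrightarrow> a u = a v"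
    and P: "finite P" "P \<subseteq> {0<..1}" "1 \<in> P" "J \<inter> {0<..1} \<subseteq> P" and S: "finite S" "S \<subseteq> {0<..1}"
  shows "hopf_cole a T f (sorted_list_of_set (P \<union> S)) 0 = hopf_cole a T f (sorted_list_of_set P) 0"
  using S
proof (induction S rule: finite_induct)
  case (insert p S)
  have PS: "finite (P \<union> S)" "P \<union> S \<subseteq> {0<..1}" using insert P by auto
  show ?case
  proof (cases "p \<in> P \<union> S")
    case True
    then have "P \<union> insert p S = P \<union> S" by auto
    then show ?thesis using insert by simp
  next
    case False
    have p: "0 < p" "p < 1" using insert.prems False P(3) by (auto simp: less_le)
    have e: "sorted_list_of_set (P \<union> insert p S) = insort p (sorted_list_of_set (P \<union> S))"
      using sorted_list_of_set_insert[OF PS(1) False] by simp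
    have "hopf_cole a T f (insort p (sorted_list_of_set (P \<union> S))) 0 = hopf_cole a T f (sorted_list_of_set (P \<union> S)) 0"
    proof (rule hopf_cole_insort[OF f a])
      have sub: "\<And>x. x \<in> set (sorted_list_of_set (P \<union> S)) \<Longrightarrow> 0 < x \<and> x \<le> 1" using PS by auto
      show "chain 0 (sorted_list_of_set (P \<union> S))"
        by (rule chain_sorted) (use sub P PS in auto)
      show "const_between a 0 (sorted_list_of_set (P \<union> S))"
        by (rule const_between_sorted[where J = J, OF J]) (use sub P PS in auto)
    qed (use p False PS in auto)
    then show ?thesis using insert e by simp
  qed
qed simp

lemma integrable_on_increasing_mult:
  fixes f g :: "real \<Rightarrow> real"
  assumes "f integrable_on {a..b}" "a \<le> b" "\<And>x y. \<lbrakk>a \<le> x; x \<le> y; y \<le> b\<rbrakk> \<Longrightarrow> g x \<le> g y"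
  shows "(\<lambda>x. g x * f x) integrable_on {a..b}"
  by (rule second_mean_value_theorem_full[OF assms]) (auto intro: has_integral_integrable)

section \<open>Distribution functions of measures on the unit interval\<close>

context
  fixes \<mu> :: "real measure"
  assumes \<mu>: "\<mu> \<in> prob_measures"
begin

lemma prob_space_\<mu>: "prob_space \<mu>" and sets_\<mu>: "sets \<mu> = sets (restrict_space borel {0..1})"
  using \<mu> by (auto simp: prob_measures_def)

lemma space_\<mu>: "space \<mu> = {0..1}"
  using sets_eq_imp_space_eq[OF sets_\<mu>] by (simp add: space_restrict_space)

lemma in_sets_\<mu>: "B \<in> sets borel \<Longrightarrow> B \<subseteq> {0..1} \<Longrightarrow> B \<in> sets \<mu>"
  unfolding sets_\<mu> by (subst sets_restrict_space_iff) auto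

lemma alpha_bounds: "0 \<le> alpha \<mu> u \<and> alpha \<mu> u \<le> 1"
  using prob_space.prob_le_1[OF prob_space_\<mu>] by (simp add: alpha_def)

lemma alpha_mono: "u \<le> v \<Longrightarrow> v \<le> 1 \<Longrightarrow> alpha \<mu> u \<le> alpha \<mu> v"
proof -
  interpret prob_space \<mu> by (rule prob_space_\<mu>)
  assume "u \<le> v" "v \<le> 1"
  then show ?thesis unfolding alpha_def by (intro finite_measure_mono in_sets_\<mu>) auto
qed

lemma alpha_integrable: "alpha \<mu> integrable_on {0..1}"
  using integrable_on_increasing_mult[OF integrable_const_ivl[of "1::real" 0 1], of "alpha \<mu>"] alpha_mono by simp

end

lemma alpha_diff_integrable:
  assumes "\<mu> \<in> prob_measures" "\<nu> \<in> prob_measures"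
  shows "(\<lambda>s. \<bar>alpha \<mu> s - alpha \<nu> s\<bar>) integrable_on {0..1}"
proof -
  have "(\<lambda>s. alpha \<mu> s - alpha \<nu> s) absolutely_integrable_on {0..1}"
  proof (rule absolutely_integrable_integrable_bound[where g = "\<lambda>_. 1"])
    show "norm (alpha \<mu> s - alpha \<nu> s) \<le> 1" for s
      using alpha_bounds[OF assms(1), of s] alpha_bounds[OF assms(2), of s] by auto
  qed (auto intro!: integrable_diff alpha_integrable assms)
  then show ?thesis by (simp add: absolutely_integrable_on_def)
qed

lemma alpha_dist_triangle:
  assumes "\<mu> \<in> prob_measures" "\<nu> \<in> prob_measures" "\<nu>' \<in> prob_measures"
  shows "alpha_dist \<nu> \<nu>' \<le> alpha_dist \<mu> \<nu> + alpha_dist \<mu> \<nu>'"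
proof -
  have "alpha_dist \<nu> \<nu>' \<le> integral {0..1} (\<lambda>s. \<bar>alpha \<mu> s - alpha \<nu> s\<bar> + \<bar>alpha \<mu> s - alpha \<nu>' s\<bar>)"
    unfolding alpha_dist_def
    by (intro integral_le alpha_diff_integrable assms Henstock_Kurzweil_Integration.integrable_add) auto
  also have "\<dots> = alpha_dist \<mu> \<nu> + alpha_dist \<mu> \<nu>'"
    unfolding alpha_dist_def by (intro Henstock_Kurzweil_Integration.integral_add alpha_diff_integrable assms)
  finally show ?thesis .
qed

lemma alpha_dist_nonneg: "\<mu> \<in> prob_measures \<Longrightarrow> \<nu> \<in> prob_measures \<Longrightarrow> 0 \<le> alpha_dist \<mu> \<nu>"
  unfolding alpha_dist_def by (intro Henstock_Kurzweil_Integration.integral_nonneg alpha_diff_integrable) auto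

text \<open>The finite carrier A of full measure may contain points of mass 0, so it contains
  \<open>atoms\<close> without having to equal it. Between atoms the distribution function is
  constant, because a half-open interval carries only the mass of its points in A.\<close>

lemma atoms_finite:
  assumes "\<nu> \<in> atomic_measures" shows "finite (atoms \<nu>)"
    and "\<And>u v. 0 \<le> u \<Longrightarrow> u \<le> v \<Longrightarrow> v \<le> 1 \<Longrightarrow> atoms \<nu> \<inter> {u<..v} = {} \<Longrightarrow> alpha \<nu> u = alpha \<nu> v"
proof -
  have \<nu>: "\<nu> \<in> prob_measures" using assms by (simp add: atomic_measures_def)
  interpret prob_space \<nu> by (rule prob_space_\<mu>[OF \<nu>])
  obtain A where A: "A \<subseteq> {0..1}" "finite A" "measure \<nu> A = 1" using assms by (auto simp: atomic_measures_def)
  note msets = in_sets_\<mu>[OF \<nu>]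
  have sA: "A \<in> sets \<nu>" using A by (intro msets) (auto intro: finite_imp_closed borel_closed)
  have z: "measure \<nu> B = 0" if "B \<in> sets \<nu>" "B \<inter> A = {}" for B
  proof -
    have "measure \<nu> (B \<union> A) = measure \<nu> B + measure \<nu> A" using that sA by (intro finite_measure_Union) auto
    then show ?thesis using A(3) prob_le_1[of "B \<union> A"] measure_nonneg[of \<nu> B] by linarith
  qed
  have "atoms \<nu> \<subseteq> A"
  proof
    fix t assume t: "t \<in> atoms \<nu>"
    then have "{t} \<in> sets \<nu>" by (intro msets) (auto simp: atoms_def)
    then show "t \<in> A" using z[of "{t}"] t by (auto simp: atoms_def)
  qed
  then show "finite (atoms \<nu>)" using A(2) by (rule finite_subset)
  fix u v :: real assume uv: "0 \<le> u" "u \<le> v" "v \<le> 1" and e: "atoms \<nu> \<inter> {u<..v} = {}"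
  have s: "{0..u} \<in> sets \<nu>" "{u<..v} \<in> sets \<nu>" using uv by (auto intro!: msets)
  have fin: "finite ({u<..v} \<inter> A)" using A(2) by simp
  have "measure \<nu> {u<..v} = measure \<nu> ({u<..v} \<inter> A) + measure \<nu> ({u<..v} - A)"
    using s sA by (subst finite_measure_Union[symmetric]) (auto simp: Int_Diff_Un)
  also have "measure \<nu> ({u<..v} - A) = 0" by (rule z) (use s sA in auto)
  also have "measure \<nu> ({u<..v} \<inter> A) = (\<Sum>t\<in>{u<..v} \<inter> A. measure \<nu> {t})"
    by (rule finite_measure_eq_sum_singleton[OF fin]) (use uv in \<open>auto intro!: msets\<close>)
  also have "\<dots> = 0"
  proof (rule sum.neutral, rule ballI)
    fix t assume t: "t \<in> {u<..v} \<inter> A"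
    then have "t \<notin> atoms \<nu>" using e by auto
    then show "measure \<nu> {t} = 0" using t uv measure_nonneg[of \<nu> "{t}"] by (auto simp: atoms_def)
  qed
  finally have "measure \<nu> {u<..v} = 0" by simp
  moreover have "measure \<nu> ({0..u} \<union> {u<..v}) = measure \<nu> {0..u} + measure \<nu> {u<..v}"
    using s by (intro finite_measure_Union) auto
  moreover have "{0..u} \<union> {u<..v} = {0..v}" using uv by auto
  ultimately show "alpha \<nu> u = alpha \<nu> v" by (simp add: alpha_def)
qed

text \<open>Rounding up to the grid of mesh \<open>1/n\<close> pushes \<open>\<mu>\<close> forward to an atomic measure whose
  distribution function lies between \<open>alpha \<mu> (s - 1/n)\<close> and \<open>alpha \<mu> s\<close>.\<close>

lemma atomic_approximation:
  assumes \<mu>: "\<mu> \<in> prob_measures" and n: "0 < n"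
  shows "\<exists>\<nu>\<in>atomic_measures. alpha_dist \<mu> \<nu> \<le> 1 / real n"
proof -
  interpret prob_space \<mu> by (rule prob_space_\<mu>[OF \<mu>])
  define g where "g t = real_of_int \<lceil>real n * t\<rceil> / real n" for t
  let ?R = "restrict_space borel {0..1::real}"
  define \<nu> where "\<nu> = distr \<mu> ?R g"
  have g01: "g t \<in> {0..1}" if "t \<in> {0..1}" for t
  proof -
    have "0 \<le> real n * t" "real n * t \<le> real n" using that n by (auto simp: mult_left_le)
    then have "0 \<le> \<lceil>real n * t\<rceil>" "\<lceil>real n * t\<rceil> \<le> int n" by (auto simp: ceiling_le_iff)
    then have "0 \<le> real_of_int \<lceil>real n * t\<rceil>" "real_of_int \<lceil>real n * t\<rceil> \<le> real n" by linarith+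
    then show ?thesis using n by (simp add: g_def)
  qed
  have gm: "g \<in> measurable \<mu> ?R"
  proof (rule measurable_restrict_space2)
    show "g \<in> space \<mu> \<rightarrow> {0..1}" using g01 space_\<mu>[OF \<mu>] by auto
    have "g \<in> borel_measurable borel" unfolding g_def[abs_def] by measurable
    then show "g \<in> borel_measurable \<mu>"
      using sets_\<mu>[OF \<mu>] by (simp cong: measurable_cong_sets add: measurable_restrict_space1)
  qed
  have \<nu>p: "\<nu> \<in> prob_measures" unfolding prob_measures_def \<nu>_def using prob_space_distr[OF gm] by simp
  define A where "A = (\<lambda>k. real k / real n) ` {..n}"
  have A: "A \<subseteq> {0..1}" "finite A" using n by (auto simp: A_def)
  have gA: "g t \<in> A" if "t \<in> {0..1}" for t
  proof -
    have "0 \<le> real n * t" "real n * t \<le> real n" using that n by (auto simp: mult_left_le)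
    then have c: "0 \<le> \<lceil>real n * t\<rceil>" "\<lceil>real n * t\<rceil> \<le> int n" by (auto simp: ceiling_le_iff)
    then have "g t = real (nat \<lceil>real n * t\<rceil>) / real n" "nat \<lceil>real n * t\<rceil> \<le> n" by (simp_all add: g_def nat_le_iff)
    then show ?thesis unfolding A_def by (intro image_eqI[of _ _ "nat \<lceil>real n * t\<rceil>"]) auto
  qed
  have sA: "A \<in> sets ?R" using A by (subst sets_restrict_space_iff) (auto intro: finite_imp_closed borel_closed)
  have "measure \<nu> A = measure \<mu> (g -` A \<inter> space \<mu>)" unfolding \<nu>_def by (rule measure_distr[OF gm sA])
  also have "g -` A \<inter> space \<mu> = space \<mu>" using gA space_\<mu>[OF \<mu>] by auto
  finally have "measure \<nu> A = 1" by (simp add: prob_space)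
  then have \<nu>a: "\<nu> \<in> atomic_measures" using \<nu>p A by (auto simp: atomic_measures_def)
  define d where "d = 1 / real n"
  have d: "0 < d" "d \<le> 1" using n by (auto simp: d_def)
  have al: "alpha \<nu> s \<le> alpha \<mu> s" "alpha \<mu> (s - d) \<le> alpha \<nu> s" if s: "s \<in> {0..1}" for s
  proof -
    have "{0..s} \<in> sets ?R" using s by (subst sets_restrict_space_iff) auto
    then have a: "alpha \<nu> s = measure \<mu> (g -` {0..s} \<inter> space \<mu>)" unfolding alpha_def \<nu>_def by (rule measure_distr[OF gm])
    have gs: "g -` {0..s} \<inter> space \<mu> \<in> sets \<mu>" using gm \<open>{0..s} \<in> sets ?R\<close> by (rule measurable_sets)
    have t_le: "t \<le> g t" "g t \<le> t + d" for t
    proof -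
      have "real n * t \<le> real_of_int \<lceil>real n * t\<rceil>" "real_of_int \<lceil>real n * t\<rceil> \<le> real n * t + 1" by linarith+
      then show "t \<le> g t" "g t \<le> t + d" using n by (auto simp: g_def d_def field_simps)
    qed
    show "alpha \<nu> s \<le> alpha \<mu> s"
      unfolding a unfolding alpha_def
      by (intro finite_measure_mono in_sets_\<mu>[OF \<mu>]) (use s space_\<mu>[OF \<mu>] in \<open>auto intro: order_trans[OF t_le(1)]\<close>)
    have "{0..s - d} \<subseteq> g -` {0..s} \<inter> space \<mu>"
    proof
      fix t assume t: "t \<in> {0..s - d}"
      then have "t \<in> {0..1}" using s d by auto
      then show "t \<in> g -` {0..s} \<inter> space \<mu>" using t_le(2)[of t] t g01[of t] space_\<mu>[OF \<mu>] by auto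
    qed
    then show "alpha \<mu> (s - d) \<le> alpha \<nu> s"
      unfolding a unfolding alpha_def by (intro finite_measure_mono gs)
  qed
  let ?a = "alpha \<mu>"
  have i1: "?a integrable_on {0..1}" by (rule alpha_integrable[OF \<mu>])
  have i2: "(\<lambda>s. ?a (s - d)) integrable_on {0..1}"
    using integrable_on_increasing_mult[OF integrable_const_ivl[of "1::real" 0 1], of "\<lambda>s. ?a (s - d)"] alpha_mono[OF \<mu>] d by simp
  have i3: "?a integrable_on {0..1 - d}" by (rule integrable_subinterval_real[OF i1]) (use d in auto)
  have "((\<lambda>s. ?a (1 *\<^sub>R s + - d)) has_integral (integral {0..1 - d} ?a /\<^sub>R 1 ^ DIM(real))) (cbox ((0 - - d) /\<^sub>R 1) ((1 - d - - d) /\<^sub>R 1))"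
    by (rule has_integral_affinity') (use i3 in auto)
  then have sh: "((\<lambda>s. ?a (s - d)) has_integral integral {0..1 - d} ?a) {d..1}" by simp
  \<comment> \<open>After the shift by d the two integrals cancel except over [1 - d, 1], where
    alpha is at most 1.\<close>
  have "alpha_dist \<mu> \<nu> \<le> integral {0..1} (\<lambda>s. ?a s - ?a (s - d))"
    unfolding alpha_dist_def
    by (rule integral_le[OF alpha_diff_integrable[OF \<mu> \<nu>p] Henstock_Kurzweil_Integration.integrable_diff[OF i1 i2]])
       (use al in force)
  also have "\<dots> = integral {0..1} ?a - integral {0..1} (\<lambda>s. ?a (s - d))"
    by (rule Henstock_Kurzweil_Integration.integral_diff[OF i1 i2])
  also have "\<dots> \<le> integral {0..1} ?a - integral {0..1 - d} ?a"
  proof -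
    have "integral {d..1} (\<lambda>s. ?a (s - d)) \<le> integral {0..1} (\<lambda>s. ?a (s - d))"
      by (rule integral_subset_le) (use sh i2 d alpha_bounds[OF \<mu>] in auto)
    then show ?thesis using integral_unique[OF sh] by simp
  qed
  also have "integral {0..1} ?a = integral {0..1 - d} ?a + integral {1 - d..1} ?a"
    by (rule Henstock_Kurzweil_Integration.integral_combine[symmetric]) (use d i1 in auto)
  also have "integral {0..1 - d} ?a + integral {1 - d..1} ?a - integral {0..1 - d} ?a \<le> integral {1 - d..1} (\<lambda>_. 1)"
  proof -
    have "?a integrable_on {1 - d..1}" by (rule integrable_subinterval_real[OF i1]) (use d in auto)
    then have "integral {1 - d..1} ?a \<le> integral {1 - d..1} (\<lambda>_. 1)"
      using alpha_bounds[OF \<mu>] by (intro integral_le) auto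
    then show ?thesis by simp
  qed
  also have "\<dots> = d" using d by simp
  finally show ?thesis using \<nu>a unfolding d_def by blast
qed

section \<open>Psi for general measures and the passage to the limit\<close>

context rsb
begin

lemma level_sum_has_integral:
  "chain s bs \<Longrightarrow> const_between a s bs \<Longrightarrow> 0 \<le> s \<Longrightarrow> ((\<lambda>u. a u * G u) has_integral level_sum a bs s) {s..1}"
proof (induction bs arbitrary: s)
  case Nil
  then show ?case by (simp add: has_integral_refl)
next
  case (Cons b bs)
  have s: "s < b" "chain b bs" "b \<le> 1" "0 \<le> s" using Cons.prems(1,3) chain_le[of b bs] by auto
  have cb: "const_between a b bs" "\<And>u. u \<in> {s..<b} \<Longrightarrow> a u = a s"
    using Cons.prems(2) by (simp_all only: const_between.simps Ball_def)
  have "((\<lambda>u. a s * G u) has_integral a s * (\<Theta> b - \<Theta> s)) {s..b}"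
    using s by (intro has_integral_mult_right G_has_integral) auto
  then have "((\<lambda>u. a u * G u) has_integral a s * (\<Theta> b - \<Theta> s)) {s..b}"
  proof (rule has_integral_spike[of "{b}", rotated 2])
    fix u assume "u \<in> {s..b} - {b}"
    then have "u \<in> {s..<b}" by auto
    from cb(2)[OF this] show "a u * G u = a s * G u" by (simp only:)
  qed simp
  from has_integral_combine[OF _ _ this Cons.IH[OF s(2) cb(1)]] s show ?case by simp
qed

lemma alpha_G_integrable:
  assumes "\<mu> \<in> prob_measures" shows "(\<lambda>s. alpha \<mu> s * G s) integrable_on {0..1}"
  using integrable_on_increasing_mult[OF has_integral_integrable[OF G_has_integral[of 0 1]], of "alpha \<mu>"] alpha_mono[OF assms] by simp

lemma alpha_G_close:
  assumes \<mu>: "\<mu> \<in> prob_measures" and \<nu>: "\<nu> \<in> prob_measures"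
  shows "\<bar>integral {0..1} (\<lambda>s. alpha \<mu> s * G s) - integral {0..1} (\<lambda>s. alpha \<nu> s * G s)\<bar> \<le> 4 * K * alpha_dist \<mu> \<nu>"
proof -
  have "\<bar>integral {0..1} (\<lambda>s. alpha \<mu> s * G s) - integral {0..1} (\<lambda>s. alpha \<nu> s * G s)\<bar>
     = norm (integral {0..1} (\<lambda>s. alpha \<mu> s * G s - alpha \<nu> s * G s))"
    by (subst Henstock_Kurzweil_Integration.integral_diff) (auto intro!: alpha_G_integrable \<mu> \<nu>)
  also have "\<dots> \<le> integral {0..1} (\<lambda>s. 4 * K * \<bar>alpha \<mu> s - alpha \<nu> s\<bar>)"
  proof (rule integral_norm_bound_integral)
    show "(\<lambda>s. alpha \<mu> s * G s - alpha \<nu> s * G s) integrable_on {0..1}"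
      by (intro Henstock_Kurzweil_Integration.integrable_diff alpha_G_integrable \<mu> \<nu>)
    show "(\<lambda>s. 4 * K * \<bar>alpha \<mu> s - alpha \<nu> s\<bar>) integrable_on {0..1}"
      by (intro integrable_on_mult_right alpha_diff_integrable \<mu> \<nu>)
    fix s :: real assume "s \<in> {0..1}"
    then have "\<bar>G s\<bar> * \<bar>alpha \<mu> s - alpha \<nu> s\<bar> \<le> 4 * K * \<bar>alpha \<mu> s - alpha \<nu> s\<bar>"
      by (intro mult_right_mono G_abs_le) auto
    then show "norm (alpha \<mu> s * G s - alpha \<nu> s * G s) \<le> 4 * K * \<bar>alpha \<mu> s - alpha \<nu> s\<bar>"
      by (simp add: left_diff_distrib[symmetric] abs_mult mult.commute)
  qed
  also have "\<dots> = 4 * K * alpha_dist \<mu> \<nu>" by (simp add: alpha_dist_def)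
  finally show ?thesis .
qed

definition breaks :: "real measure \<Rightarrow> real set" where
  "breaks \<nu> = (atoms \<nu> \<union> kinks \<rho> \<union> {1}) \<inter> {0<..1}"

lemma finite_kinks: "finite (kinks \<rho>)"
  by (rule finite_subset[OF _ D_finite]) (use \<rho>_diff in \<open>auto simp: kinks_def\<close>)

lemma breaks:
  assumes "\<nu> \<in> atomic_measures"
  shows "finite (breaks \<nu>)" "breaks \<nu> \<subseteq> {0<..1}" "1 \<in> breaks \<nu>" "atoms \<nu> \<inter> {0<..1} \<subseteq> breaks \<nu>"
  using atoms_finite[OF assms] finite_kinks by (auto simp: breaks_def)

lemma Psi_atomic_eq:
  assumes \<nu>: "\<nu> \<in> atomic_measures" and S: "finite S" "S \<subseteq> {0<..1}"
  shows "Psi_atomic \<beta> \<rho> q \<nu> lam 0 x = hopf_cole (alpha \<nu>) T (terminal lam) (sorted_list_of_set (breaks \<nu> \<union> S)) 0 x"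
proof -
  have p: "\<nu> \<in> prob_measures" using \<nu> by (simp add: atomic_measures_def)
  have "hopf_cole (alpha \<nu>) T (terminal lam) (sorted_list_of_set (breaks \<nu> \<union> S)) 0 = hopf_cole (alpha \<nu>) T (terminal lam) (sorted_list_of_set (breaks \<nu>)) 0"
    by (rule hopf_cole_refine[OF lip_terminal alpha_bounds[OF p] atoms_finite(2)[OF \<nu>] breaks[OF \<nu>] S])
  then show ?thesis by (simp add: Psi_atomic_def breaks_def)
qed

lemma partition:
  assumes \<nu>: "\<nu> \<in> atomic_measures" and S: "finite S" "S \<subseteq> {0<..1}"
  shows "chain 0 (sorted_list_of_set (breaks \<nu> \<union> S))" "const_between (alpha \<nu>) 0 (sorted_list_of_set (breaks \<nu> \<union> S))"
proof -
  note b = breaks[OF \<nu>]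
  have fin: "finite (breaks \<nu> \<union> S)" using b S by auto
  have sub: "\<And>x. x \<in> set (sorted_list_of_set (breaks \<nu> \<union> S)) \<Longrightarrow> 0 < x \<and> x \<le> 1" using b S fin by auto
  show "chain 0 (sorted_list_of_set (breaks \<nu> \<union> S))"
    by (rule chain_sorted) (use sub b fin in auto)
  show "const_between (alpha \<nu>) 0 (sorted_list_of_set (breaks \<nu> \<union> S))"
    by (rule const_between_sorted[where J = "atoms \<nu>", OF atoms_finite(2)[OF \<nu>]]) (use sub b fin in auto)
qed

lemma Psi_atomic_lipschitz:
  obtains \<kappa> where "0 \<le> \<kappa>" "\<And>\<nu> \<nu>'. \<nu> \<in> atomic_measures \<Longrightarrow> \<nu>' \<in> atomic_measures \<Longrightarrow>
    \<bar>Psi_atomic \<beta> \<rho> q \<nu> lam 0 x - Psi_atomic \<beta> \<rho> q \<nu>' lam 0 x\<bar> \<le> \<kappa> * alpha_dist \<nu> \<nu>'"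
proof -
  obtain \<kappa> where k: "0 \<le> \<kappa>" "\<And>f a a' s bs x. lip UNIV 1 (coord_fun f) \<Longrightarrow> (\<And>u. 0 \<le> a u \<and> a u \<le> 1) \<Longrightarrow> (\<And>u. 0 \<le> a' u \<and> a' u \<le> 1) \<Longrightarrow>
    chain s bs \<Longrightarrow> const_between a s bs \<Longrightarrow> const_between a' s bs \<Longrightarrow> 0 \<le> s \<Longrightarrow> (\<lambda>u. \<bar>a u - a' u\<bar>) integrable_on {0..1} \<Longrightarrow>
    \<bar>hopf_cole a T f bs s x - hopf_cole a' T f bs s x\<bar> \<le> \<kappa> * integral {s..1} (\<lambda>u. \<bar>a u - a' u\<bar>)"
    using hopf_cole_lipschitz by blast
  show ?thesis
  proof (rule that[OF k(1)])
    fix \<nu> \<nu>' assume \<nu>: "\<nu> \<in> atomic_measures" and \<nu>': "\<nu>' \<in> atomic_measures"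
    then have p: "\<nu> \<in> prob_measures" "\<nu>' \<in> prob_measures" by (auto simp: atomic_measures_def)
    note P = partition[OF \<nu> breaks(1,2)[OF \<nu>']] partition[OF \<nu>' breaks(1,2)[OF \<nu>], unfolded Un_commute[of "breaks \<nu>'"]]
    show "\<bar>Psi_atomic \<beta> \<rho> q \<nu> lam 0 x - Psi_atomic \<beta> \<rho> q \<nu>' lam 0 x\<bar> \<le> \<kappa> * alpha_dist \<nu> \<nu>'"
      unfolding Psi_atomic_eq[OF \<nu> breaks(1,2)[OF \<nu>']] Psi_atomic_eq[OF \<nu>' breaks(1,2)[OF \<nu>], unfolded Un_commute[of "breaks \<nu>'"]] alpha_dist_def
      by (rule k(2)[OF lip_terminal alpha_bounds[OF p(1)] alpha_bounds[OF p(2)] P(1,2,4) _ alpha_diff_integrable[OF p]]) simp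
  qed
qed

text \<open>\<open>Psi\<close> is a \<open>Lim\<close>, so its value is determined only once the
  limit exists and the filter is proper. The Lipschitz bound makes the values along the given
  sequence Cauchy; their limit is then shown to be the limit along the whole filter, and the same
  sequence shows that the filter is not \<open>bot\<close>.\<close>

lemma Psi_limit:
  assumes \<mu>: "\<mu> \<in> prob_measures" and \<nu>: "\<And>n. \<nu> n \<in> atomic_measures" and lim: "(\<lambda>n. alpha_dist \<mu> (\<nu> n)) \<longlonglongrightarrow> 0"
  shows "(\<lambda>n. Psi_atomic \<beta> \<rho> q (\<nu> n) lam 0 x) \<longlonglongrightarrow> Psi \<beta> \<rho> q \<mu> lam 0 x"
proof -
  let ?f = "\<lambda>\<nu>. Psi_atomic \<beta> \<rho> q \<nu> lam 0 x"
  let ?F = "inf (filtercomap (alpha_dist \<mu>) (nhds 0)) (principal atomic_measures)"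
  obtain \<kappa> where k: "0 \<le> \<kappa>" "\<And>\<nu> \<nu>'. \<nu> \<in> atomic_measures \<Longrightarrow> \<nu>' \<in> atomic_measures \<Longrightarrow> \<bar>?f \<nu> - ?f \<nu>'\<bar> \<le> \<kappa> * alpha_dist \<nu> \<nu>'"
    using Psi_atomic_lipschitz by blast
  have pm: "\<And>\<nu>. \<nu> \<in> atomic_measures \<Longrightarrow> \<nu> \<in> prob_measures" by (simp add: atomic_measures_def)
  have le: "\<bar>?f \<nu> - ?f \<nu>'\<bar> \<le> \<kappa> * (alpha_dist \<mu> \<nu> + alpha_dist \<mu> \<nu>')" if "\<nu> \<in> atomic_measures" "\<nu>' \<in> atomic_measures" for \<nu> \<nu>'
    using k(2)[OF that] mult_left_mono[OF alpha_dist_triangle[OF \<mu> pm[OF that(1)] pm[OF that(2)]] k(1)] by linarith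
  have "Cauchy (\<lambda>n. ?f (\<nu> n))"
  proof (rule metric_CauchyI)
    fix e :: real assume e: "0 < e"
    have "0 < e / (2 * (\<kappa> + 1))" using e k by simp
    with lim obtain n0 where n0: "\<And>n. n \<ge> n0 \<Longrightarrow> alpha_dist \<mu> (\<nu> n) < e / (2 * (\<kappa> + 1))"
      unfolding LIMSEQ_iff by (metis abs_ge_self diff_zero le_less_trans real_norm_def)
    have "dist (?f (\<nu> m)) (?f (\<nu> n)) < e" if "m \<ge> n0" "n \<ge> n0" for m n
    proof -
      have "\<kappa> * (alpha_dist \<mu> (\<nu> m) + alpha_dist \<mu> (\<nu> n)) \<le> \<kappa> * (e / (\<kappa> + 1))"
        using n0[OF that(1)] n0[OF that(2)] k by (intro mult_left_mono) (auto simp: field_simps)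
      also have "\<dots> < e" using e k by (simp add: field_simps)
      finally show ?thesis using le[OF \<nu>[of m] \<nu>[of n]] by (simp add: dist_real_def)
    qed
    then show "\<exists>M. \<forall>m\<ge>M. \<forall>n\<ge>M. dist (?f (\<nu> m)) (?f (\<nu> n)) < e" by blast
  qed
  then obtain l where l: "(\<lambda>n. ?f (\<nu> n)) \<longlonglongrightarrow> l" using Cauchy_convergent convergent_def by blast
  have fl: "\<bar>?f \<nu>' - l\<bar> \<le> \<kappa> * alpha_dist \<mu> \<nu>'" if "\<nu>' \<in> atomic_measures" for \<nu>'
  proof -
    have "(\<lambda>n. \<bar>?f \<nu>' - ?f (\<nu> n)\<bar>) \<longlonglongrightarrow> \<bar>?f \<nu>' - l\<bar>" by (intro tendsto_intros l)
    moreover have "(\<lambda>n. \<kappa> * (alpha_dist \<mu> \<nu>' + alpha_dist \<mu> (\<nu> n))) \<longlonglongrightarrow> \<kappa> * (alpha_dist \<mu> \<nu>' + 0)"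
      by (intro tendsto_intros lim)
    ultimately have "\<bar>?f \<nu>' - l\<bar> \<le> \<kappa> * (alpha_dist \<mu> \<nu>' + 0)"
      using le[OF that \<nu>] by (intro LIMSEQ_le) auto
    then show ?thesis by simp
  qed
  have "(?f \<longlongrightarrow> l) ?F"
  proof (rule tendstoI)
    fix e :: real assume e: "0 < e"
    show "\<forall>\<^sub>F \<nu>' in ?F. dist (?f \<nu>') l < e"
      unfolding eventually_inf_principal
    proof (rule eventually_filtercomapI[of "\<lambda>d. dist d 0 < e / (\<kappa> + 1)", THEN eventually_mono])
      have "0 < e / (\<kappa> + 1)" using e k by simp
      then show "\<forall>\<^sub>F d :: real in nhds 0. dist d 0 < e / (\<kappa> + 1)" unfolding eventually_nhds_metric by blast
      fix \<nu>' assume d: "dist (alpha_dist \<mu> \<nu>') 0 < e / (\<kappa> + 1)"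
      have "\<kappa> * alpha_dist \<mu> \<nu>' \<le> \<kappa> * (e / (\<kappa> + 1))" using d k by (intro mult_left_mono) auto
      also have "\<dots> < e" using e k by (simp add: field_simps)
      finally show "\<nu>' \<in> atomic_measures \<longrightarrow> dist (?f \<nu>') l < e" using fl[of \<nu>'] by (auto simp: dist_real_def)
    qed
  qed
  moreover have "?F \<noteq> bot"
  proof
    assume "?F = bot"
    then have "eventually (\<lambda>_. False) ?F" by simp
    then obtain Q where Q: "eventually Q (nhds 0)" "\<And>\<nu>. Q (alpha_dist \<mu> \<nu>) \<Longrightarrow> \<nu> \<in> atomic_measures \<Longrightarrow> False"
      unfolding eventually_inf_principal eventually_filtercomap by auto
    have "eventually (\<lambda>n. Q (alpha_dist \<mu> (\<nu> n))) sequentially"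
      using lim Q(1) by (auto simp: filterlim_iff)
    then have "eventually (\<lambda>n. False) sequentially" by eventually_elim (use Q(2) \<nu> in blast)
    then show False by simp
  qed
  ultimately have "Psi \<beta> \<rho> q \<mu> lam 0 x = l" unfolding Psi_def by (intro tendsto_Lim)
  then show ?thesis using l by simp
qed

theorem guerra_bound:
  fixes X :: "2 \<Rightarrow> (nat \<Rightarrow> real) \<Rightarrow> 'a \<Rightarrow> real"
  assumes N: "1 \<le> N" and q: "q \<in> overlap_values N" and M: "prob_space M"
    and jg: "jointly_gaussian M (UNIV \<times> spin_configs N) (\<lambda>(l, \<sigma>). X l \<sigma>)"
    and mean: "\<And>l \<sigma>. \<sigma> \<in> spin_configs N \<Longrightarrow> (\<integral>\<omega>. X l \<sigma> \<omega> \<partial>M) = 0"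
    and cv: "\<And>l l' \<sigma> \<tau>. \<sigma> \<in> spin_configs N \<Longrightarrow> \<tau> \<in> spin_configs N \<Longrightarrow>
           (\<integral>\<omega>. X l \<sigma> \<omega> * X l' \<tau> \<omega> \<partial>M) = real N * xi (\<beta> l l') (overlap N \<sigma> \<tau>)"
    and \<mu>: "\<mu> \<in> prob_measures"
  shows "constrained_free_energy M X h N q \<le> 2 * ln 2 + Psi \<beta> \<rho> q \<mu> lam 0 h - lam * q - 1 / 2 * integral {0..1} (\<lambda>s. alpha \<mu> s * G s)"
proof -
  let ?A = "pairs N q"
  let ?x = "field_of N (\<lambda>_ l. h $ l)"
  obtain cs where cs: "\<And>a b. a \<in> ?A \<Longrightarrow> b \<in> ?A \<Longrightarrow>
      cov cs a b = (\<Sum>l\<in>UNIV. \<Sum>l'\<in>UNIV. real N * xi (\<beta> l l') (overlap N (spin a l) (spin b l')))"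
    and law: "\<And>f L x. lip ?A L f \<Longrightarrow>
      (\<integral>\<omega>. f (\<lambda>a. x a + (\<Sum>l\<in>UNIV. X l (spin a l) \<omega>)) \<partial>M) = foldr (gauss_step 0) cs f x"
    using gaussian_process_law[OF M jg mean cv, where q = q] by blast
  have l: "lip ?A 1 (log_sum_exp ?A)" by (rule lip_log_sum_exp[OF finite_pairs pairs_nonempty[OF q]])
  \<comment> \<open>The external field is not random: it becomes the base point of the recursion,
    while the process supplies the directions \<open>cs\<close>.\<close>
  have F: "constrained_free_energy M X h N q = 1 / real N * foldr (gauss_step 0) cs (log_sum_exp ?A) ?x"
  proof -
    have "hamiltonian X h N 1 (fst a) \<omega> + hamiltonian X h N 2 (snd a) \<omega> = ?x a + (\<Sum>l\<in>UNIV. X l (spin a l) \<omega>)" for a \<omega>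
      by (simp add: hamiltonian_def field_of_def dir_def sum_2 spin_def sum.distrib sum_distrib_left mult.commute)
    then show ?thesis
      unfolding constrained_free_energy_def law[OF l, symmetric] log_sum_exp_def pairs_def[symmetric] case_prod_beta by simp
  qed
  have atomic: "constrained_free_energy M X h N q \<le> 2 * ln 2 + Psi_atomic \<beta> \<rho> q \<nu> lam 0 h - lam * q - 1 / 2 * integral {0..1} (\<lambda>s. alpha \<nu> s * G s)"
    if \<nu>: "\<nu> \<in> atomic_measures" for \<nu>
  proof -
    have p: "\<nu> \<in> prob_measures" using \<nu> by (simp add: atomic_measures_def)
    let ?bs = "sorted_list_of_set (breaks \<nu>)"
    have ch: "chain 0 ?bs" "const_between (alpha \<nu>) 0 ?bs" using partition[OF \<nu>, of "{}"] by auto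
    have "foldr (gauss_step 0) cs (log_sum_exp ?A) ?x \<le> cascade (log_sum_exp ?A) (levels (alpha \<nu>) T N ?bs 0) ?x - real N / 2 * level_sum (alpha \<nu>) ?bs 0"
      by (rule interpolation_bound[OF N q alpha_bounds[OF p] alpha_mono[OF p] ch(1)])
         (simp_all add: cs sum_distrib_left)
    also have "\<dots> \<le> real N * (2 * ln 2 + hopf_cole (alpha \<nu>) T (terminal lam) ?bs 0 h - lam * q) - real N / 2 * level_sum (alpha \<nu>) ?bs 0"
      by (intro diff_right_mono levels_bound[OF N q] alpha_bounds[OF p])
    also have "\<dots> = real N * (2 * ln 2 + Psi_atomic \<beta> \<rho> q \<nu> lam 0 h - lam * q - 1 / 2 * integral {0..1} (\<lambda>s. alpha \<nu> s * G s))"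
      using Psi_atomic_eq[OF \<nu>, of "{}" lam h] integral_unique[OF level_sum_has_integral[OF ch]] by (simp add: algebra_simps)
    finally have "foldr (gauss_step 0) cs (log_sum_exp ?A) ?x \<le> real N * (2 * ln 2 + Psi_atomic \<beta> \<rho> q \<nu> lam 0 h - lam * q - 1 / 2 * integral {0..1} (\<lambda>s. alpha \<nu> s * G s))" .
    then show ?thesis unfolding F using N by (simp add: pos_divide_le_eq mult.commute)
  qed
  have "\<exists>\<nu>. \<forall>n. \<nu> n \<in> atomic_measures \<and> alpha_dist \<mu> (\<nu> n) \<le> 1 / real (Suc n)"
    using atomic_approximation[OF \<mu>] by (intro choice) (metis zero_less_Suc)
  then obtain \<nu> where \<nu>: "\<And>n. \<nu> n \<in> atomic_measures" "\<And>n. alpha_dist \<mu> (\<nu> n) \<le> 1 / real (Suc n)" by blast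
  have p: "\<nu> n \<in> prob_measures" for n using \<nu>(1)[of n] by (simp add: atomic_measures_def)
  have lim: "(\<lambda>n. alpha_dist \<mu> (\<nu> n)) \<longlonglongrightarrow> 0"
    by (rule tendsto_sandwich[OF _ _ tendsto_const LIMSEQ_Suc[OF lim_1_over_n]])
       (use \<nu>(2) alpha_dist_nonneg[OF \<mu> p] in auto)
  have "(\<lambda>n. integral {0..1} (\<lambda>s. alpha (\<nu> n) s * G s)) \<longlonglongrightarrow> integral {0..1} (\<lambda>s. alpha \<mu> s * G s)"
  proof (rule LIM_zero_cancel, rule Lim_null_comparison)
    show "\<forall>\<^sub>F n in sequentially. norm (integral {0..1} (\<lambda>s. alpha (\<nu> n) s * G s) - integral {0..1} (\<lambda>s. alpha \<mu> s * G s)) \<le> 4 * K * alpha_dist \<mu> (\<nu> n)"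
      using alpha_G_close[OF \<mu> p] by (simp add: abs_minus_commute)
    show "(\<lambda>n. 4 * K * alpha_dist \<mu> (\<nu> n)) \<longlonglongrightarrow> 0" using tendsto_mult_left[OF lim, of "4 * K"] by simp
  qed
  then have "(\<lambda>n. 2 * ln 2 + Psi_atomic \<beta> \<rho> q (\<nu> n) lam 0 h - lam * q - 1 / 2 * integral {0..1} (\<lambda>s. alpha (\<nu> n) s * G s))
     \<longlonglongrightarrow> 2 * ln 2 + Psi \<beta> \<rho> q \<mu> lam 0 h - lam * q - 1 / 2 * integral {0..1} (\<lambda>s. alpha \<mu> s * G s)"
    by (intro tendsto_intros Psi_limit[OF \<mu> \<nu>(1) lim])
  then show ?thesis using atomic[OF \<nu>(1)] by (intro LIMSEQ_le_const) auto
qed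

end

theorem theorem6:
  fixes N :: nat and M :: "'a measure"
    and X :: "2 \<Rightarrow> (nat \<Rightarrow> real) \<Rightarrow> 'a \<Rightarrow> real"
    and \<beta> :: "2 \<Rightarrow> 2 \<Rightarrow> nat \<Rightarrow> real"
    and \<rho> :: "2 \<Rightarrow> 2 \<Rightarrow> real \<Rightarrow> real"
    and h :: "real^2" and q K lam :: real and D :: "real set" and \<mu> :: "real measure"
  assumes "N \<ge> 1"
    and "prob_space M"
    and "\<And>l l'. summable (\<lambda>p. (real p)\<^sup>2 * (\<beta> l l' p)\<^sup>2)"
    and "\<And>l l'. convex_on {-1..1} (xi (\<beta> l l'))"
    and "jointly_gaussian M (UNIV \<times> spin_configs N) (\<lambda>(l, \<sigma>). X l \<sigma>)"
    and "\<And>l \<sigma>. \<sigma> \<in> spin_configs N \<Longrightarrow> (\<integral>\<omega>. X l \<sigma> \<omega> \<partial>M) = 0"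
    and "\<And>l l' \<sigma> \<tau>. \<sigma> \<in> spin_configs N \<Longrightarrow> \<tau> \<in> spin_configs N \<Longrightarrow>
           (\<integral>\<omega>. X l \<sigma> \<omega> * X l' \<tau> \<omega> \<partial>M) = real N * xi (\<beta> l l') (overlap N \<sigma> \<tau>)"
    and "q \<in> overlap_values N"
    and "\<And>l l'. mono_on {0..1} (\<rho> l l')"
    and "\<And>l l'. continuous_on {0..1} (\<rho> l l')"
    and "\<And>l l'. \<rho> l l' 0 = 0"
    and "\<And>l l'. \<rho> l l' 1 = (if l = l' then 1 else \<bar>q\<bar>)"
    and "finite D" and "D \<subseteq> {0..<1}"
    and "\<And>l l' s. s \<in> {0..1} - D \<Longrightarrow> \<rho> l l' differentiable (at s within {0..1})"
    and "\<And>l l' s. s \<in> D \<Longrightarrow> \<rho> l l' differentiable (at_right s)"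
    and "K > 0"
    and "\<And>s. s \<in> {0..1} \<Longrightarrow> onorm ((*v) (T_mat \<beta> \<rho> q s)) \<le> K"
    and "\<And>s. s \<in> {0..1} \<Longrightarrow> pos_semidef (T_mat \<beta> \<rho> q s)"
    and "\<mu> \<in> prob_measures"
  shows "constrained_free_energy M X h N q
           \<le> 2 * ln 2 + Psi \<beta> \<rho> q \<mu> lam 0 h - lam * q
             - 1/2 * integral {0..1} (\<lambda>s. alpha \<mu> s *
                 ((\<Sum>l\<in>UNIV. \<rho> l l s * T_mat \<beta> \<rho> q s $ l $ l)
                  + iota q * (\<Sum>(l, l') \<in> {(l, l'). l \<noteq> l'}. \<rho> l l' s * T_mat \<beta> \<rho> q s $ l $ l')))"
proof -
  interpret rsb \<beta> \<rho> q K D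
    by unfold_locales (use assms overlap_values_abs in auto)
  show ?thesis
    unfolding G_eq by (rule guerra_bound[OF assms(1,8,2,5,6,7,20)])
qed

end
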